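(* Let $\alpha,\beta\in\mathbb{C}$ and fix a square root $\sqrt{-\beta}$. Consider the system $$\frac{dx}{dt}=xy+\sqrt{-\beta},\qquad \frac{dy}{dt}=\frac32x^2-\frac12y^2+\frac{\alpha}{2} .$$ After a series of blowing-ups in $\mathbb{P}^2$ one obtains a rational surface of type $E_6^{(1)}$. The phase space $\mathcal{X}$ of the system can be obtained by gluing four copies $U_j\times\mathbb{C}=\mathbb{C}^2\times\mathbb{C}\ni(x_j,y_j,t)$, $j=0,1,2,3$, via the birational and symplectic transformations $$\begin{aligned} 0)\;& x_0=x,\quad y_0=y,\\ 1)\;& x_1=\frac1x,\quad y_1=-\Bigl((y-x)x-\frac{\alpha-2\sqrt{-\beta}}{2}\Bigr)x,\\ 2)\;& x_2=\frac1x,\quad y_2=-\Bigl((y+x)x+\frac{\alpha+2\sqrt{-\beta}}{2}\Bigr)x,\\ 3)\;& x_3=-(xy+2\sqrt{-\beta})y,\quad y_3=\frac1y . \end{aligned}$$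
   Context: Symplectic means $dx_j\wedge dy_j=dx\wedge dy$ for fixed $t$. Gluing: points of different charts with the same $t$ are identified through the given birational relations wherever these are biregular. Phase space: the resulting complex manifold $\mathcal{X}$, fibred over the $t$-line $B$ (here $B=\mathbb{C}$), is the phase space (space of initial conditions) of the system if (i) rewritten in the coordinates $(x_j,y_j)$ of every chart, the system has right-hand sides that are polynomials in $(x_j,y_j)$ with coefficients holomorphic in $t$; and (ii) every solution $(x(t),y(t))$ that is meromorphic near a point $t_0\in B$ extends holomorphically across $t_0$ as a map into $\mathcal{X}$. Type: a rational surface of type $R$ (an affine Dynkin diagram) here means a smooth projective rational surface $S$ (obtained by successively blowing up $\mathbb{P}^2\supset\mathbb{C}^2\ni(x,y)$) containing the fibre $\mathcal{X}_t$ as an open subset such that $S\setminus\mathcal{X}_t$ is a union of smooth rational curves of self-intersection $-2$ whose dual intersection graph is the diagram $R$. *)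

theory Defs
  imports "HOL-Complex_Analysis.Complex_Analysis"
begin

no_notation fps_nth (infixl "$" 75)

section \<open>Rational maps of the complex plane\<close>

text \<open>In the next definition the outer variable of the nested polynomial is the first coordinate
  and the inner variable the second one.\<close>

definition poly2 :: "(complex^2 \<Rightarrow> complex) \<Rightarrow> bool" where
  "poly2 f \<longleftrightarrow> (\<exists>P :: complex poly poly. \<forall>z. f z = poly (poly P [:z $ 1:]) (z $ 2))"

definition generically :: "(complex^2 \<Rightarrow> bool) \<Rightarrow> bool" where
  "generically Q \<longleftrightarrow> (\<exists>h. poly2 h \<and> (\<exists>z. h z \<noteq> 0) \<and> (\<forall>z. h z \<noteq> 0 \<longrightarrow> Q z))"

text \<open>A rational map is represented by a total function; its values at points where it is not
  regular (such as the value \<open>1 / 0 = 0\<close>) are irrelevant.\<close>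

definition regular_at :: "(complex^2 \<Rightarrow> complex) \<Rightarrow> complex^2 \<Rightarrow> bool" where
  "regular_at f p \<longleftrightarrow>
     (\<exists>n d. poly2 n \<and> poly2 d \<and> d p \<noteq> 0 \<and> (\<forall>z. d z \<noteq> 0 \<longrightarrow> f z = n z / d z))"

definition regular_map_at :: "(complex^2 \<Rightarrow> complex^2) \<Rightarrow> complex^2 \<Rightarrow> bool" where
  "regular_map_at F p \<longleftrightarrow> (\<forall>i. regular_at (\<lambda>z. F z $ i) p)"

definition birational :: "(complex^2 \<Rightarrow> complex^2) \<Rightarrow> bool" where
  "birational F \<longleftrightarrow> (\<exists>p. regular_map_at F p) \<and>
     (\<exists>G. (\<exists>q. regular_map_at G q) \<and>
          generically (\<lambda>z. G (F z) = z) \<and> generically (\<lambda>w. F (G w) = w))"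

text \<open>The equation below says that \<open>F\<close> pulls back \<open>dx \<and> dy\<close> to itself.\<close>

definition symplectic :: "(complex^2 \<Rightarrow> complex^2) \<Rightarrow> bool" where
  "symplectic F \<longleftrightarrow> (\<forall>p. regular_map_at F p \<longrightarrow>
     (\<exists>L. (F has_derivative L) (at p) \<and>
          (\<forall>u v. L u $ 1 * L v $ 2 - L u $ 2 * L v $ 1 = u $ 1 * v $ 2 - u $ 2 * v $ 1)))"

text \<open>Let \<open>\<phi>\<close> and \<open>\<psi>\<close> be two coordinate systems, given as rational functions of \<open>(x, y)\<close>.
  The birational coordinate change \<open>\<psi> \<circ> \<phi>\<inverse>\<close> is biregular at \<open>p\<close> and takes the value \<open>q\<close> there.\<close>

definition biregular_at ::
  "(complex^2 \<Rightarrow> complex^2) \<Rightarrow> (complex^2 \<Rightarrow> complex^2) \<Rightarrow> complex^2 \<Rightarrow> complex^2 \<Rightarrow> bool" where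
  "biregular_at \<phi> \<psi> p q \<longleftrightarrow> (\<exists>F G.
     regular_map_at F p \<and> regular_map_at G q \<and> F p = q \<and> G q = p \<and>
     generically (\<lambda>z. F (\<phi> z) = \<psi> z) \<and> generically (\<lambda>z. G (\<psi> z) = \<phi> z))"


section \<open>Complex manifolds\<close>

text \<open>Holomorphic functions of several variables, on open sets.\<close>

definition holo_on :: "(complex^'n) set \<Rightarrow> (complex^'n \<Rightarrow> complex) \<Rightarrow> bool" where
  "holo_on S f \<longleftrightarrow> (\<forall>z\<in>S. \<exists>L. (f has_derivative L) (at z) \<and> (\<forall>c v. L (c *s v) = c * L v))"

text \<open>A manifold is given by an atlas of local parametrizations \<open>\<psi> : V \<rightarrow> M\<close> (inverses of charts)
  on open subsets of \<open>\<complex>\<^sup>n\<close>; only the values of \<open>\<psi>\<close> on \<open>V\<close> matter.\<close>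

type_synonym ('n, 'p) atlas = "((complex^'n) set \<times> (complex^'n \<Rightarrow> 'p)) set"

definition points :: "('n, 'p) atlas \<Rightarrow> 'p set" where
  "points A = (\<Union>(V, \<psi>)\<in>A. \<psi> ` V)"

definition manifold_topology :: "('n::finite, 'p) atlas \<Rightarrow> 'p topology" where
  "manifold_topology A =
     topology (\<lambda>U. U \<subseteq> points A \<and> (\<forall>(V, \<psi>)\<in>A. open {v \<in> V. \<psi> v \<in> U}))"

lemma openin_manifold_topology:
  assumes "\<forall>(V, \<psi>)\<in>A. open V"
  shows "openin (manifold_topology A) U \<longleftrightarrow>
           U \<subseteq> points A \<and> (\<forall>(V, \<psi>)\<in>A. open {v \<in> V. \<psi> v \<in> U})"
proof -
  have "istopology (\<lambda>U. U \<subseteq> points A \<and> (\<forall>(V, \<psi>)\<in>A. open {v \<in> V. \<psi> v \<in> U}))"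
    unfolding istopology_def
  proof (intro conjI allI impI)
    fix S T
    assume S: "S \<subseteq> points A \<and> (\<forall>(V, \<psi>)\<in>A. open {v \<in> V. \<psi> v \<in> S})"
      and T: "T \<subseteq> points A \<and> (\<forall>(V, \<psi>)\<in>A. open {v \<in> V. \<psi> v \<in> T})"
    show "S \<inter> T \<subseteq> points A" using S by blast
    have "{v \<in> V. \<psi> v \<in> S \<inter> T} = {v \<in> V. \<psi> v \<in> S} \<inter> {v \<in> V. \<psi> v \<in> T}"
      for V and \<psi> :: "complex^'a \<Rightarrow> 'b" by blast
    moreover have "open {v \<in> V. \<psi> v \<in> S}" "open {v \<in> V. \<psi> v \<in> T}" if "(V, \<psi>) \<in> A" for V \<psi>
      using S T that by blast+
    ultimately show "\<forall>(V, \<psi>)\<in>A. open {v \<in> V. \<psi> v \<in> S \<inter> T}"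
      by (auto simp only: intro!: open_Int)
  next
    fix K
    assume K: "\<forall>S\<in>K. S \<subseteq> points A \<and> (\<forall>(V, \<psi>)\<in>A. open {v \<in> V. \<psi> v \<in> S})"
    then show "\<Union>K \<subseteq> points A" by blast
    have "{v \<in> V. \<psi> v \<in> \<Union>K} = (\<Union>S\<in>K. {v \<in> V. \<psi> v \<in> S})"
      for V and \<psi> :: "complex^'a \<Rightarrow> 'b" by blast
    moreover have "open {v \<in> V. \<psi> v \<in> S}" if "(V, \<psi>) \<in> A" "S \<in> K" for V \<psi> S
      using K that by blast
    ultimately show "\<forall>(V, \<psi>)\<in>A. open {v \<in> V. \<psi> v \<in> \<Union>K}"
      by (auto simp only: intro!: open_UN)
  qed
  then show ?thesis
    by (simp add: manifold_topology_def)
qed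

definition complex_manifold :: "('n::finite, 'p) atlas \<Rightarrow> bool" where
  "complex_manifold A \<longleftrightarrow>
     (\<forall>(V, \<psi>)\<in>A. open V \<and> inj_on \<psi> V) \<and>
     (\<forall>(V, \<psi>)\<in>A. \<forall>(W, \<eta>)\<in>A. open {v \<in> V. \<psi> v \<in> \<eta> ` W} \<and>
        (\<forall>i. holo_on {v \<in> V. \<psi> v \<in> \<eta> ` W} (\<lambda>v. inv_into W \<eta> (\<psi> v) $ i))) \<and>
     Hausdorff_space (manifold_topology A) \<and> second_countable (manifold_topology A)"

definition restrict_atlas :: "('n, 'p) atlas \<Rightarrow> 'p set \<Rightarrow> ('n, 'p) atlas" where
  "restrict_atlas A U = (\<lambda>(V, \<psi>). ({v \<in> V. \<psi> v \<in> U}, \<psi>)) ` A"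

definition holo_map :: "('m::finite, 'p) atlas \<Rightarrow> ('n::finite, 'q) atlas \<Rightarrow> ('p \<Rightarrow> 'q) \<Rightarrow> bool" where
  "holo_map A B f \<longleftrightarrow> f ` points A \<subseteq> points B \<and>
     (\<forall>(V, \<psi>)\<in>A. \<forall>(W, \<eta>)\<in>B. open {v \<in> V. f (\<psi> v) \<in> \<eta> ` W} \<and>
        (\<forall>i. holo_on {v \<in> V. f (\<psi> v) \<in> \<eta> ` W} (\<lambda>v. inv_into W \<eta> (f (\<psi> v)) $ i)))"

text \<open>A biholomorphic map onto an open subset.\<close>

definition open_embedding ::
  "('n::finite, 'p) atlas \<Rightarrow> ('n, 'q) atlas \<Rightarrow> ('p \<Rightarrow> 'q) \<Rightarrow> bool" where
  "open_embedding A B f \<longleftrightarrow>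
     inj_on f (points A) \<and> openin (manifold_topology B) (f ` points A) \<and> holo_map A B f \<and>
     holo_map (restrict_atlas B (f ` points A)) A (inv_into (points A) f)"

definition holo_fun_on :: "('n::finite, 'p) atlas \<Rightarrow> 'p set \<Rightarrow> ('p \<Rightarrow> complex) \<Rightarrow> bool" where
  "holo_fun_on A U g \<longleftrightarrow> (\<forall>(V, \<psi>)\<in>A. holo_on {v \<in> V. \<psi> v \<in> U} (\<lambda>v. g (\<psi> v)))"

definition holo_curve :: "('n::finite, 'p) atlas \<Rightarrow> complex set \<Rightarrow> (complex \<Rightarrow> 'p) \<Rightarrow> bool" where
  "holo_curve A T \<gamma> \<longleftrightarrow> open T \<and> \<gamma> ` T \<subseteq> points A \<and>
     (\<forall>(V, \<psi>)\<in>A. open {t \<in> T. \<gamma> t \<in> \<psi> ` V} \<and>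
        (\<forall>i. (\<lambda>t. inv_into V \<psi> (\<gamma> t) $ i) holomorphic_on {t \<in> T. \<gamma> t \<in> \<psi> ` V}))"


section \<open>Iterated blow-ups of the projective plane\<close>

text \<open>The Riemann sphere \<open>P\<^sup>1 = \<complex> \<union> {\<infinity>}\<close> is represented by \<^typ>\<open>complex option\<close>, with \<open>None\<close>
  for infinity. Its two standard parametrizations are \<open>Some\<close> and the following one.\<close>

definition P1_inf :: "complex \<Rightarrow> complex option" where
  "P1_inf w = (if w = 0 then None else Some (1 / w))"

text \<open>Points of the plane and infinitely near points: \<open>Near p l\<close> is the point of the exceptional
  curve over \<open>p\<close> with direction \<open>l\<close>, where \<open>l\<close> is the slope in the coordinates in which \<open>p\<close> is
  blown up. A point of the projective plane is a punctured line through the origin.\<close>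

datatype ipoint = Plane "(complex^3) set" | Near ipoint "complex option"

definition proj_point :: "complex^3 \<Rightarrow> ipoint" where
  "proj_point v = Plane {c *s v | c. c \<noteq> 0}"

primrec blow_down :: "ipoint \<Rightarrow> ipoint" where
  "blow_down (Plane l) = Plane l"
| "blow_down (Near p l) = blow_down p"

definition projective_plane :: "(2, ipoint) atlas" where
  "projective_plane =
    {(UNIV, \<lambda>z. proj_point (vector [z $ 1, z $ 2, 1])),
     (UNIV, \<lambda>z. proj_point (vector [z $ 1, 1, z $ 2])),
     (UNIV, \<lambda>z. proj_point (vector [1, z $ 1, z $ 2]))}"

text \<open>Blow-up of the point \<open>\<psi> c\<close>. In the local coordinates centred at that point, the blow-down
  map is \<open>(u, m) \<mapsto> (u, u m)\<close> in the first of the two new coordinate systems and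
  \<open>(m, u) \<mapsto> (u m, u)\<close> in the second one.\<close>

definition blow_up_at ::
  "(2, ipoint) atlas \<Rightarrow> (complex^2) set \<Rightarrow> (complex^2 \<Rightarrow> ipoint) \<Rightarrow> complex^2 \<Rightarrow> (2, ipoint) atlas" where
  "blow_up_at A V \<psi> c = restrict_atlas A (- {\<psi> c}) \<union>
    {({w. c + vector [w $ 1, w $ 1 * w $ 2] \<in> V},
      \<lambda>w. if w $ 1 = 0 then Near (\<psi> c) (Some (w $ 2))
          else \<psi> (c + vector [w $ 1, w $ 1 * w $ 2])),
     ({w. c + vector [w $ 1 * w $ 2, w $ 2] \<in> V},
      \<lambda>w. if w $ 2 = 0 then Near (\<psi> c) (P1_inf (w $ 1))
          else \<psi> (c + vector [w $ 1 * w $ 2, w $ 2]))}"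

inductive blown_up_plane :: "(2, ipoint) atlas \<Rightarrow> bool" where
  start: "blown_up_plane projective_plane"
| step: "blown_up_plane A \<Longrightarrow> (V, \<psi>) \<in> A \<Longrightarrow> c \<in> V \<Longrightarrow> blown_up_plane (blow_up_at A V \<psi> c)"


section \<open>Smooth rational curves and intersection numbers\<close>

text \<open>A holomorphic embedding of \<open>P\<^sup>1\<close>; a smooth rational curve is the range of such a map.\<close>

definition P1_embedding :: "('n::finite, 'p) atlas \<Rightarrow> (complex option \<Rightarrow> 'p) \<Rightarrow> bool" where
  "P1_embedding A \<gamma> \<longleftrightarrow> inj \<gamma> \<and>
     (\<forall>\<sigma>\<in>{Some, P1_inf}. holo_curve A UNIV (\<gamma> \<circ> \<sigma>) \<and>
        (\<forall>(V, \<psi>)\<in>A. \<forall>t. \<gamma> (\<sigma> t) \<in> \<psi> ` V \<longrightarrow>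
           (\<exists>i. deriv (\<lambda>t. inv_into V \<psi> (\<gamma> (\<sigma> t)) $ i) t \<noteq> 0)))"

text \<open>For a smooth curve \<open>D\<close>, a function generates the ideal of \<open>D\<close> if and only if it vanishes
  exactly on \<open>D\<close>, with nonzero differential there.\<close>

definition local_equation :: "('n::finite, 'p) atlas \<Rightarrow> 'p set \<Rightarrow> 'p set \<Rightarrow> ('p \<Rightarrow> complex) \<Rightarrow> bool" where
  "local_equation A D U g \<longleftrightarrow> openin (manifold_topology A) U \<and> holo_fun_on A U g \<and>
     (\<forall>p\<in>U. g p = 0 \<longleftrightarrow> p \<in> D) \<and>
     (\<forall>(V, \<psi>)\<in>A. \<forall>v\<in>V. \<psi> v \<in> U \<inter> D \<longrightarrow> \<not> ((\<lambda>v. g (\<psi> v)) has_derivative (\<lambda>_. 0)) (at v))"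

definition P1_order :: "(complex option \<Rightarrow> complex) \<Rightarrow> complex option \<Rightarrow> int" where
  "P1_order s \<zeta> = (case \<zeta> of Some z \<Rightarrow> zorder (s \<circ> Some) z | None \<Rightarrow> zorder (s \<circ> P1_inf) 0)"

text \<open>The intersection number \<open>C \<cdot> D\<close> of \<open>C = range \<gamma>\<close> with a smooth curve \<open>D\<close> (where \<open>D = C\<close> is
  allowed) is the degree of the line bundle \<open>O(D)\<close> restricted to \<open>C\<close>, i.e. the number of zeros
  minus the number of poles of any nonzero meromorphic section. The bundle \<open>O(D)\<close> has the
  transition functions \<open>g / g'\<close>, for local equations \<open>g, g'\<close> of \<open>D\<close>; a section over \<open>C\<close> is a family
  \<open>s\<close> of meromorphic functions, one for each local equation, that is compatible with them.
  For \<open>D \<noteq> C\<close> one may take the restrictions of the local equations themselves, which gives the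
  sum of the local intersection multiplicities; for \<open>D = C\<close> the number is the degree of
  the normal bundle of \<open>C\<close>.\<close>

definition has_intersection_number ::
  "('n::finite, 'p) atlas \<Rightarrow> (complex option \<Rightarrow> 'p) \<Rightarrow> 'p set \<Rightarrow> int \<Rightarrow> bool" where
  "has_intersection_number A \<gamma> D n \<longleftrightarrow>
    (\<exists>(E :: ('p set \<times> ('p \<Rightarrow> complex)) set)
      (s :: 'p set \<times> ('p \<Rightarrow> complex) \<Rightarrow> complex option \<Rightarrow> complex) (ord :: complex option \<Rightarrow> int).
      (\<forall>(U, g)\<in>E. local_equation A D U g) \<and>
      range \<gamma> \<subseteq> (\<Union>(U, g)\<in>E. U) \<and>
      (\<forall>(U, g)\<in>E. \<forall>\<sigma>\<in>{Some, P1_inf}.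
         (\<lambda>z. s (U, g) (\<sigma> z)) meromorphic_on {z. \<gamma> (\<sigma> z) \<in> U} \<and>
         (\<forall>z. \<gamma> (\<sigma> z) \<in> U \<longrightarrow> (\<forall>\<^sub>F w in at z. s (U, g) (\<sigma> w) \<noteq> 0))) \<and>
      (\<forall>(U, g)\<in>E. \<forall>(U', g')\<in>E. \<exists>u. holo_fun_on A (U \<inter> U') u \<and>
         (\<forall>p\<in>U \<inter> U'. g p = u p * g' p) \<and>
         (\<forall>\<zeta>. \<gamma> \<zeta> \<in> U \<inter> U' \<longrightarrow> s (U, g) \<zeta> = u (\<gamma> \<zeta>) * s (U', g') \<zeta>)) \<and>
      (\<forall>(U, g)\<in>E. \<forall>\<zeta>. \<gamma> \<zeta> \<in> U \<longrightarrow> ord \<zeta> = P1_order (s (U, g)) \<zeta>) \<and>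
      finite {\<zeta>. ord \<zeta> \<noteq> 0} \<and> n = (\<Sum>\<zeta> | ord \<zeta> \<noteq> 0. ord \<zeta>))"


section \<open>Rational surfaces of a given type\<close>

text \<open>A diagram is a set of nodes with a set of simple edges (two-element sets of nodes).\<close>

definition E6_nodes :: "nat set" where
  "E6_nodes = {0..6}"

definition E6_edges :: "nat set set" where
  "E6_edges = {{0, 1}, {1, 2}, {0, 3}, {3, 4}, {0, 5}, {5, 6}}"

text \<open>The surface \<open>S\<close> contains the surface \<open>X\<close>, via \<open>\<iota>\<close>, as an open subset whose complement is a
  union of \<open>(-2)\<close>-curves having the given diagram as dual intersection graph.\<close>

definition surface_of_type ::
  "nat set \<Rightarrow> nat set set \<Rightarrow> (2, ipoint) atlas \<Rightarrow> (2, 'p) atlas \<Rightarrow> ('p \<Rightarrow> ipoint) \<Rightarrow> bool" where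
  "surface_of_type nodes edges S X \<iota> \<longleftrightarrow>
     blown_up_plane S \<and> open_embedding X S \<iota> \<and>
     (\<exists>\<gamma> :: nat \<Rightarrow> complex option \<Rightarrow> ipoint.
        (\<forall>i\<in>nodes. P1_embedding S (\<gamma> i)) \<and>
        inj_on (\<lambda>i. range (\<gamma> i)) nodes \<and>
        points S - \<iota> ` points X = (\<Union>i\<in>nodes. range (\<gamma> i)) \<and>
        (\<forall>i\<in>nodes. has_intersection_number S (\<gamma> i) (range (\<gamma> i)) (-2)) \<and>
        (\<forall>i\<in>nodes. \<forall>j\<in>nodes. i \<noteq> j \<longrightarrow>
           has_intersection_number S (\<gamma> i) (range (\<gamma> j)) (if {i, j} \<in> edges then 1 else 0)))"


section \<open>Gluing and phase spaces\<close>

definition join :: "complex^2 \<Rightarrow> complex \<Rightarrow> complex^3" where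
  "join z t = vector [z $ 1, z $ 2, t]"

definition plane_part :: "complex^3 \<Rightarrow> complex^2" where
  "plane_part v = vector [v $ 1, v $ 2]"

text \<open>Here and below \<open>\<phi> j t\<close> expresses the coordinates of the \<open>j\<close>-th chart at time \<open>t\<close> by \<open>(x, y)\<close>,
  for \<open>j\<close> in the index set \<open>J\<close>. A pair \<open>(j, v)\<close> is the point \<open>v = (x\<^sub>j, y\<^sub>j, t)\<close> of the \<open>j\<close>-th copy
  of \<open>\<complex>\<^sup>2 \<times> \<complex>\<close>; points of the glued space are classes of such pairs.\<close>

definition glue ::
  "nat set \<Rightarrow> (nat \<Rightarrow> complex \<Rightarrow> complex^2 \<Rightarrow> complex^2) \<Rightarrow> ((nat \<times> (complex^3)) \<times> (nat \<times> (complex^3))) set" where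
  "glue J \<phi> = {((j, v), (k, w)). j \<in> J \<and> k \<in> J \<and> v $ 3 = w $ 3 \<and>
     biregular_at (\<phi> j (v $ 3)) (\<phi> k (v $ 3)) (plane_part v) (plane_part w)}"

definition glued_point ::
  "nat set \<Rightarrow> (nat \<Rightarrow> complex \<Rightarrow> complex^2 \<Rightarrow> complex^2) \<Rightarrow> nat \<Rightarrow> complex^3 \<Rightarrow> (nat \<times> (complex^3)) set" where
  "glued_point J \<phi> j v = glue J \<phi> `` {(j, v)}"

definition glued_atlas ::
  "nat set \<Rightarrow> (nat \<Rightarrow> complex \<Rightarrow> complex^2 \<Rightarrow> complex^2) \<Rightarrow> (3, (nat \<times> (complex^3)) set) atlas" where
  "glued_atlas J \<phi> = (\<lambda>j. (UNIV, glued_point J \<phi> j)) ` J"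

definition fibre_atlas ::
  "nat set \<Rightarrow> (nat \<Rightarrow> complex \<Rightarrow> complex^2 \<Rightarrow> complex^2) \<Rightarrow> complex \<Rightarrow> (2, (nat \<times> (complex^3)) set) atlas" where
  "fibre_atlas J \<phi> t = (\<lambda>j. (UNIV, \<lambda>z. glued_point J \<phi> j (join z t))) ` J"

definition polynomial_rhs :: "(complex \<Rightarrow> complex^2 \<Rightarrow> complex^2) \<Rightarrow> bool" where
  "polynomial_rhs g \<longleftrightarrow> (\<forall>i. \<exists>(N::nat) (c :: nat \<Rightarrow> nat \<Rightarrow> complex \<Rightarrow> complex).
     (\<forall>a b. c a b holomorphic_on UNIV) \<and>
     (\<forall>t w. g t w $ i = (\<Sum>a\<le>N. \<Sum>b\<le>N. c a b t * w $ 1 ^ a * w $ 2 ^ b)))"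

text \<open>Rewriting the system \<open>(x, y)' = f t (x, y)\<close> in the coordinates of the \<open>j\<close>-th chart gives
  \<open>(x\<^sub>j, y\<^sub>j)' = g t (x\<^sub>j, y\<^sub>j)\<close>: by the chain rule, the derivative of \<open>(x, y, t) \<mapsto> \<phi> j t (x, y)\<close> maps
  the direction \<open>(f, 1)\<close> to \<open>g\<close>.\<close>

definition rewritten_system ::
  "(complex \<Rightarrow> complex^2 \<Rightarrow> complex^2) \<Rightarrow> (complex \<Rightarrow> complex^2 \<Rightarrow> complex^2) \<Rightarrow>
   (complex \<Rightarrow> complex^2 \<Rightarrow> complex^2) \<Rightarrow> bool" where
  "rewritten_system f \<phi> g \<longleftrightarrow> (\<forall>t z. regular_map_at (\<phi> t) z \<longrightarrow>
     (\<exists>L. ((\<lambda>v. \<phi> (v $ 3) (plane_part v)) has_derivative L) (at (join z t)) \<and>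
          L (join (f t z) 1) = g t (\<phi> t z)))"

definition meromorphic_solution_near ::
  "(complex \<Rightarrow> complex^2 \<Rightarrow> complex^2) \<Rightarrow> complex \<Rightarrow> (complex \<Rightarrow> complex) \<Rightarrow> (complex \<Rightarrow> complex) \<Rightarrow> bool" where
  "meromorphic_solution_near f t\<^sub>0 x y \<longleftrightarrow>
     x meromorphic_on {t\<^sub>0} \<and> y meromorphic_on {t\<^sub>0} \<and>
     (\<forall>\<^sub>F t in at t\<^sub>0.
        (x has_field_derivative f t (vector [x t, y t]) $ 1) (at t) \<and>
        (y has_field_derivative f t (vector [x t, y t]) $ 2) (at t))"

text \<open>The base is the whole complex line; chart \<open>0\<close> has the original coordinates \<open>(x, y)\<close>.\<close>

definition phase_space ::
  "(complex \<Rightarrow> complex^2 \<Rightarrow> complex^2) \<Rightarrow> nat set \<Rightarrow> (nat \<Rightarrow> complex \<Rightarrow> complex^2 \<Rightarrow> complex^2) \<Rightarrow> bool" where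
  "phase_space f J \<phi> \<longleftrightarrow>
     0 \<in> J \<and> (\<forall>t z. \<phi> 0 t z = z) \<and>
     equiv (J \<times> UNIV) (glue J \<phi>) \<and> complex_manifold (glued_atlas J \<phi>) \<and>
     (\<forall>j\<in>J. \<exists>g. polynomial_rhs g \<and> rewritten_system f (\<phi> j) g) \<and>
     (\<forall>t\<^sub>0 x y. meromorphic_solution_near f t\<^sub>0 x y \<longrightarrow>
        (\<exists>r>0. \<exists>\<Gamma>. holo_curve (glued_atlas J \<phi>) (ball t\<^sub>0 r) \<Gamma> \<and>
           (\<forall>t\<in>ball t\<^sub>0 r - {t\<^sub>0}. \<Gamma> t = glued_point J \<phi> 0 (vector [x t, y t, t]))))"


section \<open>The system and its charts\<close>

text \<open>The parameter \<open>s\<close> is the chosen square root of \<open>-\<beta>\<close>.\<close>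

definition system :: "complex \<Rightarrow> complex \<Rightarrow> complex \<Rightarrow> complex^2 \<Rightarrow> complex^2" where
  "system \<alpha> s t z = (let x = z $ 1; y = z $ 2 in
     vector [x * y + s, 3/2 * x^2 - 1/2 * y^2 + \<alpha> / 2])"

definition chart :: "complex \<Rightarrow> complex \<Rightarrow> nat \<Rightarrow> complex^2 \<Rightarrow> complex^2" where
  "chart \<alpha> s j z = (let x = z $ 1; y = z $ 2 in
     if j = 0 then vector [x, y]
     else if j = 1 then vector [1 / x, - ((y - x) * x - (\<alpha> - 2 * s) / 2) * x]
     else if j = 2 then vector [1 / x, - ((y + x) * x + (\<alpha> + 2 * s) / 2) * x]
     else vector [- (x * y + 2 * s) * y, 1 / y])"

end

theory Submission
  imports Defs
begin

text \<open>The gluing relation identifies two points of different charts exactly if both lie over the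
  same point \<open>(x, y)\<close> of the affine plane. The Hamiltonian is a constant of motion. If \<open>x\<close> has a pole,
  it forces \<open>y / x\<close> to tend to \<open>1\<close> or \<open>-1\<close> and gives the limit of the second coordinate of chart 1
  or 2; if only \<open>y\<close> has a pole, it gives the limit of the first coordinate of chart 3. So every solution
  extends into one of the charts.

  For the surface, blow up three times over each of the points \<open>[1 : 1 : 0]\<close>, \<open>[1 : -1 : 0]\<close> and
  \<open>[0 : 1 : 0]\<close> of the line at infinity. Only the first blow-up over each point meets that line, so
  its self-intersection drops from \<open>1\<close> to \<open>-2\<close>. The first two exceptional curves over each point
  become \<open>(-2)\<close>-curves and form an arm of the diagram, and the last one minus a point consists of the
  points that one chart adds to the affine plane.\<close>

section \<open>Holomorphic functions of several variables\<close>

text \<open>The three centres of an arm are dictated by the chart that the arm has to produce. With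
  \<open>m = y / x\<close> and \<open>n = 1 / x\<close> near \<open>[1 : 1 : 0]\<close>, chart 1
  solved for \<open>y\<close> reads \<open>m = 1 + a n^2 - y_1 n^3\<close>, where
  \<open>a = (\<alpha> - 2 s) / 2\<close>. The curves \<open>y_1 = const\<close> share the point,
  the direction and the second order term, so three blow-ups separate them, and only the last centre
  depends on the parameters. The obstacle is the self-intersection number, which is the degree of a
  line bundle and has to be certified by a meromorphic section. An explicit section with known
  orders is therefore carried through all blow-ups; at a blow-up of a point of the curve it is
  divided by the equation of the exceptional curve, which lowers the degree by one. To keep this
  computable, every centre is chosen in a chart in which the curve through it is a coordinate line
  with the coordinate itself as its equation. Infinitely near points are formal terms, so a further
  invariant is needed to ensure that the points created by a blow-up are new.\<close>

definition vholo_on :: "(complex^'m) set \<Rightarrow> (complex^'m \<Rightarrow> complex^'n) \<Rightarrow> bool" where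
  "vholo_on S f \<longleftrightarrow> (\<forall>i. holo_on S (\<lambda>v. f v $ i))"

lemma holo_onI:
  "(\<And>z. z \<in> S \<Longrightarrow> \<exists>L. (f has_derivative L) (at z) \<and> (\<forall>c v. L (c *s v) = c * L v)) \<Longrightarrow> holo_on S f"
  by (auto simp: holo_on_def)

lemma holo_onE:
  assumes "holo_on S f" "z \<in> S"
  obtains L where "(f has_derivative L) (at z)" "\<And>c v. L (c *s v) = c * L v"
  using assms by (auto simp: holo_on_def)

lemma holo_on_subset: "holo_on S f \<Longrightarrow> T \<subseteq> S \<Longrightarrow> holo_on T f"
  by (auto simp: holo_on_def)

lemma vholo_on_subset: "vholo_on S f \<Longrightarrow> T \<subseteq> S \<Longrightarrow> vholo_on T f"
  by (auto simp: vholo_on_def intro: holo_on_subset)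

lemma holo_on_nth: "vholo_on S f \<Longrightarrow> holo_on S (\<lambda>v. f v $ i)"
  by (simp add: vholo_on_def)

lemma holo_on_const: "holo_on S (\<lambda>_. c)"
  by (rule holo_onI, rule exI[of _ "\<lambda>_. 0"]) (auto intro: derivative_eq_intros)

lemma holo_on_coord: "holo_on S (\<lambda>v. v $ i)"
  by (rule holo_onI, rule exI[of _ "\<lambda>v. v $ i"])
    (auto intro!: bounded_linear_imp_has_derivative bounded_linear_vec_nth)

lemma vholo_on_id: "vholo_on S (\<lambda>v. v)"
  by (simp add: vholo_on_def holo_on_coord)

lemma holo_on_add:
  assumes "holo_on S f" "holo_on S g"
  shows "holo_on S (\<lambda>v. f v + g v)"
proof (rule holo_onI)
  fix z assume z: "z \<in> S"
  obtain L where L: "(f has_derivative L) (at z)"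
    "\<And>c v. L (c *s v) = c * L v" using holo_onE[OF assms(1) z] by blast
  obtain M where M: "(g has_derivative M) (at z)"
    "\<And>c v. M (c *s v) = c * M v" using holo_onE[OF assms(2) z] by blast
  show "\<exists>L. ((\<lambda>v. f v + g v) has_derivative L) (at z) \<and> (\<forall>c v. L (c *s v) = c * L v)"
    by (rule exI[of _ "\<lambda>v. L v + M v"]) (auto intro!: derivative_eq_intros L(1) M(1) simp: L M algebra_simps)
qed

lemma holo_on_mult:
  assumes "holo_on S f" "holo_on S g"
  shows "holo_on S (\<lambda>v. f v * g v)"
proof (rule holo_onI)
  fix z assume z: "z \<in> S"
  obtain L where L: "(f has_derivative L) (at z)"
    "\<And>c v. L (c *s v) = c * L v" using holo_onE[OF assms(1) z] by blast
  obtain M where M: "(g has_derivative M) (at z)"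
    "\<And>c v. M (c *s v) = c * M v" using holo_onE[OF assms(2) z] by blast
  show "\<exists>L. ((\<lambda>v. f v * g v) has_derivative L) (at z) \<and> (\<forall>c v. L (c *s v) = c * L v)"
    by (rule exI[of _ "\<lambda>v. f z * M v + L v * g z"])
      (auto intro!: derivative_eq_intros L(1) M(1) simp: L M algebra_simps)
qed

lemma holo_on_minus: "holo_on S f \<Longrightarrow> holo_on S (\<lambda>v. - f v)"
  using holo_on_mult[OF holo_on_const[of S "-1"], of f] by simp

lemma holo_on_diff: "holo_on S f \<Longrightarrow> holo_on S g \<Longrightarrow> holo_on S (\<lambda>v. f v - g v)"
  using holo_on_add[of S f "\<lambda>v. - g v"] holo_on_minus[of S g] by simp

lemma holo_on_power: "holo_on S f \<Longrightarrow> holo_on S (\<lambda>v. f v ^ n)"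
  by (induction n) (auto intro: holo_on_const holo_on_mult)

lemma holo_on_inverse:
  assumes "holo_on S f" "\<And>z. z \<in> S \<Longrightarrow> f z \<noteq> 0"
  shows "holo_on S (\<lambda>v. inverse (f v))"
proof (rule holo_onI)
  fix z assume z: "z \<in> S"
  obtain L where L: "(f has_derivative L) (at z)"
    "\<And>c v. L (c *s v) = c * L v" using holo_onE[OF assms(1) z] by blast
  show "\<exists>L. ((\<lambda>v. inverse (f v)) has_derivative L) (at z) \<and> (\<forall>c v. L (c *s v) = c * L v)"
    by (rule exI[of _ "\<lambda>v. - (inverse (f z) * L v * inverse (f z))"])
      (auto intro!: derivative_eq_intros L(1) assms(2) z simp: L algebra_simps)
qed

lemma holo_on_divide:
  "holo_on S f \<Longrightarrow> holo_on S g \<Longrightarrow> (\<And>z. z \<in> S \<Longrightarrow> g z \<noteq> 0) \<Longrightarrow> holo_on S (\<lambda>v. f v / g v)"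
  using holo_on_mult[of S f "\<lambda>v. inverse (g v)"] holo_on_inverse[of S g] by (simp add: divide_inverse)

lemmas holo_intros = holo_on_const holo_on_coord holo_on_add holo_on_mult holo_on_minus holo_on_diff
  holo_on_power holo_on_divide holo_on_nth

text \<open>Derivatives at a point depend on the values in a whole neighbourhood, so the two
  functions are compared on an open set.\<close>

lemma holo_on_cong:
  assumes "open S" "holo_on S f" "\<And>z. z \<in> S \<Longrightarrow> f z = g z"
  shows "holo_on S g"
proof (rule holo_onI)
  fix z assume z: "z \<in> S"
  obtain L where L: "(f has_derivative L) (at z)"
    "\<And>c v. L (c *s v) = c * L v" using holo_onE[OF assms(2) z] by blast
  have "(g has_derivative L) (at z)"
    by (rule has_derivative_transform_within_open[OF L(1) assms(1) z assms(3)])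
  with L show "\<exists>L. (g has_derivative L) (at z) \<and> (\<forall>c v. L (c *s v) = c * L v)" by blast
qed

lemma vholo_on_cong:
  assumes "open S" "vholo_on S f" "\<And>z. z \<in> S \<Longrightarrow> f z = g z"
  shows "vholo_on S g"
  unfolding vholo_on_def
proof
  fix i
  show "holo_on S (\<lambda>v. g v $ i)"
    by (rule holo_on_cong[OF assms(1), of "\<lambda>v. f v $ i"]) (use assms in \<open>auto simp: vholo_on_def\<close>)
qed

text \<open>\<open>holo_on\<close> speaks of full derivatives at the points, not of derivatives
  within the set. It is thus a condition on single points.\<close>

lemma holo_on_locally:
  assumes "\<And>z. z \<in> S \<Longrightarrow> \<exists>N. z \<in> N \<and> holo_on N f"
  shows "holo_on S f"
  unfolding holo_on_def using assms unfolding holo_on_def by blast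

text \<open>A real basis vector is \<open>axis i u\<close> with \<open>u\<close> a basis vector of
  the complex plane, so the real coordinates of \<open>f\<close> are real coordinates of its complex
  components.\<close>

lemma has_derivative_vec:
  fixes f :: "'a::real_normed_vector \<Rightarrow> complex^'n"
  assumes "\<And>i. ((\<lambda>v. f v $ i) has_derivative L i) (at z)"
  shows "(f has_derivative (\<lambda>v. \<chi> i. L i v)) (at z)"
proof -
  have "((\<lambda>v. f v \<bullet> b) has_derivative (\<lambda>v. (\<chi> i. L i v) \<bullet> b)) (at z)" if "b \<in> Basis" for b
  proof -
    from that obtain i u where b: "b = axis i u" by (auto simp: Basis_vec_def)
    have "((\<lambda>v. f v $ i \<bullet> u) has_derivative (\<lambda>v. L i v \<bullet> u)) (at z)"
      by (rule has_derivative_inner_left[OF assms])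
    then show ?thesis by (simp add: b inner_axis)
  qed
  then show ?thesis using has_derivative_componentwise_within[of f _ z UNIV] by blast
qed

lemma vholo_onE:
  fixes f :: "complex^'m \<Rightarrow> complex^'n"
  assumes "vholo_on S f" "z \<in> S"
  obtains L where "(f has_derivative L) (at z)" "\<And>c v. L (c *s v) = c *s L v"
proof -
  have "\<forall>i. \<exists>L. ((\<lambda>v. f v $ i) has_derivative L) (at z) \<and> (\<forall>c v. L (c *s v) = c * L v)"
    using assms by (auto simp: vholo_on_def holo_on_def)
  then obtain L where L: "\<And>i. ((\<lambda>v. f v $ i) has_derivative L i) (at z)"
    "\<And>i c v. L i (c *s v) = c * L i v" by metis
  show ?thesis
    by (rule that[OF has_derivative_vec[OF L(1)]]) (simp add: vec_eq_iff L(2))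
qed

lemma holo_on_imp_continuous_on: "holo_on S f \<Longrightarrow> continuous_on S f"
  by (meson continuous_at_imp_continuous_on has_derivative_continuous holo_on_def)

lemma vholo_on_imp_continuous_on: "vholo_on S f \<Longrightarrow> continuous_on S f"
  by (meson continuous_at_imp_continuous_on has_derivative_continuous vholo_onE)

lemma holo_on_compose:
  assumes "vholo_on S f" "holo_on T g" "f ` S \<subseteq> T"
  shows "holo_on S (\<lambda>v. g (f v))"
proof (rule holo_onI)
  fix z assume z: "z \<in> S"
  obtain L where L: "(f has_derivative L) (at z)"
    "\<And>c v. L (c *s v) = c *s L v" using vholo_onE[OF assms(1) z] by blast
  from z assms(3) have fz: "f z \<in> T" by blast
  obtain M where M: "(g has_derivative M) (at (f z))"
    "\<And>c v. M (c *s v) = c * M v" using holo_onE[OF assms(2) fz] by blast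
  show "\<exists>L. ((\<lambda>v. g (f v)) has_derivative L) (at z) \<and> (\<forall>c v. L (c *s v) = c * L v)"
    by (rule exI[of _ "\<lambda>v. M (L v)"]) (use has_derivative_compose[OF L(1) M(1)] L M in auto)
qed

lemma vholo_on_compose:
  "vholo_on S f \<Longrightarrow> vholo_on T g \<Longrightarrow> f ` S \<subseteq> T \<Longrightarrow> vholo_on S (\<lambda>v. g (f v))"
  unfolding vholo_on_def[of _ "\<lambda>v. g (f v)"] vholo_on_def[of T g] using holo_on_compose by blast

definition vholomorphic_on :: "(complex \<Rightarrow> complex^'n) \<Rightarrow> complex set \<Rightarrow> bool" where
  "vholomorphic_on f S \<longleftrightarrow> (\<forall>i. (\<lambda>t. f t $ i) holomorphic_on S)"

lemma vholomorphic_on_subset: "vholomorphic_on f S \<Longrightarrow> T \<subseteq> S \<Longrightarrow> vholomorphic_on f T"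
  by (auto simp: vholomorphic_on_def intro: holomorphic_on_subset)

lemma vholomorphic_onD:
  fixes f :: "complex \<Rightarrow> complex^'n"
  assumes "vholomorphic_on f S" "open S" "t \<in> S"
  shows "(f has_derivative (\<lambda>h. h *s (\<chi> i. deriv (\<lambda>t. f t $ i) t))) (at t)"
proof -
  have "((\<lambda>t. f t $ i) has_derivative (\<lambda>h. deriv (\<lambda>t. f t $ i) t * h)) (at t)" for i
    using assms holomorphic_derivI[of "\<lambda>t. f t $ i" S t]
    by (auto simp: vholomorphic_on_def has_field_derivative_def)
  from has_derivative_vec[OF this] show ?thesis
    by (simp add: vector_scalar_mult_def mult.commute)
qed

lemma vholomorphic_on_imp_continuous_on: "vholomorphic_on f S \<Longrightarrow> continuous_on S f"
  unfolding vholomorphic_on_def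
  by (rule continuous_on_vec_lambda[where f = "\<lambda>i t. f t $ i", simplified])
     (auto intro: holomorphic_on_imp_continuous_on)

text \<open>The differential \<open>M\<close> is complex homogeneous, so the scalar factor in the
  differential of the curve can be pulled out of it. The real chain rule then gives a complex
  derivative, namely \<open>M\<close> applied to the velocity vector.\<close>

lemma has_field_derivative_holo_compose:
  fixes f :: "complex \<Rightarrow> complex^'n"
  assumes "vholomorphic_on f S" "open S" "t \<in> S"
    and "(g has_derivative M) (at (f t))" "\<And>c v. M (c *s v) = c * M v"
  shows "((\<lambda>t. g (f t)) has_field_derivative M (\<chi> i. deriv (\<lambda>t. f t $ i) t)) (at t)"
proof -
  have "(\<lambda>h. h * M (\<chi> i. deriv (\<lambda>t. f t $ i) t)) = times (M (\<chi> i. deriv (\<lambda>t. f t $ i) t))"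
    by (auto simp: mult.commute)
  with has_derivative_compose[OF vholomorphic_onD[OF assms(1-3)] assms(4)] assms(5)
  show ?thesis by (simp add: has_field_derivative_def)
qed

lemma holomorphic_on_holo_compose:
  fixes f :: "complex \<Rightarrow> complex^'n"
  assumes "vholomorphic_on f S" "open S" "holo_on T g" "f ` S \<subseteq> T"
  shows "(\<lambda>t. g (f t)) holomorphic_on S"
proof -
  have "\<exists>D. ((\<lambda>t. g (f t)) has_field_derivative D) (at t)" if t: "t \<in> S" for t
  proof -
    from t assms(4) have fz: "f t \<in> T" by blast
    obtain M where "(g has_derivative M) (at (f t))"
      "\<And>c v. M (c *s v) = c * M v" using holo_onE[OF assms(3) fz] by blast
    from has_field_derivative_holo_compose[OF assms(1,2) t this] show ?thesis by blast
  qed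
  then show ?thesis using assms(2) by (auto simp: holomorphic_on_open)
qed

lemma vholomorphic_on_holo_compose:
  "vholomorphic_on f S \<Longrightarrow> open S \<Longrightarrow> vholo_on T g \<Longrightarrow> f ` S \<subseteq> T \<Longrightarrow> vholomorphic_on (\<lambda>t. g (f t)) S"
  unfolding vholomorphic_on_def[of "\<lambda>t. g (f t)"] vholo_on_def[of T g]
  using holomorphic_on_holo_compose by blast

section \<open>Atlases with holomorphic transition maps\<close>

text \<open>Manifolds and holomorphic maps are defined through \<open>inv_into\<close>. Here a local
  coordinate expression \<open>f\<close> of \<open>h\<close> in the parametrization
  \<open>\<eta>\<close> merely has to be exhibited near \<open>v\<close>; injectivity of
  \<open>\<eta>\<close> later identifies it with \<open>inv_into\<close>.\<close>

definition lift_at ::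
  "(complex^'n) set \<Rightarrow> (complex^'n \<Rightarrow> 'p) \<Rightarrow> (complex^'m \<Rightarrow> 'p) \<Rightarrow> complex^'m \<Rightarrow> bool" where
  "lift_at W \<eta> h v \<longleftrightarrow>
     (\<exists>N f. open N \<and> v \<in> N \<and> vholo_on N f \<and> f ` N \<subseteq> W \<and> (\<forall>x\<in>N. \<eta> (f x) = h x))"

text \<open>The part of \<open>complex_manifold\<close> that concerns transition maps, in pointwise
  form. The work on blow-ups relies on this part alone; the Hausdorff property and second
  countability are added only for the glued space.\<close>

definition compat :: "('n::finite, 'p) atlas \<Rightarrow> bool" where
  "compat A \<longleftrightarrow> (\<forall>(V, \<psi>)\<in>A. open V \<and> inj_on \<psi> V) \<and>
     (\<forall>(V, \<psi>)\<in>A. \<forall>(W, \<eta>)\<in>A. \<forall>v\<in>V. \<psi> v \<in> \<eta> ` W \<longrightarrow> lift_at W \<eta> \<psi> v)"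

lemma compat_open: "compat A \<Longrightarrow> (V, \<psi>) \<in> A \<Longrightarrow> open V"
  and compat_inj: "compat A \<Longrightarrow> (V, \<psi>) \<in> A \<Longrightarrow> inj_on \<psi> V"
  by (auto simp: compat_def)

lemma compat_lift:
  assumes "compat A" "(V, \<psi>) \<in> A" "(W, \<eta>) \<in> A" "v \<in> V" "\<psi> v \<in> \<eta> ` W"
  obtains N f where "open N" "v \<in> N" "N \<subseteq> V" "vholo_on N f" "f ` N \<subseteq> W" "\<And>x. x \<in> N \<Longrightarrow> \<eta> (f x) = \<psi> x"
proof -
  have "lift_at W \<eta> \<psi> v" using assms unfolding compat_def by fast
  then obtain N f where N: "open N" "v \<in> N" "vholo_on N f" "f ` N \<subseteq> W" "\<forall>x\<in>N. \<eta> (f x) = \<psi> x"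
    by (auto simp: lift_at_def)
  show ?thesis
    by (rule that[of "N \<inter> V" f]) (use N assms compat_open[OF assms(1,2)] in \<open>auto intro: vholo_on_subset\<close>)
qed

lemma lift_atI:
  "open N \<Longrightarrow> v \<in> N \<Longrightarrow> vholo_on N f \<Longrightarrow> (\<And>x. x \<in> N \<Longrightarrow> f x \<in> W) \<Longrightarrow> (\<And>x. x \<in> N \<Longrightarrow> \<eta> (f x) = h x)
    \<Longrightarrow> lift_at W \<eta> h v"
  by (auto simp: lift_at_def)

text \<open>An injective parametrization leaves only one candidate for a lift with values in
  \<open>W\<close>.\<close>

lemma lift_at_inv:
  assumes "lift_at W \<eta> h v" "inj_on \<eta> W"
  shows "\<exists>N. open N \<and> v \<in> N \<and> vholo_on N (\<lambda>x. inv_into W \<eta> (h x)) \<and> (\<forall>x\<in>N. h x \<in> \<eta> ` W)"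
proof -
  from assms(1) obtain N f where N: "open N" "v \<in> N" "vholo_on N f" "f ` N \<subseteq> W"
    "\<forall>x\<in>N. \<eta> (f x) = h x" by (auto simp: lift_at_def)
  have eq: "f x = inv_into W \<eta> (h x)" if "x \<in> N" for x
    using N that assms(2) by (metis image_subset_iff inv_into_f_f)
  have "vholo_on N (\<lambda>x. inv_into W \<eta> (h x))" by (rule vholo_on_cong[OF N(1,3) eq])
  with N show ?thesis by (metis image_eqI image_subset_iff)
qed

text \<open>The lift is composed with the transition map from \<open>V\<close> to \<open>W\<close>.
  Its domain shrinks to a preimage under the first lift, which is open by continuity.\<close>

lemma lift_change:
  fixes A :: "('n::finite, 'p) atlas"
  assumes "compat A" "(V, \<psi>) \<in> A" "(W, \<eta>) \<in> A" "lift_at V \<psi> h v" "h v \<in> \<eta> ` W"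
  shows "lift_at W \<eta> h v"
proof -
  from assms(4) obtain N f where N: "open N" "v \<in> N" "vholo_on N f" "f ` N \<subseteq> V"
    "\<forall>x\<in>N. \<psi> (f x) = h x" by (auto simp: lift_at_def)
  have "f v \<in> V" "\<psi> (f v) \<in> \<eta> ` W" using N assms(5) by auto
  from compat_lift[OF assms(1-3) this] obtain M g where M: "open M" "f v \<in> M" "M \<subseteq> V" "vholo_on M g"
    "g ` M \<subseteq> W" "\<And>x. x \<in> M \<Longrightarrow> \<eta> (g x) = \<psi> x" by blast
  define N' where "N' = N \<inter> f -` M"
  have op: "open N'"
    unfolding N'_def using continuous_on_open_vimage[OF N(1), of f] vholo_on_imp_continuous_on[OF N(3)] M(1)
    by (metis Int_commute)
  show ?thesis
  proof (rule lift_atI[of N' v "\<lambda>x. g (f x)"])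
    show "vholo_on N' (\<lambda>x. g (f x))"
      by (rule vholo_on_compose[OF vholo_on_subset[OF N(3)] M(4)]) (auto simp: N'_def)
  qed (use N M op in \<open>auto simp: N'_def\<close>)
qed

text \<open>Local lifts are unique, so they patch together to the coordinate expression on the whole
  set where the chart \<open>W\<close> is reached.\<close>

lemma lift_domain:
  fixes A :: "('n::finite, 'p) atlas" and h :: "complex^'m \<Rightarrow> 'p"
  assumes "compat A" "(W, \<eta>) \<in> A" "open S"
    and "\<And>v. v \<in> S \<Longrightarrow> h v \<in> \<eta> ` W \<Longrightarrow> lift_at W \<eta> h v"
  shows "open {v \<in> S. h v \<in> \<eta> ` W}" (is "open ?D")
    and "vholo_on {v \<in> S. h v \<in> \<eta> ` W} (\<lambda>v. inv_into W \<eta> (h v))"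
proof -
  note inj = compat_inj[OF assms(1,2)]
  have *: "\<exists>N. open N \<and> v \<in> N \<and> vholo_on N (\<lambda>x. inv_into W \<eta> (h x)) \<and> N \<subseteq> ?D" if "v \<in> ?D" for v
  proof -
    from that lift_at_inv[OF assms(4) inj, of v] obtain N where "open N" "v \<in> N"
      "vholo_on N (\<lambda>x. inv_into W \<eta> (h x))" "\<forall>x\<in>N. h x \<in> \<eta> ` W" by blast
    then show ?thesis using that assms(3) by (intro exI[of _ "N \<inter> S"]) (auto intro: vholo_on_subset)
  qed
  then show "open ?D" by (subst open_subopen) blast
  show "vholo_on ?D (\<lambda>v. inv_into W \<eta> (h v))"
    unfolding vholo_on_def
  proof
    fix i
    show "holo_on ?D (\<lambda>v. inv_into W \<eta> (h v) $ i)"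
      by (rule holo_on_locally) (use * in \<open>unfold vholo_on_def, blast\<close>)
  qed
qed

lemma lift_at_chart:
  assumes "compat A" "(V, \<psi>) \<in> A" "(W, \<eta>) \<in> A" "v \<in> V" "\<psi> v \<in> \<eta> ` W"
  shows "lift_at W \<eta> \<psi> v"
  using assms unfolding compat_def by fast

lemma complex_manifoldI:
  assumes "compat A" "Hausdorff_space (manifold_topology A)" "second_countable (manifold_topology A)"
  shows "complex_manifold A"
proof -
  have "open {v \<in> V. \<psi> v \<in> \<eta> ` W} \<and> (\<forall>i. holo_on {v \<in> V. \<psi> v \<in> \<eta> ` W} (\<lambda>v. inv_into W \<eta> (\<psi> v) $ i))"
    if "(V, \<psi>) \<in> A" "(W, \<eta>) \<in> A" for V \<psi> W \<eta>
    using lift_domain[OF assms(1) that(2) compat_open[OF assms(1) that(1)], of \<psi>]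
      lift_at_chart[OF assms(1) that] by (auto simp: vholo_on_def)
  with assms show ?thesis by (auto simp: complex_manifold_def compat_def)
qed

text \<open>One suitable target chart at each point is enough: \<open>lift_change\<close> carries
  the lift over to every other chart of \<open>B\<close> that contains the image point.\<close>

lemma holo_mapI:
  fixes A :: "('m::finite, 'p) atlas" and B :: "('n::finite, 'q) atlas"
  assumes "compat B" "\<And>V \<psi>. (V, \<psi>) \<in> A \<Longrightarrow> open V"
    and "\<And>V \<psi> v. (V, \<psi>) \<in> A \<Longrightarrow> v \<in> V \<Longrightarrow> \<exists>(W, \<eta>)\<in>B. lift_at W \<eta> (\<lambda>v. f (\<psi> v)) v"
  shows "holo_map A B f"
proof -
  have "f (\<psi> v) \<in> points B" if "(V, \<psi>) \<in> A" "v \<in> V" for V \<psi> v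
  proof -
    from assms(3)[OF that] obtain W \<eta> where "(W, \<eta>) \<in> B" "lift_at W \<eta> (\<lambda>v. f (\<psi> v)) v" by blast
    then show ?thesis unfolding lift_at_def points_def by (metis (mono_tags, lifting) UN_iff case_prod_conv image_eqI image_subset_iff)
  qed
  moreover have "open {v \<in> V. f (\<psi> v) \<in> \<eta> ` W} \<and>
        (\<forall>i. holo_on {v \<in> V. f (\<psi> v) \<in> \<eta> ` W} (\<lambda>v. inv_into W \<eta> (f (\<psi> v)) $ i))"
    if "(V, \<psi>) \<in> A" "(W, \<eta>) \<in> B" for V \<psi> W \<eta>
  proof -
    have "lift_at W \<eta> (\<lambda>v. f (\<psi> v)) v" if v: "v \<in> V" "f (\<psi> v) \<in> \<eta> ` W" for v
      using assms(3)[OF \<open>(V, \<psi>) \<in> A\<close> v(1)] lift_change[OF assms(1) _ \<open>(W, \<eta>) \<in> B\<close>, of _ _ "\<lambda>v. f (\<psi> v)" v] v(2)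
      by blast
    from lift_domain[OF assms(1) that(2) assms(2)[OF that(1)], of "\<lambda>v. f (\<psi> v)"] this
    show ?thesis by (auto simp: vholo_on_def)
  qed
  ultimately show ?thesis by (auto simp: holo_map_def points_def)
qed

lemma openin_compat:
  "compat A \<Longrightarrow> openin (manifold_topology A) U \<longleftrightarrow>
     U \<subseteq> points A \<and> (\<forall>(V, \<psi>)\<in>A. open {v \<in> V. \<psi> v \<in> U})"
  by (rule openin_manifold_topology) (auto simp: compat_def)

text \<open>Parametrizations are open maps: in any other chart, the image of \<open>O'\<close> is
  locally the preimage of \<open>O'\<close> under a transition map.\<close>

lemma openin_chart:
  assumes "compat A" "(W, \<eta>) \<in> A" "open O'" "O' \<subseteq> W"
  shows "openin (manifold_topology A) (\<eta> ` O')"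
  unfolding openin_compat[OF assms(1)]
proof (intro conjI ballI)
  show "\<eta> ` O' \<subseteq> points A" using assms by (auto simp: points_def)
  fix X assume "X \<in> A"
  obtain V \<psi> where X: "X = (V, \<psi>)" by force
  with \<open>X \<in> A\<close> have A: "(V, \<psi>) \<in> A" by simp
  have "open {v \<in> V. \<psi> v \<in> \<eta> ` O'}"
  proof (subst open_subopen, intro ballI)
    fix v assume v: "v \<in> {v \<in> V. \<psi> v \<in> \<eta> ` O'}"
    then obtain w where w: "w \<in> O'" "\<psi> v = \<eta> w" by blast
    from v assms(4) have "v \<in> V" "\<psi> v \<in> \<eta> ` W" by blast+
    from compat_lift[OF assms(1) A assms(2) this] obtain N f where N: "open N" "v \<in> N" "N \<subseteq> V" "vholo_on N f"
      "f ` N \<subseteq> W" "\<And>x. x \<in> N \<Longrightarrow> \<eta> (f x) = \<psi> x" by blast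
    have fv: "f v = w" using N w assms(4) compat_inj[OF assms(1,2)]
      by (metis (no_types, opaque_lifting) image_subset_iff inj_onD subsetD)
    have "open (N \<inter> f -` O')"
      using continuous_on_open_vimage[OF N(1), of f] vholo_on_imp_continuous_on[OF N(4)] assms(3)
      by (metis Int_commute)
    moreover have "N \<inter> f -` O' \<subseteq> {v \<in> V. \<psi> v \<in> \<eta> ` O'}" using N(3,6) by force
    ultimately show "\<exists>T. open T \<and> v \<in> T \<and> T \<subseteq> {v \<in> V. \<psi> v \<in> \<eta> ` O'}"
      using N(2) w fv by (intro exI[of _ "N \<inter> f -` O'"]) auto
  qed
  then show "case X of (V, \<psi>) \<Rightarrow> open {v \<in> V. \<psi> v \<in> \<eta> ` O'}" by (simp add: X)
qed

lemma topspace_manifold_topology: "compat A \<Longrightarrow> topspace (manifold_topology A) = points A"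
proof -
  assume A: "compat A"
  have "openin (manifold_topology A) (points A)"
    unfolding openin_compat[OF A]
  proof (intro conjI ballI, simp)
    fix X assume "X \<in> A"
    then have "{v \<in> fst X. snd X v \<in> points A} = fst X" unfolding points_def by (cases X) auto
    with A \<open>X \<in> A\<close> show "case X of (V, \<psi>) \<Rightarrow> open {v \<in> V. \<psi> v \<in> points A}"
      by (auto simp: compat_def)
  qed
  then show ?thesis
    by (meson A openin_compat openin_subset openin_topspace subset_antisym)
qed

text \<open>A countable base of the coordinate space, pushed forward by countably many charts, is a
  base.\<close>

lemma second_countable_atlas:
  assumes "compat A" "countable A"
  shows "second_countable (manifold_topology A)"
proof -
  obtain \<B> :: "(complex^'a) set set" where B: "countable \<B>" "\<And>C. C \<in> \<B> \<Longrightarrow> open C"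
    "\<And>S. open S \<Longrightarrow> \<exists>U. U \<subseteq> \<B> \<and> S = \<Union>U"
    using univ_second_countable by blast
  define \<C> where "\<C> = (\<lambda>((V, \<psi>), O'). \<psi> ` (V \<inter> O')) ` (A \<times> \<B>)"
  have "countable \<C>" unfolding \<C>_def using assms(2) B(1) by auto
  moreover have "openin (manifold_topology A) C" if "C \<in> \<C>" for C
    using that B(2) openin_chart[OF assms(1)] compat_open[OF assms(1)] by (auto simp: \<C>_def intro!: openin_chart[OF assms(1)])
  moreover have "\<exists>C\<in>\<C>. x \<in> C \<and> C \<subseteq> U" if U: "openin (manifold_topology A) U" "x \<in> U" for U x
  proof -
    from U openin_compat[OF assms(1)] have *: "U \<subseteq> points A" "\<forall>(V, \<psi>)\<in>A. open {v \<in> V. \<psi> v \<in> U}" by auto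
    from * U(2) obtain V \<psi> v where V: "(V, \<psi>) \<in> A" "v \<in> V" "x = \<psi> v" by (auto simp: points_def)
    with * have "open {v \<in> V. \<psi> v \<in> U}" by blast
    with B(3) obtain \<U> where "\<U> \<subseteq> \<B>" "{v \<in> V. \<psi> v \<in> U} = \<Union>\<U>" by blast
    then obtain O' where O': "O' \<in> \<B>" "v \<in> O'" "O' \<subseteq> {v \<in> V. \<psi> v \<in> U}" using V U(2) by blast
    then have "\<psi> ` (V \<inter> O') \<in> \<C>"
      unfolding \<C>_def using V(1) by (intro image_eqI[where x = "((V, \<psi>), O')"]) simp_all
    moreover have "x \<in> \<psi> ` (V \<inter> O')" "\<psi> ` (V \<inter> O') \<subseteq> U" using O' V by auto
    ultimately show ?thesis by (intro bexI[of _ "\<psi> ` (V \<inter> O')"] conjI)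
  qed
  ultimately show ?thesis unfolding second_countable_def by blast
qed

text \<open>Charts are open maps, so points may be separated inside the coordinate domains.\<close>

lemma Hausdorff_atlas:
  assumes "compat A"
    and "\<And>V \<psi> W \<eta> v w. (V, \<psi>) \<in> A \<Longrightarrow> (W, \<eta>) \<in> A \<Longrightarrow> v \<in> V \<Longrightarrow> w \<in> W \<Longrightarrow> \<psi> v \<noteq> \<eta> w \<Longrightarrow>
      \<exists>N M. open N \<and> open M \<and> v \<in> N \<and> w \<in> M \<and> N \<subseteq> V \<and> M \<subseteq> W \<and> \<psi> ` N \<inter> \<eta> ` M = {}"
  shows "Hausdorff_space (manifold_topology A)"
  unfolding Hausdorff_space_def topspace_manifold_topology[OF assms(1)]
proof (intro allI impI)
  fix x y assume xy: "x \<in> points A \<and> y \<in> points A \<and> x \<noteq> y"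
  then obtain V \<psi> v W \<eta> w where "(V, \<psi>) \<in> A" "v \<in> V" "x = \<psi> v" "(W, \<eta>) \<in> A" "w \<in> W" "y = \<eta> w"
    by (auto simp: points_def)
  with assms(2)[of V \<psi> W \<eta> v w] xy obtain N M where
    "open N \<and> open M \<and> v \<in> N \<and> w \<in> M \<and> N \<subseteq> V \<and> M \<subseteq> W \<and> \<psi> ` N \<inter> \<eta> ` M = {}" by blast
  with openin_chart[OF assms(1) \<open>(V, \<psi>) \<in> A\<close>, of N] openin_chart[OF assms(1) \<open>(W, \<eta>) \<in> A\<close>, of M]
  show "\<exists>U V. openin (manifold_topology A) U \<and> openin (manifold_topology A) V \<and> x \<in> U \<and> y \<in> V \<and> disjnt U V"
    using \<open>x = \<psi> v\<close> \<open>y = \<eta> w\<close> unfolding disjnt_def by blast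
qed

lemma holo_fun_on_chart:
  assumes "compat A" "(W, \<eta>) \<in> A" "holo_on O' g" "O' \<subseteq> W" "open O'"
  shows "holo_fun_on A (\<eta> ` O') (\<lambda>p. g (inv_into W \<eta> p))"
  unfolding holo_fun_on_def
proof clarify
  fix V \<psi> assume A: "(V, \<psi>) \<in> A"
  note inj = compat_inj[OF assms(1,2)]
  have h: "vholo_on {v \<in> V. \<psi> v \<in> \<eta> ` W} (\<lambda>v. inv_into W \<eta> (\<psi> v))"
    by (rule lift_domain(2)[OF assms(1,2) compat_open[OF assms(1) A]]) (rule lift_at_chart[OF assms(1) A assms(2)])
  show "holo_on {v \<in> V. \<psi> v \<in> \<eta> ` O'} (\<lambda>v. g (inv_into W \<eta> (\<psi> v)))"
    by (rule holo_on_compose[OF vholo_on_subset[OF h] assms(3)]) (use inj assms(4) in \<open>auto simp: subset_iff\<close>)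
qed

lemma holo_fun_on_intros:
  "holo_fun_on A U (\<lambda>_. c)"
  "holo_fun_on A U f \<Longrightarrow> holo_fun_on A U g \<Longrightarrow> holo_fun_on A U (\<lambda>p. f p * g p)"
  "holo_fun_on A U f \<Longrightarrow> holo_fun_on A U g \<Longrightarrow> (\<And>p. p \<in> U \<Longrightarrow> g p \<noteq> 0) \<Longrightarrow> holo_fun_on A U (\<lambda>p. f p / g p)"
proof -
  show "holo_fun_on A U (\<lambda>_. c)" unfolding holo_fun_on_def by (auto intro: holo_on_const)
  show "holo_fun_on A U (\<lambda>p. f p * g p)" if "holo_fun_on A U f" "holo_fun_on A U g"
    unfolding holo_fun_on_def
  proof clarify
    fix V \<psi> assume "(V, \<psi>) \<in> A"
    with that show "holo_on {v \<in> V. \<psi> v \<in> U} (\<lambda>v. f (\<psi> v) * g (\<psi> v))"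
      by (intro holo_on_mult) (auto simp: holo_fun_on_def)
  qed
  show "holo_fun_on A U (\<lambda>p. f p / g p)"
    if "holo_fun_on A U f" "holo_fun_on A U g" "\<And>p. p \<in> U \<Longrightarrow> g p \<noteq> 0"
    unfolding holo_fun_on_def
  proof clarify
    fix V \<psi> assume "(V, \<psi>) \<in> A"
    with that show "holo_on {v \<in> V. \<psi> v \<in> U} (\<lambda>v. f (\<psi> v) / g (\<psi> v))"
      by (intro holo_on_divide) (auto simp: holo_fun_on_def)
  qed
qed

lemma holo_fun_on_subset: "holo_fun_on A U g \<Longrightarrow> U' \<subseteq> U \<Longrightarrow> holo_fun_on A U' g"
proof -
  assume *: "holo_fun_on A U g" "U' \<subseteq> U"
  have "holo_on {v \<in> V. \<psi> v \<in> U'} (\<lambda>v. g (\<psi> v))" if "(V, \<psi>) \<in> A" for V \<psi>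
    by (rule holo_on_subset[of "{v \<in> V. \<psi> v \<in> U}"]) (use * that in \<open>auto simp: holo_fun_on_def\<close>)
  then show ?thesis by (auto simp: holo_fun_on_def)
qed

lemma vholo_on_vector2:
  fixes f g :: "complex^'n \<Rightarrow> complex"
  shows "holo_on S f \<Longrightarrow> holo_on S g \<Longrightarrow> vholo_on S (\<lambda>v. vector [f v, g v] :: complex^2)"
  by (simp add: vholo_on_def forall_2)

lemma vec2_eq_iff: "(v :: 'a^2) = w \<longleftrightarrow> v $ 1 = w $ 1 \<and> v $ 2 = w $ 2"
  by (simp add: vec_eq_iff forall_2)

subsection \<open>Curves\<close>

text \<open>The analogue of \<open>lift_at\<close> for a curve, with nonzero velocity built in.
  Embeddings of the Riemann sphere require this, and solution curves have it because time is one of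
  their coordinates.\<close>

definition clift_at ::
  "(complex^'n) set \<Rightarrow> (complex^'n \<Rightarrow> 'p) \<Rightarrow> (complex \<Rightarrow> 'p) \<Rightarrow> complex \<Rightarrow> bool" where
  "clift_at W \<eta> \<gamma> t \<longleftrightarrow>
     (\<exists>N f. open N \<and> t \<in> N \<and> vholomorphic_on f N \<and> f ` N \<subseteq> W \<and> (\<forall>x\<in>N. \<eta> (f x) = \<gamma> x) \<and>
        (\<exists>i. deriv (\<lambda>t. f t $ i) t \<noteq> 0))"

lemma clift_atI:
  assumes "open N" "t \<in> N" "vholomorphic_on f N" "\<And>x. x \<in> N \<Longrightarrow> f x \<in> W" "\<And>x. x \<in> N \<Longrightarrow> \<eta> (f x) = \<gamma> x"
    and "deriv (\<lambda>t. f t $ i) t \<noteq> 0"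
  shows "clift_at W \<eta> \<gamma> t"
  unfolding clift_at_def
proof (intro exI conjI)
  show "open N" "t \<in> N" "vholomorphic_on f N" "f ` N \<subseteq> W" "\<forall>x\<in>N. \<eta> (f x) = \<gamma> x"
    "deriv (\<lambda>t. f t $ i) t \<noteq> 0"
    using assms by auto
qed

text \<open>The transition map has a holomorphic inverse \<open>h\<close>. If the velocity vanished
  in the new chart, the chain rule for \<open>h\<close> would make it vanish in the old one.\<close>

lemma clift_change:
  fixes A :: "('n::finite, 'p) atlas"
  assumes "compat A" "(V, \<psi>) \<in> A" "(W, \<eta>) \<in> A" "clift_at V \<psi> \<gamma> t" "\<gamma> t \<in> \<eta> ` W"
  shows "clift_at W \<eta> \<gamma> t"
proof -
  from assms(4) obtain N f i where N: "open N" "t \<in> N" "vholomorphic_on f N" "f ` N \<subseteq> V"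
    "\<And>x. x \<in> N \<Longrightarrow> \<psi> (f x) = \<gamma> x" and i: "deriv (\<lambda>t. f t $ i) t \<noteq> 0" by (auto simp: clift_at_def)
  have ft: "f t \<in> V" "\<psi> (f t) \<in> \<eta> ` W" using N assms(5) by auto
  from compat_lift[OF assms(1-3) ft] obtain M g where M: "open M" "f t \<in> M" "M \<subseteq> V" "vholo_on M g"
    "g ` M \<subseteq> W" "\<And>x. x \<in> M \<Longrightarrow> \<eta> (g x) = \<psi> x" by blast
  have gt: "g (f t) \<in> W" "\<eta> (g (f t)) \<in> \<psi> ` V" using M(2,5,6) ft by auto
  from compat_lift[OF assms(1,3,2) gt] obtain K h where K: "open K" "g (f t) \<in> K" "K \<subseteq> W" "vholo_on K h"
    "h ` K \<subseteq> V" "\<And>x. x \<in> K \<Longrightarrow> \<psi> (h x) = \<eta> x" by blast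
  define N1 where "N1 = f -` M \<inter> N"
  have N1: "open N1" "N1 \<subseteq> N" "f ` N1 \<subseteq> M" "t \<in> N1"
    unfolding N1_def using continuous_on_open_vimage[OF N(1), of f] vholomorphic_on_imp_continuous_on[OF N(3)] M N
    by auto
  have gf: "vholomorphic_on (\<lambda>x. g (f x)) N1"
    by (rule vholomorphic_on_holo_compose[OF vholomorphic_on_subset[OF N(3) N1(2)] N1(1) M(4) N1(3)])
  define N2 where "N2 = (\<lambda>x. g (f x)) -` K \<inter> N1"
  have N2: "open N2" "N2 \<subseteq> N1" "t \<in> N2"
    unfolding N2_def using continuous_on_open_vimage[OF N1(1)] vholomorphic_on_imp_continuous_on[OF gf] K N1
    by auto
  have inv: "h (g (f x)) = f x" if "x \<in> N2" for x
  proof -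
    have x: "x \<in> N" "f x \<in> M" "g (f x) \<in> K" using that N2 N1 by (auto simp: N2_def)
    then have "\<psi> (h (g (f x))) = \<psi> (f x)" using K(6) M(6) by metis
    moreover have "h (g (f x)) \<in> V" "f x \<in> V" using x K(5) M(3) by auto
    ultimately show ?thesis using compat_inj[OF assms(1,2)] by (auto dest: inj_onD)
  qed
  have "\<exists>j. deriv (\<lambda>t. g (f t) $ j) t \<noteq> 0"
  proof (rule ccontr)
    assume no: "\<not> ?thesis"
    obtain L where L: "((\<lambda>v. h v $ i) has_derivative L) (at (g (f t)))" "\<And>c v. L (c *s v) = c * L v"
      using holo_onE[OF holo_on_nth[OF K(4)] K(2)] by blast
    have "((\<lambda>x. h (g (f x)) $ i) has_field_derivative L (\<chi> j. deriv (\<lambda>t. g (f t) $ j) t)) (at t)"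
      by (rule has_field_derivative_holo_compose[OF gf N1(1,4) L])
    \<comment> \<open>The zero vector is written as \<open>0 *s 0\<close>, so that the homogeneity
      of \<open>L\<close> yields the derivative \<open>0\<close>.\<close>
    also have "(\<chi> j. deriv (\<lambda>t. g (f t) $ j) t) = 0 *s 0" using no by (simp add: vec_eq_iff)
    finally have "((\<lambda>x. h (g (f x)) $ i) has_field_derivative 0) (at t)" by (simp only: L(2)) simp
    then have "((\<lambda>x. f x $ i) has_field_derivative 0) (at t)"
      by (rule has_field_derivative_transform_within_open[OF _ N2(1,3)]) (simp add: inv)
    with i show False by (simp add: DERIV_imp_deriv)
  qed
  then obtain j where "deriv (\<lambda>t. g (f t) $ j) t \<noteq> 0" ..
  show ?thesis
  proof (rule clift_atI[OF N1(1,4) gf _ _ \<open>deriv (\<lambda>t. g (f t) $ j) t \<noteq> 0\<close>])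
    fix x assume "x \<in> N1"
    with N1 have x: "x \<in> N" "f x \<in> M" by auto
    then show "g (f x) \<in> W" "\<eta> (g (f x)) = \<gamma> x" using M(5,6) N(5) by auto
  qed
qed

lemma clift_domain:
  assumes "compat A" "(W, \<eta>) \<in> A" "clift_at W \<eta> \<gamma> t"
  obtains N where "open N" "t \<in> N" "vholomorphic_on (\<lambda>x. inv_into W \<eta> (\<gamma> x)) N" "\<And>x. x \<in> N \<Longrightarrow> \<gamma> x \<in> \<eta> ` W"
    "\<exists>i. deriv (\<lambda>t. inv_into W \<eta> (\<gamma> t) $ i) t \<noteq> 0"
proof -
  from assms(3) obtain N f i where N: "open N" "t \<in> N" "vholomorphic_on f N" "f ` N \<subseteq> W"
    "\<And>x. x \<in> N \<Longrightarrow> \<eta> (f x) = \<gamma> x" and i: "deriv (\<lambda>t. f t $ i) t \<noteq> 0" by (auto simp: clift_at_def)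
  have eq: "f x = inv_into W \<eta> (\<gamma> x)" if "x \<in> N" for x
    using N(4,5) that compat_inj[OF assms(1,2)] by (metis image_subset_iff inv_into_f_f)
  show ?thesis
  proof (rule that[OF N(1,2)])
    show "vholomorphic_on (\<lambda>x. inv_into W \<eta> (\<gamma> x)) N"
      unfolding vholomorphic_on_def
    proof
      fix i
      show "(\<lambda>x. inv_into W \<eta> (\<gamma> x) $ i) holomorphic_on N"
        using N(3) eq by (subst holomorphic_cong[OF refl, of _ _ "\<lambda>x. f x $ i"]) (auto simp: vholomorphic_on_def)
    qed
    show "\<gamma> x \<in> \<eta> ` W" if "x \<in> N" for x using N(4,5) that by force
    have "deriv (\<lambda>t. inv_into W \<eta> (\<gamma> t) $ i) t = deriv (\<lambda>t. f t $ i) t"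
      by (rule deriv_cong_ev) (use eventually_nhds N(1,2) eq in \<open>auto simp: eventually_nhds\<close>)
    with i show "\<exists>i. deriv (\<lambda>t. inv_into W \<eta> (\<gamma> t) $ i) t \<noteq> 0" by metis
  qed
qed

lemma holo_curveI:
  assumes "compat A" "open T" "\<And>t. t \<in> T \<Longrightarrow> \<exists>(V, \<psi>)\<in>A. clift_at V \<psi> \<gamma> t"
  shows "holo_curve A T \<gamma>"
proof -
  have "\<gamma> ` T \<subseteq> points A"
  proof clarify
    fix t assume "t \<in> T"
    with assms(3) obtain V \<psi> where V: "(V, \<psi>) \<in> A" "clift_at V \<psi> \<gamma> t" by blast
    from V(2) have "\<gamma> t \<in> \<psi> ` V" unfolding clift_at_def by (metis image_eqI image_subset_iff)
    with V(1) show "\<gamma> t \<in> points A" by (auto simp: points_def)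
  qed
  moreover have "open {t \<in> T. \<gamma> t \<in> \<psi> ` V} \<and>
        (\<forall>i. (\<lambda>t. inv_into V \<psi> (\<gamma> t) $ i) holomorphic_on {t \<in> T. \<gamma> t \<in> \<psi> ` V})" (is "open ?D \<and> _")
    if A: "(V, \<psi>) \<in> A" for V \<psi>
  proof -
    have *: "\<exists>N. open N \<and> t \<in> N \<and> vholomorphic_on (\<lambda>x. inv_into V \<psi> (\<gamma> x)) N \<and> N \<subseteq> ?D" if "t \<in> ?D" for t
    proof -
      from that assms(3) obtain W \<eta> where W: "(W, \<eta>) \<in> A" "clift_at W \<eta> \<gamma> t" by blast
      have t: "\<gamma> t \<in> \<psi> ` V" using that by simp
      obtain N where N: "open N" "t \<in> N" "vholomorphic_on (\<lambda>x. inv_into V \<psi> (\<gamma> x)) N" "\<And>x. x \<in> N \<Longrightarrow> \<gamma> x \<in> \<psi> ` V"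
        using clift_domain[OF assms(1) A clift_change[OF assms(1) W(1) A W(2) t]] by metis
      have "vholomorphic_on (\<lambda>x. inv_into V \<psi> (\<gamma> x)) (N \<inter> T)"
        by (rule vholomorphic_on_subset[OF N(3)]) simp
      moreover have "open (N \<inter> T)" "t \<in> N \<inter> T" "N \<inter> T \<subseteq> ?D" using N assms(2) that by auto
      ultimately show ?thesis by metis
    qed
    then have op: "open ?D" by (subst open_subopen) blast
    moreover have "(\<lambda>t. inv_into V \<psi> (\<gamma> t) $ i) holomorphic_on ?D" for i
      unfolding holomorphic_on_open[OF op]
    proof
      fix t assume "t \<in> ?D"
      from *[OF this] obtain N where "open N" "t \<in> N" "(\<lambda>t. inv_into V \<psi> (\<gamma> t) $ i) holomorphic_on N"
        by (auto simp: vholomorphic_on_def)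
      then show "\<exists>D. ((\<lambda>t. inv_into V \<psi> (\<gamma> t) $ i) has_field_derivative D) (at t)"
        by (auto simp: holomorphic_on_open)
    qed
    ultimately show ?thesis by blast
  qed
  ultimately show ?thesis using assms(2) unfolding holo_curve_def by blast
qed

lemma P1_embeddingI:
  assumes "compat A" "inj \<gamma>"
    and "\<And>\<sigma> t. \<sigma> \<in> {Some, P1_inf} \<Longrightarrow> \<exists>(V, \<psi>)\<in>A. clift_at V \<psi> (\<lambda>x. \<gamma> (\<sigma> x)) t"
  shows "P1_embedding A \<gamma>"
  unfolding P1_embedding_def
proof (intro conjI ballI, rule assms)
  fix \<sigma> :: "complex \<Rightarrow> complex option" assume \<sigma>: "\<sigma> \<in> {Some, P1_inf}"
  show "holo_curve A UNIV (\<gamma> \<circ> \<sigma>)"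
    unfolding comp_def by (rule holo_curveI[OF assms(1) open_UNIV]) (use assms(3)[OF \<sigma>] in blast)
  fix X assume "X \<in> A"
  obtain V \<psi> where X: "X = (V, \<psi>)" by force
  with \<open>X \<in> A\<close> have A: "(V, \<psi>) \<in> A" by simp
  have "\<exists>i. deriv (\<lambda>t. inv_into V \<psi> (\<gamma> (\<sigma> t)) $ i) t \<noteq> 0" if "\<gamma> (\<sigma> t) \<in> \<psi> ` V" for t
  proof -
    from assms(3)[OF \<sigma>] obtain W \<eta> where W: "(W, \<eta>) \<in> A" "clift_at W \<eta> (\<lambda>x. \<gamma> (\<sigma> x)) t" by blast
    show ?thesis
      using clift_domain[OF assms(1) A clift_change[OF assms(1) W(1) A W(2) that]] by metis
  qed
  then show "case X of (V, \<psi>) \<Rightarrow> \<forall>t. \<gamma> (\<sigma> t) \<in> \<psi> ` V \<longrightarrow> (\<exists>i. deriv (\<lambda>t. inv_into V \<psi> (\<gamma> (\<sigma> t)) $ i) t \<noteq> 0)"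
    by (simp add: X)
qed

lemma P1_embedding_clift:
  assumes "P1_embedding A \<gamma>" "(V, \<psi>) \<in> A" "\<sigma> \<in> {Some, P1_inf}" "\<gamma> (\<sigma> t) \<in> \<psi> ` V"
  shows "clift_at V \<psi> (\<lambda>x. \<gamma> (\<sigma> x)) t"
proof -
  have hc: "holo_curve A UNIV (\<gamma> \<circ> \<sigma>)" using assms(1,3) unfolding P1_embedding_def by blast
  have d: "\<forall>(V, \<psi>)\<in>A. \<forall>t. \<gamma> (\<sigma> t) \<in> \<psi> ` V \<longrightarrow> (\<exists>i. deriv (\<lambda>t. inv_into V \<psi> (\<gamma> (\<sigma> t)) $ i) t \<noteq> 0)"
    using assms(1,3) unfolding P1_embedding_def by blast
  from bspec[OF d assms(2)] assms(4) obtain i where i: "deriv (\<lambda>t. inv_into V \<psi> (\<gamma> (\<sigma> t)) $ i) t \<noteq> 0" by auto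
  have "open {t. \<gamma> (\<sigma> t) \<in> \<psi> ` V}" "\<And>i. (\<lambda>t. inv_into V \<psi> (\<gamma> (\<sigma> t)) $ i) holomorphic_on {t. \<gamma> (\<sigma> t) \<in> \<psi> ` V}"
    using hc assms(2) unfolding holo_curve_def comp_def by auto
  then show ?thesis
    by (intro clift_atI[where i = i and f = "\<lambda>t. inv_into V \<psi> (\<gamma> (\<sigma> t))"])
      (use assms(4) i in \<open>auto simp: vholomorphic_on_def inv_into_into f_inv_into_f\<close>)
qed

lemma P1_cases:
  obtains \<sigma> t where "\<sigma> \<in> {Some, P1_inf}" "\<zeta> = \<sigma> t"
proof (cases \<zeta>)
  case None
  then show ?thesis using that[of P1_inf 0] by (simp add: P1_inf_def)
next
  case (Some z)
  then show ?thesis using that[of Some z] by simp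
qed

lemma P1_embedding_points: "P1_embedding A \<gamma> \<Longrightarrow> range \<gamma> \<subseteq> points A"
proof
  fix x assume P: "P1_embedding A \<gamma>" and "x \<in> range \<gamma>"
  then obtain \<zeta> where x: "x = \<gamma> \<zeta>" by blast
  obtain \<sigma> t where \<sigma>: "\<sigma> \<in> {Some, P1_inf}" "\<zeta> = \<sigma> t" by (rule P1_cases)
  have "holo_curve A UNIV (\<gamma> \<circ> \<sigma>)" using P \<sigma>(1) unfolding P1_embedding_def by blast
  then have "(\<gamma> \<circ> \<sigma>) t \<in> points A" unfolding holo_curve_def by blast
  then show "x \<in> points A" using x \<sigma>(2) by simp
qed

subsection \<open>Local equations\<close>

text \<open>The differential need be tested in only one chart through each point of
  \<open>D\<close>: if it vanished in another chart, its pullback by the transition map would vanish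
  as well.\<close>

lemma local_equationI:
  assumes "compat A" "openin (manifold_topology A) U" "holo_fun_on A U g" "\<And>p. p \<in> U \<Longrightarrow> g p = 0 \<longleftrightarrow> p \<in> D"
    and "\<And>q. q \<in> U \<inter> D \<Longrightarrow> \<exists>(V, \<psi>)\<in>A. \<exists>v\<in>V. \<psi> v = q \<and> \<not> ((\<lambda>v. g (\<psi> v)) has_derivative (\<lambda>_. 0)) (at v)"
  shows "local_equation A D U g"
proof -
  have "\<not> ((\<lambda>v. g (\<eta> v)) has_derivative (\<lambda>_. 0)) (at w)"
    if A: "(W, \<eta>) \<in> A" and w: "w \<in> W" "\<eta> w \<in> U \<inter> D" for W \<eta> w
  proof
    assume d0: "((\<lambda>v. g (\<eta> v)) has_derivative (\<lambda>_. 0)) (at w)"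
    from assms(5)[OF w(2)] obtain V \<psi> v where V: "(V, \<psi>) \<in> A" "v \<in> V" "\<psi> v = \<eta> w"
      and nd: "\<not> ((\<lambda>v. g (\<psi> v)) has_derivative (\<lambda>_. 0)) (at v)" by blast
    from V w have "\<psi> v \<in> \<eta> ` W" by auto
    from compat_lift[OF assms(1) V(1) A V(2) this] obtain N f where N: "open N" "v \<in> N" "N \<subseteq> V" "vholo_on N f"
      "f ` N \<subseteq> W" "\<And>x. x \<in> N \<Longrightarrow> \<eta> (f x) = \<psi> x" by blast
    have fv: "f v = w" using compat_inj[OF assms(1) A] N(2,5,6) w V(3) by (metis image_subset_iff inj_onD)
    obtain L where L: "(f has_derivative L) (at v)" using vholo_onE[OF N(4,2)] by blast
    from d0 have "((\<lambda>v. g (\<eta> v)) has_derivative (\<lambda>_. 0)) (at (f v))" by (simp add: fv)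
    from has_derivative_compose[OF L this] have "((\<lambda>x. g (\<eta> (f x))) has_derivative (\<lambda>_. 0)) (at v)" .
    then have "((\<lambda>x. g (\<psi> x)) has_derivative (\<lambda>_. 0)) (at v)"
      by (rule has_derivative_transform_within_open[OF _ N(1,2)]) (simp add: N(6))
    with nd show False ..
  qed
  then have "\<forall>(V, \<psi>)\<in>A. \<forall>v\<in>V. \<psi> v \<in> U \<inter> D \<longrightarrow> \<not> ((\<lambda>v. g (\<psi> v)) has_derivative (\<lambda>_. 0)) (at v)"
    by auto
  with assms(2-4) show ?thesis unfolding local_equation_def by simp
qed

lemma coord_has_nonzero_derivative:
  fixes v :: "complex^'n"
  assumes "open W" "v \<in> W" "\<And>x. x \<in> W \<Longrightarrow> g x = x $ i - k"
  shows "\<not> (g has_derivative (\<lambda>_. 0)) (at v)"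
proof
  assume "(g has_derivative (\<lambda>_. 0)) (at v)"
  then have "((\<lambda>x. x $ i - k) has_derivative (\<lambda>_. 0)) (at v)"
    by (rule has_derivative_transform_within_open[OF _ assms(1,2)]) (simp add: assms(3))
  moreover have "((\<lambda>x. x $ i - k) has_derivative (\<lambda>x. x $ i)) (at v)"
    by (auto intro!: derivative_eq_intros bounded_linear_imp_has_derivative bounded_linear_vec_nth)
  ultimately have "(\<lambda>x :: complex^'n. x $ i) = (\<lambda>_. 0)" by (rule has_derivative_unique[rotated])
  from fun_cong[OF this, of "axis i 1"] show False by simp
qed

text \<open>All local equations below, apart from the constant \<open>1\<close> off a curve,
  originate here: a curve that is a coordinate line in some chart has that coordinate, minus its
  value on the line, as an equation.\<close>

lemma local_equation_chart:
  assumes "compat A" "(W, \<eta>) \<in> A" "\<And>w. w \<in> W \<Longrightarrow> w $ i = k \<longleftrightarrow> \<eta> w \<in> D"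
  shows "local_equation A D (\<eta> ` W) (\<lambda>p. inv_into W \<eta> p $ i - k)"
proof (rule local_equationI[OF assms(1)])
  note inj = compat_inj[OF assms(1,2)] and op = compat_open[OF assms(1,2)]
  show "openin (manifold_topology A) (\<eta> ` W)" by (rule openin_chart[OF assms(1,2) op]) simp
  show "holo_fun_on A (\<eta> ` W) (\<lambda>p. inv_into W \<eta> p $ i - k)"
    by (rule holo_fun_on_chart[OF assms(1,2) _ _ op]) (auto intro!: holo_intros)
  show "inv_into W \<eta> p $ i - k = 0 \<longleftrightarrow> p \<in> D" if "p \<in> \<eta> ` W" for p
  proof -
    from that obtain w where "w \<in> W" "p = \<eta> w" by blast
    then show ?thesis using assms(3)[of w] inj by simp
  qed
  show "\<exists>(V, \<psi>)\<in>A. \<exists>v\<in>V. \<psi> v = q \<and> \<not> ((\<lambda>v. inv_into W \<eta> (\<psi> v) $ i - k) has_derivative (\<lambda>_. 0)) (at v)"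
    if "q \<in> \<eta> ` W \<inter> D" for q
  proof -
    from that obtain w where w: "w \<in> W" "q = \<eta> w" by blast
    have "\<not> ((\<lambda>v. inv_into W \<eta> (\<eta> v) $ i - k) has_derivative (\<lambda>_. 0)) (at w)"
      by (rule coord_has_nonzero_derivative[OF op w(1), of _ i k]) (simp add: inj)
    with w assms(2) show ?thesis by blast
  qed
qed

section \<open>Blowing up\<close>

text \<open>By injectivity at most one coordinate vector is removed.\<close>

lemma open_punctured_chart:
  assumes "compat A" "(V, \<psi>) \<in> A"
  shows "open {v \<in> V. \<psi> v \<in> - {p}}"
proof -
  have "{v \<in> V. \<psi> v \<in> - {p}} = V - {v \<in> V. \<psi> v = p}" by auto
  moreover have "finite {v \<in> V. \<psi> v = p}"
    by (rule finite_subset[of _ "{inv_into V \<psi> p}"]) (use compat_inj[OF assms] in auto)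
  ultimately show ?thesis using compat_open[OF assms] by (simp add: open_Diff finite_imp_closed)
qed

lemma restrict_atlas_iff: "(V, \<psi>) \<in> restrict_atlas A U \<longleftrightarrow> (\<exists>W. (W, \<psi>) \<in> A \<and> V = {v \<in> W. \<psi> v \<in> U})"
  unfolding restrict_atlas_def image_iff by force

lemma points_iff: "p \<in> points A \<longleftrightarrow> (\<exists>V \<psi> v. (V, \<psi>) \<in> A \<and> v \<in> V \<and> p = \<psi> v)"
  unfolding points_def by force

text \<open>\<open>fresh\<close> says that no point infinitely near the centre is present already.
  The injectivity of the new parametrizations rests on it, and so does the fact that a point seen in
  an old chart is never exceptional.\<close>

locale blowup =
  fixes A :: "(2, ipoint) atlas" and V \<psi> c
  assumes compat: "compat A" and chart: "(V, \<psi>) \<in> A" and centre: "c \<in> V"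
    and fresh: "Near (\<psi> c) l \<notin> points A"
begin

text \<open>\<open>\<beta>a\<close> and \<open>\<beta>b\<close> express the blow-down in the two new
  coordinate systems; \<open>\<delta>a\<close> and \<open>\<delta>b\<close> invert them where their
  denominators do not vanish.\<close>

definition "\<beta>a w = c + vector [w $ 1, w $ 1 * w $ 2]" for w :: "complex^2"
definition "\<beta>b w = c + vector [w $ 1 * w $ 2, w $ 2]" for w :: "complex^2"
definition "\<delta>a y = (vector [y $ 1 - c $ 1, (y $ 2 - c $ 2) / (y $ 1 - c $ 1)] :: complex^2)" for y :: "complex^2"
definition "\<delta>b y = (vector [(y $ 1 - c $ 1) / (y $ 2 - c $ 2), y $ 2 - c $ 2] :: complex^2)" for y :: "complex^2"
definition "\<psi>a w = (if w $ 1 = 0 then Near (\<psi> c) (Some (w $ 2)) else \<psi> (\<beta>a w))"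
definition "\<psi>b w = (if w $ 2 = 0 then Near (\<psi> c) (P1_inf (w $ 1)) else \<psi> (\<beta>b w))"
definition "Va = {w. \<beta>a w \<in> V}"
definition "Vb = {w. \<beta>b w \<in> V}"

abbreviation "A' \<equiv> blow_up_at A V \<psi> c"
abbreviation "p \<equiv> \<psi> c"
abbreviation "new_charts \<equiv> {(Va, \<psi>a), (Vb, \<psi>b)}"

lemma blow_up_eq: "A' = restrict_atlas A (- {p}) \<union> new_charts"
  unfolding blow_up_at_def Va_def Vb_def \<psi>a_def[abs_def] \<psi>b_def[abs_def] \<beta>a_def \<beta>b_def by simp

lemma \<beta>_nth [simp]: "\<beta>a w $ 1 = c $ 1 + w $ 1" "\<beta>a w $ 2 = c $ 2 + w $ 1 * w $ 2"
  "\<beta>b w $ 1 = c $ 1 + w $ 1 * w $ 2" "\<beta>b w $ 2 = c $ 2 + w $ 2"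
  by (simp_all add: \<beta>a_def \<beta>b_def)

lemma \<delta>_nth [simp]: "\<delta>a y $ 1 = y $ 1 - c $ 1" "\<delta>a y $ 2 = (y $ 2 - c $ 2) / (y $ 1 - c $ 1)"
  "\<delta>b y $ 1 = (y $ 1 - c $ 1) / (y $ 2 - c $ 2)" "\<delta>b y $ 2 = y $ 2 - c $ 2"
  by (simp_all add: \<delta>a_def \<delta>b_def)

lemma vholo_\<beta>: "vholo_on UNIV \<beta>a" "vholo_on UNIV \<beta>b"
  unfolding vholo_on_def forall_2 \<beta>_nth by (auto intro!: holo_intros)

lemma open_V: "open V" and inj_\<psi>: "inj_on \<psi> V"
  using compat_open[OF compat chart] compat_inj[OF compat chart] .

lemma open_new: "open Va" "open Vb"
proof -
  have "open (\<beta>a -` V)" "open (\<beta>b -` V)"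
    using vholo_on_imp_continuous_on[OF vholo_\<beta>(1)] vholo_on_imp_continuous_on[OF vholo_\<beta>(2)] open_V
    by (auto simp: continuous_on_open_vimage)
  then show "open Va" "open Vb" by (simp_all add: Va_def Vb_def vimage_def)
qed

lemma \<psi>_notin_Near: "v \<in> V \<Longrightarrow> \<psi> v \<noteq> Near p l"
  using fresh[of l] chart unfolding points_iff by metis

lemma \<psi>_eq_p: "v \<in> V \<Longrightarrow> \<psi> v = p \<longleftrightarrow> v = c"
  using inj_\<psi> centre by (auto dest: inj_onD)

lemma inj_new: "inj_on \<psi>a Va" "inj_on \<psi>b Vb"
proof -
  show "inj_on \<psi>a Va"
  proof (rule inj_onI)
    fix x y assume xy: "x \<in> Va" "y \<in> Va" "\<psi>a x = \<psi>a y"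
    then show "x = y"
      using \<psi>_notin_Near[of "\<beta>a x"] \<psi>_notin_Near[THEN not_sym, of "\<beta>a y"] inj_onD[OF inj_\<psi>, of "\<beta>a x" "\<beta>a y"]
      by (auto simp: \<psi>a_def Va_def vec2_eq_iff split: if_splits)
  qed
  have inf: "inj P1_inf" by (auto simp: inj_def P1_inf_def split: if_splits)
  show "inj_on \<psi>b Vb"
  proof (rule inj_onI)
    fix x y assume xy: "x \<in> Vb" "y \<in> Vb" "\<psi>b x = \<psi>b y"
    then show "x = y"
      using \<psi>_notin_Near[of "\<beta>b x"] \<psi>_notin_Near[THEN not_sym, of "\<beta>b y"] inj_onD[OF inj_\<psi>, of "\<beta>b x" "\<beta>b y"] injD[OF inf]
      by (auto simp: \<psi>b_def Vb_def vec2_eq_iff split: if_splits)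
  qed
qed

text \<open>Both new charts are treated at once: \<open>e\<close> is the coordinate that vanishes on
  the exceptional curve and \<open>l\<close> gives the direction of an exceptional point. The point
  \<open>\<eta> v\<close> is old, hence not exceptional, so it lifts through \<open>\<psi>\<close>
  and then to the blow-up by \<open>\<delta>\<close>.\<close>

lemma lift_to_new:
  fixes \<beta> \<delta> :: "complex^2 \<Rightarrow> complex^2" and e :: 2
  assumes "\<And>y. y $ e \<noteq> c $ e \<Longrightarrow> \<beta> (\<delta> y) = y \<and> \<delta> y $ e \<noteq> 0"
    and "\<And>w. w $ e \<noteq> 0 \<Longrightarrow> \<beta> w $ e \<noteq> c $ e"
    and "vholo_on {y. y $ e \<noteq> c $ e} \<delta>"
    and "\<And>w. \<psi>' w = (if w $ e = 0 then Near p (l w) else \<psi> (\<beta> w))"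
    and "(W, \<eta>) \<in> A" "v \<in> W" "\<eta> v \<in> \<psi>' ` {w. \<beta> w \<in> V}"
  shows "lift_at {w. \<beta> w \<in> V} \<psi>' \<eta> v"
proof -
  from assms(7) obtain w where w: "\<eta> v = \<psi>' w" "\<beta> w \<in> V" by blast
  have "\<eta> v \<in> points A" using assms(5,6) by (auto simp: points_def)
  with w fresh assms(4) have w0: "w $ e \<noteq> 0" by metis
  with w assms(4) have "\<eta> v = \<psi> (\<beta> w)" by simp
  with w have "\<eta> v \<in> \<psi> ` V" by blast
  from compat_lift[OF compat assms(5) chart assms(6) this] obtain N f where N: "open N" "v \<in> N" "N \<subseteq> W"
    "vholo_on N f" "f ` N \<subseteq> V" "\<And>x. x \<in> N \<Longrightarrow> \<psi> (f x) = \<eta> x" by blast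
  have "f v = \<beta> w" using N w \<open>\<eta> v = \<psi> (\<beta> w)\<close> by (metis image_subset_iff inj_\<psi> inj_onD)
  with assms(2)[OF w0] have fv: "f v $ e \<noteq> c $ e" by simp
  define N' where "N' = (\<lambda>x. f x $ e) -` (- {c $ e}) \<inter> N"
  have "continuous_on N (\<lambda>x. f x $ e)"
    using holo_on_imp_continuous_on[OF holo_on_nth[OF N(4)]] .
  then have op: "open N'"
    unfolding N'_def using N(1) by (metis continuous_on_open_vimage open_Compl closed_singleton)
  have N': "N' \<subseteq> N" "v \<in> N'" "\<And>x. x \<in> N' \<Longrightarrow> f x $ e \<noteq> c $ e" using fv N(2) by (auto simp: N'_def)
  show ?thesis
  proof (rule lift_atI[OF op N'(2)])
    show "vholo_on N' (\<lambda>x. \<delta> (f x))"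
      by (rule vholo_on_compose[OF vholo_on_subset[OF N(4) N'(1)] assms(3)]) (use N'(3) in auto)
    show "\<delta> (f x) \<in> {w. \<beta> w \<in> V}" if "x \<in> N'" for x
    proof -
      have "f x \<in> V" using that N'(1) N(5) by blast
      then show ?thesis using assms(1) N'(3)[OF that] by simp
    qed
    show "\<psi>' (\<delta> (f x)) = \<eta> x" if "x \<in> N'" for x
      using that assms(1,4) N'(1,3) N(6) by auto
  qed
qed

text \<open>The opposite passage, with the same meaning of \<open>e\<close> and \<open>l\<close>: a
  point of a new chart that is also seen in an old chart lies off the exceptional line, where the
  new chart is \<open>\<psi>\<close> after the blow-down \<open>\<beta>\<close>.\<close>

lemma lift_from_new:
  fixes \<beta> :: "complex^2 \<Rightarrow> complex^2" and e :: 2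
  assumes "\<And>w. w $ e \<noteq> 0 \<Longrightarrow> \<beta> w \<noteq> c"
    and "vholo_on UNIV \<beta>"
    and "\<And>w. \<psi>' w = (if w $ e = 0 then Near p (l w) else \<psi> (\<beta> w))"
    and "(W, \<eta>) \<in> A" "\<beta> w \<in> V" "\<psi>' w \<in> \<eta> ` {v \<in> W. \<eta> v \<in> - {p}}"
  shows "lift_at {v \<in> W. \<eta> v \<in> - {p}} \<eta> \<psi>' w"
proof -
  have "\<psi>' w \<in> points A" using assms(4,6) by (auto simp: points_def)
  with fresh assms(3) have w0: "w $ e \<noteq> 0" by metis
  with assms(3,6) have "\<psi> (\<beta> w) \<in> \<eta> ` W" by auto
  from compat_lift[OF compat chart assms(4,5) this] obtain N f where N: "open N" "\<beta> w \<in> N" "N \<subseteq> V"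
    "vholo_on N f" "f ` N \<subseteq> W" "\<And>x. x \<in> N \<Longrightarrow> \<eta> (f x) = \<psi> x" by blast
  define N' where "N' = {x. x $ e \<noteq> 0} \<inter> \<beta> -` N"
  have "open (\<beta> -` N)" using vholo_on_imp_continuous_on[OF assms(2)] N(1) by (auto simp: continuous_on_open_vimage)
  moreover have "open {x :: complex^2. x $ e \<noteq> 0}"
    by (intro open_Collect_neq continuous_intros)
  ultimately have op: "open N'" by (simp add: N'_def open_Int)
  show ?thesis
  proof (rule lift_atI[OF op])
    show "w \<in> N'" using w0 N by (simp add: N'_def)
    show "vholo_on N' (\<lambda>x. f (\<beta> x))"
      by (rule vholo_on_compose[OF vholo_on_subset[OF assms(2)] N(4)]) (auto simp: N'_def)
    show "\<eta> (f (\<beta> x)) = \<psi>' x" if "x \<in> N'" for x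
      using that assms(3) N(6) by (simp add: N'_def)
    show "f (\<beta> x) \<in> {v \<in> W. \<eta> v \<in> - {p}}" if "x \<in> N'" for x
      using that N(3,5,6) assms(1) \<psi>_eq_p[of "\<beta> x"] by (auto simp: N'_def)
  qed
qed

text \<open>The transition from the first new chart to the second: coordinate \<open>u\<close> and
  slope \<open>m\<close> become the reciprocal slope \<open>1 / m\<close> and the coordinate
  \<open>u m\<close>.\<close>

lemma \<psi>b_flip:
  assumes "w \<in> Va" "w $ 2 \<noteq> 0"
  shows "\<psi>b (vector [1 / w $ 2, w $ 1 * w $ 2]) = \<psi>a w" "vector [1 / w $ 2, w $ 1 * w $ 2] \<in> Vb"
proof -
  have *: "\<beta>b (vector [1 / w $ 2, w $ 1 * w $ 2]) = \<beta>a w" using assms by (simp add: vec2_eq_iff)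
  show "\<psi>b (vector [1 / w $ 2, w $ 1 * w $ 2]) = \<psi>a w"
    using assms unfolding \<psi>a_def \<psi>b_def * by (simp add: P1_inf_def)
  show "vector [1 / w $ 2, w $ 1 * w $ 2] \<in> Vb" using assms by (simp add: Va_def Vb_def *)
qed

lemma \<psi>a_flip:
  assumes "w \<in> Vb" "w $ 1 \<noteq> 0"
  shows "\<psi>a (vector [w $ 1 * w $ 2, 1 / w $ 1]) = \<psi>b w" "vector [w $ 1 * w $ 2, 1 / w $ 1] \<in> Va"
proof -
  have *: "\<beta>a (vector [w $ 1 * w $ 2, 1 / w $ 1]) = \<beta>b w" using assms by (simp add: vec2_eq_iff)
  show "\<psi>a (vector [w $ 1 * w $ 2, 1 / w $ 1]) = \<psi>b w"
    using assms unfolding \<psi>a_def \<psi>b_def * by (simp add: P1_inf_def)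
  show "vector [w $ 1 * w $ 2, 1 / w $ 1] \<in> Va" using assms by (simp add: Va_def Vb_def *)
qed

text \<open>What one new chart misses of the other is the strict transform of a coordinate axis
  through the centre: the line of slope zero in the first chart and of reciprocal slope zero in the
  second.\<close>

lemma new_overlap_ab: "w \<in> Va \<Longrightarrow> \<psi>a w \<in> \<psi>b ` Vb \<longleftrightarrow> w $ 2 \<noteq> 0"
  and new_overlap_ba: "w \<in> Vb \<Longrightarrow> \<psi>b w \<in> \<psi>a ` Va \<longleftrightarrow> w $ 1 \<noteq> 0"
proof -
  have no: False if "x \<in> Va" "y \<in> Vb" "\<psi>a x = \<psi>b y" "x $ 2 = 0 \<or> y $ 1 = 0" for x y
  proof (cases "x $ 1 = 0")
    case True
    then show False using that \<psi>_notin_Near[of "\<beta>b y"]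
      by (auto simp: \<psi>a_def \<psi>b_def Vb_def P1_inf_def split: if_splits) (metis)+
  next
    case False
    then show False using that \<psi>_notin_Near[of "\<beta>a x"] inj_onD[OF inj_\<psi>, of "\<beta>a x" "\<beta>b y"]
      by (auto simp: \<psi>a_def \<psi>b_def Va_def Vb_def vec2_eq_iff split: if_splits)
  qed
  show "\<psi>a w \<in> \<psi>b ` Vb \<longleftrightarrow> w $ 2 \<noteq> 0" if "w \<in> Va" using that \<psi>b_flip[OF that] no[OF that] by (metis imageE image_eqI)
  show "\<psi>b w \<in> \<psi>a ` Va \<longleftrightarrow> w $ 1 \<noteq> 0" if "w \<in> Vb" using that \<psi>a_flip[OF that] no[OF _ that] by (metis imageE image_eqI)
qed

text \<open>Nine cases by the kinds of the two charts. Two old charts keep their transition map, an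
  old and a new one are compared through the blow-down, and the two new ones are related by the
  flips.\<close>

lemma compat_blow_up: "compat A'"
proof -
  have "(\<forall>v\<in>W. \<forall>(W', \<eta>')\<in>A'. \<eta> v \<in> \<eta>' ` W' \<longrightarrow> lift_at W' \<eta>' \<eta> v) \<and> open W \<and> inj_on \<eta> W"
    if W: "(W, \<eta>) \<in> A'" for W \<eta>
  proof (intro conjI)
  have hol: "vholo_on {y. y $ 1 \<noteq> c $ 1} \<delta>a" "vholo_on {y. y $ 2 \<noteq> c $ 2} \<delta>b"
    unfolding vholo_on_def forall_2 \<delta>_nth by (auto intro!: holo_intros)
  consider (old) U where "(U, \<eta>) \<in> A" "W = {v \<in> U. \<eta> v \<in> - {p}}" | (a) "W = Va" "\<eta> = \<psi>a" | (b) "W = Vb" "\<eta> = \<psi>b"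
    using W unfolding blow_up_eq Un_iff restrict_atlas_iff by blast
  note cW = this
  have oi: "open W \<and> inj_on \<eta> W"
  proof (cases rule: cW)
    case (old U)
    have "inj_on \<eta> W" by (rule inj_on_subset[OF compat_inj[OF compat old(1)]]) (use old in auto)
    with old open_punctured_chart[OF compat old(1)] show ?thesis by simp
  qed (use open_new inj_new in simp_all)
  then show "open W" "inj_on \<eta> W" by auto
  have "lift_at W' \<eta>' \<eta> v" if W': "(W', \<eta>') \<in> A'" and v: "v \<in> W" "\<eta> v \<in> \<eta>' ` W'" for W' \<eta>' v
  proof -
    consider (old) U where "(U, \<eta>') \<in> A" "W' = {v \<in> U. \<eta>' v \<in> - {p}}" | (a) "W' = Va" "\<eta>' = \<psi>a" | (b) "W' = Vb" "\<eta>' = \<psi>b"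
      using W' unfolding blow_up_eq Un_iff restrict_atlas_iff by blast
    note cW' = this
    show ?thesis
    proof (cases rule: cW')
      case U': (old U')
      show ?thesis
      proof (cases rule: cW)
        case (old U)
        have "v \<in> U" "\<eta> v \<in> \<eta>' ` U'" "\<eta> v \<noteq> p" using old U' v by auto
        from compat_lift[OF compat old(1) U'(1) this(1,2)] obtain N f where N: "open N" "v \<in> N" "N \<subseteq> U"
          "vholo_on N f" "f ` N \<subseteq> U'" "\<And>x. x \<in> N \<Longrightarrow> \<eta>' (f x) = \<eta> x" by blast
        show ?thesis
          by (rule lift_atI[of "N \<inter> W" v f])
            (use N v U' W open_punctured_chart[OF compat old(1)] old(2) in \<open>auto intro: vholo_on_subset\<close>)
      next
        case a
        show ?thesis unfolding U'(2) a(2)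
          by (rule lift_from_new[where e = 1 and \<psi>' = \<psi>a and l = "\<lambda>w. Some (w $ 2)", OF _ vholo_\<beta>(1) \<psi>a_def U'(1)]) (use v a U' in \<open>auto simp: Va_def vec2_eq_iff\<close>)
      next
        case b
        show ?thesis unfolding U'(2) b(2)
          by (rule lift_from_new[where e = 2 and \<psi>' = \<psi>b and l = "\<lambda>w. P1_inf (w $ 1)", OF _ vholo_\<beta>(2) \<psi>b_def U'(1)]) (use v b U' in \<open>auto simp: Vb_def vec2_eq_iff\<close>)
      qed
    next
      case a': a
      show ?thesis
      proof (cases rule: cW)
        case (old U)
        show ?thesis unfolding a' Va_def
          by (rule lift_to_new[where e = 1 and \<psi>' = \<psi>a and l = "\<lambda>w. Some (w $ 2)", OF _ _ hol(1) \<psi>a_def old(1)]) (use v old a' in \<open>auto simp: Va_def vec2_eq_iff\<close>)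
      next
        case a
        show ?thesis unfolding a a' by (rule lift_atI[OF open_new(1) _ vholo_on_id]) (use v a in auto)
      next
        case b
        have w: "v \<in> Vb" "v $ 1 \<noteq> 0" using v new_overlap_ba unfolding a' b by auto
        have op: "open (Vb \<inter> {x. x $ 1 \<noteq> 0})"
          by (intro open_Int open_new open_Collect_neq continuous_intros)
        show ?thesis unfolding a' b
          by (rule lift_atI[OF op, of _ "\<lambda>w. vector [w $ 1 * w $ 2, 1 / w $ 1]"])
            (use w \<psi>a_flip in \<open>auto intro!: vholo_on_vector2 holo_intros\<close>)
      qed
    next
      case b': b
      show ?thesis
      proof (cases rule: cW)
        case (old U)
        show ?thesis unfolding b' Vb_def
          by (rule lift_to_new[where e = 2 and \<psi>' = \<psi>b and l = "\<lambda>w. P1_inf (w $ 1)", OF _ _ hol(2) \<psi>b_def old(1)]) (use v old b' in \<open>auto simp: Vb_def vec2_eq_iff\<close>)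
      next
        case b
        show ?thesis unfolding b b' by (rule lift_atI[OF open_new(2) _ vholo_on_id]) (use v b in auto)
      next
        case a
        have w: "v \<in> Va" "v $ 2 \<noteq> 0" using v new_overlap_ab unfolding b' a by auto
        have op: "open (Va \<inter> {x. x $ 2 \<noteq> 0})"
          by (intro open_Int open_new open_Collect_neq continuous_intros)
        show ?thesis unfolding b' a
          by (rule lift_atI[OF op, of _ "\<lambda>w. vector [1 / w $ 2, w $ 1 * w $ 2]"])
            (use w \<psi>b_flip in \<open>auto intro!: vholo_on_vector2 holo_intros\<close>)
      qed
    qed
  qed
  then show "\<forall>v\<in>W. \<forall>(W', \<eta>')\<in>A'. \<eta> v \<in> \<eta>' ` W' \<longrightarrow> lift_at W' \<eta>' \<eta> v" by blast
  qed
  then show ?thesis unfolding compat_def by blast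
qed

end

section \<open>Infinitely near points, strict transforms and sections of line bundles\<close>

primrec ancestors :: "ipoint \<Rightarrow> ipoint set" where
  "ancestors (Plane l) = {}"
| "ancestors (Near p l) = insert p (ancestors p)"

text \<open>The invariant that makes every later blow-up \<open>fresh\<close>: since
  \<open>p\<close> is an ancestor of each \<open>Near p l\<close>, an atlas that contains
  \<open>p\<close> cannot contain any of these.\<close>

definition unrelated :: "(2, ipoint) atlas \<Rightarrow> bool" where
  "unrelated A \<longleftrightarrow> (\<forall>q\<in>points A. ancestors q \<inter> points A = {})"

lemma not_self_ancestor: "p \<notin> ancestors p"
proof
  have *: "size q < size p" if "q \<in> ancestors p" for p q
    using that by (induction p) auto
  assume "p \<in> ancestors p"
  from *[OF this] show False by simp
qed

lemma ancestors_trans: "q \<in> ancestors p \<Longrightarrow> ancestors q \<subseteq> ancestors p"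
  by (induction p) auto

lemma unrelated_fresh:
  assumes "unrelated A" "p \<in> points A"
  shows "Near p l \<notin> points A"
proof
  assume "Near p l \<in> points A"
  with assms(1) have "ancestors (Near p l) \<inter> points A = {}" unfolding unrelated_def by blast
  with assms(2) show False by simp
qed

text \<open>The new point over the centre gets the direction \<open>Some 0\<close>, which is right
  when the curve runs along the first coordinate axis of the chart in which the blow-up is made. A
  curve that avoids the centre is unchanged, so one formula serves for all curves of a
  configuration.\<close>

definition strict :: "ipoint \<Rightarrow> (complex option \<Rightarrow> ipoint) \<Rightarrow> complex option \<Rightarrow> ipoint" where
  "strict p \<gamma> \<zeta> = (if \<gamma> \<zeta> = p then Near p (Some 0) else \<gamma> \<zeta>)"

text \<open>Openness of the complement, tested in the charts; off the curve the constant
  \<open>1\<close> will then serve as a local equation.\<close>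

definition closed_curve :: "(2, ipoint) atlas \<Rightarrow> (complex option \<Rightarrow> ipoint) \<Rightarrow> bool" where
  "closed_curve A \<gamma> \<longleftrightarrow> (\<forall>(V, \<psi>)\<in>A. open {v \<in> V. \<psi> v \<notin> range \<gamma>})"

text \<open>Transversality is encoded by a chart in which the two curves are two different
  coordinate lines. Every crossing of the construction arises in this form and keeps it when other
  points are blown up.\<close>

definition crossing :: "(2, ipoint) atlas \<Rightarrow> (complex option \<Rightarrow> ipoint) \<Rightarrow> (complex option \<Rightarrow> ipoint) \<Rightarrow> bool" where
  "crossing A \<gamma> \<delta> \<longleftrightarrow> (\<exists>V \<psi> v i j. (V, \<psi>) \<in> A \<and> v \<in> V \<and> i \<noteq> j \<and> range \<gamma> \<inter> range \<delta> = {\<psi> v} \<and>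
     (\<forall>x\<in>V. \<psi> x \<in> range \<gamma> \<longleftrightarrow> x $ i = v $ i) \<and> (\<forall>x\<in>V. \<psi> x \<in> range \<delta> \<longleftrightarrow> x $ j = v $ j))"

lemma crossing_sym: "crossing A \<gamma> \<delta> \<Longrightarrow> crossing A \<delta> \<gamma>"
  unfolding crossing_def by (metis Int_commute)

definition section_at :: "(complex option \<Rightarrow> complex) \<Rightarrow> (complex \<Rightarrow> complex option) \<Rightarrow> complex \<Rightarrow> int \<Rightarrow> bool" where
  "section_at s \<sigma> z n \<longleftrightarrow> (\<lambda>w. s (\<sigma> w)) meromorphic_on {z} \<and> (\<forall>\<^sub>F w in at z. s (\<sigma> w) \<noteq> 0) \<and>
     zorder (\<lambda>w. s (\<sigma> w)) z = n"

text \<open>The witnesses hidden in \<open>has_intersection_number\<close>, with each section stored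
  next to its local equation and with its orders prescribed by \<open>ord\<close>. Only explicit
  witnesses can be modified by a blow-up.\<close>

definition intersection_data ::
  "('n::finite, 'p) atlas \<Rightarrow> (complex option \<Rightarrow> 'p) \<Rightarrow> 'p set \<Rightarrow>
   ('p set \<times> ('p \<Rightarrow> complex) \<times> (complex option \<Rightarrow> complex)) set \<Rightarrow> (complex option \<Rightarrow> int) \<Rightarrow> bool" where
  "intersection_data A \<gamma> D \<T> ord \<longleftrightarrow>
     (\<forall>U g s. (U, g, s) \<in> \<T> \<longrightarrow> local_equation A D U g) \<and>
     (\<forall>\<zeta>. \<exists>U g s. (U, g, s) \<in> \<T> \<and> \<gamma> \<zeta> \<in> U) \<and>
     (\<forall>U g s \<sigma> z. (U, g, s) \<in> \<T> \<longrightarrow> \<sigma> \<in> {Some, P1_inf} \<longrightarrow> \<gamma> (\<sigma> z) \<in> U \<longrightarrow> section_at s \<sigma> z (ord (\<sigma> z))) \<and>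
     (\<forall>U g s U' g' s'. (U, g, s) \<in> \<T> \<longrightarrow> (U', g', s') \<in> \<T> \<longrightarrow>
        (\<exists>u. holo_fun_on A (U \<inter> U') u \<and> (\<forall>p\<in>U \<inter> U'. g p = u p * g' p) \<and>
          (\<forall>\<zeta>. \<gamma> \<zeta> \<in> U \<inter> U' \<longrightarrow> s \<zeta> = u (\<gamma> \<zeta>) * s' \<zeta>))) \<and>
     finite {\<zeta>. ord \<zeta> \<noteq> 0}"

lemma intersection_dataD:
  assumes "intersection_data A \<gamma> D \<T> ord"
  shows "(U, g, s) \<in> \<T> \<Longrightarrow> local_equation A D U g"
    and "\<exists>U g s. (U, g, s) \<in> \<T> \<and> \<gamma> \<zeta> \<in> U"
    and "(U, g, s) \<in> \<T> \<Longrightarrow> \<sigma> \<in> {Some, P1_inf} \<Longrightarrow> \<gamma> (\<sigma> z) \<in> U \<Longrightarrow> section_at s \<sigma> z (ord (\<sigma> z))"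
    and "(U, g, s) \<in> \<T> \<Longrightarrow> (U', g', s') \<in> \<T> \<Longrightarrow>
        \<exists>u. holo_fun_on A (U \<inter> U') u \<and> (\<forall>p\<in>U \<inter> U'. g p = u p * g' p) \<and>
          (\<forall>\<zeta>. \<gamma> \<zeta> \<in> U \<inter> U' \<longrightarrow> s \<zeta> = u (\<gamma> \<zeta>) * s' \<zeta>)"
    and "finite {\<zeta>. ord \<zeta> \<noteq> 0}"
  using assms unfolding intersection_data_def by (elim conjE, metis)+

lemma has_intersection_numberI:
  assumes "intersection_data A \<gamma> D \<T> ord" "n = (\<Sum>\<zeta> | ord \<zeta> \<noteq> 0. ord \<zeta>)"
  shows "has_intersection_number A \<gamma> D n"
proof -
  note D = intersection_dataD[OF assms(1)]
  define E where "E = (\<lambda>(U, g, s). (U, g)) ` \<T>"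
  \<comment> \<open>In \<open>has_intersection_number\<close> the section is a function of the pair
    \<open>(U, g)\<close>. One triple is chosen for each pair; as any two triples of the data are
    compatible, the choice is harmless.\<close>
  define S where "S X = (SOME s. (fst X, snd X, s) \<in> \<T>)" for X
  have S: "(U, g, S (U, g)) \<in> \<T>" if UE: "(U, g) \<in> E" for U g
  proof -
    from UE have "\<exists>s. (U, g, s) \<in> \<T>" by (auto simp: E_def)
    from someI_ex[OF this] show ?thesis by (simp add: S_def)
  qed
  show ?thesis
    unfolding has_intersection_number_def
  proof (rule exI[of _ E], rule exI[of _ S], rule exI[of _ ord], intro conjI)
    show "\<forall>(U, g)\<in>E. local_equation A D U g" using D(1) S by blast
    show "range \<gamma> \<subseteq> (\<Union>(U, g)\<in>E. U)"
    proof clarify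
      fix \<zeta>
      from D(2)[of \<zeta>] obtain U g s where "(U, g, s) \<in> \<T>" "\<gamma> \<zeta> \<in> U" by blast
      then show "\<gamma> \<zeta> \<in> (\<Union>(U, g)\<in>E. U)" unfolding E_def by force
    qed
    show "finite {\<zeta>. ord \<zeta> \<noteq> 0}" "n = (\<Sum>\<zeta> | ord \<zeta> \<noteq> 0. ord \<zeta>)" by (rule D(5), rule assms(2))
    have sec: "section_at (S (U, g)) \<sigma> z (ord (\<sigma> z))"
      if "(U, g) \<in> E" "\<sigma> \<in> {Some, P1_inf}" "\<gamma> (\<sigma> z) \<in> U" for U g \<sigma> z
      by (rule D(3)[OF S[OF that(1)] that(2,3)])
    show "\<forall>(U, g)\<in>E. \<forall>\<sigma>\<in>{Some, P1_inf}. (\<lambda>z. S (U, g) (\<sigma> z)) meromorphic_on {z. \<gamma> (\<sigma> z) \<in> U} \<and>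
       (\<forall>z. \<gamma> (\<sigma> z) \<in> U \<longrightarrow> (\<forall>\<^sub>F w in at z. S (U, g) (\<sigma> w) \<noteq> 0))"
    proof (clarify, intro conjI)
      fix U g \<sigma> assume *: "(U, g) \<in> E" "\<sigma> \<in> {Some, P1_inf}"
      show "(\<lambda>z. S (U, g) (\<sigma> z)) meromorphic_on {z. \<gamma> (\<sigma> z) \<in> U}"
        using sec[OF *] unfolding section_at_def meromorphic_on_def by auto
      show "\<forall>z. \<gamma> (\<sigma> z) \<in> U \<longrightarrow> (\<forall>\<^sub>F w in at z. S (U, g) (\<sigma> w) \<noteq> 0)"
        using sec[OF *] unfolding section_at_def by auto
    qed
    show "\<forall>(U, g)\<in>E. \<forall>\<zeta>. \<gamma> \<zeta> \<in> U \<longrightarrow> ord \<zeta> = P1_order (S (U, g)) \<zeta>"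
    proof clarify
      fix U g \<zeta> assume *: "(U, g) \<in> E" "\<gamma> \<zeta> \<in> U"
      show "ord \<zeta> = P1_order (S (U, g)) \<zeta>"
      proof (cases \<zeta>)
        case None
        then show ?thesis using sec[OF *(1), of P1_inf 0] *(2)
          by (simp add: section_at_def P1_order_def comp_def P1_inf_def)
      next
        case (Some z)
        then show ?thesis using sec[OF *(1), of Some z] *(2)
          by (simp add: section_at_def P1_order_def comp_def)
      qed
    qed
    show "\<forall>(U, g)\<in>E. \<forall>(U', g')\<in>E. \<exists>u. holo_fun_on A (U \<inter> U') u \<and> (\<forall>p\<in>U \<inter> U'. g p = u p * g' p) \<and>
        (\<forall>\<zeta>. \<gamma> \<zeta> \<in> U \<inter> U' \<longrightarrow> S (U, g) \<zeta> = u (\<gamma> \<zeta>) * S (U', g') \<zeta>)"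
    proof (intro ballI, clarify)
      fix U g U' g' assume "(U, g) \<in> E" "(U', g') \<in> E"
      from D(4)[OF S[OF this(1)] S[OF this(2)]]
      show "\<exists>u. holo_fun_on A (U \<inter> U') u \<and> (\<forall>p\<in>U \<inter> U'. g p = u p * g' p) \<and>
        (\<forall>\<zeta>. \<gamma> \<zeta> \<in> U \<inter> U' \<longrightarrow> S (U, g) \<zeta> = u (\<gamma> \<zeta>) * S (U', g') \<zeta>)" .
    qed
  qed
qed

lemma section_at_holomorphic:
  assumes "open N" "z \<in> N" "(\<lambda>w. s (\<sigma> w)) holomorphic_on N" "s (\<sigma> z) \<noteq> 0"
  shows "section_at s \<sigma> z 0"
proof -
  have an: "(\<lambda>w. s (\<sigma> w)) analytic_on {z}" using assms by (auto simp: analytic_at)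
  have "isCont (\<lambda>w. s (\<sigma> w)) z" using an by (rule analytic_at_imp_isCont)
  then have "\<forall>\<^sub>F w in at z. s (\<sigma> w) \<noteq> 0"
    using assms(4) by (auto simp: isCont_def intro: tendsto_imp_eventually_ne)
  with an assms(4) show ?thesis
    unfolding section_at_def by (auto intro: analytic_on_imp_meromorphic_on zorder_eq_0I)
qed

lemma simple_zero:
  assumes "open N" "z \<in> N" "f holomorphic_on N" "f z = 0" "deriv f z \<noteq> 0"
  shows "f meromorphic_on {z}" "\<forall>\<^sub>F w in at z. f w \<noteq> 0" "zorder f z = 1"
proof -
  have an: "f analytic_on {z}" using assms by (auto simp: analytic_at)
  then show "f meromorphic_on {z}" by (rule analytic_on_imp_meromorphic_on)
  show z1: "zorder f z = 1" by (rule zorder_zero_eqI[OF assms(3,1,2)]) (use assms in auto)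
  have D: "(f has_field_derivative deriv f z) (at z)" using assms by (metis holomorphic_derivI)
  show "\<forall>\<^sub>F w in at z. f w \<noteq> 0"
  proof -
    have "((\<lambda>w. (f w - f z) / (w - z)) \<longlongrightarrow> deriv f z) (at z)" using D by (simp add: has_field_derivative_iff)
    from tendsto_imp_eventually_ne[OF this assms(5)] show ?thesis
      by (rule eventually_mono) (use assms(4) in auto)
  qed
qed

lemma section_at_simple_zero:
  assumes "open N" "z \<in> N" "(\<lambda>w. s (\<sigma> w)) holomorphic_on N" "s (\<sigma> z) = 0" "deriv (\<lambda>w. s (\<sigma> w)) z \<noteq> 0"
  shows "section_at s \<sigma> z 1"
  using simple_zero[OF assms] by (simp add: section_at_def)

section \<open>Points and charts of the blown-up atlas\<close>

context blowup
begin

lemma old_chart: "(W, \<eta>) \<in> A \<Longrightarrow> ({v \<in> W. \<eta> v \<in> - {p}}, \<eta>) \<in> A'"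
  unfolding blow_up_eq Un_iff restrict_atlas_iff by blast

lemma new_charts_in: "(Va, \<psi>a) \<in> A'" "(Vb, \<psi>b) \<in> A'"
  by (simp_all add: blow_up_eq)

lemma chart_cases:
  assumes "(W, \<eta>) \<in> A'"
  obtains (old) U where "(U, \<eta>) \<in> A" "W = {v \<in> U. \<eta> v \<in> - {p}}" | (a) "W = Va" "\<eta> = \<psi>a" | (b) "W = Vb" "\<eta> = \<psi>b"
  using assms unfolding blow_up_eq Un_iff restrict_atlas_iff by blast

lemma open_vimage_\<beta>: "open S \<Longrightarrow> open (\<beta>a -` S)" "open S \<Longrightarrow> open (\<beta>b -` S)"
  using vholo_on_imp_continuous_on[OF vholo_\<beta>(1)] vholo_on_imp_continuous_on[OF vholo_\<beta>(2)]
  by (auto simp: continuous_on_open_vimage)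

lemma p_in_points: "p \<in> points A"
  using chart centre unfolding points_iff by blast

lemma zero_in_new: "0 \<in> Va" "0 \<in> Vb" "vector [0, m] \<in> Va" "vector [m, 0] \<in> Vb"
proof -
  have "\<beta>a 0 = c" "\<beta>b 0 = c" "\<beta>a (vector [0, m]) = c" "\<beta>b (vector [m, 0]) = c"
    by (simp_all add: vec2_eq_iff)
  with centre show "0 \<in> Va" "0 \<in> Vb" "vector [0, m] \<in> Va" "vector [m, 0] \<in> Vb" by (simp_all add: Va_def Vb_def)
qed

lemma exceptional_param:
  "\<psi>a (vector [0, m]) = Near p (Some m)" "\<psi>b (vector [m, 0]) = Near p (P1_inf m)"
  by (simp_all add: \<psi>a_def \<psi>b_def)

lemma \<psi>_in_points: "w \<in> V \<Longrightarrow> \<psi> w \<in> points A"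
  using chart unfolding points_iff by blast

lemma new_nonexc:
  "w \<in> Va \<Longrightarrow> w $ 1 \<noteq> 0 \<Longrightarrow> \<psi>a w = \<psi> (\<beta>a w) \<and> \<beta>a w \<in> V \<and> \<psi>a w \<in> points A - {p}"
  "w \<in> Vb \<Longrightarrow> w $ 2 \<noteq> 0 \<Longrightarrow> \<psi>b w = \<psi> (\<beta>b w) \<and> \<beta>b w \<in> V \<and> \<psi>b w \<in> points A - {p}"
proof -
  assume "w \<in> Va" "w $ 1 \<noteq> 0"
  moreover have "\<beta>a w \<noteq> c" using \<open>w $ 1 \<noteq> 0\<close> by (simp add: vec2_eq_iff)
  ultimately show "\<psi>a w = \<psi> (\<beta>a w) \<and> \<beta>a w \<in> V \<and> \<psi>a w \<in> points A - {p}"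
    using \<psi>_in_points \<psi>_eq_p by (simp add: \<psi>a_def Va_def)
next
  assume "w \<in> Vb" "w $ 2 \<noteq> 0"
  moreover have "\<beta>b w \<noteq> c" using \<open>w $ 2 \<noteq> 0\<close> by (simp add: vec2_eq_iff)
  ultimately show "\<psi>b w = \<psi> (\<beta>b w) \<and> \<beta>b w \<in> V \<and> \<psi>b w \<in> points A - {p}"
    using \<psi>_in_points \<psi>_eq_p by (simp add: \<psi>b_def Vb_def)
qed

lemma points_blow_up: "points A' = (points A - {p}) \<union> range (Near p)"
proof (intro set_eqI iffI)
  fix q assume "q \<in> points A'"
  then obtain W \<eta> w where W: "(W, \<eta>) \<in> A'" "w \<in> W" "q = \<eta> w" unfolding points_iff by blast
  from W(1) show "q \<in> (points A - {p}) \<union> range (Near p)"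
  proof (cases rule: chart_cases)
    case (old U)
    then have "q \<in> points A" using W(2,3) unfolding points_iff by blast
    with old W show ?thesis by simp
  next
    case a
    then show ?thesis using W new_nonexc(1)[of w] by (cases "w $ 1 = 0") (auto simp: \<psi>a_def)
  next
    case b
    then show ?thesis using W new_nonexc(2)[of w] by (cases "w $ 2 = 0") (auto simp: \<psi>b_def)
  qed
next
  fix q assume "q \<in> (points A - {p}) \<union> range (Near p)"
  then consider "q \<in> points A" "q \<noteq> p" | l where "q = Near p l" by blast
  then show "q \<in> points A'"
  proof cases
    case 1
    then obtain W \<eta> w where "(W, \<eta>) \<in> A" "w \<in> W" "q = \<eta> w" unfolding points_iff by blast
    with 1 old_chart show ?thesis unfolding points_iff by blast
  next
    case (2 l)
    obtain \<sigma> t where "\<sigma> \<in> {Some, P1_inf}" "l = \<sigma> t" by (rule P1_cases)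
    then consider "l = Some t" | "l = P1_inf t" by blast
    then show ?thesis
      using 2 exceptional_param[of t, symmetric] zero_in_new(3,4)[of t] new_charts_in unfolding points_iff
      by cases blast+
  qed
qed

lemma not_Near_old: "q \<in> points A \<Longrightarrow> q \<noteq> Near p l"
  using fresh by blast

text \<open>The ancestors of a new point are \<open>p\<close> and the ancestors of \<open>p\<close>:
  the first has been removed, and the others were never present, because \<open>p\<close> was. An
  old point above a new one would also lie above \<open>p\<close>.\<close>

lemma unrelated_blow_up:
  assumes "unrelated A"
  shows "unrelated A'"
  unfolding unrelated_def
proof (intro ballI equals0I)
  have old: "y \<notin> points A" if "x \<in> points A" "y \<in> ancestors x" for x y
    using assms that unfolding unrelated_def by blast
  fix x y assume x: "x \<in> points A'" and y: "y \<in> ancestors x \<inter> points A'"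
  show False
  proof (cases "x \<in> points A")
    case True
    with y old have "y \<notin> points A" by blast
    then obtain l where "y = Near p l" using y points_blow_up by auto
    with y have "p \<in> ancestors x" using ancestors_trans[of y x] by auto
    with old[OF True] p_in_points show False by blast
  next
    case False
    then obtain l where "x = Near p l" using x points_blow_up by auto
    then have "y \<in> ancestors p \<or> y = p" using y by auto
    then have "y \<noteq> Near p l'" for l'
      using not_self_ancestor[of p] ancestors_trans[of "Near p l'" p] by (auto dest: arg_cong[of _ _ size])
    with y points_blow_up have "y \<in> points A - {p}" by auto
    with \<open>y \<in> ancestors p \<or> y = p\<close> old[OF p_in_points] show False by blast
  qed
qed

subsection \<open>Objects away from the centre\<close>

text \<open>In the new charts the set \<open>U - {p}\<close> is the preimage, under the blow-down,
  of an open set from which only \<open>c\<close> is removed.\<close>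

lemma openin_away:
  assumes "openin (manifold_topology A) U"
  shows "openin (manifold_topology A') (U - {p})"
  unfolding openin_compat[OF compat_blow_up]
proof (intro conjI)
  from assms have U: "U \<subseteq> points A" "\<And>W \<eta>. (W, \<eta>) \<in> A \<Longrightarrow> open {v \<in> W. \<eta> v \<in> U}"
    unfolding openin_compat[OF compat] by auto
  then show "U - {p} \<subseteq> points A'" unfolding points_blow_up by blast
  have *: "open {v \<in> V. \<psi> v \<in> U - {p}}"
  proof -
    have "{v \<in> V. \<psi> v \<in> U - {p}} = {v \<in> V. \<psi> v \<in> U} - {c}" using \<psi>_eq_p by auto
    then show ?thesis using U(2)[OF chart] by (simp add: open_Diff)
  qed
  have "open {v \<in> W. \<eta> v \<in> U - {p}}" if "(W, \<eta>) \<in> A'" for W \<eta>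
    using that
  proof (cases rule: chart_cases)
    case (old U')
    then have "{v \<in> W. \<eta> v \<in> U - {p}} = {v \<in> U'. \<eta> v \<in> U} \<inter> W" by auto
    moreover have "open W" using that by (rule compat_open[OF compat_blow_up])
    ultimately show ?thesis using U(2)[OF old(1)] by (simp add: open_Int)
  next
    case a
    have "{v \<in> W. \<eta> v \<in> U - {p}} = \<beta>a -` {v \<in> V. \<psi> v \<in> U - {p}}"
      using a U(1) fresh \<psi>_eq_p by (auto simp: Va_def \<psi>a_def vec2_eq_iff split: if_splits)
    then show ?thesis using open_vimage_\<beta>(1)[OF *] by (simp only:)
  next
    case b
    have "{v \<in> W. \<eta> v \<in> U - {p}} = \<beta>b -` {v \<in> V. \<psi> v \<in> U - {p}}"
      using b U(1) fresh \<psi>_eq_p by (auto simp: Vb_def \<psi>b_def vec2_eq_iff split: if_splits)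
    then show ?thesis using open_vimage_\<beta>(2)[OF *] by (simp only:)
  qed
  then show "\<forall>(W, \<eta>)\<in>A'. open {v \<in> W. \<eta> v \<in> U - {p}}" by auto
qed

lemma holo_fun_away:
  assumes "openin (manifold_topology A) U" "holo_fun_on A U g"
  shows "holo_fun_on A' (U - {p}) g"
proof -
  have U: "U \<subseteq> points A" using assms(1) unfolding openin_compat[OF compat] by blast
  have NU: "Near p l \<notin> U" for l using U fresh by blast
  have g: "holo_on {v \<in> W. \<eta> v \<in> U} (\<lambda>v. g (\<eta> v))" if "(W, \<eta>) \<in> A" for W \<eta>
    using assms(2) that unfolding holo_fun_on_def by auto
  have op: "open {v \<in> W. \<eta> v \<in> U - {p}}" if "(W, \<eta>) \<in> A'" for W \<eta>
    using openin_away[OF assms(1)] that unfolding openin_compat[OF compat_blow_up] by auto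
  have "holo_on {v \<in> W. \<eta> v \<in> U - {p}} (\<lambda>v. g (\<eta> v))" if "(W, \<eta>) \<in> A'" for W \<eta>
    using that
  proof (cases rule: chart_cases)
    case (old U')
    show ?thesis by (rule holo_on_subset[OF g[OF old(1)]]) (use old in auto)
  next
    case a
    have w: "w $ 1 \<noteq> 0" if "w \<in> W" "\<eta> w \<in> U - {p}" for w
    proof
      assume "w $ 1 = 0"
      with that a have "Near p (Some (w $ 2)) \<in> U" by (simp add: \<psi>a_def)
      with NU show False by simp
    qed
    have w': "\<eta> v = \<psi> (\<beta>a v) \<and> \<beta>a v \<in> V" if "v \<in> W" "\<eta> v \<in> U - {p}" for v
      using new_nonexc(1)[of v] w[OF that] that a by simp
    show ?thesis
    proof (rule holo_on_cong[OF op[OF that]])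
      show "holo_on {v \<in> W. \<eta> v \<in> U - {p}} (\<lambda>v. g (\<psi> (\<beta>a v)))"
        by (rule holo_on_compose[OF vholo_on_subset[OF vholo_\<beta>(1)] g[OF chart]])
          (use w' in auto)
    qed (use w' in auto)
  next
    case b
    have w: "w $ 2 \<noteq> 0" if "w \<in> W" "\<eta> w \<in> U - {p}" for w
    proof
      assume "w $ 2 = 0"
      with that b have "Near p (P1_inf (w $ 1)) \<in> U" by (simp add: \<psi>b_def)
      with NU show False by simp
    qed
    have w': "\<eta> v = \<psi> (\<beta>b v) \<and> \<beta>b v \<in> V" if "v \<in> W" "\<eta> v \<in> U - {p}" for v
      using new_nonexc(2)[of v] w[OF that] that b by simp
    show ?thesis
    proof (rule holo_on_cong[OF op[OF that]])
      show "holo_on {v \<in> W. \<eta> v \<in> U - {p}} (\<lambda>v. g (\<psi> (\<beta>b v)))"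
        by (rule holo_on_compose[OF vholo_on_subset[OF vholo_\<beta>(2)] g[OF chart]])
          (use w' in auto)
    qed (use w' in auto)
  qed
  then show ?thesis unfolding holo_fun_on_def by auto
qed

text \<open>\<open>D'\<close> may differ from \<open>D\<close> at \<open>p\<close> and on the
  exceptional curve. This freedom allows \<open>D'\<close> to be the strict transform of
  \<open>D\<close>.\<close>

lemma local_equation_away:
  assumes "local_equation A D U g" "\<And>q. q \<in> points A - {p} \<Longrightarrow> q \<in> D' \<longleftrightarrow> q \<in> D"
  shows "local_equation A' D' (U - {p}) g"
proof (rule local_equationI[OF compat_blow_up])
  from assms(1) have U: "openin (manifold_topology A) U" "holo_fun_on A U g" "\<And>p. p \<in> U \<Longrightarrow> g p = 0 \<longleftrightarrow> p \<in> D"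
    and nd: "\<And>W \<eta> v. (W, \<eta>) \<in> A \<Longrightarrow> v \<in> W \<Longrightarrow> \<eta> v \<in> U \<inter> D \<Longrightarrow> \<not> ((\<lambda>v. g (\<eta> v)) has_derivative (\<lambda>_. 0)) (at v)"
    unfolding local_equation_def by auto
  have sub: "U \<subseteq> points A" using U(1) unfolding openin_compat[OF compat] by blast
  show "openin (manifold_topology A') (U - {p})" by (rule openin_away[OF U(1)])
  show "holo_fun_on A' (U - {p}) g" by (rule holo_fun_away[OF U(1,2)])
  show "g q = 0 \<longleftrightarrow> q \<in> D'" if "q \<in> U - {p}" for q using that U(3)[of q] assms(2)[of q] sub by auto
  show "\<exists>(W, \<eta>)\<in>A'. \<exists>v\<in>W. \<eta> v = q \<and> \<not> ((\<lambda>v. g (\<eta> v)) has_derivative (\<lambda>_. 0)) (at v)"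
    if "q \<in> (U - {p}) \<inter> D'" for q
  proof -
    from that sub assms(2)[of q] have q: "q \<in> U \<inter> D" "q \<noteq> p" "q \<in> points A" by auto
    then obtain W \<eta> v where W: "(W, \<eta>) \<in> A" "v \<in> W" "q = \<eta> v" unfolding points_iff by blast
    then have "\<not> ((\<lambda>v. g (\<eta> v)) has_derivative (\<lambda>_. 0)) (at v)" using nd q by simp
    with W q show ?thesis by (intro bexI[OF _ old_chart[OF W(1)]]) auto
  qed
qed

lemma clift_away:
  assumes "clift_at W \<eta> \<gamma> t" "\<gamma> t \<noteq> p" "inj \<gamma>"
  shows "clift_at {v \<in> W. \<eta> v \<in> - {p}} \<eta> \<gamma> t"
proof -
  from assms(1) obtain N f i where N: "open N" "t \<in> N" "vholomorphic_on f N" "f ` N \<subseteq> W"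
    "\<And>x. x \<in> N \<Longrightarrow> \<eta> (f x) = \<gamma> x" "deriv (\<lambda>t. f t $ i) t \<noteq> 0" by (auto simp: clift_at_def)
  \<comment> \<open>Injectivity leaves finitely many parameters over \<open>p\<close>, so removing
    them from \<open>N\<close> leaves an open set.\<close>
  have "finite (\<gamma> -` {p})" using assms(3) by (simp add: finite_vimageI)
  then have "open (N - \<gamma> -` {p})" using N(1) by (simp add: open_Diff finite_imp_closed)
  then show ?thesis
    by (rule clift_atI[where f = f and i = i])
      (use N assms(2) in \<open>auto intro: vholomorphic_on_subset\<close>)
qed

lemma closed_away:
  assumes "closed_curve A \<gamma>" "p \<notin> range \<gamma>" "range \<gamma> \<subseteq> points A"
  shows "closed_curve A' \<gamma>"
proof -
  have cl: "open {v \<in> W. \<eta> v \<notin> range \<gamma>}" if "(W, \<eta>) \<in> A" for W \<eta>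
    using assms(1) that unfolding closed_curve_def by auto
  have Nr: "Near p l \<notin> range \<gamma>" for l using fresh assms(3) by blast
  have "open {v \<in> W. \<eta> v \<notin> range \<gamma>}" if "(W, \<eta>) \<in> A'" for W \<eta>
    using that
  proof (cases rule: chart_cases)
    case (old U')
    then have "{v \<in> W. \<eta> v \<notin> range \<gamma>} = {v \<in> U'. \<eta> v \<notin> range \<gamma>} \<inter> W" by auto
    moreover have "open W" using that by (rule compat_open[OF compat_blow_up])
    ultimately show ?thesis using cl[OF old(1)] by (simp add: open_Int)
  next
    case a
    \<comment> \<open>The exceptional line is blown down to \<open>c\<close>, which lies off the
      curve; the preimage of the complement therefore contains that line, as it should.\<close>
    have "\<beta>a w = c" if "w $ 1 = 0" for w using that by (simp add: vec2_eq_iff)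
    then have "{v \<in> W. \<eta> v \<notin> range \<gamma>} = \<beta>a -` {v \<in> V. \<psi> v \<notin> range \<gamma>}"
      using a Nr assms(2) by (auto simp: Va_def \<psi>a_def)
    then show ?thesis using open_vimage_\<beta>(1)[OF cl[OF chart]] by (simp only:)
  next
    case b
    have "\<beta>b w = c" if "w $ 2 = 0" for w using that by (simp add: vec2_eq_iff)
    then have "{v \<in> W. \<eta> v \<notin> range \<gamma>} = \<beta>b -` {v \<in> V. \<psi> v \<notin> range \<gamma>}"
      using b Nr assms(2) by (auto simp: Vb_def \<psi>b_def)
    then show ?thesis using open_vimage_\<beta>(2)[OF cl[OF chart]] by (simp only:)
  qed
  then show ?thesis unfolding closed_curve_def by auto
qed

lemma strict_away: "p \<notin> range \<gamma> \<Longrightarrow> strict p \<gamma> = \<gamma>"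
  by (rule ext) (simp add: strict_def, metis rangeI)

lemma strict_range_old: "q \<in> points A - {p} \<Longrightarrow> q \<in> range (strict p \<gamma>) \<longleftrightarrow> q \<in> range \<gamma>"
  using not_Near_old[of q "Some 0"] unfolding strict_def image_iff by (metis DiffD1 DiffD2 UNIV_I singletonI)

lemma P1_embedding_away:
  assumes "P1_embedding A \<gamma>" "p \<notin> range \<gamma>"
  shows "P1_embedding A' \<gamma>"
proof (rule P1_embeddingI[OF compat_blow_up])
  show inj: "inj \<gamma>" using assms(1) unfolding P1_embedding_def by blast
  fix \<sigma> :: "complex \<Rightarrow> complex option" and t assume \<sigma>: "\<sigma> \<in> {Some, P1_inf}"
  then have inj\<sigma>: "inj \<sigma>" by (auto simp: inj_def P1_inf_def split: if_splits)
  have "\<gamma> (\<sigma> t) \<in> points A" using P1_embedding_points[OF assms(1)] by blast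
  then obtain W \<eta> w where W: "(W, \<eta>) \<in> A" "w \<in> W" "\<gamma> (\<sigma> t) = \<eta> w" unfolding points_iff by blast
  then have "clift_at W \<eta> (\<lambda>x. \<gamma> (\<sigma> x)) t" by (intro P1_embedding_clift[OF assms(1) W(1) \<sigma>]) blast
  moreover have "inj (\<lambda>x. \<gamma> (\<sigma> x))" using inj inj\<sigma> by (simp add: inj_def)
  moreover have "\<gamma> (\<sigma> t) \<noteq> p" using assms(2) by (metis rangeI)
  ultimately have "clift_at {v \<in> W. \<eta> v \<in> - {p}} \<eta> (\<lambda>x. \<gamma> (\<sigma> x)) t" by (intro clift_away)
  with old_chart[OF W(1)] show "\<exists>(V, \<psi>)\<in>A'. clift_at V \<psi> (\<lambda>x. \<gamma> (\<sigma> x)) t" by blast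
qed

text \<open>A curve that avoids the centre keeps its sections and orders; only the domains of the
  local equations lose the point \<open>p\<close>.\<close>

lemma intersection_data_away:
  assumes "intersection_data A \<gamma> D \<T> ord" "p \<notin> range \<gamma>" "p \<notin> D" 
  shows "intersection_data A' \<gamma> D ((\<lambda>(U, g, s). (U - {p}, g, s)) ` \<T>) ord"
proof -
  note I = intersection_dataD[OF assms(1)]
  have op: "openin (manifold_topology A) U" if "(U, g, s) \<in> \<T>" for U g s
    using I(1)[OF that] unfolding local_equation_def by blast
  show ?thesis
    unfolding intersection_data_def
  proof (intro conjI allI impI)
    show "local_equation A' D U g" if "(U, g, s) \<in> (\<lambda>(U, g, s). (U - {p}, g, s)) ` \<T>" for U g s
      using that I(1) local_equation_away[of D _ _ D] by auto
    show "\<exists>U g s. (U, g, s) \<in> (\<lambda>(U, g, s). (U - {p}, g, s)) ` \<T> \<and> \<gamma> \<zeta> \<in> U" for \<zeta>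
    proof -
      from I(2)[of \<zeta>] obtain U g s where U: "(U, g, s) \<in> \<T>" "\<gamma> \<zeta> \<in> U" by blast
      then have "(U - {p}, g, s) \<in> (\<lambda>(U, g, s). (U - {p}, g, s)) ` \<T>" by force
      moreover have "\<gamma> \<zeta> \<in> U - {p}" using U assms(2) by (metis DiffI rangeI singletonD)
      ultimately show ?thesis by blast
    qed
    show "section_at s \<sigma> z (ord (\<sigma> z))"
      if "(U, g, s) \<in> (\<lambda>(U, g, s). (U - {p}, g, s)) ` \<T>" "\<sigma> \<in> {Some, P1_inf}" "\<gamma> (\<sigma> z) \<in> U" for U g s \<sigma> z
      using that I(3)[OF _ that(2)] by auto
    show "finite {\<zeta>. ord \<zeta> \<noteq> 0}" by (rule I(5))
    fix U g s U' g' s'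
    assume "(U, g, s) \<in> (\<lambda>(U, g, s). (U - {p}, g, s)) ` \<T>" "(U', g', s') \<in> (\<lambda>(U, g, s). (U - {p}, g, s)) ` \<T>"
    then obtain U1 U2 where T: "(U1, g, s) \<in> \<T>" "U = U1 - {p}" "(U2, g', s') \<in> \<T>" "U' = U2 - {p}" by auto
    from I(4)[OF T(1,3)] obtain u where u: "holo_fun_on A (U1 \<inter> U2) u" "\<forall>p\<in>U1 \<inter> U2. g p = u p * g' p"
       "\<forall>\<zeta>. \<gamma> \<zeta> \<in> U1 \<inter> U2 \<longrightarrow> s \<zeta> = u (\<gamma> \<zeta>) * s' \<zeta>" by blast
    have "U \<inter> U' = U1 \<inter> U2 - {p}" using T by auto
    with holo_fun_away[OF openin_Int[OF op[OF T(1)] op[OF T(3)]] u(1)] u(2,3)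
    show "\<exists>u. holo_fun_on A' (U \<inter> U') u \<and> (\<forall>p\<in>U \<inter> U'. g p = u p * g' p) \<and>
          (\<forall>\<zeta>. \<gamma> \<zeta> \<in> U \<inter> U' \<longrightarrow> s \<zeta> = u (\<gamma> \<zeta>) * s' \<zeta>)"
      by (intro exI[of _ u]) auto
  qed
qed

end

section \<open>The strict transform of a curve through the centre\<close>

definition adapted :: "(complex^2) set \<Rightarrow> (complex^2 \<Rightarrow> ipoint) \<Rightarrow> ipoint set \<Rightarrow> bool" where
  "adapted V \<psi> D \<longleftrightarrow> (\<forall>v\<in>V. \<psi> v \<in> D \<longleftrightarrow> v $ 2 = 0)"

lemma P1_param_inj: "\<sigma> \<in> {Some, P1_inf} \<Longrightarrow> inj \<sigma>"
  by (auto simp: inj_def P1_inf_def split: if_splits)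

lemma section_at_divide:
  assumes "section_at s \<sigma> z m" "section_at d \<sigma> z n"
  shows "section_at (\<lambda>\<zeta>. s \<zeta> / d \<zeta>) \<sigma> z (m - n)"
  unfolding section_at_def
proof (intro conjI)
  from assms have s: "(\<lambda>w. s (\<sigma> w)) meromorphic_on {z}" "\<forall>\<^sub>F w in at z. s (\<sigma> w) \<noteq> 0" "zorder (\<lambda>w. s (\<sigma> w)) z = m"
    and d: "(\<lambda>w. d (\<sigma> w)) meromorphic_on {z}" "\<forall>\<^sub>F w in at z. d (\<sigma> w) \<noteq> 0" "zorder (\<lambda>w. d (\<sigma> w)) z = n"
    by (auto simp: section_at_def)
  show "(\<lambda>w. s (\<sigma> w) / d (\<sigma> w)) meromorphic_on {z}" by (intro meromorphic_intros s d)
  show "\<forall>\<^sub>F w in at z. s (\<sigma> w) / d (\<sigma> w) \<noteq> 0" using s(2) d(2) by eventually_elim simp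
  have "zorder (\<lambda>w. s (\<sigma> w) / d (\<sigma> w)) z = zorder (\<lambda>w. s (\<sigma> w)) z - zorder (\<lambda>w. d (\<sigma> w)) z"
    by (rule zorder_divide) (use s d in \<open>auto intro: eventually_frequently\<close>)
  then show "zorder (\<lambda>w. s (\<sigma> w) / d (\<sigma> w)) z = m - n" using s d by simp
qed

text \<open>In the chart of the blow-up the curve is the line where the second coordinate vanishes,
  and the centre lies on it. Its strict transform therefore meets the exceptional curve in the
  direction \<open>Some 0\<close> and is a coordinate line again.\<close>

locale strict_transform = blowup +
  fixes \<gamma> :: "complex option \<Rightarrow> ipoint"
  assumes emb: "P1_embedding A \<gamma>" and adapted: "adapted V \<psi> (range \<gamma>)" and c2: "c $ 2 = 0"
begin

abbreviation "\<gamma>' \<equiv> strict (\<psi> c) \<gamma>"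

lemma adaptedD: "v \<in> V \<Longrightarrow> \<psi> v \<in> range \<gamma> \<longleftrightarrow> v $ 2 = 0"
  using adapted by (simp add: adapted_def)

lemma p_on_curve: "p \<in> range \<gamma>"
  using adaptedD[OF centre] c2 by simp

lemma inj_\<gamma>: "inj \<gamma>"
  using emb unfolding P1_embedding_def by blast

lemma \<gamma>_points: "\<gamma> \<zeta> \<in> points A"
  using P1_embedding_points[OF emb] by blast

lemma \<gamma>_not_Near: "\<gamma> \<zeta> \<noteq> Near p l"
  using not_Near_old[OF \<gamma>_points] .

lemma strict_Near: "Near p l \<in> range \<gamma>' \<longleftrightarrow> l = Some 0"
proof
  assume "Near p l \<in> range \<gamma>'"
  then show "l = Some 0" using \<gamma>_not_Near by (auto simp: strict_def split: if_splits) (metis)+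
next
  assume "l = Some 0"
  from p_on_curve obtain \<zeta> where "p = \<gamma> \<zeta>" by blast
  then have "\<gamma>' \<zeta> = Near p l" using \<open>l = Some 0\<close> by (simp add: strict_def)
  then show "Near p l \<in> range \<gamma>'" by (metis rangeI)
qed

text \<open>Because \<open>c $ 2 = 0\<close>, the blow-down has second coordinate
  \<open>w $ 1 * w $ 2\<close> here. The total transform splits into the exceptional line
  \<open>w $ 1 = 0\<close> and the line \<open>w $ 2 = 0\<close>, which is the strict
  transform.\<close>

lemma strict_a: "w \<in> Va \<Longrightarrow> \<psi>a w \<in> range \<gamma>' \<longleftrightarrow> w $ 2 = 0"
proof (cases "w $ 1 = 0")
  case True
  then show ?thesis using strict_Near by (simp add: \<psi>a_def)
next
  case False
  assume "w \<in> Va"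
  note * = new_nonexc(1)[OF this False]
  then have "\<psi>a w \<in> range \<gamma>' \<longleftrightarrow> \<psi>a w \<in> range \<gamma>" by (intro strict_range_old) blast
  with * adaptedD[of "\<beta>a w"] c2 False show ?thesis by simp
qed

text \<open>Here the second coordinate of the blow-down is \<open>w $ 2\<close>, so the total
  transform is just the exceptional line, and the direction \<open>Some 0\<close> is not of the form
  \<open>P1_inf m\<close>.\<close>

lemma strict_b: "w \<in> Vb \<Longrightarrow> \<psi>b w \<notin> range \<gamma>'"
proof (cases "w $ 2 = 0")
  case True
  then show ?thesis using strict_Near by (simp add: \<psi>b_def P1_inf_def)
next
  case False
  assume "w \<in> Vb"
  note * = new_nonexc(2)[OF this False]
  then have "\<psi>b w \<in> range \<gamma>' \<longleftrightarrow> \<psi>b w \<in> range \<gamma>" by (intro strict_range_old) blast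
  with * adaptedD[of "\<beta>b w"] c2 False show ?thesis by simp
qed

lemma closed_strict:
  assumes "closed_curve A \<gamma>"
  shows "closed_curve A' \<gamma>'"
proof -
  have "open {v \<in> W. \<eta> v \<notin> range \<gamma>'}" if W: "(W, \<eta>) \<in> A'" for W \<eta>
    using W
  proof (cases rule: chart_cases)
    case (old U)
    have "\<eta> v \<in> range \<gamma>' \<longleftrightarrow> \<eta> v \<in> range \<gamma>" if "v \<in> W" for v
      by (rule strict_range_old) (use that old in \<open>auto simp: points_iff\<close>)
    then have "{v \<in> W. \<eta> v \<notin> range \<gamma>'} = {v \<in> U. \<eta> v \<notin> range \<gamma>} \<inter> W" using old(2) by auto
    moreover have "open W" using W by (rule compat_open[OF compat_blow_up])
    moreover have "open {v \<in> U. \<eta> v \<notin> range \<gamma>}" using assms old(1) unfolding closed_curve_def by auto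
    ultimately show ?thesis by (simp add: open_Int)
  next
    case a
    then have "{v \<in> W. \<eta> v \<notin> range \<gamma>'} = Va \<inter> {w. w $ 2 \<noteq> 0}" using strict_a by auto
    moreover have "open (Va \<inter> {w. w $ 2 \<noteq> 0})" by (intro open_Int open_new open_Collect_neq continuous_intros)
    ultimately show ?thesis by simp
  next
    case b
    then have "{v \<in> W. \<eta> v \<notin> range \<gamma>'} = Vb" using strict_b by auto
    then show ?thesis using open_new by simp
  qed
  then show ?thesis unfolding closed_curve_def by auto
qed

text \<open>Along the curve the second coordinate is identically zero, so the nonzero velocity shows
  in the first coordinate, which is thus a local parameter of the curve.\<close>

lemma local_param:
  assumes "\<sigma> \<in> {Some, P1_inf}" "\<gamma> (\<sigma> t) \<in> \<psi> ` V"
  obtains N where "open N" "t \<in> N" "\<And>x. x \<in> N \<Longrightarrow> \<gamma> (\<sigma> x) \<in> \<psi> ` V"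
    "(\<lambda>x. inv_into V \<psi> (\<gamma> (\<sigma> x)) $ 1) holomorphic_on N" "\<And>x. x \<in> N \<Longrightarrow> inv_into V \<psi> (\<gamma> (\<sigma> x)) $ 2 = 0"
    "deriv (\<lambda>x. inv_into V \<psi> (\<gamma> (\<sigma> x)) $ 1) t \<noteq> 0"
proof -
  obtain N where N: "open N" "t \<in> N" "vholomorphic_on (\<lambda>x. inv_into V \<psi> (\<gamma> (\<sigma> x))) N"
    "\<And>x. x \<in> N \<Longrightarrow> \<gamma> (\<sigma> x) \<in> \<psi> ` V" "\<exists>i. deriv (\<lambda>t. inv_into V \<psi> (\<gamma> (\<sigma> t)) $ i) t \<noteq> 0"
    using clift_domain[OF compat chart P1_embedding_clift[OF emb chart assms]] by metis
  have z: "inv_into V \<psi> (\<gamma> (\<sigma> x)) $ 2 = 0" if "x \<in> N" for x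
    using adaptedD[OF inv_into_into[OF N(4)[OF that]]] f_inv_into_f[OF N(4)[OF that]] by simp
  have "deriv (\<lambda>x. inv_into V \<psi> (\<gamma> (\<sigma> x)) $ 2) t = deriv (\<lambda>_. 0) t"
    by (rule deriv_cong_ev) (use N(1,2) z in \<open>auto simp: eventually_nhds\<close>)
  then have "deriv (\<lambda>x. inv_into V \<psi> (\<gamma> (\<sigma> x)) $ 2) t = 0" by simp
  with N(5) have "deriv (\<lambda>x. inv_into V \<psi> (\<gamma> (\<sigma> x)) $ 1) t \<noteq> 0" by (metis exhaust_2)
  then show ?thesis using that N z by (auto simp: vholomorphic_on_def)
qed

lemma strict_lift:
  assumes "\<sigma> \<in> {Some, P1_inf}" "\<gamma> (\<sigma> t) = p"
  shows "clift_at Va \<psi>a (\<lambda>x. \<gamma>' (\<sigma> x)) t"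
proof -
  have "\<gamma> (\<sigma> t) \<in> \<psi> ` V" using assms centre by auto
  then obtain N where N: "open N" "t \<in> N" "\<And>x. x \<in> N \<Longrightarrow> \<gamma> (\<sigma> x) \<in> \<psi> ` V"
    "(\<lambda>x. inv_into V \<psi> (\<gamma> (\<sigma> x)) $ 1) holomorphic_on N" "\<And>x. x \<in> N \<Longrightarrow> inv_into V \<psi> (\<gamma> (\<sigma> x)) $ 2 = 0"
    "deriv (\<lambda>x. inv_into V \<psi> (\<gamma> (\<sigma> x)) $ 1) t \<noteq> 0"
    by (rule local_param[OF assms(1)]) (rule that)
  define f where "f x = (vector [inv_into V \<psi> (\<gamma> (\<sigma> x)) $ 1 - c $ 1, 0] :: complex^2)" for x
  have \<beta>f: "\<beta>a (f x) = inv_into V \<psi> (\<gamma> (\<sigma> x))" if "x \<in> N" for x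
    using N(5)[OF that] c2 by (simp add: f_def vec2_eq_iff)
  show ?thesis
  proof (rule clift_atI[OF N(1,2), of f])
    show "vholomorphic_on f N"
      unfolding vholomorphic_on_def forall_2 f_def using N(4) by (auto intro!: holomorphic_intros)
    fix x assume x: "x \<in> N"
    show "f x \<in> Va" using inv_into_into[OF N(3)[OF x]] by (simp add: Va_def \<beta>f[OF x])
    have "f x $ 1 = 0 \<longleftrightarrow> \<gamma> (\<sigma> x) = p"
    proof -
      have "f x $ 1 = 0 \<longleftrightarrow> inv_into V \<psi> (\<gamma> (\<sigma> x)) = c" using N(5)[OF x] c2 by (simp add: f_def vec2_eq_iff)
      also have "\<dots> \<longleftrightarrow> \<gamma> (\<sigma> x) = p"
        using \<psi>_eq_p[OF inv_into_into[OF N(3)[OF x]]] f_inv_into_f[OF N(3)[OF x]] by simp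
      finally show ?thesis .
    qed
    then show "\<psi>a (f x) = \<gamma>' (\<sigma> x)"
      using f_inv_into_f[OF N(3)[OF x]] by (auto simp: \<psi>a_def strict_def \<beta>f[OF x]) (simp add: f_def)
  next
    have "(\<lambda>x. inv_into V \<psi> (\<gamma> (\<sigma> x)) $ 1) field_differentiable at t"
      using N(1,2,4) by (metis holomorphic_on_imp_differentiable_at)
    then have "deriv (\<lambda>x. f x $ 1) t = deriv (\<lambda>x. inv_into V \<psi> (\<gamma> (\<sigma> x)) $ 1) t"
      by (simp add: f_def deriv_diff)
    then show "deriv (\<lambda>x. f x $ 1) t \<noteq> 0" using N(6) by simp
  qed
qed

lemma P1_embedding_strict: "P1_embedding A' \<gamma>'"
proof (rule P1_embeddingI[OF compat_blow_up])
  show "inj \<gamma>'"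
  proof (rule injI)
    fix x y assume "\<gamma>' x = \<gamma>' y"
    then show "x = y" using \<gamma>_not_Near[of x] \<gamma>_not_Near[of y, THEN not_sym] injD[OF inj_\<gamma>, of x y]
      by (auto simp: strict_def split: if_splits)
  qed
  fix \<sigma> :: "complex \<Rightarrow> complex option" and t assume \<sigma>: "\<sigma> \<in> {Some, P1_inf}"
  note inj\<sigma> = P1_param_inj[OF \<sigma>]
  show "\<exists>(V, \<psi>)\<in>A'. clift_at V \<psi> (\<lambda>x. \<gamma>' (\<sigma> x)) t"
  proof (cases "\<gamma> (\<sigma> t) = p")
    case True
    from strict_lift[OF \<sigma> this] new_charts_in(1) show ?thesis by blast
  next
    case False
    obtain W \<eta> w where W: "(W, \<eta>) \<in> A" "w \<in> W" "\<gamma> (\<sigma> t) = \<eta> w"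
      using \<gamma>_points[of "\<sigma> t"] unfolding points_iff by blast
    then have "clift_at W \<eta> (\<lambda>x. \<gamma> (\<sigma> x)) t" by (intro P1_embedding_clift[OF emb W(1) \<sigma>]) blast
    moreover have "inj (\<lambda>x. \<gamma> (\<sigma> x))" using inj_\<gamma> inj\<sigma> by (simp add: inj_def)
    ultimately have "clift_at {v \<in> W. \<eta> v \<in> - {p}} \<eta> (\<lambda>x. \<gamma> (\<sigma> x)) t" using False by (intro clift_away)
    then obtain N f i where N: "open N" "t \<in> N" "vholomorphic_on f N" "f ` N \<subseteq> {v \<in> W. \<eta> v \<in> - {p}}"
      "\<And>x. x \<in> N \<Longrightarrow> \<eta> (f x) = \<gamma> (\<sigma> x)" "deriv (\<lambda>t. f t $ i) t \<noteq> 0" by (auto simp: clift_at_def)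
    have "clift_at {v \<in> W. \<eta> v \<in> - {p}} \<eta> (\<lambda>x. \<gamma>' (\<sigma> x)) t"
    proof (rule clift_atI[OF N(1-3) _ _ N(6)])
      fix x assume x: "x \<in> N"
      then have "f x \<in> {v \<in> W. \<eta> v \<in> - {p}}" using N(4) by blast
      then show "f x \<in> {v \<in> W. \<eta> v \<in> - {p}}" "\<eta> (f x) = \<gamma>' (\<sigma> x)" using N(5)[OF x] by (auto simp: strict_def)
    qed
    with old_chart[OF W(1)] show ?thesis by blast
  qed
qed

text \<open>The equation of the curve factors as \<open>g0 = d * ?gn\<close>, where \<open>d\<close>
  is the equation of the exceptional curve. The bundle of the strict transform is therefore the old
  one twisted by minus the exceptional curve, and dividing \<open>s0\<close> by the restriction of
  \<open>d\<close> gives a section of it. That restriction is the first coordinate minus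
  \<open>c $ 1\<close>, which has a simple zero at the parameter of the centre: the order drops by
  one there and nowhere else.\<close>

lemma intersection_data_strict:
  assumes I: "intersection_data A \<gamma> (range \<gamma>) \<T> ord"
    and T0: "(\<psi> ` V, g0, s0) \<in> \<T>" and g0: "\<And>v. v \<in> V \<Longrightarrow> g0 (\<psi> v) = v $ 2"
  shows "intersection_data A' \<gamma>' (range \<gamma>')
      (insert (\<psi>a ` Va, \<lambda>q. inv_into Va \<psi>a q $ 2, \<lambda>\<zeta>. s0 \<zeta> / (inv_into V \<psi> (\<gamma> \<zeta>) $ 1 - c $ 1))
        ((\<lambda>(U, g, s). (U - {p}, g, s)) ` \<T>))
      (\<lambda>\<zeta>. ord \<zeta> - (if \<gamma> \<zeta> = p then 1 else 0))"
    (is "intersection_data _ _ _ (insert (?Un, ?gn, ?sn) ?\<T>) ?ord")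
proof -
  note I = intersection_dataD[OF I]
  have op: "openin (manifold_topology A) U" if "(U, g, s) \<in> \<T>" for U g s
    using I(1)[OF that] unfolding local_equation_def by blast
  have img: "(U - {p}, g, s) \<in> ?\<T>" if "(U, g, s) \<in> \<T>" for U g s
    using that by force
  have le_new: "local_equation A' (range \<gamma>') ?Un ?gn"
    using local_equation_chart[OF compat_blow_up new_charts_in(1), of 2 0 "range \<gamma>'"] strict_a by simp
  have le_old: "local_equation A' (range \<gamma>') (U - {p}) g" if "(U, g, s) \<in> \<T>" for U g s
    by (rule local_equation_away[OF I(1)[OF that]]) (rule strict_range_old)
  have \<gamma>'_old: "\<gamma> \<zeta> \<in> U - {p} \<and> \<gamma>' \<zeta> = \<gamma> \<zeta>" if "(U, g, s) \<in> \<T>" "\<gamma>' \<zeta> \<in> U - {p}" for U g s \<zeta>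
  proof -
    have "U \<subseteq> points A" using op[OF that(1)] unfolding openin_compat[OF compat] by blast
    then have "Near p (Some 0) \<notin> U" using fresh by blast
    then show ?thesis using that(2) by (auto simp: strict_def split: if_splits)
  qed
  \<comment> \<open>On the curve the exceptional equation of the new chart equals the shifted first
    coordinate of the old one, also at the centre, where both vanish.\<close>
  have \<gamma>'_new: "\<gamma> \<zeta> \<in> \<psi> ` V \<and> inv_into V \<psi> (\<gamma> \<zeta>) $ 1 - c $ 1 = inv_into Va \<psi>a (\<gamma>' \<zeta>) $ 1
      \<and> (inv_into Va \<psi>a (\<gamma>' \<zeta>) $ 1 = 0 \<longleftrightarrow> \<gamma> \<zeta> = p)" if "\<gamma>' \<zeta> \<in> ?Un" for \<zeta>
  proof -
    from that obtain w where w: "w \<in> Va" "\<gamma>' \<zeta> = \<psi>a w" by blast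
    then have iw: "inv_into Va \<psi>a (\<gamma>' \<zeta>) = w" using inj_new by simp
    show ?thesis
    proof (cases "\<gamma> \<zeta> = p")
      case True
      then have "\<psi>a w = \<psi>a 0" using w by (simp add: strict_def \<psi>a_def)
      then have "w = 0" using inj_onD[OF inj_new(1)] w zero_in_new by blast
      moreover have "inv_into V \<psi> (\<gamma> \<zeta>) = c" using True centre inj_\<psi> by simp
      ultimately show ?thesis using True centre iw by simp
    next
      case False
      then have e: "\<gamma> \<zeta> = \<psi>a w" using w by (simp add: strict_def)
      then have w1: "w $ 1 \<noteq> 0" using \<gamma>_not_Near by (auto simp: \<psi>a_def)
      from new_nonexc(1)[OF w(1) w1] have *: "\<gamma> \<zeta> = \<psi> (\<beta>a w)" "\<beta>a w \<in> V" using e by auto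
      then have "inv_into V \<psi> (\<gamma> \<zeta>) = \<beta>a w" using inj_\<psi> by simp
      then show ?thesis using False iw w1 * by simp
    qed
  qed
  have sec_new: "section_at ?sn \<sigma> z (?ord (\<sigma> z))" if \<sigma>: "\<sigma> \<in> {Some, P1_inf}" "\<gamma>' (\<sigma> z) \<in> ?Un" for \<sigma> z
  proof -
    have gz: "\<gamma> (\<sigma> z) \<in> \<psi> ` V" using \<gamma>'_new[OF \<sigma>(2)] by blast
    obtain N where N: "open N" "z \<in> N"
      "(\<lambda>x. inv_into V \<psi> (\<gamma> (\<sigma> x)) $ 1) holomorphic_on N"
      "deriv (\<lambda>x. inv_into V \<psi> (\<gamma> (\<sigma> x)) $ 1) z \<noteq> 0"
      by (rule local_param[OF \<sigma>(1) gz]) (rule that)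
    have hol: "(\<lambda>x. inv_into V \<psi> (\<gamma> (\<sigma> x)) $ 1 - c $ 1) holomorphic_on N"
      by (intro holomorphic_intros N)
    have "(\<lambda>x. inv_into V \<psi> (\<gamma> (\<sigma> x)) $ 1) field_differentiable at z"
      using N by (metis holomorphic_on_imp_differentiable_at)
    then have der: "deriv (\<lambda>x. inv_into V \<psi> (\<gamma> (\<sigma> x)) $ 1 - c $ 1) z \<noteq> 0"
      using N(4) by (simp add: deriv_diff)
    have "section_at (\<lambda>\<zeta>. inv_into V \<psi> (\<gamma> \<zeta>) $ 1 - c $ 1) \<sigma> z (if \<gamma> (\<sigma> z) = p then 1 else 0)"
    proof (cases "\<gamma> (\<sigma> z) = p")
      case True
      then have "inv_into V \<psi> (\<gamma> (\<sigma> z)) $ 1 - c $ 1 = 0" using \<gamma>'_new[OF \<sigma>(2)] by simp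
      then show ?thesis using section_at_simple_zero[OF N(1,2) hol _ der] True by simp
    next
      case False
      then have "inv_into V \<psi> (\<gamma> (\<sigma> z)) $ 1 - c $ 1 \<noteq> 0" using \<gamma>'_new[OF \<sigma>(2)] by simp
      then show ?thesis using section_at_holomorphic[OF N(1,2) hol] False by simp
    qed
    from section_at_divide[OF I(3)[OF T0 \<sigma>(1) gz] this] show ?thesis .
  qed
  define d where "d q = inv_into Va \<psi>a q $ 1" for q
  have d: "holo_fun_on A' ?Un d"
    unfolding d_def by (rule holo_fun_on_chart[OF compat_blow_up new_charts_in(1) _ _ open_new(1)]) (auto intro: holo_intros)
  \<comment> \<open>A point of the new chart that is also an old point is not exceptional; so
    \<open>d\<close> is invertible on the overlap with every old domain.\<close>
  have on_overlap: "q \<in> \<psi> ` V \<and> d q \<noteq> 0 \<and> g0 q = d q * ?gn q" if "q \<in> ?Un" "q \<in> points A" for q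
  proof -
    from that obtain w where w: "w \<in> Va" "q = \<psi>a w" by blast
    have w1: "w $ 1 \<noteq> 0" using w that(2) fresh by (auto simp: \<psi>a_def)
    from new_nonexc(1)[OF w(1) w1] have *: "q = \<psi> (\<beta>a w)" "\<beta>a w \<in> V" using w by auto
    then have "g0 q = w $ 1 * w $ 2" using g0 c2 by simp
    moreover have "q \<in> \<psi> ` V" using * by blast
    moreover have "inv_into Va \<psi>a q = w" using w inj_new by simp
    ultimately show ?thesis using w1 by (simp add: d_def)
  qed
  have on_curve: "?sn \<zeta> = s0 \<zeta> / d (\<gamma>' \<zeta>)" if "\<gamma>' \<zeta> \<in> ?Un" for \<zeta>
    using \<gamma>'_new[OF that] by (simp add: d_def)
  \<comment> \<open>The transition functions to and from the new equation are those to and from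
    \<open>g0\<close>, multiplied or divided by \<open>d\<close>.\<close>
  have tr: "(\<exists>u. holo_fun_on A' ((U - {p}) \<inter> ?Un) u \<and> (\<forall>q\<in>(U - {p}) \<inter> ?Un. g q = u q * ?gn q) \<and>
          (\<forall>\<zeta>. \<gamma>' \<zeta> \<in> (U - {p}) \<inter> ?Un \<longrightarrow> s \<zeta> = u (\<gamma>' \<zeta>) * ?sn \<zeta>)) \<and>
      (\<exists>u. holo_fun_on A' (?Un \<inter> (U - {p})) u \<and> (\<forall>q\<in>?Un \<inter> (U - {p}). ?gn q = u q * g q) \<and>
          (\<forall>\<zeta>. \<gamma>' \<zeta> \<in> ?Un \<inter> (U - {p}) \<longrightarrow> ?sn \<zeta> = u (\<gamma>' \<zeta>) * s \<zeta>))"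
    if T: "(U, g, s) \<in> \<T>" for U g s
  proof -
    have UA: "U \<subseteq> points A" using op[OF T] unfolding openin_compat[OF compat] by blast
    from I(4)[OF T T0] obtain u where u: "holo_fun_on A (U \<inter> \<psi> ` V) u" "\<forall>p\<in>U \<inter> \<psi> ` V. g p = u p * g0 p"
       "\<forall>\<zeta>. \<gamma> \<zeta> \<in> U \<inter> \<psi> ` V \<longrightarrow> s \<zeta> = u (\<gamma> \<zeta>) * s0 \<zeta>" by blast
    from I(4)[OF T0 T] obtain u' where u': "holo_fun_on A (\<psi> ` V \<inter> U) u'" "\<forall>p\<in>\<psi> ` V \<inter> U. g0 p = u' p * g p"
       "\<forall>\<zeta>. \<gamma> \<zeta> \<in> \<psi> ` V \<inter> U \<longrightarrow> s0 \<zeta> = u' (\<gamma> \<zeta>) * s \<zeta>" by blast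
    have sub: "(U - {p}) \<inter> ?Un \<subseteq> U \<inter> \<psi> ` V - {p}" "?Un \<inter> (U - {p}) \<subseteq> \<psi> ` V \<inter> U - {p}"
      using on_overlap UA by auto
    have hu: "holo_fun_on A' ((U - {p}) \<inter> ?Un) u" "holo_fun_on A' (?Un \<inter> (U - {p})) u'"
      using holo_fun_on_subset[OF holo_fun_away[OF openin_Int[OF op[OF T] op[OF T0]] u(1)] sub(1)]
        holo_fun_on_subset[OF holo_fun_away[OF openin_Int[OF op[OF T0] op[OF T]] u'(1)] sub(2)] by auto
    have hd: "holo_fun_on A' ((U - {p}) \<inter> ?Un) d" "holo_fun_on A' (?Un \<inter> (U - {p})) d"
      by (rule holo_fun_on_subset[OF d]; blast)+
    have ov: "q \<in> \<psi> ` V \<and> d q \<noteq> 0 \<and> g0 q = d q * ?gn q" if "q \<in> ?Un" "q \<in> U" for q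
      using on_overlap[OF that(1)] that(2) UA by blast
    have cv: "\<gamma> \<zeta> = \<gamma>' \<zeta> \<and> \<gamma> \<zeta> \<in> U \<and> \<gamma> \<zeta> \<in> \<psi> ` V \<and> d (\<gamma>' \<zeta>) \<noteq> 0 \<and> ?sn \<zeta> = s0 \<zeta> / d (\<gamma>' \<zeta>)"
      if "\<gamma>' \<zeta> \<in> ?Un" "\<gamma>' \<zeta> \<in> U - {p}" for \<zeta>
      using \<gamma>'_old[OF T that(2)] ov[OF that(1)] on_curve[OF that(1)] that(2) by simp
    show ?thesis
    proof (intro conjI)
      show "\<exists>u. holo_fun_on A' ((U - {p}) \<inter> ?Un) u \<and> (\<forall>q\<in>(U - {p}) \<inter> ?Un. g q = u q * ?gn q) \<and>
          (\<forall>\<zeta>. \<gamma>' \<zeta> \<in> (U - {p}) \<inter> ?Un \<longrightarrow> s \<zeta> = u (\<gamma>' \<zeta>) * ?sn \<zeta>)"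
      proof (intro exI[of _ "\<lambda>q. u q * d q"] conjI ballI allI impI)
        show "holo_fun_on A' ((U - {p}) \<inter> ?Un) (\<lambda>q. u q * d q)" by (rule holo_fun_on_intros(2)[OF hu(1) hd(1)])
        show "g q = u q * d q * ?gn q" if "q \<in> (U - {p}) \<inter> ?Un" for q
          using u(2) ov[of q] that by auto
        show "s \<zeta> = u (\<gamma>' \<zeta>) * d (\<gamma>' \<zeta>) * ?sn \<zeta>" if "\<gamma>' \<zeta> \<in> (U - {p}) \<inter> ?Un" for \<zeta>
        proof -
          have *: "\<gamma>' \<zeta> \<in> ?Un" "\<gamma>' \<zeta> \<in> U - {p}" using that by auto
          have e: "\<gamma> \<zeta> = \<gamma>' \<zeta>" "d (\<gamma>' \<zeta>) \<noteq> 0" and sn: "?sn \<zeta> = s0 \<zeta> / d (\<gamma>' \<zeta>)"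
            and i: "\<gamma> \<zeta> \<in> U" "\<gamma> \<zeta> \<in> \<psi> ` V" using cv[OF *] by blast+
          have "s \<zeta> = u (\<gamma> \<zeta>) * s0 \<zeta>" using u(3) i by simp
          then show ?thesis unfolding sn using e by simp
        qed
      qed
      show "\<exists>u. holo_fun_on A' (?Un \<inter> (U - {p})) u \<and> (\<forall>q\<in>?Un \<inter> (U - {p}). ?gn q = u q * g q) \<and>
          (\<forall>\<zeta>. \<gamma>' \<zeta> \<in> ?Un \<inter> (U - {p}) \<longrightarrow> ?sn \<zeta> = u (\<gamma>' \<zeta>) * s \<zeta>)"
      proof (intro exI[of _ "\<lambda>q. u' q / d q"] conjI ballI allI impI)
        show "holo_fun_on A' (?Un \<inter> (U - {p})) (\<lambda>q. u' q / d q)"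
          by (rule holo_fun_on_intros(3)[OF hu(2) hd(2)]) (use ov in auto)
        show "?gn q = u' q / d q * g q" if "q \<in> ?Un \<inter> (U - {p})" for q
        proof -
          have *: "q \<in> ?Un" "q \<in> U" using that by auto
          from ov[OF *] have "?gn q = g0 q / d q" by simp
          also have "g0 q = u' q * g q" using u'(2) ov[OF *] * by blast
          finally show ?thesis by simp
        qed
        show "?sn \<zeta> = u' (\<gamma>' \<zeta>) / d (\<gamma>' \<zeta>) * s \<zeta>" if "\<gamma>' \<zeta> \<in> ?Un \<inter> (U - {p})" for \<zeta>
        proof -
          have *: "\<gamma>' \<zeta> \<in> ?Un" "\<gamma>' \<zeta> \<in> U - {p}" using that by auto
          have e: "\<gamma> \<zeta> = \<gamma>' \<zeta>" "d (\<gamma>' \<zeta>) \<noteq> 0" and sn: "?sn \<zeta> = s0 \<zeta> / d (\<gamma>' \<zeta>)"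
            and i: "\<gamma> \<zeta> \<in> U" "\<gamma> \<zeta> \<in> \<psi> ` V" using cv[OF *] by blast+
          have "s0 \<zeta> = u' (\<gamma> \<zeta>) * s \<zeta>" using u'(3) i by simp
          then show ?thesis unfolding sn using e by simp
        qed
      qed
    qed
  qed
  show ?thesis
    unfolding intersection_data_def
  proof (intro conjI allI impI)
    show "local_equation A' (range \<gamma>') U g" if "(U, g, s) \<in> insert (?Un, ?gn, ?sn) ?\<T>" for U g s
      using that le_new le_old by auto
    show "\<exists>U g s. (U, g, s) \<in> insert (?Un, ?gn, ?sn) ?\<T> \<and> \<gamma>' \<zeta> \<in> U" for \<zeta>
    proof (cases "\<gamma> \<zeta> = p")
      case True
      then have "\<gamma>' \<zeta> = \<psi>a 0" by (simp add: strict_def \<psi>a_def)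
      then have "\<gamma>' \<zeta> \<in> ?Un" using zero_in_new by simp
      then show ?thesis by blast
    next
      case False
      from I(2)[of \<zeta>] obtain U g s where U: "(U, g, s) \<in> \<T>" "\<gamma> \<zeta> \<in> U" by blast
      then have "\<gamma>' \<zeta> \<in> U - {p}" using False by (simp add: strict_def)
      with img[OF U(1)] show ?thesis by blast
    qed
    show "section_at s \<sigma> z (?ord (\<sigma> z))"
      if T: "(U, g, s) \<in> insert (?Un, ?gn, ?sn) ?\<T>" and \<sigma>: "\<sigma> \<in> {Some, P1_inf}" "\<gamma>' (\<sigma> z) \<in> U" for U g s \<sigma> z
      using T
    proof (elim insertE)
      assume "(U, g, s) = (?Un, ?gn, ?sn)"
      then show ?thesis using sec_new \<sigma> by simp
    next
      assume "(U, g, s) \<in> ?\<T>"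
      then obtain U' where U: "(U', g, s) \<in> \<T>" "U = U' - {p}" by auto
      from \<gamma>'_old[OF U(1)] \<sigma>(2) U(2) have "\<gamma> (\<sigma> z) \<in> U'" "\<gamma> (\<sigma> z) \<noteq> p" by auto
      with I(3)[OF U(1) \<sigma>(1)] show ?thesis by simp
    qed
    have "{\<zeta>. \<gamma> \<zeta> = p} = \<gamma> -` {p}" by auto
    then have "finite {\<zeta>. \<gamma> \<zeta> = p}" using inj_\<gamma> by (simp add: finite_vimageI)
    then show "finite {\<zeta>. ?ord \<zeta> \<noteq> 0}"
      by (rule finite_subset[rotated, OF finite_UnI[OF I(5)]]) auto
    fix U g s U' g' s'
    assume T: "(U, g, s) \<in> insert (?Un, ?gn, ?sn) ?\<T>" "(U', g', s') \<in> insert (?Un, ?gn, ?sn) ?\<T>"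
    show "\<exists>u. holo_fun_on A' (U \<inter> U') u \<and> (\<forall>p\<in>U \<inter> U'. g p = u p * g' p) \<and>
          (\<forall>\<zeta>. \<gamma>' \<zeta> \<in> U \<inter> U' \<longrightarrow> s \<zeta> = u (\<gamma>' \<zeta>) * s' \<zeta>)"
    proof (cases "(U, g, s) = (?Un, ?gn, ?sn)")
      case new: True
      show ?thesis
      proof (cases "(U', g', s') = (?Un, ?gn, ?sn)")
        case True
        with new show ?thesis by (intro exI[of _ "\<lambda>_. 1"]) (auto intro: holo_fun_on_intros(1))
      next
        case False
        with T(2) obtain U2 where "(U2, g', s') \<in> \<T>" "U' = U2 - {p}" by auto
        with tr new show ?thesis by simp
      qed
    next
      case False
      with T(1) obtain U1 where U1: "(U1, g, s) \<in> \<T>" "U = U1 - {p}" by auto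
      show ?thesis
      proof (cases "(U', g', s') = (?Un, ?gn, ?sn)")
        case True
        with tr U1 show ?thesis by simp
      next
        case False
        with T(2) obtain U2 where U2: "(U2, g', s') \<in> \<T>" "U' = U2 - {p}" by auto
        from I(4)[OF U1(1) U2(1)] obtain u where u: "holo_fun_on A (U1 \<inter> U2) u" "\<forall>p\<in>U1 \<inter> U2. g p = u p * g' p"
           "\<forall>\<zeta>. \<gamma> \<zeta> \<in> U1 \<inter> U2 \<longrightarrow> s \<zeta> = u (\<gamma> \<zeta>) * s' \<zeta>" by blast
        have e: "U \<inter> U' = U1 \<inter> U2 - {p}" using U1 U2 by auto
        have "s \<zeta> = u (\<gamma>' \<zeta>) * s' \<zeta>" if "\<gamma>' \<zeta> \<in> U \<inter> U'" for \<zeta>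
          using \<gamma>'_old[OF U1(1), of \<zeta>] \<gamma>'_old[OF U2(1), of \<zeta>] that U1 U2 u(3) by auto
        with holo_fun_away[OF openin_Int[OF op[OF U1(1)] op[OF U2(1)]] u(1)] u(2) e
        show ?thesis by (intro exI[of _ u]) auto
      qed
    qed
  qed
qed

end

section \<open>The exceptional curve and its position relative to the other curves\<close>

context blowup
begin

lemma exceptional_a: "w \<in> Va \<Longrightarrow> \<psi>a w \<in> range (Near p) \<longleftrightarrow> w $ 1 = 0"
  using new_nonexc(1)[of w] not_Near_old by (cases "w $ 1 = 0") (auto simp: \<psi>a_def)

lemma exceptional_b: "w \<in> Vb \<Longrightarrow> \<psi>b w \<in> range (Near p) \<longleftrightarrow> w $ 2 = 0"
  using new_nonexc(2)[of w] not_Near_old by (cases "w $ 2 = 0") (auto simp: \<psi>b_def)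

lemma closed_exceptional: "closed_curve A' (Near p)"
proof -
  have "open {v \<in> W. \<eta> v \<notin> range (Near p)}" if W: "(W, \<eta>) \<in> A'" for W \<eta>
    using W
  proof (cases rule: chart_cases)
    case (old U)
    have "\<eta> v \<notin> range (Near p)" if "v \<in> W" for v
      using not_Near_old[of "\<eta> v"] that old by (auto simp: points_iff)
    then have "{v \<in> W. \<eta> v \<notin> range (Near p)} = W" by auto
    then show ?thesis using compat_open[OF compat_blow_up W] by simp
  next
    case a
    then have "{v \<in> W. \<eta> v \<notin> range (Near p)} = Va \<inter> {w. w $ 1 \<noteq> 0}" using exceptional_a by auto
    moreover have "open (Va \<inter> {w. w $ 1 \<noteq> 0})" by (intro open_Int open_new open_Collect_neq continuous_intros)
    ultimately show ?thesis by simp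
  next
    case b
    then have "{v \<in> W. \<eta> v \<notin> range (Near p)} = Vb \<inter> {w. w $ 2 \<noteq> 0}" using exceptional_b by auto
    moreover have "open (Vb \<inter> {w. w $ 2 \<noteq> 0})" by (intro open_Int open_new open_Collect_neq continuous_intros)
    ultimately show ?thesis by simp
  qed
  then show ?thesis unfolding closed_curve_def by auto
qed

lemma exceptional_lift:
  "clift_at Va \<psi>a (\<lambda>x. Near p (Some x)) t" "clift_at Vb \<psi>b (\<lambda>x. Near p (P1_inf x)) t"
proof -
  show "clift_at Va \<psi>a (\<lambda>x. Near p (Some x)) t"
    by (rule clift_atI[OF open_UNIV, where f = "\<lambda>m. vector [0, m]" and i = 2])
      (use zero_in_new exceptional_param in \<open>auto simp: vholomorphic_on_def forall_2\<close>)
  show "clift_at Vb \<psi>b (\<lambda>x. Near p (P1_inf x)) t"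
    by (rule clift_atI[OF open_UNIV, where f = "\<lambda>m. vector [m, 0]" and i = 1])
      (use zero_in_new exceptional_param in \<open>auto simp: vholomorphic_on_def forall_2\<close>)
qed

lemma P1_embedding_exceptional: "P1_embedding A' (Near p)"
proof (rule P1_embeddingI[OF compat_blow_up])
  show "inj (Near p)" by (simp add: inj_def)
  fix \<sigma> :: "complex \<Rightarrow> complex option" and t assume "\<sigma> \<in> {Some, P1_inf}"
  then show "\<exists>(V, \<psi>)\<in>A'. clift_at V \<psi> (\<lambda>x. Near p (\<sigma> x)) t"
    using exceptional_lift new_charts_in by blast
qed

text \<open>The two equations of the exceptional curve differ by the slope: the equation in the
  second chart is the slope times that in the first. The section \<open>1\<close> over the first
  chart is hence the slope over the second, with a simple pole at infinity and neither zeros nor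
  other poles in its domain: the normal bundle has degree \<open>- 1\<close>.\<close>

lemma intersection_data_exceptional:
  "intersection_data A' (Near p) (range (Near p))
    {(\<psi>a ` Va, \<lambda>q. inv_into Va \<psi>a q $ 1, \<lambda>_. 1),
     (\<psi>b ` Vb, \<lambda>q. inv_into Vb \<psi>b q $ 2, \<lambda>\<zeta>. case \<zeta> of None \<Rightarrow> 0 | Some z \<Rightarrow> z)}
    (\<lambda>\<zeta>. if \<zeta> = None then - 1 else 0)"
    (is "intersection_data _ _ _ {(?Ua, ?ga, ?sa), (?Ub, ?gb, ?sb)} ?ord")
proof -
  have lea: "local_equation A' (range (Near p)) ?Ua ?ga"
    using local_equation_chart[OF compat_blow_up new_charts_in(1), of 1 0 "range (Near p)"] exceptional_a by simp
  have leb: "local_equation A' (range (Near p)) ?Ub ?gb"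
    using local_equation_chart[OF compat_blow_up new_charts_in(2), of 2 0 "range (Near p)"] exceptional_b by simp
  have ina: "Near p l \<in> ?Ua \<longleftrightarrow> l \<noteq> None" for l
  proof
    assume "Near p l \<in> ?Ua"
    then obtain w where w: "w \<in> Va" "Near p l = \<psi>a w" by blast
    then have "w $ 1 = 0" using exceptional_a[of w] by (metis rangeI)
    with w show "l \<noteq> None" by (simp add: \<psi>a_def)
  next
    assume "l \<noteq> None"
    then obtain m where "l = Some m" by blast
    then show "Near p l \<in> ?Ua" using exceptional_param(1)[of m, symmetric] zero_in_new(3)[of m] by simp
  qed
  have inb: "Near p l \<in> ?Ub \<longleftrightarrow> l \<noteq> Some 0" for l
  proof
    assume "Near p l \<in> ?Ub"
    then obtain w where w: "w \<in> Vb" "Near p l = \<psi>b w" by blast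
    then have "w $ 2 = 0" using exceptional_b[of w] by (metis rangeI)
    with w show "l \<noteq> Some 0" by (auto simp: \<psi>b_def P1_inf_def)
  next
    assume l: "l \<noteq> Some 0"
    have "\<exists>m. l = P1_inf m"
    proof (cases l)
      case None
      then show ?thesis by (intro exI[of _ 0]) (simp add: P1_inf_def)
    next
      case (Some z)
      with l show ?thesis by (intro exI[of _ "1 / z"]) (simp add: P1_inf_def)
    qed
    then obtain m where "l = P1_inf m" by blast
    then show "Near p l \<in> ?Ub" using exceptional_param(2)[of m, symmetric] zero_in_new(4)[of m] by simp
  qed
  define u where "u q = inv_into Va \<psi>a q $ 2" for q
  have hu: "holo_fun_on A' ?Ua u"
    unfolding u_def by (rule holo_fun_on_chart[OF compat_blow_up new_charts_in(1) _ _ open_new(1)]) (auto intro: holo_intros)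
  have ov: "u q \<noteq> 0 \<and> ?gb q = u q * ?ga q" if "q \<in> ?Ua" "q \<in> ?Ub" for q
  proof -
    from that(1) obtain w where w: "w \<in> Va" "q = \<psi>a w" by blast
    with that(2) new_overlap_ab[OF w(1)] have w2: "w $ 2 \<noteq> 0" by simp
    have "inv_into Va \<psi>a q = w" using w inj_new by simp
    moreover have "inv_into Vb \<psi>b q = vector [1 / w $ 2, w $ 1 * w $ 2]"
      using \<psi>b_flip[OF w(1) w2] w(2) inj_new(2) by (metis inv_into_f_f)
    ultimately show ?thesis using w2 by (simp add: u_def)
  qed
  have uc: "u (Near p (Some m)) = m" for m
    using exceptional_param(1)[of m] zero_in_new(3)[of m] inj_new(1) unfolding u_def
    by (metis inv_into_f_f vector_2(2))
  show ?thesis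
    unfolding intersection_data_def
  proof (intro conjI allI impI)
    show "local_equation A' (range (Near p)) U g" if "(U, g, s) \<in> {(?Ua, ?ga, ?sa), (?Ub, ?gb, ?sb)}" for U g s
      using that lea leb by auto
    show "\<exists>U g s. (U, g, s) \<in> {(?Ua, ?ga, ?sa), (?Ub, ?gb, ?sb)} \<and> Near p \<zeta> \<in> U" for \<zeta>
      using ina[of \<zeta>] inb[of \<zeta>] by (cases "\<zeta> = None") (metis insertI1 insertI2 option.distinct(1))+
    show "finite {\<zeta>. ?ord \<zeta> \<noteq> 0}" by simp
    show "section_at s \<sigma> z (?ord (\<sigma> z))"
      if T: "(U, g, s) \<in> {(?Ua, ?ga, ?sa), (?Ub, ?gb, ?sb)}" and \<sigma>: "\<sigma> \<in> {Some, P1_inf}" "Near p (\<sigma> z) \<in> U" for U g s \<sigma> z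
      using T
    proof (elim insertE emptyE)
      assume "(U, g, s) = (?Ua, ?ga, ?sa)"
      moreover from this have "\<sigma> z \<noteq> None" using \<sigma> ina[of "\<sigma> z"] by blast
      ultimately show ?thesis using section_at_holomorphic[of UNIV z "\<lambda>_. 1" \<sigma>] by auto
    next
      assume e: "(U, g, s) = (?Ub, ?gb, ?sb)"
      then have nz: "\<sigma> z \<noteq> Some 0" using \<sigma> inb by simp
      from \<sigma>(1) consider "\<sigma> = Some" | "\<sigma> = P1_inf" by blast
      then show ?thesis
      proof cases
        case 1
        then show ?thesis using section_at_holomorphic[of UNIV z ?sb \<sigma>] nz e by simp
      next
        case 2
        have s: "?sb (P1_inf w) = 1 / w" for w by (simp add: P1_inf_def)
        show ?thesis
        proof (cases "z = 0")
          case True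
          \<comment> \<open>The pole is obtained as the constant section divided by one with a
            simple zero. The default value \<open>1 / 0 = 0\<close> agrees with the value
            \<open>0\<close> of the section at \<open>None\<close>.\<close>
          have "section_at (\<lambda>\<zeta>. 1 / (case \<zeta> of None \<Rightarrow> 0 | Some z \<Rightarrow> 1 / z)) P1_inf 0 (0 - 1)"
          proof (rule section_at_divide)
            show "section_at (\<lambda>_. 1) P1_inf 0 0" using section_at_holomorphic[of UNIV 0 "\<lambda>_. 1" P1_inf] by simp
            have "(\<lambda>w. case P1_inf w of None \<Rightarrow> 0 | Some z \<Rightarrow> 1 / z) = (\<lambda>w. w)"
              by (auto simp: P1_inf_def)
            then show "section_at (\<lambda>\<zeta>. case \<zeta> of None \<Rightarrow> 0 | Some z \<Rightarrow> 1 / z) P1_inf 0 1"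
              by (intro section_at_simple_zero[of UNIV]) (auto simp: P1_inf_def)
          qed
          moreover have "(\<lambda>\<zeta>. 1 / (case \<zeta> of None \<Rightarrow> 0 | Some z \<Rightarrow> 1 / z)) = ?sb" by (auto split: option.split)
          ultimately show ?thesis using 2 True e by (simp add: P1_inf_def)
        next
          case False
          have "(\<lambda>w. ?sb (\<sigma> w)) holomorphic_on (- {0})" unfolding 2 s by (intro holomorphic_intros) auto
          then have "section_at ?sb \<sigma> z 0"
            by (intro section_at_holomorphic[of "- {0}"]) (use False 2 s[of z] in auto)
          then show ?thesis using False 2 e by (simp add: P1_inf_def)
        qed
      qed
    qed
    fix U g s U' g' s'
    assume T: "(U, g, s) \<in> {(?Ua, ?ga, ?sa), (?Ub, ?gb, ?sb)}" "(U', g', s') \<in> {(?Ua, ?ga, ?sa), (?Ub, ?gb, ?sb)}"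
    consider (same) "(U, g, s) = (U', g', s')" | (ab) "(U, g, s) = (?Ua, ?ga, ?sa)" "(U', g', s') = (?Ub, ?gb, ?sb)"
      | (ba) "(U, g, s) = (?Ub, ?gb, ?sb)" "(U', g', s') = (?Ua, ?ga, ?sa)" using T by blast
    then show "\<exists>u. holo_fun_on A' (U \<inter> U') u \<and> (\<forall>p\<in>U \<inter> U'. g p = u p * g' p) \<and>
          (\<forall>\<zeta>. Near p \<zeta> \<in> U \<inter> U' \<longrightarrow> s \<zeta> = u (Near p \<zeta>) * s' \<zeta>)"
    proof cases
      case same
      then show ?thesis by (intro exI[of _ "\<lambda>_. 1"]) (simp add: holo_fun_on_intros(1))
    next
      case ba
      have "?sb \<zeta> = u (Near p \<zeta>) * 1" if "Near p \<zeta> \<in> ?Ub \<inter> ?Ua" for \<zeta>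
        using that ina[of \<zeta>] uc by (cases \<zeta>) (simp_all only: Int_iff option.case mult_1_right simp_thms)
      moreover have "holo_fun_on A' (?Ub \<inter> ?Ua) u" by (rule holo_fun_on_subset[OF hu]) simp
      ultimately show ?thesis using ba
        by (intro exI[of _ u]) (use ov in simp)
    next
      case ab
      have "holo_fun_on A' (?Ua \<inter> ?Ub) (\<lambda>q. 1 / u q)"
        by (rule holo_fun_on_intros(3)[OF holo_fun_on_intros(1) holo_fun_on_subset[OF hu]]) (use ov in auto)
      moreover have "1 = 1 / u (Near p \<zeta>) * ?sb \<zeta>" if "Near p \<zeta> \<in> ?Ua" "Near p \<zeta> \<in> ?Ub" for \<zeta>
      proof -
        from that ina[of \<zeta>] obtain m where m: "\<zeta> = Some m" by blast
        have "m \<noteq> 0" using that(2) inb[of \<zeta>] m by blast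
        then show ?thesis by (simp add: m uc)
      qed
      ultimately show ?thesis using ab
        by (intro exI[of _ "\<lambda>q. 1 / u q"]) (use ov in simp)
    qed
  qed
qed

text \<open>The centre is not the crossing point, so the chart at the crossing survives without the
  centre. If one of the curves passes through the centre, it gains an exceptional point which the
  other curve does not have.\<close>

lemma crossing_away:
  assumes "crossing A \<gamma> \<delta>" "\<not> (p \<in> range \<gamma> \<and> p \<in> range \<delta>)" "range \<gamma> \<subseteq> points A" "range \<delta> \<subseteq> points A"
  shows "crossing A' (strict p \<gamma>) (strict p \<delta>)"
proof -
  from assms(1) obtain W \<eta> v i j where *: "(W, \<eta>) \<in> A" "v \<in> W" "i \<noteq> j" "range \<gamma> \<inter> range \<delta> = {\<eta> v}"
     "\<forall>x\<in>W. \<eta> x \<in> range \<gamma> \<longleftrightarrow> x $ i = v $ i" "\<forall>x\<in>W. \<eta> x \<in> range \<delta> \<longleftrightarrow> x $ j = v $ j"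
    unfolding crossing_def by blast
  have both: "q \<in> range \<gamma> \<and> q \<in> range \<delta> \<longleftrightarrow> q = \<eta> v" for q
    using arg_cong[OF *(4), of "\<lambda>S. q \<in> S"] by simp
  have vp: "\<eta> v \<noteq> p" using both assms(2) by metis
  have e: "q \<in> range (strict p \<epsilon>) \<longleftrightarrow> q \<in> range \<epsilon> - {p} \<or> (p \<in> range \<epsilon> \<and> q = Near p (Some 0))"
    if "range \<epsilon> \<subseteq> points A" for q \<epsilon>
  proof -
    have "q \<in> range (strict p \<epsilon>) \<longleftrightarrow> (\<exists>x. (\<epsilon> x = p \<and> q = Near p (Some 0)) \<or> (\<epsilon> x \<noteq> p \<and> q = \<epsilon> x))"
      unfolding strict_def image_iff by auto
    also have "\<dots> \<longleftrightarrow> q \<in> range \<epsilon> - {p} \<or> (p \<in> range \<epsilon> \<and> q = Near p (Some 0))"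
      unfolding image_iff Diff_iff singleton_iff bex_UNIV by metis
    finally show ?thesis .
  qed
  have N: "Near p (Some 0) \<notin> range \<gamma>" "Near p (Some 0) \<notin> range \<delta>" using assms(3,4) fresh[of "Some 0"] by blast+
  have r: "range (strict p \<gamma>) \<inter> range (strict p \<delta>) = {\<eta> v}"
  proof (rule set_eqI)
    fix q
    show "q \<in> range (strict p \<gamma>) \<inter> range (strict p \<delta>) \<longleftrightarrow> q \<in> {\<eta> v}"
      unfolding Int_iff e[OF assms(3)] e[OF assms(4)] singleton_iff Diff_iff
      using both[of q] vp assms(2) N by metis
  qed
  have W: "\<eta> x \<in> range (strict p \<epsilon>) \<longleftrightarrow> \<eta> x \<in> range \<epsilon>" if "x \<in> W" "\<eta> x \<in> - {p}" for x \<epsilon>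
    by (rule strict_range_old) (use that * in \<open>auto simp: points_iff\<close>)
  show ?thesis
    unfolding crossing_def
    by (rule exI[of _ "{v \<in> W. \<eta> v \<in> - {p}}"], rule exI[of _ \<eta>], rule exI[of _ v], rule exI[of _ i], rule exI[of _ j])
      (use *(2,3,5,6) vp r W old_chart[OF *(1)] in \<open>simp del: Compl_iff\<close>, use vp in simp)
qed

lemma disjoint_away:
  assumes "range \<gamma> \<inter> range \<delta> = {}" "range \<gamma> \<subseteq> points A" "range \<delta> \<subseteq> points A"
  shows "range (strict p \<gamma>) \<inter> range (strict p \<delta>) = {}"
proof -
  have "strict p \<gamma> x \<noteq> strict p \<delta> y" for x y
  proof -
    have "\<gamma> x \<noteq> \<delta> y" "\<gamma> x \<noteq> Near p (Some 0)" "\<delta> y \<noteq> Near p (Some 0)"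
      using assms not_Near_old by blast+
    then show ?thesis by (auto simp: strict_def)
  qed
  then show ?thesis by blast
qed

end

text \<open>In the first new chart the two curves are the coordinate axes and meet at the origin; in
  the second one the strict transform is absent.\<close>

lemma (in strict_transform) crossing_exceptional: "crossing A' \<gamma>' (Near p)"
  unfolding crossing_def
proof (rule exI[of _ Va], rule exI[of _ \<psi>a], rule exI[of _ 0], rule exI[of _ 2], rule exI[of _ 1], intro conjI)
  show "(Va, \<psi>a) \<in> A'" "0 \<in> Va" "(2::2) \<noteq> 1" using new_charts_in zero_in_new by auto
  have "\<psi>a 0 = Near p (Some 0)" by (simp add: \<psi>a_def)
  moreover have "range \<gamma>' \<inter> range (Near p) = {Near p (Some 0)}"
  proof (intro equalityI subsetI)
    fix q assume q: "q \<in> range \<gamma>' \<inter> range (Near p)"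
    then obtain l where "q = Near p l" by (elim IntE rangeE)
    with q strict_Near[of l] show "q \<in> {Near p (Some 0)}" by simp
  qed (use strict_Near[of "Some 0"] in simp)
  ultimately show "range \<gamma>' \<inter> range (Near p) = {\<psi>a 0}" by simp
  show "\<forall>x\<in>Va. \<psi>a x \<in> range \<gamma>' \<longleftrightarrow> x $ 2 = 0 $ 2" using strict_a by simp
  show "\<forall>x\<in>Va. \<psi>a x \<in> range (Near p) \<longleftrightarrow> x $ 1 = 0 $ 1" using exceptional_a by simp
qed

section \<open>Configurations of curves\<close>

text \<open>\<open>n\<close> is the self-intersection number. \<open>T\<close> collects charts in
  which the stored local equation is the second coordinate itself, not just some equation of the
  same line. Only there does \<open>intersection_data_strict\<close> apply, so these are the charts
  in which a further centre may be chosen.\<close>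

definition curve ::
  "(2, ipoint) atlas \<Rightarrow> (complex option \<Rightarrow> ipoint) \<Rightarrow> int \<Rightarrow> (2, ipoint) atlas \<Rightarrow> bool" where
  "curve A \<gamma> n T \<longleftrightarrow> P1_embedding A \<gamma> \<and> closed_curve A \<gamma> \<and> T \<subseteq> A \<and>
     (\<exists>\<T> ord. intersection_data A \<gamma> (range \<gamma>) \<T> ord \<and> n = (\<Sum>\<zeta> | ord \<zeta> \<noteq> 0. ord \<zeta>) \<and>
       (\<forall>V \<psi>. (V, \<psi>) \<in> T \<longrightarrow> (\<exists>g s. (\<psi> ` V, g, s) \<in> \<T> \<and> (\<forall>v\<in>V. g (\<psi> v) = v $ 2))))"

lemma curve_points: "curve A \<gamma> n T \<Longrightarrow> range \<gamma> \<subseteq> points A"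
  unfolding curve_def using P1_embedding_points by blast

lemma curve_adapted:
  assumes "curve A \<gamma> n T" "(V, \<psi>) \<in> T"
  shows "adapted V \<psi> (range \<gamma>)"
proof -
  from assms obtain \<T> ord g s where I: "intersection_data A \<gamma> (range \<gamma>) \<T> ord" "(\<psi> ` V, g, s) \<in> \<T>"
    "\<forall>v\<in>V. g (\<psi> v) = v $ 2" unfolding curve_def by blast
  from intersection_dataD(1)[OF I(1,2)] have "\<forall>p\<in>\<psi> ` V. g p = 0 \<longleftrightarrow> p \<in> range \<gamma>"
    unfolding local_equation_def by blast
  with I(3) show ?thesis unfolding adapted_def by simp
qed

text \<open>The support may gain or lose the point \<open>\<zeta>0\<close>, so both sums are
  compared over the old support enlarged by it.\<close>

lemma sum_order_decrement:
  fixes ord :: "'a \<Rightarrow> int"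
  assumes "finite {\<zeta>. ord \<zeta> \<noteq> 0}"
  shows "(\<Sum>\<zeta> | ord \<zeta> - (if \<zeta> = \<zeta>0 then 1 else 0) \<noteq> 0. ord \<zeta> - (if \<zeta> = \<zeta>0 then 1 else 0)) =
    (\<Sum>\<zeta> | ord \<zeta> \<noteq> 0. ord \<zeta>) - 1"
proof -
  let ?F = "insert \<zeta>0 {\<zeta>. ord \<zeta> \<noteq> 0}"
  have "(\<Sum>\<zeta> | ord \<zeta> - (if \<zeta> = \<zeta>0 then 1 else 0) \<noteq> 0. ord \<zeta> - (if \<zeta> = \<zeta>0 then 1 else 0)) =
    (\<Sum>\<zeta>\<in>?F. ord \<zeta> - (if \<zeta> = \<zeta>0 then 1 else 0))"
    by (rule sum.mono_neutral_left) (use assms in \<open>auto split: if_splits\<close>)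
  also have "\<dots> = (\<Sum>\<zeta>\<in>?F. ord \<zeta>) - (\<Sum>\<zeta>\<in>?F. if \<zeta> = \<zeta>0 then 1 else 0)"
    by (rule sum_subtractf)
  also have "(\<Sum>\<zeta>\<in>?F. if \<zeta> = \<zeta>0 then 1 else 0) = (1 :: int)"
    using assms by (simp add: sum.delta)
  also have "(\<Sum>\<zeta>\<in>?F. ord \<zeta>) = (\<Sum>\<zeta> | ord \<zeta> \<noteq> 0. ord \<zeta>)"
    by (rule sum.mono_neutral_right) (use assms in auto)
  finally show ?thesis .
qed

context blowup
begin

lemma restrict_T:
  assumes "\<And>V \<psi>. (V, \<psi>) \<in> T \<Longrightarrow> \<exists>g s. (\<psi> ` V, g, s) \<in> \<T> \<and> (\<forall>v\<in>V. g (\<psi> v) = v $ (2::2))"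
    and "(W, \<eta>) \<in> restrict_atlas T (- {q})"
  shows "\<exists>g s. (\<eta> ` W, g, s) \<in> (\<lambda>(U, g, s). (U - {q}, g, s)) ` \<T> \<and> (\<forall>v\<in>W. g (\<eta> v) = v $ 2)"
proof -
  from assms(2) obtain U where U: "(U, \<eta>) \<in> T" "W = {v \<in> U. \<eta> v \<in> - {q}}" unfolding restrict_atlas_iff by blast
  from assms(1)[OF U(1)] obtain g s where g: "(\<eta> ` U, g, s) \<in> \<T>" "\<forall>v\<in>U. g (\<eta> v) = v $ 2" by blast
  have "\<eta> ` W = \<eta> ` U - {q}" using U(2) by auto
  then have "(\<eta> ` W, g, s) \<in> (\<lambda>(U, g, s). (U - {q}, g, s)) ` \<T>" using g(1) by force
  with g(2) U(2) show ?thesis by (intro exI[of _ g] exI[of _ s]) auto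
qed

lemma restrict_atlas_subset: "T \<subseteq> A \<Longrightarrow> restrict_atlas T (- {p}) \<subseteq> A'"
  unfolding blow_up_eq restrict_atlas_def by blast

lemma curve_away:
  assumes "curve A \<gamma> n T" "p \<notin> range \<gamma>"
  shows "curve A' (strict p \<gamma>) n (restrict_atlas T (- {p}))"
proof -
  from assms(1) obtain \<T> ord where c: "P1_embedding A \<gamma>" "closed_curve A \<gamma>" "T \<subseteq> A"
    "intersection_data A \<gamma> (range \<gamma>) \<T> ord" "n = (\<Sum>\<zeta> | ord \<zeta> \<noteq> 0. ord \<zeta>)"
    "\<And>V \<psi>. (V, \<psi>) \<in> T \<Longrightarrow> \<exists>g s. (\<psi> ` V, g, s) \<in> \<T> \<and> (\<forall>v\<in>V. g (\<psi> v) = v $ 2)"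
    unfolding curve_def by blast
  show ?thesis
    unfolding curve_def strict_away[OF assms(2)]
    using P1_embedding_away[OF c(1) assms(2)] closed_away[OF c(2) assms(2) curve_points[OF assms(1)]]
      restrict_atlas_subset[OF c(3)] intersection_data_away[OF c(4) assms(2) assms(2)] c(5) restrict_T[OF c(6)]
    by blast
qed

text \<open>The second chart is recorded, because there the exceptional curve is the line
  \<open>w $ 2 = 0\<close>, the form required for a next blow-up. It covers the whole curve except
  the direction \<open>Some 0\<close>.\<close>

lemma curve_exceptional: "curve A' (Near p) (- 1) {(Vb, \<psi>b)}"
proof -
  have "{\<zeta>. (if \<zeta> = None then - 1 else 0) \<noteq> (0::int)} = {None}" for \<zeta> :: "complex option" by auto
  then have s: "(- 1 :: int) = (\<Sum>\<zeta>::complex option | (if \<zeta> = None then - 1 else 0) \<noteq> (0::int). (if \<zeta> = None then - 1 else 0))"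
    by simp
  have "inv_into Vb \<psi>b (\<psi>b v) $ 2 = v $ 2" if "v \<in> Vb" for v using that inj_new by simp
  with P1_embedding_exceptional closed_exceptional new_charts_in(2) intersection_data_exceptional s
  show ?thesis unfolding curve_def by (intro conjI exI) (assumption | auto)+
qed

end

lemma (in strict_transform) curve_strict:
  assumes "curve A \<gamma> n T" "(V, \<psi>) \<in> T"
  shows "curve A' \<gamma>' (n - 1) (restrict_atlas T (- {p}))"
proof -
  from assms(1) obtain \<T> ord where c: "P1_embedding A \<gamma>" "closed_curve A \<gamma>" "T \<subseteq> A"
    "intersection_data A \<gamma> (range \<gamma>) \<T> ord" "n = (\<Sum>\<zeta> | ord \<zeta> \<noteq> 0. ord \<zeta>)"
    "\<And>V \<psi>. (V, \<psi>) \<in> T \<Longrightarrow> \<exists>g s. (\<psi> ` V, g, s) \<in> \<T> \<and> (\<forall>v\<in>V. g (\<psi> v) = v $ 2)"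
    unfolding curve_def by blast
  from c(6)[OF assms(2)] obtain g0 s0 where g0: "(\<psi> ` V, g0, s0) \<in> \<T>" "\<And>v. v \<in> V \<Longrightarrow> g0 (\<psi> v) = v $ 2" by blast
  from p_on_curve obtain \<zeta>0 where z: "\<gamma> \<zeta>0 = p" by (metis imageE)
  then have e: "\<gamma> \<zeta> = p \<longleftrightarrow> \<zeta> = \<zeta>0" for \<zeta> using inj_\<gamma> by (metis injD)
  from intersection_data_strict[OF c(4) g0] have I: "intersection_data A' \<gamma>' (range \<gamma>')
      (insert (\<psi>a ` Va, \<lambda>q. inv_into Va \<psi>a q $ 2, \<lambda>\<zeta>. s0 \<zeta> / (inv_into V \<psi> (\<gamma> \<zeta>) $ 1 - c $ 1))
        ((\<lambda>(U, g, s). (U - {p}, g, s)) ` \<T>))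
      (\<lambda>\<zeta>. ord \<zeta> - (if \<zeta> = \<zeta>0 then 1 else 0))" by (simp only: e)
  have n: "n - 1 = (\<Sum>\<zeta> | ord \<zeta> - (if \<zeta> = \<zeta>0 then 1 else 0) \<noteq> 0. ord \<zeta> - (if \<zeta> = \<zeta>0 then 1 else 0))"
    unfolding sum_order_decrement[OF intersection_dataD(5)[OF c(4)]] c(5) ..
  show ?thesis
    unfolding curve_def
  proof (intro conjI exI)
    show "P1_embedding A' \<gamma>'" "closed_curve A' \<gamma>'" "restrict_atlas T (- {p}) \<subseteq> A'"
      using P1_embedding_strict closed_strict[OF c(2)] restrict_atlas_subset[OF c(3)] by auto
    show "\<forall>W \<eta>. (W, \<eta>) \<in> restrict_atlas T (- {p}) \<longrightarrow> (\<exists>g s. (\<eta> ` W, g, s) \<in>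
        insert (\<psi>a ` Va, \<lambda>q. inv_into Va \<psi>a q $ 2, \<lambda>\<zeta>. s0 \<zeta> / (inv_into V \<psi> (\<gamma> \<zeta>) $ 1 - c $ 1))
        ((\<lambda>(U, g, s). (U - {p}, g, s)) ` \<T>) \<and> (\<forall>v\<in>W. g (\<eta> v) = v $ 2))"
    proof (intro allI impI)
      fix W \<eta> assume "(W, \<eta>) \<in> restrict_atlas T (- {p})"
      from restrict_T[OF c(6) this] obtain g s where "(\<eta> ` W, g, s) \<in> (\<lambda>(U, g, s). (U - {p}, g, s)) ` \<T>"
        "\<forall>v\<in>W. g (\<eta> v) = v $ 2" by blast
      then show "\<exists>g s. (\<eta> ` W, g, s) \<in>
        insert (\<psi>a ` Va, \<lambda>q. inv_into Va \<psi>a q $ 2, \<lambda>\<zeta>. s0 \<zeta> / (inv_into V \<psi> (\<gamma> \<zeta>) $ 1 - c $ 1))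
        ((\<lambda>(U, g, s). (U - {p}, g, s)) ` \<T>) \<and> (\<forall>v\<in>W. g (\<eta> v) = v $ 2)" by blast
    qed
  qed (rule I n)+
qed

definition config ::
  "(2, ipoint) atlas \<Rightarrow> nat set \<Rightarrow> nat set set \<Rightarrow> (nat \<Rightarrow> int) \<Rightarrow> (nat \<Rightarrow> complex option \<Rightarrow> ipoint) \<Rightarrow>
   (nat \<Rightarrow> (2, ipoint) atlas) \<Rightarrow> bool" where
  "config A N E n \<gamma> T \<longleftrightarrow> compat A \<and> unrelated A \<and> \<Union>E \<subseteq> N \<and> (\<forall>i\<in>N. curve A (\<gamma> i) (n i) (T i)) \<and>
     (\<forall>i\<in>N. \<forall>j\<in>N. i \<noteq> j \<longrightarrow>
        (if {i, j} \<in> E then crossing A (\<gamma> i) (\<gamma> j) else range (\<gamma> i) \<inter> range (\<gamma> j) = {}))"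

text \<open>The centre lies on the curve \<open>i\<close> only, so no crossing is blown up and the
  old edges survive. The exceptional curve \<open>k\<close> meets the strict transform of
  \<open>i\<close> and is disjoint from the other curves, which have not moved.\<close>

theorem config_blow_up:
  assumes C: "config A N E n \<gamma> T" and i: "i \<in> N" and ch: "(V, \<psi>) \<in> T i" "c \<in> V" "c $ 2 = 0"
    and off: "\<And>j. j \<in> N \<Longrightarrow> j \<noteq> i \<Longrightarrow> \<psi> c \<notin> range (\<gamma> j)" and k: "k \<notin> N"
  shows "config (blow_up_at A V \<psi> c) (insert k N) (insert {i, k} E) (n(i := n i - 1, k := - 1))
    (\<lambda>j. if j = k then Near (\<psi> c) else strict (\<psi> c) (\<gamma> j))
    (\<lambda>j. if j = k then {(blowup.Vb V c, blowup.\<psi>b \<psi> c)} else restrict_atlas (T j) (- {\<psi> c}))"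
proof -
  from C have cA: "compat A" and un: "unrelated A" and EN: "\<Union>E \<subseteq> N"
    and cu: "\<And>j. j \<in> N \<Longrightarrow> curve A (\<gamma> j) (n j) (T j)"
    and pairs: "\<And>j l. j \<in> N \<Longrightarrow> l \<in> N \<Longrightarrow> j \<noteq> l \<Longrightarrow>
      (if {j, l} \<in> E then crossing A (\<gamma> j) (\<gamma> l) else range (\<gamma> j) \<inter> range (\<gamma> l) = {})"
    using C unfolding config_def by simp_all
  have chA: "(V, \<psi>) \<in> A" using cu[OF i] ch(1) unfolding curve_def by blast
  have pA: "\<psi> c \<in> points A" using chA ch(2) unfolding points_iff by blast
  interpret strict_transform A V \<psi> c "\<gamma> i"
  proof
    show "compat A" "(V, \<psi>) \<in> A" "c \<in> V" "c $ 2 = 0" by fact+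
    show "Near (\<psi> c) l \<notin> points A" for l by (rule unrelated_fresh[OF un pA])
    show "P1_embedding A (\<gamma> i)" using cu[OF i] unfolding curve_def by blast
    show "adapted V \<psi> (range (\<gamma> i))" by (rule curve_adapted[OF cu[OF i] ch(1)])
  qed
  have sub: "range (\<gamma> j) \<subseteq> points A" if "j \<in> N" for j using curve_points[OF cu[OF that]] .
  have ik: "i \<noteq> k" using i k by blast
  have c1: "curve A' (strict p (\<gamma> j)) (if j = i then n i - 1 else n j) (restrict_atlas (T j) (- {p}))" if "j \<in> N" for j
    using curve_strict[OF cu[OF i] ch(1)] curve_away[OF cu[OF that] off[OF that]] by auto
  have pr: "if {j, l} \<in> insert {i, k} E then crossing A' (strict p (\<gamma> j)) (strict p (\<gamma> l))
      else range (strict p (\<gamma> j)) \<inter> range (strict p (\<gamma> l)) = {}" if jl: "j \<in> N" "l \<in> N" "j \<noteq> l" for j l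
  proof -
    have "{j, l} \<noteq> {i, k}" using jl k by (auto simp: doubleton_eq_iff)
    moreover have "\<not> (p \<in> range (\<gamma> j) \<and> p \<in> range (\<gamma> l))" using off jl by metis
    ultimately show ?thesis
      using pairs[OF jl] crossing_away[OF _ _ sub[OF jl(1)] sub[OF jl(2)]] disjoint_away[OF _ sub[OF jl(1)] sub[OF jl(2)]]
      by auto
  qed
  have pk: "if {j, k} \<in> insert {i, k} E then crossing A' (strict p (\<gamma> j)) (Near p)
      else range (strict p (\<gamma> j)) \<inter> range (Near p) = {}" if j: "j \<in> N" for j
  proof (cases "j = i")
    case True
    then show ?thesis using crossing_exceptional by simp
  next
    case False
    have "{j, k} \<notin> E" using EN k by (metis UnionI insertI1 insertI2 subsetD)
    then have "{j, k} \<notin> insert {i, k} E" using False j k by (simp add: doubleton_eq_iff)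
    moreover have "range (strict p (\<gamma> j)) \<inter> range (Near p) = {}"
    proof (intro equals0I)
      fix q assume q: "q \<in> range (strict p (\<gamma> j)) \<inter> range (Near p)"
      then obtain l where "q = Near p l" by (elim IntE rangeE)
      with q sub[OF j] fresh[of l] show False unfolding strict_away[OF off[OF j False]] by simp (metis rangeI subsetD)
    qed
    ultimately show ?thesis by simp
  qed
  show ?thesis
    unfolding config_def
  proof (intro conjI ballI impI)
    show "compat A'" by (rule compat_blow_up)
    show "unrelated A'" by (rule unrelated_blow_up[OF un])
    show "\<Union> (insert {i, k} E) \<subseteq> insert k N" using EN i by auto
    fix j assume j: "j \<in> insert k N"
    show "curve A' (if j = k then Near p else strict p (\<gamma> j)) ((n(i := n i - 1, k := - 1)) j)
      (if j = k then {(Vb, \<psi>b)} else restrict_atlas (T j) (- {p}))"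
    proof (cases "j = k")
      case True
      then show ?thesis using curve_exceptional by simp
    next
      case False
      with j have "j \<in> N" by blast
      from c1[OF this] False show ?thesis by auto
    qed
    fix l assume l: "l \<in> insert k N" and jl: "j \<noteq> l"
    show "if {j, l} \<in> insert {i, k} E
      then crossing A' (if j = k then Near p else strict p (\<gamma> j)) (if l = k then Near p else strict p (\<gamma> l))
      else range (if j = k then Near p else strict p (\<gamma> j)) \<inter> range (if l = k then Near p else strict p (\<gamma> l)) = {}"
    proof (cases "j = k")
      case True
      then have "l \<in> N" "l \<noteq> k" using l jl by auto
      with pk[of l] True show ?thesis by (auto simp: insert_commute Int_commute crossing_sym split: if_splits)
    next
      case jk: False
      then have "j \<in> N" using j by blast
      show ?thesis
      proof (cases "l = k")
        case True
        with pk[OF \<open>j \<in> N\<close>] jk show ?thesis by simp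
      next
        case False
        then have "l \<in> N" using l by blast
        from pr[OF \<open>j \<in> N\<close> this jl] jk False show ?thesis by simp
      qed
    qed
  qed
qed

section \<open>The projective plane and the line at infinity\<close>

lemma proj_point_eq_iff: "proj_point v = proj_point w \<longleftrightarrow> (\<exists>c. c \<noteq> 0 \<and> v = c *s w)"
proof
  assume "proj_point v = proj_point w"
  then have "{c *s v | c. c \<noteq> 0} = {c *s w | c. c \<noteq> 0}" by (simp add: proj_point_def)
  moreover have "v \<in> {c *s v | c. c \<noteq> 0}" by (rule CollectI, rule exI[of _ 1]) simp
  ultimately show "\<exists>c. c \<noteq> 0 \<and> v = c *s w" by blast
next
  assume "\<exists>c. c \<noteq> 0 \<and> v = c *s w"
  then obtain c where c: "c \<noteq> 0" "v = c *s w" by blast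
  have "{d *s v | d. d \<noteq> 0} = {d *s w | d. d \<noteq> 0}"
  proof (intro equalityI subsetI)
    fix x assume "x \<in> {d *s v | d. d \<noteq> 0}"
    then obtain d where "d \<noteq> 0" "x = d *s v" by blast
    with c show "x \<in> {d *s w | d. d \<noteq> 0}" by (intro CollectI exI[of _ "d * c"]) simp
  next
    fix x assume "x \<in> {d *s w | d. d \<noteq> 0}"
    then obtain d where "d \<noteq> 0" "x = d *s w" by blast
    with c show "x \<in> {d *s v | d. d \<noteq> 0}" by (intro CollectI exI[of _ "d / c"]) simp
  qed
  then show "proj_point v = proj_point w" by (simp add: proj_point_def)
qed

text \<open>The letter names the homogeneous coordinate that is set to \<open>1\<close>.
  \<open>chartZ\<close> is the affine plane; in the two other charts the line at infinity is
  \<open>z $ 2 = 0\<close>, as needed for blowing up its points.\<close>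

definition chartZ :: "complex^2 \<Rightarrow> ipoint" where "chartZ z = proj_point (vector [z $ 1, z $ 2, 1])"
definition chartY :: "complex^2 \<Rightarrow> ipoint" where "chartY z = proj_point (vector [z $ 1, 1, z $ 2])"
definition chartX :: "complex^2 \<Rightarrow> ipoint" where "chartX z = proj_point (vector [1, z $ 1, z $ 2])"

lemma projective_plane_eq: "projective_plane = {(UNIV, chartZ), (UNIV, chartY), (UNIV, chartX)}"
  unfolding projective_plane_def chartZ_def[abs_def] chartY_def[abs_def] chartX_def[abs_def] ..

lemma vec3_eq_iff: "(v :: 'a^3) = w \<longleftrightarrow> v $ 1 = w $ 1 \<and> v $ 2 = w $ 2 \<and> v $ 3 = w $ 3"
  by (simp add: vec_eq_iff forall_3)

text \<open>\<open>m\<close> is the homogeneous coordinate that equals \<open>1\<close> in the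
  target chart, \<open>e\<close> and \<open>e'\<close> are the affine embeddings of the two charts
  and \<open>r'\<close> reads off the remaining coordinates. The transition map divides by the
  \<open>m\<close>-th coordinate.\<close>

lemma projective_lift:
  fixes e e' :: "complex^2 \<Rightarrow> complex^3" and r' :: "complex^3 \<Rightarrow> complex^2"
  assumes "\<And>v. v $ m = 1 \<Longrightarrow> e' (r' v) = v" "\<And>w. e' w $ m = 1" "vholo_on UNIV e" "vholo_on UNIV r'"
    and "proj_point (e z) \<in> range (\<lambda>w. proj_point (e' w))"
  shows "lift_at UNIV (\<lambda>w. proj_point (e' w)) (\<lambda>z. proj_point (e z)) z"
proof -
  from assms(5) obtain w c where "c \<noteq> 0" "e z = c *s e' w" by (auto simp: proj_point_eq_iff)
  then have z: "e z $ m \<noteq> 0" using assms(2) by simp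
  have "open {z. e z $ m \<noteq> 0}"
    using vholo_on_imp_continuous_on[OF assms(3)] by (intro open_Collect_neq continuous_intros) auto
  then show ?thesis
  proof (rule lift_atI[where f = "\<lambda>z. r' (inverse (e z $ m) *s e z)"])
    have "vholo_on {z. e z $ m \<noteq> 0} (\<lambda>z. inverse (e z $ m) *s e z)"
      unfolding vholo_on_def using vholo_on_subset[OF assms(3), of "{z. e z $ m \<noteq> 0}"]
      by (auto intro!: holo_on_mult holo_on_inverse holo_on_nth)
    from vholo_on_compose[OF this assms(4)]
    show "vholo_on {z. e z $ m \<noteq> 0} (\<lambda>z. r' (inverse (e z $ m) *s e z))" by simp
    fix x assume "x \<in> {z. e z $ m \<noteq> 0}"
    then have x: "e x $ m \<noteq> 0" by simp
    then have "e' (r' (inverse (e x $ m) *s e x)) = inverse (e x $ m) *s e x" by (intro assms(1)) simp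
    then show "proj_point (e' (r' (inverse (e x $ m) *s e x))) = proj_point (e x)"
      using x by (auto simp: proj_point_eq_iff intro!: exI[of _ "inverse (e x $ m)"])
  qed (use z in auto)
qed

lemma inj_plane_charts: "inj chartZ" "inj chartY" "inj chartX"
  unfolding inj_def chartZ_def chartY_def chartX_def proj_point_eq_iff vec2_eq_iff vec3_eq_iff by auto

lemma compat_projective_plane: "compat projective_plane"
proof -
  define E1 :: "complex^2 \<Rightarrow> complex^3" where "E1 z = vector [z $ 1, z $ 2, 1]" for z
  define E2 :: "complex^2 \<Rightarrow> complex^3" where "E2 z = vector [z $ 1, 1, z $ 2]" for z
  define E3 :: "complex^2 \<Rightarrow> complex^3" where "E3 z = vector [1, z $ 1, z $ 2]" for z
  have ch: "chartZ = (\<lambda>z. proj_point (E1 z))" "chartY = (\<lambda>z. proj_point (E2 z))" "chartX = (\<lambda>z. proj_point (E3 z))"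
    by (simp_all add: fun_eq_iff chartZ_def chartY_def chartX_def E1_def E2_def E3_def)
  have hE: "vholo_on UNIV E1" "vholo_on UNIV E2" "vholo_on UNIV E3"
    unfolding vholo_on_def forall_3 E1_def E2_def E3_def by (auto intro: holo_intros)
  have hR: "vholo_on UNIV (\<lambda>v :: complex^3. vector [v $ i, v $ j] :: complex^2)" for i j
    by (intro vholo_on_vector2 holo_intros)
  have l: "lift_at UNIV (\<lambda>w. proj_point (e' w)) (\<lambda>z. proj_point (e z)) z"
    if "e \<in> {E1, E2, E3}" "e' \<in> {E1, E2, E3}" "proj_point (e z) \<in> range (\<lambda>w. proj_point (e' w))" for e e' z
  proof -
    have e: "vholo_on UNIV e" using that(1) hE by auto
    from that(2) consider "e' = E1" | "e' = E2" | "e' = E3" by blast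
    then show ?thesis
    proof cases
      case 1
      show ?thesis
        by (rule projective_lift[where m = 3, OF _ _ e hR[of 1 2]]) (use that(3) 1 in \<open>auto simp: E1_def vec3_eq_iff\<close>)
    next
      case 2
      show ?thesis
        by (rule projective_lift[where m = 2, OF _ _ e hR[of 1 3]]) (use that(3) 2 in \<open>auto simp: E2_def vec3_eq_iff\<close>)
    next
      case 3
      show ?thesis
        by (rule projective_lift[where m = 1, OF _ _ e hR[of 2 3]]) (use that(3) 3 in \<open>auto simp: E3_def vec3_eq_iff\<close>)
    qed
  qed
  show ?thesis
    unfolding compat_def projective_plane_eq
    using inj_plane_charts unfolding ch by (simp add: l)
qed

text \<open>The parameter is the slope \<open>y / x\<close>; its infinite value belongs to the point
  \<open>[0 : 1 : 0]\<close>.\<close>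

definition line :: "complex option \<Rightarrow> ipoint" where
  "line \<zeta> = (case \<zeta> of None \<Rightarrow> chartY 0 | Some m \<Rightarrow> chartX (vector [m, 0]))"

lemma line_inf: "line (P1_inf w) = chartY (vector [w, 0])"
  by (auto simp: line_def P1_inf_def chartX_def chartY_def proj_point_eq_iff vec3_eq_iff intro!: exI[of _ "1 / w"])

lemma line_Some: "line (Some m) = chartX (vector [m, 0])"
  by (simp add: line_def)

lemma chartX_line: "chartX z \<in> range line \<longleftrightarrow> z $ 2 = 0"
proof
  assume "chartX z \<in> range line"
  then obtain \<zeta> where "chartX z = line \<zeta>" by blast
  then show "z $ 2 = 0"
    by (cases \<zeta>) (auto simp: line_def chartX_def chartY_def proj_point_eq_iff vec3_eq_iff)
next
  assume "z $ 2 = 0"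
  then have "chartX z = line (Some (z $ 1))" by (simp add: line_def chartX_def)
  then show "chartX z \<in> range line" by (rule range_eqI)
qed

lemma chartY_line: "chartY z \<in> range line \<longleftrightarrow> z $ 2 = 0"
proof
  assume "chartY z \<in> range line"
  then obtain \<zeta> where "chartY z = line \<zeta>" by blast
  then show "z $ 2 = 0"
    by (cases \<zeta>) (auto simp: line_def chartX_def chartY_def proj_point_eq_iff vec3_eq_iff)
next
  assume "z $ 2 = 0"
  then have "chartY z = line (P1_inf (z $ 1))" by (simp add: line_inf chartY_def)
  then show "chartY z \<in> range line" by (rule range_eqI)
qed

lemma chartZ_line: "chartZ z \<notin> range line"
proof
  assume "chartZ z \<in> range line"
  then obtain \<zeta> where "chartZ z = line \<zeta>" by blast
  then show False
    by (cases \<zeta>) (auto simp: line_def chartZ_def chartX_def chartY_def proj_point_eq_iff vec3_eq_iff)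
qed

lemma points_projective_plane: "points projective_plane = range chartZ \<union> range line"
proof (intro equalityI subsetI)
  fix q assume "q \<in> points projective_plane"
  then obtain z where z: "q = chartZ z \<or> q = chartY z \<or> q = chartX z"
    unfolding points_iff projective_plane_eq by blast
  have "chartY z = chartZ (vector [z $ 1 / z $ 2, 1 / z $ 2])" "chartX z = chartZ (vector [1 / z $ 2, z $ 1 / z $ 2])"
    if "z $ 2 \<noteq> 0"
    using that by (auto simp: chartZ_def chartX_def chartY_def proj_point_eq_iff vec3_eq_iff intro!: exI[of _ "z $ 2"])
  then show "q \<in> range chartZ \<union> range line" using z chartX_line[of z] chartY_line[of z] by (metis UnCI rangeI)
next
  fix q assume "q \<in> range chartZ \<union> range line"
  then consider z where "q = chartZ z" | \<zeta> where "q = line \<zeta>" by blast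
  then show "q \<in> points projective_plane"
  proof cases
    case 1
    then show ?thesis unfolding points_iff projective_plane_eq by blast
  next
    case (2 \<zeta>)
    then show ?thesis unfolding points_iff projective_plane_eq by (cases \<zeta>) (auto simp: line_def)
  qed
qed

lemma line_Plane: "line \<zeta> \<in> range Plane" "chartZ z \<in> range Plane" "chartX z \<in> range Plane" "chartY z \<in> range Plane"
  by (auto simp: line_def chartZ_def chartX_def chartY_def proj_point_def split: option.split)

lemma plane_charts_in: "(UNIV, chartZ) \<in> projective_plane" "(UNIV, chartY) \<in> projective_plane" "(UNIV, chartX) \<in> projective_plane"
  by (simp_all add: projective_plane_eq)

lemma unrelated_projective_plane: "unrelated projective_plane"
  unfolding unrelated_def points_projective_plane
proof
  fix q assume "q \<in> range chartZ \<union> range line"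
  then have "q \<in> range Plane" using line_Plane by blast
  then show "ancestors q \<inter> (range chartZ \<union> range line) = {}" by auto
qed

lemma line_clift: "clift_at UNIV chartX (\<lambda>x. line (Some x)) t" "clift_at UNIV chartY (\<lambda>x. line (P1_inf x)) t"
proof -
  show "clift_at UNIV chartX (\<lambda>x. line (Some x)) t"
    by (rule clift_atI[OF open_UNIV, where f = "\<lambda>m. vector [m, 0]" and i = 1])
      (auto simp: vholomorphic_on_def forall_2 line_Some)
  show "clift_at UNIV chartY (\<lambda>x. line (P1_inf x)) t"
    by (rule clift_atI[OF open_UNIV, where f = "\<lambda>m. vector [m, 0]" and i = 1])
      (auto simp: vholomorphic_on_def forall_2 line_inf)
qed

lemma P1_embedding_line: "P1_embedding projective_plane line"
proof (rule P1_embeddingI[OF compat_projective_plane])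
  show "inj line"
    unfolding inj_def
  proof (intro allI impI)
    fix x y assume "line x = line y"
    then show "x = y"
      by (cases x; cases y) (auto simp: line_def chartX_def chartY_def proj_point_eq_iff vec3_eq_iff)
  qed
  fix \<sigma> :: "complex \<Rightarrow> complex option" and t assume "\<sigma> \<in> {Some, P1_inf}"
  then show "\<exists>(V, \<psi>)\<in>projective_plane. clift_at V \<psi> (\<lambda>x. line (\<sigma> x)) t"
    using line_clift plane_charts_in by blast
qed

lemma closed_line: "closed_curve projective_plane line"
proof -
  have "open {v :: complex^2. v $ 2 \<noteq> 0}" by (intro open_Collect_neq continuous_intros)
  then show ?thesis
    unfolding closed_curve_def projective_plane_eq by (simp add: chartX_line chartY_line chartZ_line)
qed

text \<open>The two equations of the line differ by the slope: the one in \<open>chartX\<close> is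
  the slope times the one in \<open>chartY\<close>. The section \<open>1\<close> over
  \<open>chartX\<close> becomes the reciprocal slope over \<open>chartY\<close>, whose only zero is
  simple and lies at infinity, so the degree is \<open>1\<close>.\<close>

lemma intersection_data_line:
  "intersection_data projective_plane line (range line)
    {(range chartX, \<lambda>q. inv_into UNIV chartX q $ 2, \<lambda>_. 1),
     (range chartY, \<lambda>q. inv_into UNIV chartY q $ 2, \<lambda>\<zeta>. case \<zeta> of None \<Rightarrow> 0 | Some z \<Rightarrow> 1 / z)}
    (\<lambda>\<zeta>. if \<zeta> = None then 1 else 0)"
    (is "intersection_data _ _ _ {(?Ua, ?ga, ?sa), (?Ub, ?gb, ?sb)} ?ord")
proof -
  have lea: "local_equation projective_plane (range line) ?Ua ?ga"
    using local_equation_chart[OF compat_projective_plane plane_charts_in(3), of 2 0 "range line"] chartX_line by simp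
  have leb: "local_equation projective_plane (range line) ?Ub ?gb"
    using local_equation_chart[OF compat_projective_plane plane_charts_in(2), of 2 0 "range line"] chartY_line by simp
  have ina: "line l \<in> ?Ua \<longleftrightarrow> l \<noteq> None" for l
  proof (cases l)
    case None
    then show ?thesis by (auto simp: line_def chartX_def chartY_def proj_point_eq_iff vec3_eq_iff)
  qed (simp add: line_Some)
  have inb: "line l \<in> ?Ub \<longleftrightarrow> l \<noteq> Some 0" for l
  proof (cases l)
    case None
    then show ?thesis by (simp add: line_def)
  next
    case (Some z)
    show ?thesis
    proof (cases "z = 0")
      case True
      then show ?thesis using Some by (auto simp: line_def chartX_def chartY_def proj_point_eq_iff vec3_eq_iff)
    next
      case False
      then have "line l = chartY (vector [1 / z, 0])" using Some line_inf[of "1 / z"] by (simp add: P1_inf_def)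
      then show ?thesis using Some False by simp
    qed
  qed
  define u where "u q = inv_into UNIV chartX q $ 1" for q
  have hu: "holo_fun_on projective_plane ?Ua u"
    unfolding u_def
    by (rule holo_fun_on_chart[OF compat_projective_plane plane_charts_in(3) _ _ open_UNIV]) (auto intro: holo_intros)
  have ov: "u q \<noteq> 0 \<and> ?ga q = u q * ?gb q" if "q \<in> ?Ua" "q \<in> ?Ub" for q
  proof -
    from that obtain w v where w: "q = chartX w" "q = chartY v" by blast
    have i: "inv_into UNIV chartX q = w" "inv_into UNIV chartY q = v"
      using w inj_plane_charts by (metis inv_f_f)+
    from w have "chartX w = chartY v" by simp
    then have "w $ 1 \<noteq> 0 \<and> w $ 2 = w $ 1 * v $ 2"
      by (auto simp: chartX_def chartY_def proj_point_eq_iff vec3_eq_iff)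
    then show ?thesis unfolding u_def i .
  qed
  have uc: "u (line (Some m)) = m" for m
    unfolding u_def line_Some using inj_plane_charts(3) by simp
  show ?thesis
    unfolding intersection_data_def
  proof (intro conjI allI impI)
    show "local_equation projective_plane (range line) U g" if "(U, g, s) \<in> {(?Ua, ?ga, ?sa), (?Ub, ?gb, ?sb)}" for U g s
      using that lea leb by auto
    show "\<exists>U g s. (U, g, s) \<in> {(?Ua, ?ga, ?sa), (?Ub, ?gb, ?sb)} \<and> line \<zeta> \<in> U" for \<zeta>
      using ina[of \<zeta>] inb[of \<zeta>] by (cases "\<zeta> = None") (metis insertI1 insertI2 option.distinct(1))+
    show "finite {\<zeta>. ?ord \<zeta> \<noteq> 0}" by simp
    show "section_at s \<sigma> z (?ord (\<sigma> z))"
      if T: "(U, g, s) \<in> {(?Ua, ?ga, ?sa), (?Ub, ?gb, ?sb)}" and \<sigma>: "\<sigma> \<in> {Some, P1_inf}" "line (\<sigma> z) \<in> U" for U g s \<sigma> z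
      using T
    proof (elim insertE emptyE)
      assume "(U, g, s) = (?Ua, ?ga, ?sa)"
      moreover from this have "\<sigma> z \<noteq> None" using \<sigma> ina[of "\<sigma> z"] by blast
      ultimately show ?thesis using section_at_holomorphic[of UNIV z "\<lambda>_. 1" \<sigma>] by auto
    next
      assume e: "(U, g, s) = (?Ub, ?gb, ?sb)"
      then have nz: "\<sigma> z \<noteq> Some 0" using \<sigma> inb by simp
      from \<sigma>(1) consider "\<sigma> = Some" | "\<sigma> = P1_inf" by blast
      then show ?thesis
      proof cases
        case 1
        have "(\<lambda>w. ?sb (\<sigma> w)) holomorphic_on (- {0})" unfolding 1 by (simp, intro holomorphic_intros) auto
        then have "section_at ?sb \<sigma> z 0"
          by (intro section_at_holomorphic[of "- {0}"]) (use nz 1 in auto)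
        then show ?thesis using 1 e by simp
      next
        case 2
        have s: "(\<lambda>w. ?sb (P1_inf w)) = (\<lambda>w. w)" by (auto simp: P1_inf_def)
        have s': "?sb (P1_inf w) = w" for w using fun_cong[OF s] .
        show ?thesis
        proof (cases "z = 0")
          case True
          have "section_at ?sb P1_inf 0 1"
            by (intro section_at_simple_zero[of UNIV]) (simp_all only: s s' holomorphic_on_ident open_UNIV UNIV_I deriv_ident one_neq_zero simp_thms)
          then show ?thesis using 2 True e by (simp add: P1_inf_def)
        next
          case False
          have "section_at ?sb P1_inf z 0"
            by (intro section_at_holomorphic[of UNIV]) (use False in \<open>simp_all only: s s' holomorphic_on_ident open_UNIV UNIV_I simp_thms\<close>)
          then show ?thesis using False 2 e by (simp add: P1_inf_def)
        qed
      qed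
    qed
    fix U g s U' g' s'
    assume T: "(U, g, s) \<in> {(?Ua, ?ga, ?sa), (?Ub, ?gb, ?sb)}" "(U', g', s') \<in> {(?Ua, ?ga, ?sa), (?Ub, ?gb, ?sb)}"
    consider (same) "(U, g, s) = (U', g', s')" | (ab) "(U, g, s) = (?Ua, ?ga, ?sa)" "(U', g', s') = (?Ub, ?gb, ?sb)"
      | (ba) "(U, g, s) = (?Ub, ?gb, ?sb)" "(U', g', s') = (?Ua, ?ga, ?sa)" using T by blast
    then show "\<exists>u. holo_fun_on projective_plane (U \<inter> U') u \<and> (\<forall>p\<in>U \<inter> U'. g p = u p * g' p) \<and>
          (\<forall>\<zeta>. line \<zeta> \<in> U \<inter> U' \<longrightarrow> s \<zeta> = u (line \<zeta>) * s' \<zeta>)"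
    proof cases
      case same
      then show ?thesis by (intro exI[of _ "\<lambda>_. 1"]) (simp add: holo_fun_on_intros(1))
    next
      case ab
      have "1 = u (line \<zeta>) * ?sb \<zeta>" if "line \<zeta> \<in> ?Ua \<inter> ?Ub" for \<zeta>
      proof -
        from that ina[of \<zeta>] obtain m where m: "\<zeta> = Some m" by blast
        have "m \<noteq> 0" using that inb[of \<zeta>] m by blast
        then show ?thesis by (simp add: m uc)
      qed
      moreover have "holo_fun_on projective_plane (?Ua \<inter> ?Ub) u" by (rule holo_fun_on_subset[OF hu]) simp
      ultimately show ?thesis using ab
        by (intro exI[of _ u]) (use ov in simp)
    next
      case ba
      have "holo_fun_on projective_plane (?Ub \<inter> ?Ua) (\<lambda>q. 1 / u q)"
        by (rule holo_fun_on_intros(3)[OF holo_fun_on_intros(1) holo_fun_on_subset[OF hu]]) (use ov in auto)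
      moreover have "?sb \<zeta> = 1 / u (line \<zeta>) * 1" if "line \<zeta> \<in> ?Ub" "line \<zeta> \<in> ?Ua" for \<zeta>
      proof -
        from that ina[of \<zeta>] obtain m where m: "\<zeta> = Some m" by blast
        then show ?thesis by (simp add: m uc)
      qed
      ultimately show ?thesis using ba
        by (intro exI[of _ "\<lambda>q. 1 / u q"]) (use ov in simp)
    qed
  qed
qed

lemma curve_line: "curve projective_plane line 1 {(UNIV, chartX), (UNIV, chartY)}"
proof -
  have "{\<zeta>. (if \<zeta> = None then 1 else 0) \<noteq> (0::int)} = {None}" for \<zeta> :: "complex option" by auto
  then have s: "(1 :: int) = (\<Sum>\<zeta>::complex option | (if \<zeta> = None then 1 else 0) \<noteq> (0::int). (if \<zeta> = None then 1 else 0))"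
    by simp
  have i: "inv_into UNIV chartX (chartX v) = v" "inv_into UNIV chartY (chartY v) = v" for v
    using inj_plane_charts by simp_all
  show ?thesis
    unfolding curve_def
  proof (intro conjI exI)
    show "\<forall>V \<psi>. (V, \<psi>) \<in> {(UNIV, chartX), (UNIV, chartY)} \<longrightarrow> (\<exists>g s. (\<psi> ` V, g, s) \<in>
       {(range chartX, \<lambda>q. inv_into UNIV chartX q $ 2, \<lambda>_. 1),
        (range chartY, \<lambda>q. inv_into UNIV chartY q $ 2, \<lambda>\<zeta>. case \<zeta> of None \<Rightarrow> 0 | Some z \<Rightarrow> 1 / z)} \<and>
        (\<forall>v\<in>V. g (\<psi> v) = v $ 2))"
      using i by auto
  qed (use plane_charts_in P1_embedding_line closed_line intersection_data_line s in auto)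
qed

section \<open>Intersection numbers of crossing and of disjoint curves\<close>

lemma closed_curve_openin:
  assumes "compat A" "closed_curve A \<delta>"
  shows "openin (manifold_topology A) (points A - range \<delta>)"
  unfolding openin_compat[OF assms(1)]
proof (intro conjI)
  have "open {v \<in> V. \<psi> v \<in> points A - range \<delta>}" if "(V, \<psi>) \<in> A" for V \<psi>
  proof -
    have "\<psi> v \<in> points A" if "v \<in> V" for v using that \<open>(V, \<psi>) \<in> A\<close> unfolding points_iff by blast
    then have "{v \<in> V. \<psi> v \<in> points A - range \<delta>} = {v \<in> V. \<psi> v \<notin> range \<delta>}" by auto
    then show ?thesis using assms(2) that unfolding closed_curve_def by auto
  qed
  then show "\<forall>(V, \<psi>)\<in>A. open {v \<in> V. \<psi> v \<in> points A - range \<delta>}" by auto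
qed simp

lemma local_equation_complement:
  assumes "compat A" "closed_curve A \<delta>"
  shows "local_equation A (range \<delta>) (points A - range \<delta>) (\<lambda>_. 1)"
  by (rule local_equationI[OF assms(1) closed_curve_openin[OF assms]]) (auto intro: holo_fun_on_intros(1))

text \<open>A single domain, the complement of the second curve, covers the first one; equation and
  section are both \<open>1\<close>.\<close>

lemma intersection_number_disjoint:
  assumes "compat A" "closed_curve A \<delta>" "range \<gamma> \<subseteq> points A" "range \<gamma> \<inter> range \<delta> = {}"
  shows "has_intersection_number A \<gamma> (range \<delta>) 0"
proof (rule has_intersection_numberI)
  have s: "section_at (\<lambda>_. 1) \<sigma> z 0" for \<sigma> z
    by (rule section_at_holomorphic[of UNIV]) auto
  show "intersection_data A \<gamma> (range \<delta>) {(points A - range \<delta>, \<lambda>_ :: ipoint. 1 :: complex, \<lambda>_ :: complex option. 1 :: complex)} (\<lambda>_. 0)"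
    unfolding intersection_data_def
  proof (intro conjI allI impI)
    show "\<exists>U g s. (U, g, s) \<in> {(points A - range \<delta>, \<lambda>_ :: ipoint. 1 :: complex, \<lambda>_ :: complex option. 1 :: complex)} \<and> \<gamma> \<zeta> \<in> U" for \<zeta>
    proof -
      have "\<gamma> \<zeta> \<in> points A - range \<delta>" using assms(3,4) rangeI[of \<gamma> \<zeta>] unfolding disjoint_iff by auto
      then show ?thesis by blast
    qed
    fix U g s U' g' s'
    assume "(U, g, s) \<in> {(points A - range \<delta>, \<lambda>_ :: ipoint. 1 :: complex, \<lambda>_ :: complex option. 1 :: complex)}" "(U', g', s') \<in> {(points A - range \<delta>, \<lambda>_ :: ipoint. 1 :: complex, \<lambda>_ :: complex option. 1 :: complex)}"
    then show "\<exists>u. holo_fun_on A (U \<inter> U') u \<and> (\<forall>p\<in>U \<inter> U'. g p = u p * g' p) \<and>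
        (\<forall>\<zeta>. \<gamma> \<zeta> \<in> U \<inter> U' \<longrightarrow> s \<zeta> = u (\<gamma> \<zeta>) * s' \<zeta>)"
      by (intro exI[of _ "\<lambda>_. 1"]) (simp add: holo_fun_on_intros(1))
  qed (use s local_equation_complement[OF assms(1,2)] in auto)
qed simp

text \<open>The local equations of the second curve, restricted to the first, form the section. In
  the crossing chart coordinate \<open>i\<close> is constant along the first curve; its velocity is
  then visible in coordinate \<open>j\<close>, and the equation of the second curve has a simple
  zero.\<close>

lemma intersection_number_crossing:
  assumes "compat A" "closed_curve A \<delta>" "P1_embedding A \<gamma>" "crossing A \<gamma> \<delta>"
  shows "has_intersection_number A \<gamma> (range \<delta>) 1"
proof -
  from assms(4) obtain V \<psi> v i j where cr: "(V, \<psi>) \<in> A" "v \<in> V" "i \<noteq> j" "range \<gamma> \<inter> range \<delta> = {\<psi> v}"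
     "\<And>x. x \<in> V \<Longrightarrow> \<psi> x \<in> range \<gamma> \<longleftrightarrow> x $ i = v $ i" "\<And>x. x \<in> V \<Longrightarrow> \<psi> x \<in> range \<delta> \<longleftrightarrow> x $ j = v $ j"
    unfolding crossing_def by blast
  have both: "q \<in> range \<gamma> \<and> q \<in> range \<delta> \<longleftrightarrow> q = \<psi> v" for q
    using arg_cong[OF cr(4), of "\<lambda>S. q \<in> S"] by simp
  obtain \<zeta>0 where z0: "\<gamma> \<zeta>0 = \<psi> v" using both[of "\<psi> v"] by (metis imageE)
  have inj: "inj \<gamma>" using assms(3) unfolding P1_embedding_def by blast
  have on: "\<gamma> \<zeta> \<in> range \<delta> \<longleftrightarrow> \<zeta> = \<zeta>0" for \<zeta>
    using both[of "\<gamma> \<zeta>"] z0 inj by (metis injD rangeI)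
  let ?U = "points A - range \<delta>"
  let ?g = "\<lambda>p. inv_into V \<psi> p $ j - v $ j"
  let ?\<T> = "{(?U, \<lambda>_ :: ipoint. 1 :: complex, \<lambda>_ :: complex option. 1 :: complex), (\<psi> ` V, ?g, \<lambda>\<zeta>. ?g (\<gamma> \<zeta>))}"
  let ?ord = "\<lambda>\<zeta>. if \<zeta> = \<zeta>0 then 1 else 0 :: int"
  have le: "local_equation A (range \<delta>) (\<psi> ` V) ?g"
    by (rule local_equation_chart[OF assms(1) cr(1)]) (use cr(6) in auto)
  have hg: "holo_fun_on A (\<psi> ` V) ?g" using le unfolding local_equation_def by blast
  have g0: "?g q = 0 \<longleftrightarrow> q \<in> range \<delta>" if "q \<in> \<psi> ` V" for q
    using le that unfolding local_equation_def by blast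
  have sec: "section_at (\<lambda>\<zeta>. ?g (\<gamma> \<zeta>)) \<sigma> z (?ord (\<sigma> z))" if \<sigma>: "\<sigma> \<in> {Some, P1_inf}" "\<gamma> (\<sigma> z) \<in> \<psi> ` V" for \<sigma> z
  proof -
    obtain N where N: "open N" "z \<in> N" "vholomorphic_on (\<lambda>x. inv_into V \<psi> (\<gamma> (\<sigma> x))) N"
      "\<And>x. x \<in> N \<Longrightarrow> \<gamma> (\<sigma> x) \<in> \<psi> ` V" "\<exists>i. deriv (\<lambda>t. inv_into V \<psi> (\<gamma> (\<sigma> t)) $ i) z \<noteq> 0"
      by (rule clift_domain[OF assms(1) cr(1) P1_embedding_clift[OF assms(3) cr(1) \<sigma>]]) (rule that)
    have c: "inv_into V \<psi> (\<gamma> (\<sigma> x)) $ i = v $ i" if "x \<in> N" for x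
      using cr(5)[OF inv_into_into[OF N(4)[OF that]]] f_inv_into_f[OF N(4)[OF that]] by simp
    have "deriv (\<lambda>x. inv_into V \<psi> (\<gamma> (\<sigma> x)) $ i) z = deriv (\<lambda>_. v $ i) z"
      by (rule deriv_cong_ev) (use N(1,2) c in \<open>auto simp: eventually_nhds\<close>)
    then have "deriv (\<lambda>x. inv_into V \<psi> (\<gamma> (\<sigma> x)) $ i) z = 0" by simp
    moreover from N(5) obtain l where l: "deriv (\<lambda>x. inv_into V \<psi> (\<gamma> (\<sigma> x)) $ l) z \<noteq> 0" ..
    ultimately have "l \<noteq> i" by metis
    then have "l = j" using cr(3) exhaust_2[of i] exhaust_2[of j] exhaust_2[of l] by auto
    with l have d: "deriv (\<lambda>x. inv_into V \<psi> (\<gamma> (\<sigma> x)) $ j) z \<noteq> 0" by simp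
    have h: "(\<lambda>x. inv_into V \<psi> (\<gamma> (\<sigma> x)) $ j) holomorphic_on N" using N(3) by (simp add: vholomorphic_on_def)
    then have hol: "(\<lambda>x. ?g (\<gamma> (\<sigma> x))) holomorphic_on N" by (intro holomorphic_intros)
    have "(\<lambda>x. inv_into V \<psi> (\<gamma> (\<sigma> x)) $ j) field_differentiable at z"
      using h N by (metis holomorphic_on_imp_differentiable_at)
    then have d': "deriv (\<lambda>x. ?g (\<gamma> (\<sigma> x))) z \<noteq> 0" using d by (simp add: deriv_diff)
    show ?thesis
    proof (cases "\<sigma> z = \<zeta>0")
      case True
      then have "?g (\<gamma> (\<sigma> z)) = 0" using g0[OF \<sigma>(2)] on by simp
      from section_at_simple_zero[OF N(1,2) hol this d'] True show ?thesis by simp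
    next
      case False
      then have "?g (\<gamma> (\<sigma> z)) \<noteq> 0" using g0[OF \<sigma>(2)] on by simp
      from section_at_holomorphic[OF N(1,2) hol this] False show ?thesis by simp
    qed
  qed
  have s1: "section_at (\<lambda>_. 1) \<sigma> z 0" for \<sigma> z
    by (rule section_at_holomorphic[of UNIV]) auto
  have "intersection_data A \<gamma> (range \<delta>) ?\<T> ?ord"
    unfolding intersection_data_def
  proof (intro conjI allI impI)
    show "local_equation A (range \<delta>) U g" if "(U, g, s) \<in> ?\<T>" for U g s
      using that le local_equation_complement[OF assms(1,2)] by blast
    show "\<exists>U g s. (U, g, s) \<in> ?\<T> \<and> \<gamma> \<zeta> \<in> U" for \<zeta>
    proof (cases "\<zeta> = \<zeta>0")
      case True
      then have "\<gamma> \<zeta> \<in> \<psi> ` V" using z0 cr(2) by simp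
      then show ?thesis by blast
    next
      case False
      then have "\<gamma> \<zeta> \<in> ?U" using on P1_embedding_points[OF assms(3)] by blast
      then show ?thesis by blast
    qed
    show "section_at s \<sigma> z (?ord (\<sigma> z))"
      if T: "(U, g, s) \<in> ?\<T>" and \<sigma>: "\<sigma> \<in> {Some, P1_inf}" "\<gamma> (\<sigma> z) \<in> U" for U g s \<sigma> z
      using T
    proof (elim insertE emptyE)
      assume e: "(U, g, s) = (?U, \<lambda>_ :: ipoint. 1 :: complex, \<lambda>_ :: complex option. 1 :: complex)"
      then have "\<sigma> z \<noteq> \<zeta>0" using \<sigma>(2) on by blast
      then show ?thesis using e s1 by simp
    next
      assume "(U, g, s) = (\<psi> ` V, ?g, \<lambda>\<zeta>. ?g (\<gamma> \<zeta>))"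
      then show ?thesis using sec \<sigma> by simp
    qed
    show "finite {\<zeta>. ?ord \<zeta> \<noteq> 0}" by simp
    fix U g s U' g' s'
    assume T: "(U, g, s) \<in> ?\<T>" "(U', g', s') \<in> ?\<T>"
    consider (same) "(U, g, s) = (U', g', s')"
      | (ab) "(U, g, s) = (?U, \<lambda>_ :: ipoint. 1 :: complex, \<lambda>_ :: complex option. 1 :: complex)" "(U', g', s') = (\<psi> ` V, ?g, \<lambda>\<zeta>. ?g (\<gamma> \<zeta>))"
      | (ba) "(U, g, s) = (\<psi> ` V, ?g, \<lambda>\<zeta>. ?g (\<gamma> \<zeta>))" "(U', g', s') = (?U, \<lambda>_ :: ipoint. 1 :: complex, \<lambda>_ :: complex option. 1 :: complex)" using T by blast
    then show "\<exists>u. holo_fun_on A (U \<inter> U') u \<and> (\<forall>p\<in>U \<inter> U'. g p = u p * g' p) \<and>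
        (\<forall>\<zeta>. \<gamma> \<zeta> \<in> U \<inter> U' \<longrightarrow> s \<zeta> = u (\<gamma> \<zeta>) * s' \<zeta>)"
    proof cases
      case same
      then show ?thesis by (intro exI[of _ "\<lambda>_. 1"]) (simp add: holo_fun_on_intros(1))
    next
      case ab
      have nz: "?g q \<noteq> 0" if "q \<in> ?U \<inter> \<psi> ` V" for q using g0 that by blast
      have "holo_fun_on A (?U \<inter> \<psi> ` V) (\<lambda>q. 1 / ?g q)"
        by (rule holo_fun_on_intros(3)[OF holo_fun_on_intros(1) holo_fun_on_subset[OF hg] nz]) auto
      then show ?thesis using ab by (intro exI[of _ "\<lambda>q. 1 / ?g q"]) (use nz in simp)
    next
      case ba
      have "holo_fun_on A (\<psi> ` V \<inter> ?U) ?g" by (rule holo_fun_on_subset[OF hg]) simp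
      then show ?thesis using ba by (intro exI[of _ ?g]) simp
    qed
  qed
  moreover have "{\<zeta>. ?ord \<zeta> \<noteq> 0} = {\<zeta>0}" by auto
  then have "1 = (\<Sum>\<zeta> | ?ord \<zeta> \<noteq> 0. ?ord \<zeta>)" by simp
  ultimately show ?thesis by (rule has_intersection_numberI)
qed

section \<open>Chains of three blow-ups\<close>

text \<open>The second new chart as a free-standing construction that can be iterated outside the
  locale. In each arm all centres after the first are taken in such charts.\<close>

definition bdom :: "(complex^2) set \<Rightarrow> complex^2 \<Rightarrow> (complex^2) set" where
  "bdom V c = {w. c + vector [w $ 1 * w $ 2, w $ 2] \<in> V}"

definition bmap :: "(complex^2 \<Rightarrow> ipoint) \<Rightarrow> complex^2 \<Rightarrow> complex^2 \<Rightarrow> ipoint" where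
  "bmap \<psi> c w = (if w $ 2 = 0 then Near (\<psi> c) (P1_inf (w $ 1)) else \<psi> (c + vector [w $ 1 * w $ 2, w $ 2]))"

lemma (in blowup) new_chart_eq: "Vb = bdom V c" "\<psi>b = bmap \<psi> c"
  by (simp_all add: fun_eq_iff bdom_def bmap_def Vb_def \<psi>b_def \<beta>b_def)

text \<open>The invariant of the whole construction, with index \<open>0\<close> for the line at
  infinity. A triple \<open>(k, k', q)\<close> in \<open>ends\<close> marks a finished arm: its last
  curve \<open>k\<close> is exceptional over \<open>q\<close>, meets \<open>k'\<close> in the
  direction \<open>Some 0\<close> and contains no other point of any further curve. Without that
  direction it is the part that will belong to the fibre.\<close>

definition stage ::
  "(2, ipoint) atlas \<Rightarrow> nat set \<Rightarrow> nat set set \<Rightarrow> (nat \<Rightarrow> int) \<Rightarrow> (nat \<Rightarrow> complex option \<Rightarrow> ipoint) \<Rightarrow>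
   (nat \<Rightarrow> (2, ipoint) atlas) \<Rightarrow> (nat \<times> nat \<times> ipoint) set \<Rightarrow> bool" where
  "stage A N E n \<gamma> T ends \<longleftrightarrow> blown_up_plane A \<and> config A N E n \<gamma> T \<and>
     points A = range chartZ \<union> (\<Union>i\<in>N. range (\<gamma> i)) \<and>
     (\<forall>i\<in>N. range (\<gamma> i) \<inter> range chartZ = {}) \<and>
     (\<forall>i\<in>N. i \<noteq> 0 \<longrightarrow> range (\<gamma> i) \<inter> range Plane = {}) \<and>
     (\<forall>k k' q. (k, k', q) \<in> ends \<longrightarrow> k \<in> N \<and> k' \<in> N \<and> \<gamma> k = Near q \<and> Near q (Some 0) \<in> range (\<gamma> k') \<and>
        (\<forall>j\<in>N. \<forall>l. Near q l \<in> range (\<gamma> j) \<longrightarrow> j = k \<or> l = Some 0))"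

text \<open>An end is retained only if neither of its two curves is the one being blown up. Both
  then avoid the centre and stay the same maps.\<close>

lemma stage_blow_up:
  assumes S: "stage A N E n \<gamma> T ends" and i: "i \<in> N" and ch: "(V, \<psi>) \<in> T i" "c \<in> V" "c $ 2 = 0"
    and off: "\<And>j. j \<in> N \<Longrightarrow> j \<noteq> i \<Longrightarrow> \<psi> c \<notin> range (\<gamma> j)" and k: "k \<notin> N" "k \<noteq> 0"
    and ends: "ends' \<subseteq> ends" "\<And>a b q. (a, b, q) \<in> ends' \<Longrightarrow> a \<noteq> i \<and> b \<noteq> i"
  shows "stage (blow_up_at A V \<psi> c) (insert k N) (insert {i, k} E) (n(i := n i - 1, k := - 1))
    (\<lambda>j. if j = k then Near (\<psi> c) else strict (\<psi> c) (\<gamma> j))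
    (\<lambda>j. if j = k then {(bdom V c, bmap \<psi> c)} else restrict_atlas (T j) (- {\<psi> c})) (insert (k, i, \<psi> c) ends')"
proof -
  from S have B: "blown_up_plane A" and C: "config A N E n \<gamma> T"
    and pts: "points A = range chartZ \<union> (\<Union>i\<in>N. range (\<gamma> i))"
    and aff: "\<And>i. i \<in> N \<Longrightarrow> range (\<gamma> i) \<inter> range chartZ = {}"
    and pl: "\<And>i. i \<in> N \<Longrightarrow> i \<noteq> 0 \<Longrightarrow> range (\<gamma> i) \<inter> range Plane = {}"
    and en: "\<And>k k' q. (k, k', q) \<in> ends \<Longrightarrow> k \<in> N \<and> k' \<in> N \<and> \<gamma> k = Near q \<and> Near q (Some 0) \<in> range (\<gamma> k') \<and>
        (\<forall>j\<in>N. \<forall>l. Near q l \<in> range (\<gamma> j) \<longrightarrow> j = k \<or> l = Some 0)"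
    unfolding stage_def by simp_all
  from C have cA: "compat A" and un: "unrelated A"
    and cu: "curve A (\<gamma> i) (n i) (T i)" using i unfolding config_def by simp_all
  have chA: "(V, \<psi>) \<in> A" using cu ch(1) unfolding curve_def by blast
  have pA: "\<psi> c \<in> points A" using chA ch(2) unfolding points_iff by blast
  interpret strict_transform A V \<psi> c "\<gamma> i"
  proof
    show "compat A" "(V, \<psi>) \<in> A" "c \<in> V" "c $ 2 = 0" by fact+
    show "Near (\<psi> c) l \<notin> points A" for l by (rule unrelated_fresh[OF un pA])
    show "P1_embedding A (\<gamma> i)" using cu unfolding curve_def by blast
    show "adapted V \<psi> (range (\<gamma> i))" by (rule curve_adapted[OF cu ch(1)])
  qed
  have subN: "range (\<gamma> j) \<subseteq> points A" if "j \<in> N" for j unfolding pts using that by blast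
  have str: "q \<in> range (strict p (\<gamma> j)) \<longleftrightarrow> q \<in> range (\<gamma> j) - {p} \<or> (j = i \<and> q = Near p (Some 0))" if j: "j \<in> N" for j q
  proof (cases "j = i")
    case True
    show ?thesis
    proof (cases "q \<in> points A - {p}")
      case True
      then show ?thesis using strict_range_old[OF True] fresh by auto
    next
      case False
      have "q \<in> range \<gamma>' \<longleftrightarrow> q = Near p (Some 0)"
      proof
        assume "q \<in> range \<gamma>'"
        then obtain \<zeta> where "q = \<gamma>' \<zeta>" by blast
        with False \<gamma>_points[of \<zeta>] show "q = Near p (Some 0)" by (auto simp: strict_def split: if_splits)
      qed (use strict_Near in simp)
      then show ?thesis using True False subN[OF i] by auto
    qed
  next
    case False
    then show ?thesis unfolding strict_away[OF off[OF j False]] using off[OF j False] by auto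
  qed
  have paff: "p \<notin> range chartZ" using p_on_curve aff[OF i] by blast
  have Naff: "Near p l \<notin> range chartZ" for l
  proof
    assume "Near p l \<in> range chartZ"
    then obtain z where "Near p l = chartZ z" by blast
    with line_Plane(2)[of z] show False by auto
  qed
  let ?\<gamma> = "\<lambda>j. if j = k then Near p else strict p (\<gamma> j)"
  have rg: "q \<in> range (?\<gamma> j) \<longleftrightarrow>
      (if j = k then q \<in> range (Near p) else q \<in> range (\<gamma> j) - {p} \<or> (j = i \<and> q = Near p (Some 0)))"
    if "j \<in> insert k N" for j q
  proof (cases "j = k")
    case False
    with that str[of j q] show ?thesis by (simp only: if_False insert_iff simp_thms)
  qed simp
  show ?thesis
    unfolding stage_def
  proof (intro conjI allI impI ballI)
    show "blown_up_plane A'" by (rule blown_up_plane.step[OF B chA ch(2)])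
    show "config A' (insert k N) (insert {i, k} E) (n(i := n i - 1, k := - 1)) ?\<gamma>
      (\<lambda>j. if j = k then {(bdom V c, bmap \<psi> c)} else restrict_atlas (T j) (- {p}))"
      using config_blow_up[OF C i ch off k(1)] unfolding new_chart_eq .
    have u: "(\<Union>j\<in>insert k N. range (?\<gamma> j)) = (\<Union>j\<in>N. range (\<gamma> j)) - {p} \<union> range (Near p)"
    proof (rule set_eqI)
      fix q
      have "q \<in> (\<Union>j\<in>insert k N. range (?\<gamma> j)) \<longleftrightarrow> (\<exists>j\<in>insert k N. q \<in> range (?\<gamma> j))" by blast
      also have "\<dots> \<longleftrightarrow> (\<exists>j\<in>insert k N. (if j = k then q \<in> range (Near p)
          else q \<in> range (\<gamma> j) - {p} \<or> (j = i \<and> q = Near p (Some 0))))"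
        by (rule bex_cong[OF refl rg])
      also have "\<dots> \<longleftrightarrow> q \<in> (\<Union>j\<in>N. range (\<gamma> j)) - {p} \<union> range (Near p)"
        using k(1) by auto
      finally show "q \<in> (\<Union>j\<in>insert k N. range (?\<gamma> j)) \<longleftrightarrow> q \<in> (\<Union>j\<in>N. range (\<gamma> j)) - {p} \<union> range (Near p)" .
    qed
    show "points A' = range chartZ \<union> (\<Union>j\<in>insert k N. range (?\<gamma> j))"
      unfolding points_blow_up u pts using paff by blast
    show "range (?\<gamma> j) \<inter> range chartZ = {}" if j: "j \<in> insert k N" for j
    proof (rule equals0I)
      fix q assume q: "q \<in> range (?\<gamma> j) \<inter> range chartZ"
      then have "j \<noteq> k \<and> q \<in> range (\<gamma> j) \<or> (\<exists>l. q = Near p l)"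
        using rg[OF j, of q] by (auto split: if_splits)
      moreover have "q \<notin> range (\<gamma> j)" if "j \<noteq> k" using q aff[of j] j that by blast
      moreover have "q \<noteq> Near p l" for l using q Naff[of l] by blast
      ultimately show False by blast
    qed
    show "range (?\<gamma> j) \<inter> range Plane = {}" if j: "j \<in> insert k N" "j \<noteq> 0" for j
    proof (rule equals0I)
      fix q assume q: "q \<in> range (?\<gamma> j) \<inter> range Plane"
      then have "j \<noteq> k \<and> q \<in> range (\<gamma> j) \<or> (\<exists>l. q = Near p l)"
        using rg[OF j(1), of q] by (auto split: if_splits)
      moreover have "q \<notin> range (\<gamma> j)" if "j \<noteq> k" using q pl[of j] j that by blast
      moreover have "q \<noteq> Near p l" for l using q by auto
      ultimately show False by blast
    qed
    fix a b q assume e: "(a, b, q) \<in> insert (k, i, p) ends'"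
    have "a \<in> insert k N \<and> b \<in> insert k N \<and> ?\<gamma> a = Near q \<and> Near q (Some 0) \<in> range (?\<gamma> b) \<and>
      (\<forall>j\<in>insert k N. \<forall>l. Near q l \<in> range (?\<gamma> j) \<longrightarrow> j = a \<or> l = Some 0)"
    proof (cases "(a, b, q) = (k, i, p)")
      case True
      have "j = k \<or> l = Some 0" if "j \<in> insert k N" "Near p l \<in> range (?\<gamma> j)" for j l
        using that(2) subN[of j] fresh[of l] that(1) unfolding rg[OF that(1)] by (auto split: if_splits)
      moreover have "Near p (Some 0) \<in> range (?\<gamma> i)" unfolding rg[OF insertI2[OF i]] using i k(1) by auto
      ultimately show ?thesis using True i by auto
    next
      case False
      then have e': "(a, b, q) \<in> ends'" using e by blast
      then have "(a, b, q) \<in> ends" using ends(1) by blast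
      note en = en[OF this]
      have ab: "a \<noteq> i" "b \<noteq> i" "a \<noteq> k" "b \<noteq> k" using ends(2)[OF e'] en k(1) by auto
      have aN: "a \<in> N" "b \<in> N" using en by auto
      note st = strict_away[OF off[OF aN(1) ab(1)]] strict_away[OF off[OF aN(2) ab(2)]]
      have qp: "q \<noteq> p"
      proof
        assume "q = p"
        then have "Near p (Some 0) \<in> range (\<gamma> b)" using en by blast
        with subN[OF aN(2)] fresh[of "Some 0"] show False by blast
      qed
      have "j = a \<or> l = Some 0" if "j \<in> insert k N" "Near q l \<in> range (?\<gamma> j)" for j l
      proof -
        have "j \<in> N \<and> Near q l \<in> range (\<gamma> j) \<or> l = Some 0"
          using that(2) qp that(1) unfolding rg[OF that(1)] by (auto split: if_splits)
        with en show ?thesis by blast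
      qed
      moreover have "?\<gamma> a = \<gamma> a" "?\<gamma> b = \<gamma> b" using st ab(3,4) by simp_all
      ultimately show ?thesis using en by simp
    qed
    then show "a \<in> insert k N" "b \<in> insert k N" "?\<gamma> a = Near q" "Near q (Some 0) \<in> range (?\<gamma> b)"
      "\<And>j l. j \<in> insert k N \<Longrightarrow> Near q l \<in> range (?\<gamma> j) \<Longrightarrow> j = a \<or> l = Some 0" by blast+
  qed
qed

text \<open>The second centre is the direction \<open>None\<close>, along the second coordinate
  axis; the strict transform of the line at infinity has the direction \<open>Some 0\<close> and is
  avoided. The third centre sits on the second exceptional curve, at a position given by the second
  order coefficient \<open>d\<close> of the curves to be separated.\<close>

definition arm_atlas ::
  "(2, ipoint) atlas \<Rightarrow> (complex^2) set \<Rightarrow> (complex^2 \<Rightarrow> ipoint) \<Rightarrow> complex^2 \<Rightarrow> complex \<Rightarrow> (2, ipoint) atlas" where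
  "arm_atlas A V \<psi> c d = blow_up_at (blow_up_at (blow_up_at A V \<psi> c) UNIV (bmap \<psi> c) 0)
     UNIV (bmap (bmap \<psi> c) 0) (vector [d, 0])"

definition arm_map :: "(complex^2 \<Rightarrow> ipoint) \<Rightarrow> complex^2 \<Rightarrow> complex \<Rightarrow> complex^2 \<Rightarrow> ipoint" where
  "arm_map \<psi> c d = bmap (bmap (bmap \<psi> c) 0) (vector [d, 0])"

definition arm_point :: "ipoint \<Rightarrow> complex \<Rightarrow> ipoint" where
  "arm_point p d = Near (Near p None) (P1_inf d)"

lemma bmap_centre: "bmap \<psi> c 0 = Near (\<psi> c) None" "bmap (bmap \<psi> c) 0 (vector [d, 0]) = arm_point (\<psi> c) d"
  by (simp_all add: bmap_def P1_inf_def arm_point_def)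

text \<open>The composite of the three blow-downs. Along the curve \<open>w $ 1 = const\<close> the
  first coordinate expands in \<open>w $ 2\<close> with coefficient \<open>d\<close> in second order
  and \<open>w $ 1\<close> in third order; this form will be matched with the charts of the
  system.\<close>

lemma arm_map_eq:
  "arm_map \<psi> c d w = (if w $ 2 = 0 then Near (arm_point (\<psi> c) d) (P1_inf (w $ 1))
     else \<psi> (c + vector [(d + w $ 1 * w $ 2) * w $ 2 ^ 2, w $ 2]))"
proof (cases "w $ 2 = 0")
  case True
  then show ?thesis by (simp add: arm_map_def bmap_def[of _ "vector [d, 0]"] bmap_centre)
next
  case False
  have "arm_map \<psi> c d w = \<psi> (c + vector [(d + w $ 1 * w $ 2) * w $ 2 * w $ 2, w $ 2])"
    using False by (simp add: arm_map_def bmap_def)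
  with False show ?thesis by (simp add: power2_eq_square mult.assoc)
qed

text \<open>The second chart of an exceptional curve omits the direction in which the preceding
  curve passes, so a centre chosen in that chart is off the preceding curve.\<close>

lemma P1_inf_neq: "P1_inf w \<noteq> Some 0"
  by (simp add: P1_inf_def)

lemma restrict_atlasI: "(W, \<eta>) \<in> T \<Longrightarrow> W' = {v \<in> W. \<eta> v \<in> U} \<Longrightarrow> (W', \<eta>) \<in> restrict_atlas T U"
  unfolding restrict_atlas_iff by blast

lemma blow_up_keep:
  assumes "(W, \<eta>) \<in> A" "\<And>w. w \<in> W \<Longrightarrow> \<eta> w \<noteq> \<psi> c"
  shows "(W, \<eta>) \<in> blow_up_at A V \<psi> c"
proof -
  have "{w \<in> W. \<eta> w \<in> - {\<psi> c}} = W" using assms(2) by auto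
  then have "(W, \<eta>) \<in> restrict_atlas A (- {\<psi> c})" using restrict_atlasI[OF assms(1), of W "- {\<psi> c}"] by simp
  then show ?thesis by (simp add: blow_up_at_def)
qed

lemma arm_atlas_keep:
  assumes "(W, \<eta>) \<in> A" "\<And>w. w \<in> W \<Longrightarrow> \<eta> w \<noteq> \<psi> c \<and> \<eta> w \<noteq> Near (\<psi> c) None \<and> \<eta> w \<noteq> arm_point (\<psi> c) d"
  shows "(W, \<eta>) \<in> arm_atlas A V \<psi> c d"
  unfolding arm_atlas_def
  by (rule blow_up_keep, rule blow_up_keep, rule blow_up_keep[OF assms(1)])
    (use assms(2) in \<open>simp_all add: bmap_centre\<close>)

lemma stage_ends:
  assumes "stage A N E n \<gamma> T ends" "(k, k', q) \<in> ends"
  shows "k \<in> N" "k' \<in> N" "\<gamma> k = Near q" "Near q (Some 0) \<in> range (\<gamma> k')"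
    "j \<in> N \<Longrightarrow> Near q l \<in> range (\<gamma> j) \<Longrightarrow> j = k \<or> l = Some 0"
  using assms unfolding stage_def by simp_all

lemma stage_curve: "stage A N E n \<gamma> T ends \<Longrightarrow> i \<in> N \<Longrightarrow> curve A (\<gamma> i) (n i) (T i)"
  unfolding stage_def config_def by simp

lemma stage_no_Plane: "stage A N E n \<gamma> T ends \<Longrightarrow> i \<in> N \<Longrightarrow> i \<noteq> 0 \<Longrightarrow> range (\<gamma> i) \<inter> range Plane = {}"
  unfolding stage_def by simp

text \<open>The condition on \<open>V\<close> makes the new domains the whole coordinate plane. The
  curves \<open>k1\<close> and \<open>k2\<close> are created with number \<open>- 1\<close> and lose
  another \<open>1\<close> when the next centre is placed on them, while \<open>k3\<close> is left
  at \<open>- 1\<close>. The last clause keeps the charts of the line at infinity available for the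
  next arm.\<close>

lemma stage_arm:
  assumes S: "stage A N E n \<gamma> T ends" and N: "0 \<in> N" "k1 \<notin> N" "k2 \<notin> N" "k3 \<notin> N" "distinct [k1, k2, k3]"
    and ch: "(V, \<psi>) \<in> T 0" "{v. v $ 2 \<noteq> 0} \<subseteq> V" "c \<in> V" "c $ 2 = 0" "\<psi> c \<in> range Plane"
    and ends: "\<forall>e\<in>ends. fst e \<noteq> 0 \<and> fst (snd e) \<noteq> 0"
  shows "\<exists>\<gamma>' T'. stage (arm_atlas A V \<psi> c d) (N \<union> {k1, k2, k3}) (E \<union> {{0, k1}, {k1, k2}, {k2, k3}})
      (n(0 := n 0 - 1, k1 := - 2, k2 := - 2, k3 := - 1)) \<gamma>' T' (insert (k3, k2, arm_point (\<psi> c) d) ends) \<and>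
    (UNIV, arm_map \<psi> c d) \<in> arm_atlas A V \<psi> c d \<and>
    (\<forall>W \<eta>. (W, \<eta>) \<in> T 0 \<longrightarrow> (\<forall>w\<in>W. \<eta> w \<in> range Plane) \<longrightarrow> ({w \<in> W. \<eta> w \<in> - {\<psi> c}}, \<eta>) \<in> T' 0)"
proof -
  have k: "k1 \<noteq> 0" "k2 \<noteq> 0" "k3 \<noteq> 0" "k1 \<noteq> k2" "k2 \<noteq> k3" "k1 \<noteq> k3" using N by (metis distinct_length_2_or_more)+
  have dom: "bdom V c = UNIV"
  proof -
    have "c + vector [w $ 1 * w $ 2, w $ 2] \<in> V" for w :: "complex^2"
    proof (cases "w $ 2 = 0")
      case True
      then have "c + vector [w $ 1 * w $ 2, w $ 2] = c" by (simp add: vec2_eq_iff)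
      then show ?thesis using ch(3) by simp
    next
      case False
      then show ?thesis using ch(2,4) by auto
    qed
    then show ?thesis by (auto simp: bdom_def)
  qed
  have dom': "bdom UNIV x = UNIV" for x by (simp add: bdom_def)
  have ends': "a \<noteq> 0 \<and> b \<noteq> 0" if "(a, b, q) \<in> ends" for a b q using bspec[OF ends that] by simp
  have endsN: "a \<in> N \<and> b \<in> N" if "(a, b, q) \<in> ends" for a b q using stage_ends[OF S that] by simp
  let ?\<gamma>1 = "\<lambda>j. if j = k1 then Near (\<psi> c) else strict (\<psi> c) (\<gamma> j)"
  let ?T1 = "\<lambda>j. if j = k1 then {(UNIV, bmap \<psi> c)} else restrict_atlas (T j) (- {\<psi> c})"
  have off1: "\<psi> c \<notin> range (\<gamma> j)" if "j \<in> N" "j \<noteq> 0" for j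
    using stage_no_Plane[OF S that] ch(5) by blast
  have S1: "stage (blow_up_at A V \<psi> c) (insert k1 N) (insert {0, k1} E) (n(0 := n 0 - 1, k1 := - 1))
    ?\<gamma>1 ?T1 (insert (k1, 0, \<psi> c) ends)"
    using stage_blow_up[OF S N(1) ch(1,3,4) off1 N(2) k(1) order_refl ends'] unfolding dom .
  have off: "Near q l \<notin> range (\<gamma>' j)"
    if "stage A' N' E' n' \<gamma>' T' ends'" "(k, k', q) \<in> ends'" "j \<in> N'" "j \<noteq> k" "l \<noteq> Some 0"
    for A' N' E' n' \<gamma>' T' ends' k k' q j l
    using stage_ends(5)[OF that(1,2,3), of l] that(4,5) by blast
  let ?A1 = "blow_up_at A V \<psi> c"
  let ?n1 = "n(0 := n 0 - 1, k1 := - 1)"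
  let ?\<gamma>2 = "\<lambda>j. if j = k2 then Near (bmap \<psi> c 0) else strict (bmap \<psi> c 0) (?\<gamma>1 j)"
  let ?T2 = "\<lambda>j. if j = k2 then {(UNIV, bmap (bmap \<psi> c) 0)} else restrict_atlas (?T1 j) (- {bmap \<psi> c 0})"
  have S2: "stage (blow_up_at ?A1 UNIV (bmap \<psi> c) 0) (insert k2 (insert k1 N)) (insert {k1, k2} (insert {0, k1} E))
    (?n1(k1 := ?n1 k1 - 1, k2 := - 1)) ?\<gamma>2 ?T2 (insert (k2, k1, bmap \<psi> c 0) ends)"
  proof -
    have "(UNIV, bmap \<psi> c) \<in> ?T1 k1" "k1 \<in> insert k1 N" "k2 \<notin> insert k1 N" "(0::complex^2) $ 2 = 0" using k N by auto
    moreover have "bmap \<psi> c 0 \<notin> range (?\<gamma>1 j)" if "j \<in> insert k1 N" "j \<noteq> k1" for j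
      unfolding bmap_centre by (rule off[OF S1 insertI1 that]) simp
    moreover have "a \<noteq> k1 \<and> b \<noteq> k1" if "(a, b, q) \<in> ends" for a b q using endsN[OF that] N by auto
    ultimately show ?thesis
      using stage_blow_up[OF S1, of k1 UNIV "bmap \<psi> c" 0 k2 ends] k unfolding dom' by blast
  qed
  let ?A2 = "blow_up_at ?A1 UNIV (bmap \<psi> c) 0"
  let ?n2 = "?n1(k1 := ?n1 k1 - 1, k2 := - 1)"
  let ?p3 = "bmap (bmap \<psi> c) 0 (vector [d, 0])"
  let ?\<gamma>3 = "\<lambda>j. if j = k3 then Near ?p3 else strict ?p3 (?\<gamma>2 j)"
  let ?T3 = "\<lambda>j. if j = k3 then {(UNIV, arm_map \<psi> c d)} else restrict_atlas (?T2 j) (- {?p3})"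
  have S3: "stage (arm_atlas A V \<psi> c d) (insert k3 (insert k2 (insert k1 N)))
    (insert {k2, k3} (insert {k1, k2} (insert {0, k1} E)))
    (?n2(k2 := ?n2 k2 - 1, k3 := - 1)) ?\<gamma>3 ?T3 (insert (k3, k2, ?p3) ends)"
  proof -
    have "(UNIV, bmap (bmap \<psi> c) 0) \<in> ?T2 k2" "k2 \<in> insert k2 (insert k1 N)" "k3 \<notin> insert k2 (insert k1 N)"
      "(vector [d, 0]::complex^2) $ 2 = 0" using k N by auto
    moreover have "?p3 \<notin> range (?\<gamma>2 j)" if "j \<in> insert k2 (insert k1 N)" "j \<noteq> k2" for j
      unfolding bmap_centre(2) arm_point_def bmap_centre(1)[symmetric]
      by (rule off[OF S2 insertI1 that]) (rule P1_inf_neq)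
    moreover have "a \<noteq> k2 \<and> b \<noteq> k2" if "(a, b, q) \<in> ends" for a b q using endsN[OF that] N by auto
    ultimately show ?thesis
      using stage_blow_up[OF S2, of k2 UNIV "bmap (bmap \<psi> c) 0" "vector [d, 0]" k3 ends] k
      unfolding dom' arm_atlas_def arm_map_def by blast
  qed
  have n: "?n2(k2 := ?n2 k2 - 1, k3 := - 1) = n(0 := n 0 - 1, k1 := - 2, k2 := - 2, k3 := - 1)"
    using k by (auto simp: fun_eq_iff)
  have NE: "insert k3 (insert k2 (insert k1 N)) = N \<union> {k1, k2, k3}"
    "insert {k2, k3} (insert {k1, k2} (insert {0, k1} E)) = E \<union> {{0, k1}, {k1, k2}, {k2, k3}}"
    by (simp_all add: insert_commute)
  have "curve (arm_atlas A V \<psi> c d) (?\<gamma>3 k3) ((?n2(k2 := ?n2 k2 - 1, k3 := - 1)) k3) (?T3 k3)"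
    by (rule stage_curve[OF S3]) simp
  then have in3: "(UNIV, arm_map \<psi> c d) \<in> arm_atlas A V \<psi> c d" unfolding curve_def by simp
  \<comment> \<open>The second and third centres are infinitely near points, so a chart with values
    in the projective plane loses nothing beyond the first centre.\<close>
  have T0: "({w \<in> W. \<eta> w \<in> - {\<psi> c}}, \<eta>) \<in> ?T3 0" if W: "(W, \<eta>) \<in> T 0" "\<forall>w\<in>W. \<eta> w \<in> range Plane" for W \<eta>
  proof -
    have ne: "\<eta> w \<noteq> Near q l" if "w \<in> W" for w q l using W(2) that by fastforce
    have 1: "({w \<in> W. \<eta> w \<in> - {\<psi> c}}, \<eta>) \<in> restrict_atlas (T 0) (- {\<psi> c})"
      by (rule restrict_atlasI[OF W(1) refl])
    have 2: "({w \<in> W. \<eta> w \<in> - {\<psi> c}}, \<eta>)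
        \<in> restrict_atlas (restrict_atlas (T 0) (- {\<psi> c})) (- {bmap \<psi> c 0})"
      by (rule restrict_atlasI[OF 1]) (use ne in \<open>auto simp: bmap_centre\<close>)
    have "({w \<in> W. \<eta> w \<in> - {\<psi> c}}, \<eta>)
        \<in> restrict_atlas (restrict_atlas (restrict_atlas (T 0) (- {\<psi> c})) (- {bmap \<psi> c 0})) (- {?p3})"
      by (rule restrict_atlasI[OF 2]) (use ne in \<open>auto simp: bmap_centre arm_point_def\<close>)
    then show ?thesis using k by simp
  qed
  show ?thesis
  proof (rule exI[of _ ?\<gamma>3], rule exI[of _ ?T3], intro conjI)
    show "stage (arm_atlas A V \<psi> c d) (N \<union> {k1, k2, k3}) (E \<union> {{0, k1}, {k1, k2}, {k2, k3}})
      (n(0 := n 0 - 1, k1 := - 2, k2 := - 2, k3 := - 1)) ?\<gamma>3 ?T3 (insert (k3, k2, arm_point (\<psi> c) d) ends)"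
      using S3 unfolding n NE bmap_centre(2) .
    show "\<forall>W \<eta>. (W, \<eta>) \<in> T 0 \<longrightarrow> (\<forall>w\<in>W. \<eta> w \<in> range Plane) \<longrightarrow> ({w \<in> W. \<eta> w \<in> - {\<psi> c}}, \<eta>) \<in> ?T3 0"
      using T0 by blast
  qed (rule in3)
qed

section \<open>The surface of type \<open>E6\<close>\<close>

lemma stage_line: "stage projective_plane {0} {} (\<lambda>_. 1) (\<lambda>_. line) (\<lambda>_. {(UNIV, chartX), (UNIV, chartY)}) {}"
proof -
  have "range line \<inter> range chartZ = {}" unfolding disjoint_iff by (metis chartZ_line imageE)
  then show ?thesis
    unfolding stage_def config_def
    by (simp add: blown_up_plane.start compat_projective_plane unrelated_projective_plane curve_line points_projective_plane)
qed

text \<open>Two members with equal ranges would meet in that whole range; but they meet in at most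
  one point, and an embedded sphere has more.\<close>

lemma stage_curve_ranges_distinct:
  assumes "config A N E n \<gamma> T" "i \<in> N" "j \<in> N" "range (\<gamma> i) = range (\<gamma> j)"
  shows "i = j"
proof (rule ccontr)
  assume "i \<noteq> j"
  have inj: "inj (\<gamma> i)" using assms(1,2) unfolding config_def curve_def P1_embedding_def by blast
  have "if {i, j} \<in> E then crossing A (\<gamma> i) (\<gamma> j) else range (\<gamma> i) \<inter> range (\<gamma> j) = {}"
    using assms(1-3) \<open>i \<noteq> j\<close> unfolding config_def by blast
  then consider "range (\<gamma> i) = {}" | q where "range (\<gamma> i) = {q}"
    unfolding crossing_def assms(4)[symmetric] Int_absorb by (auto split: if_splits)
  then show False
  proof cases
    case 2
    then have "\<gamma> i None = q" "\<gamma> i (Some 0) = q" by blast+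
    then show False using injD[OF inj, of None "Some 0"] by simp
  qed simp
qed

lemma config_intersection_numbers:
  assumes "config A N E n \<gamma> T" "i \<in> N" "j \<in> N"
  shows "has_intersection_number A (\<gamma> i) (range (\<gamma> i)) (n i)"
    and "i \<noteq> j \<Longrightarrow> has_intersection_number A (\<gamma> i) (range (\<gamma> j)) (if {i, j} \<in> E then 1 else 0)"
proof -
  from assms have cA: "compat A" and ci: "curve A (\<gamma> i) (n i) (T i)" and cj: "curve A (\<gamma> j) (n j) (T j)"
    unfolding config_def by auto
  from ci obtain \<T> ord where "intersection_data A (\<gamma> i) (range (\<gamma> i)) \<T> ord" "n i = (\<Sum>\<zeta> | ord \<zeta> \<noteq> 0. ord \<zeta>)"
    unfolding curve_def by blast
  then show "has_intersection_number A (\<gamma> i) (range (\<gamma> i)) (n i)" by (rule has_intersection_numberI)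
  assume "i \<noteq> j"
  then have "if {i, j} \<in> E then crossing A (\<gamma> i) (\<gamma> j) else range (\<gamma> i) \<inter> range (\<gamma> j) = {}"
    using assms unfolding config_def by blast
  moreover have "P1_embedding A (\<gamma> i)" "closed_curve A (\<gamma> j)" using ci cj unfolding curve_def by auto
  ultimately show "has_intersection_number A (\<gamma> i) (range (\<gamma> j)) (if {i, j} \<in> E then 1 else 0)"
    using intersection_number_crossing[OF cA] intersection_number_disjoint[OF cA _ curve_points[OF ci]]
    by (auto split: if_splits)
qed

definition end_points :: "complex \<Rightarrow> complex \<Rightarrow> complex \<Rightarrow> ipoint set" where
  "end_points a b d = {arm_point (chartX (vector [1, 0])) a, arm_point (chartX (vector [- 1, 0])) b, arm_point (chartY 0) d}"

text \<open>Node \<open>0\<close> is the line at infinity and the arms are \<open>1, 2\<close>, then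
  \<open>3, 4\<close> and \<open>5, 6\<close>. The curves \<open>7\<close>, \<open>8\<close>,
  \<open>9\<close> that end the arms have self-intersection \<open>- 1\<close> and are not nodes:
  each belongs to the fibre except for its point on the preceding curve.\<close>

lemma E6_surface:
  fixes a b d :: complex
  obtains S \<gamma> where "blown_up_plane S" "compat S" "(UNIV, chartZ) \<in> S"
    "(UNIV, arm_map chartX (vector [1, 0]) a) \<in> S" "(UNIV, arm_map chartX (vector [- 1, 0]) b) \<in> S"
    "(UNIV, arm_map chartY 0 d) \<in> S"
    "\<forall>i\<in>E6_nodes. P1_embedding S (\<gamma> i)" "inj_on (\<lambda>i. range (\<gamma> i)) E6_nodes"
    "points S - (range chartZ \<union> (\<Union>q\<in>end_points a b d. range (\<lambda>w. Near q (P1_inf w)))) = (\<Union>i\<in>E6_nodes. range (\<gamma> i))"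
    "\<forall>i\<in>E6_nodes. has_intersection_number S (\<gamma> i) (range (\<gamma> i)) (- 2)"
    "\<forall>i\<in>E6_nodes. \<forall>j\<in>E6_nodes. i \<noteq> j \<longrightarrow>
       has_intersection_number S (\<gamma> i) (range (\<gamma> j)) (if {i, j} \<in> E6_edges then 1 else 0)"
proof -
  define p1 where "p1 = chartX (vector [1, 0])"
  define p2 where "p2 = chartX (vector [- 1, 0])"
  define p3 where "p3 = chartY 0"
  have Pl: "p1 \<in> range Plane" "p2 \<in> range Plane" "p3 \<in> range Plane" using line_Plane by (auto simp: p1_def p2_def p3_def)
  have off: "chartX v \<noteq> p1" "chartX v \<noteq> p2" "chartY v \<noteq> p1" "chartY v \<noteq> p2" "chartY v \<noteq> p3" if "v $ 2 \<noteq> 0" for v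
    using that by (auto simp: p1_def p2_def p3_def chartX_def chartY_def proj_point_eq_iff vec3_eq_iff)
  have ne: "chartX (vector [- 1, 0]) \<noteq> p1" "chartY 0 \<noteq> p1" "chartY 0 \<noteq> p2"
    by (auto simp: p1_def p2_def chartX_def chartY_def proj_point_eq_iff vec3_eq_iff)
  define A1 where "A1 = arm_atlas projective_plane UNIV chartX (vector [1, 0]) a"
  define V2 where "V2 = {v. chartX v \<in> - {p1}}"
  define A2 where "A2 = arm_atlas A1 V2 chartX (vector [- 1, 0]) b"
  \<comment> \<open>\<open>chartY\<close> also covers the first two base points, which are no longer
    present when the third arm is attached.\<close>
  define V3 where "V3 = {v \<in> {v. chartY v \<in> - {p1}}. chartY v \<in> - {p2}}"
  define A3 where "A3 = arm_atlas A2 V3 chartY 0 d"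
  define n1 :: "nat \<Rightarrow> int" where "n1 = (\<lambda>_. 1)(0 := 1 - 1, 1 := - 2, 2 := - 2, 7 := - 1)"
  define n2 where "n2 = n1(0 := n1 0 - 1, 3 := - 2, 4 := - 2, 8 := - 1)"
  define n where "n = n2(0 := n2 0 - 1, 5 := - 2, 6 := - 2, 9 := - 1)"
  have N1: "(0::nat) \<in> {0}" "(1::nat) \<notin> {0}" "(2::nat) \<notin> {0}" "(7::nat) \<notin> {0}" "distinct [1, 2, 7 :: nat]"
    by simp_all
  have c1: "(UNIV, chartX) \<in> {(UNIV, chartX), (UNIV, chartY)}" "{v. v $ 2 \<noteq> 0} \<subseteq> (UNIV :: (complex^2) set)"
    "vector [1, 0] \<in> (UNIV :: (complex^2) set)" "(vector [1, 0] :: complex^2) $ 2 = 0" by simp_all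
  have e1: "\<forall>e\<in>{} :: (nat \<times> nat \<times> ipoint) set. fst e \<noteq> (0::nat) \<and> fst (snd e) \<noteq> (0::nat)" by simp
  from stage_arm[OF stage_line N1 c1 Pl(1)[unfolded p1_def] e1, where d = a, folded A1_def p1_def n1_def]
  obtain \<gamma>1 T1 where
    S1: "stage A1 ({0} \<union> {1, 2, 7}) ({} \<union> {{0, 1}, {1, 2}, {2, 7}}) n1 \<gamma>1 T1 {(7, 2, arm_point p1 a)}"
    and ch1: "(UNIV, arm_map chartX (vector [1, 0]) a) \<in> A1"
    and T1: "\<forall>W \<eta>. (W, \<eta>) \<in> {(UNIV, chartX), (UNIV, chartY)} \<longrightarrow> (\<forall>w\<in>W. \<eta> w \<in> range Plane) \<longrightarrow>
      ({w \<in> W. \<eta> w \<in> - {p1}}, \<eta>) \<in> T1 0"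
    by (elim exE conjE) (rule that)
  have T1': "(V2, chartX) \<in> T1 0" "({v. chartY v \<in> - {p1}}, chartY) \<in> T1 0"
    using T1[rule_format, of UNIV chartX] T1[rule_format, of UNIV chartY] line_Plane unfolding V2_def by simp_all
  have V2: "{v. v $ 2 \<noteq> 0} \<subseteq> V2" "vector [- 1, 0] \<in> V2" using off ne by (auto simp: V2_def)
  have N2: "(0::nat) \<in> {0} \<union> {1, 2, 7}" "(3::nat) \<notin> {0} \<union> {1, 2, 7}" "(4::nat) \<notin> {0} \<union> {1, 2, 7}"
    "(8::nat) \<notin> {0} \<union> {1, 2, 7}" "distinct [3, 4, 8 :: nat]" by simp_all
  have z2: "(vector [- 1, 0] :: complex^2) $ 2 = 0" by simp
  have e2: "\<forall>e\<in>{(7 :: nat, 2 :: nat, arm_point p1 a)}. fst e \<noteq> (0::nat) \<and> fst (snd e) \<noteq> (0::nat)" by simp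
  from stage_arm[OF S1 N2 T1'(1) V2 z2 Pl(2)[unfolded p2_def] e2, where d = b, folded A2_def p2_def n2_def]
  obtain \<gamma>2 T2 where
    S2: "stage A2 ({0} \<union> {1, 2, 7} \<union> {3, 4, 8}) ({} \<union> {{0, 1}, {1, 2}, {2, 7}} \<union> {{0, 3}, {3, 4}, {4, 8}})
      n2 \<gamma>2 T2 {(8, 4, arm_point p2 b), (7, 2, arm_point p1 a)}"
    and ch2: "(UNIV, arm_map chartX (vector [- 1, 0]) b) \<in> A2"
    and T2: "\<forall>W \<eta>. (W, \<eta>) \<in> T1 0 \<longrightarrow> (\<forall>w\<in>W. \<eta> w \<in> range Plane) \<longrightarrow> ({w \<in> W. \<eta> w \<in> - {p2}}, \<eta>) \<in> T2 0"
    by (elim exE conjE) (rule that)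
  have T2': "(V3, chartY) \<in> T2 0"
    using T2[rule_format, OF T1'(2)] line_Plane(4) unfolding V3_def by simp
  have V3: "{v. v $ 2 \<noteq> 0} \<subseteq> V3" "0 \<in> V3" using off ne by (auto simp: V3_def)
  have N3: "(0::nat) \<in> {0} \<union> {1, 2, 7} \<union> {3, 4, 8}" "(5::nat) \<notin> {0} \<union> {1, 2, 7} \<union> {3, 4, 8}"
    "(6::nat) \<notin> {0} \<union> {1, 2, 7} \<union> {3, 4, 8}" "(9::nat) \<notin> {0} \<union> {1, 2, 7} \<union> {3, 4, 8}"
    "distinct [5, 6, 9 :: nat]" by simp_all
  have z3: "(0 :: complex^2) $ 2 = 0" by simp
  have e3: "\<forall>e\<in>{(8 :: nat, 4 :: nat, arm_point p2 b), (7, 2, arm_point p1 a)}. fst e \<noteq> (0::nat) \<and> fst (snd e) \<noteq> (0::nat)" by simp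
  from stage_arm[OF S2 N3 T2' V3 z3 Pl(3)[unfolded p3_def] e3, where d = d, folded A3_def p3_def n_def]
  obtain \<gamma> T where
    S3: "stage A3 ({0} \<union> {1, 2, 7} \<union> {3, 4, 8} \<union> {5, 6, 9})
      ({} \<union> {{0, 1}, {1, 2}, {2, 7}} \<union> {{0, 3}, {3, 4}, {4, 8}} \<union> {{0, 5}, {5, 6}, {6, 9}}) n
      \<gamma> T {(9, 6, arm_point p3 d), (8, 4, arm_point p2 b), (7, 2, arm_point p1 a)}"
    and ch3: "(UNIV, arm_map chartY 0 d) \<in> A3"
    by (elim exE conjE) (rule that)
  define N where "N = {0} \<union> {1, 2, 7} \<union> {3, 4, 8} \<union> {5, 6, 9 :: nat}"
  define E where "E = {} \<union> {{0, 1}, {1, 2}, {2, 7}} \<union> {{0, 3}, {3, 4}, {4, 8}} \<union> {{0, 5}, {5, 6}, {6, 9 :: nat}}"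
  define ends where "ends = {(9 :: nat, 6 :: nat, arm_point p3 d), (8, 4, arm_point p2 b), (7, 2, arm_point p1 a)}"
  have St: "stage A3 N E n \<gamma> T ends" using S3 unfolding N_def E_def ends_def .
  then have C: "config A3 N E n \<gamma> T" and B: "blown_up_plane A3" unfolding stage_def by simp_all
  have nodes: "E6_nodes = {0, 1, 2, 3, 4, 5, 6}" unfolding E6_nodes_def by auto
  have sub: "E6_nodes \<subseteq> N" unfolding nodes N_def by auto
  have Nodes: "N = E6_nodes \<union> {7, 8, 9}" unfolding nodes N_def by auto
  have ni: "n i = - 2" if "i \<in> E6_nodes" for i
  proof -
    have "i = 0 \<or> i = 1 \<or> i = 2 \<or> i = 3 \<or> i = 4 \<or> i = 5 \<or> i = 6" using that unfolding nodes by simp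
    then show ?thesis by (elim disjE) (simp_all add: n_def n2_def n1_def)
  qed
  have Ei: "{i, j} \<in> E \<longleftrightarrow> {i, j} \<in> E6_edges" if "i \<in> E6_nodes" "j \<in> E6_nodes" for i j
  proof -
    have E: "e \<in> E \<longleftrightarrow> e \<in> E6_edges \<or> e = {2, 7} \<or> e = {4, 8} \<or> e = {6, 9}" for e
      unfolding E_def E6_edges_def Un_iff insert_iff by (simp only: empty_iff simp_thms disj_ac)
    have "7 \<notin> {i, j}" "8 \<notin> {i, j}" "9 \<notin> {i, j}" using that unfolding nodes by auto
    then have "{i, j} \<noteq> {2, 7}" "{i, j} \<noteq> {4, 8}" "{i, j} \<noteq> {6, 9}" by (metis insertCI)+
    with E show ?thesis by simp
  qed
  \<comment> \<open>Charts of the affine plane and of earlier arms avoid the centres of a later arm.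
    Their points are affine or lie one level above some \<open>arm_point\<close>, while a centre is
    a point of the line, a direction at it, or an \<open>arm_point\<close> itself.\<close>
  have keep: "x \<noteq> p \<and> x \<noteq> Near p None \<and> x \<noteq> arm_point p e"
    if "x \<in> range chartZ \<union> range (Near (arm_point q e'))" "p \<in> range line" for x p e q e'
  proof -
    have p: "p \<in> range Plane" "p \<notin> range chartZ" using that(2) line_Plane chartZ_line by blast+
    then have "p \<notin> range chartZ \<union> range (Near (arm_point q e'))" by auto
    with that(1) have "x \<noteq> p" by metis
    moreover have "x \<in> range Plane \<union> range (Near (arm_point q e'))" 
      using that(1) image_subsetI[of UNIV chartZ "range Plane", OF line_Plane(2)] by blast
    ultimately show ?thesis using p(1) by (auto simp: arm_point_def)
  qed
  have pl: "p1 \<in> range line" "p2 \<in> range line" "p3 \<in> range line"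
    unfolding p1_def p2_def p3_def chartX_line chartY_line by auto
  have am: "arm_map \<psi> c e w \<in> range chartZ \<union> range (Near (arm_point (\<psi> c) e))"
    if "\<psi> \<in> {chartX, chartY}" "c $ 2 = 0" for \<psi> c e w
  proof (cases "w $ 2 = 0")
    case True
    then show ?thesis by (simp add: arm_map_eq)
  next
    case False
    have "\<psi> v \<in> range chartZ" if "v $ 2 \<noteq> 0" for v
    proof -
      have "chartX v \<in> points projective_plane" "chartY v \<in> points projective_plane"
        using plane_charts_in unfolding points_iff by blast+
      then show ?thesis using \<open>\<psi> \<in> _\<close> that chartX_line[of v] chartY_line[of v] unfolding points_projective_plane by auto
    qed
    then show ?thesis using False that(2) by (simp add: arm_map_eq)
  qed
  show ?thesis
  proof (rule that[of A3 \<gamma>])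
    show "blown_up_plane A3" by fact
    show "compat A3" using C unfolding config_def by blast
    have kZ: "chartZ w \<noteq> p \<and> chartZ w \<noteq> Near p None \<and> chartZ w \<noteq> arm_point p e" if "p \<in> range line" for w p e
      by (rule keep, rule UnI1, rule rangeI, rule that)
    have "(UNIV, chartZ) \<in> A1" unfolding A1_def
      by (rule arm_atlas_keep[OF plane_charts_in(1)]) (rule kZ[OF pl(1), unfolded p1_def])
    then have "(UNIV, chartZ) \<in> A2" unfolding A2_def
      by (rule arm_atlas_keep) (rule kZ[OF pl(2), unfolded p2_def])
    then show "(UNIV, chartZ) \<in> A3" unfolding A3_def
      by (rule arm_atlas_keep) (rule kZ[OF pl(3), unfolded p3_def])
    have am1: "chartX \<in> {chartX, chartY}" "(vector [1, 0] :: complex^2) $ 2 = 0" by simp_all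
    have am2: "chartX \<in> {chartX, chartY}" "(vector [- 1, 0] :: complex^2) $ 2 = 0" by simp_all
    have k1: "(UNIV, arm_map chartX (vector [1, 0]) a) \<in> A2" unfolding A2_def
      by (rule arm_atlas_keep[OF ch1]) (rule keep[OF am[OF am1] pl(2), unfolded p2_def])
    show "(UNIV, arm_map chartX (vector [1, 0]) a) \<in> A3" unfolding A3_def
      by (rule arm_atlas_keep[OF k1]) (rule keep[OF am[OF am1] pl(3), unfolded p3_def])
    show "(UNIV, arm_map chartX (vector [- 1, 0]) b) \<in> A3" unfolding A3_def
      by (rule arm_atlas_keep[OF ch2]) (rule keep[OF am[OF am2] pl(3), unfolded p3_def])
    show "(UNIV, arm_map chartY 0 d) \<in> A3" by fact
    show "\<forall>i\<in>E6_nodes. P1_embedding A3 (\<gamma> i)" using C sub unfolding config_def curve_def by blast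
    show "inj_on (\<lambda>i. range (\<gamma> i)) E6_nodes"
      by (rule inj_onI) (rule stage_curve_ranges_distinct[OF C], use sub in auto)
    show "\<forall>i\<in>E6_nodes. has_intersection_number A3 (\<gamma> i) (range (\<gamma> i)) (- 2)"
    proof
      fix i assume i: "i \<in> E6_nodes"
      from config_intersection_numbers(1)[OF C, of i i] i sub ni[OF i]
      show "has_intersection_number A3 (\<gamma> i) (range (\<gamma> i)) (- 2)" by auto
    qed
    show "\<forall>i\<in>E6_nodes. \<forall>j\<in>E6_nodes. i \<noteq> j \<longrightarrow>
       has_intersection_number A3 (\<gamma> i) (range (\<gamma> j)) (if {i, j} \<in> E6_edges then 1 else 0)"
    proof (intro ballI impI)
      fix i j assume ij: "i \<in> E6_nodes" "j \<in> E6_nodes" "i \<noteq> j"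
      from config_intersection_numbers(2)[OF C, of i j] ij sub
      show "has_intersection_number A3 (\<gamma> i) (range (\<gamma> j)) (if {i, j} \<in> E6_edges then 1 else 0)"
        unfolding Ei[OF ij(1,2), symmetric] by blast
    qed
    from St have pts: "points A3 = range chartZ \<union> (\<Union>i\<in>N. range (\<gamma> i))"
      and aff: "\<And>i. i \<in> N \<Longrightarrow> range (\<gamma> i) \<inter> range chartZ = {}"
      and en: "\<And>k k' q. (k, k', q) \<in> ends \<Longrightarrow> \<gamma> k = Near q \<and> Near q (Some 0) \<in> range (\<gamma> k') \<and>
        (\<forall>j\<in>N. \<forall>l. Near q l \<in> range (\<gamma> j) \<longrightarrow> j = k \<or> l = Some 0)"
      using stage_ends[OF St] unfolding stage_def by simp_all
    have ep: "q \<in> end_points a b d \<longleftrightarrow> (\<exists>k k'. (k, k', q) \<in> ends)" for q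
      unfolding end_points_def ends_def p1_def p2_def p3_def by auto
    have ek: "k \<in> {7, 8, 9} \<and> k' \<in> E6_nodes" if "(k, k', q) \<in> ends" for k k' q
      using that unfolding ends_def nodes by auto
    have ke: "\<exists>k' q. (k, k', q) \<in> ends" if "k \<in> {7, 8, 9}" for k
      using that unfolding ends_def by auto
    show "points A3 - (range chartZ \<union> (\<Union>q\<in>end_points a b d. range (\<lambda>w. Near q (P1_inf w)))) = (\<Union>i\<in>E6_nodes. range (\<gamma> i))"
    proof (intro equalityI subsetI)
      fix x assume x: "x \<in> points A3 - (range chartZ \<union> (\<Union>q\<in>end_points a b d. range (\<lambda>w. Near q (P1_inf w))))"
      then obtain i where i: "i \<in> N" "x \<in> range (\<gamma> i)" unfolding pts by blast
      show "x \<in> (\<Union>i\<in>E6_nodes. range (\<gamma> i))"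
      proof (cases "i \<in> E6_nodes")
        case True
        then show ?thesis using i by blast
      next
        case False
        then have "i \<in> {7, 8, 9}" using i(1) Nodes by blast
        from ke[OF this] obtain k' q where e: "(i, k', q) \<in> ends" by blast
        from en[OF e] i(2) obtain l where l: "x = Near q l" by auto
        have "q \<in> end_points a b d" using ep e by blast
        \<comment> \<open>The only direction outside the range of \<open>P1_inf\<close> is
          \<open>Some 0\<close>, the common point of the last curve and its predecessor.\<close>
        then have "l \<noteq> P1_inf w" for w using x l by blast
        then have "l = Some 0"
        proof (cases l)
          case None
          then show ?thesis using \<open>\<And>w. l \<noteq> P1_inf w\<close>[of 0] by (simp add: P1_inf_def)
        next
          case (Some z)
          then show ?thesis using \<open>\<And>w. l \<noteq> P1_inf w\<close>[of "1 / z"] by (cases "z = 0") (auto simp: P1_inf_def)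
        qed
        with en[OF e] l have "x \<in> range (\<gamma> k')" by simp
        with ek[OF e] show ?thesis by blast
      qed
    next
      fix x assume "x \<in> (\<Union>i\<in>E6_nodes. range (\<gamma> i))"
      then obtain i where i: "i \<in> E6_nodes" "x \<in> range (\<gamma> i)" by blast
      then have iN: "i \<in> N" using sub by blast
      have "x \<notin> range chartZ" using aff[OF iN] i(2) by blast
      moreover have "x \<noteq> Near q (P1_inf w)" if "q \<in> end_points a b d" for q w
      proof
        assume x: "x = Near q (P1_inf w)"
        from that ep obtain k k' where e: "(k, k', q) \<in> ends" by blast
        have "i = k" using stage_ends(5)[OF St e iN, of "P1_inf w"] i(2) x P1_inf_neq[of w] by simp
        with ek[OF e] i(1) show False unfolding nodes by auto
      qed
      moreover have "x \<in> points A3" unfolding pts using i(2) iN by blast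
      ultimately show "x \<in> points A3 - (range chartZ \<union> (\<Union>q\<in>end_points a b d. range (\<lambda>w. Near q (P1_inf w))))" by blast
    qed
  qed
qed

section \<open>Polynomial and regular functions of two variables\<close>

lemma poly2_const: "poly2 (\<lambda>_. c)"
  unfolding poly2_def by (rule exI[of _ "[:[:c:]:]"]) simp

lemma poly2_fst: "poly2 (\<lambda>z. z $ 1)"
  unfolding poly2_def by (rule exI[of _ "[:0, 1:]"]) simp

lemma poly2_snd: "poly2 (\<lambda>z. z $ 2)"
  unfolding poly2_def by (rule exI[of _ "[:[:0, 1:]:]"]) simp

lemma poly2_add:
  assumes "poly2 f" "poly2 g"
  shows "poly2 (\<lambda>z. f z + g z)"
proof -
  from assms obtain P Q where "\<forall>z. f z = poly (poly P [:z $ 1:]) (z $ 2)" "\<forall>z. g z = poly (poly Q [:z $ 1:]) (z $ 2)"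
    unfolding poly2_def by blast
  then show ?thesis unfolding poly2_def by (intro exI[of _ "P + Q"]) simp
qed

lemma poly2_mult:
  assumes "poly2 f" "poly2 g"
  shows "poly2 (\<lambda>z. f z * g z)"
proof -
  from assms obtain P Q where "\<forall>z. f z = poly (poly P [:z $ 1:]) (z $ 2)" "\<forall>z. g z = poly (poly Q [:z $ 1:]) (z $ 2)"
    unfolding poly2_def by blast
  then show ?thesis unfolding poly2_def by (intro exI[of _ "P * Q"]) simp
qed

lemma poly2_minus: "poly2 f \<Longrightarrow> poly2 (\<lambda>z. - f z)"
  using poly2_mult[OF poly2_const[of "-1"], of f] by simp

lemma poly2_diff: "poly2 f \<Longrightarrow> poly2 g \<Longrightarrow> poly2 (\<lambda>z. f z - g z)"
  using poly2_add[of f "\<lambda>z. - g z"] poly2_minus[of g] by simp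

lemma poly2_power: "poly2 f \<Longrightarrow> poly2 (\<lambda>z. f z ^ n)"
  by (induction n) (auto intro: poly2_const poly2_mult)

lemmas poly2_intros = poly2_const poly2_fst poly2_snd poly2_add poly2_mult poly2_minus poly2_diff poly2_power

lemma poly2_coeffs:
  assumes "poly2 f"
  obtains N :: nat and c :: "nat \<Rightarrow> nat \<Rightarrow> complex" where "\<And>z. f z = (\<Sum>a\<le>N. \<Sum>b\<le>N. c a b * z $ 1 ^ a * z $ 2 ^ b)"
proof -
  from assms obtain P where P: "\<And>z. f z = poly (poly P [:z $ 1:]) (z $ 2)" unfolding poly2_def by blast
  \<comment> \<open>A common bound for the outer degree and for all inner degrees; the sums may run
    up to it because the missing coefficients are zero.\<close>
  define N where "N = degree P + (\<Sum>a\<le>degree P. degree (coeff P a))"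
  have deg: "degree (coeff P a) \<le> N" for a
  proof (cases "a \<le> degree P")
    case True
    then have "degree (coeff P a) \<le> (\<Sum>a\<le>degree P. degree (coeff P a))"
      by (intro member_le_sum) auto
    then show ?thesis by (simp add: N_def)
  next
    case False
    then show ?thesis by (simp add: coeff_eq_0)
  qed
  have poly_N: "poly p x = (\<Sum>i\<le>N. coeff p i * x ^ i)" if "degree p \<le> N" for p :: "'a :: comm_semiring_1 poly" and x
    unfolding poly_altdef by (rule sum.mono_neutral_left) (use that in \<open>auto simp: coeff_eq_0\<close>)
  have "f z = (\<Sum>a\<le>N. \<Sum>b\<le>N. coeff (coeff P a) b * z $ 1 ^ a * z $ 2 ^ b)" for z
  proof -
    have "f z = (\<Sum>a\<le>N. poly (coeff P a) (z $ 2) * z $ 1 ^ a)"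
      unfolding P by (subst poly_N) (simp_all add: N_def poly_sum poly_power)
    also have "\<dots> = (\<Sum>a\<le>N. (\<Sum>b\<le>N. coeff (coeff P a) b * z $ 2 ^ b) * z $ 1 ^ a)"
      by (simp only: poly_N[OF deg])
    also have "\<dots> = (\<Sum>a\<le>N. \<Sum>b\<le>N. coeff (coeff P a) b * z $ 1 ^ a * z $ 2 ^ b)"
      by (simp add: sum_distrib_right sum_distrib_left mult_ac)
    finally show ?thesis .
  qed
  then show ?thesis by (rule that)
qed

lemma holo_on_sum: "(\<And>i. i \<in> I \<Longrightarrow> holo_on S (f i)) \<Longrightarrow> holo_on S (\<lambda>v. \<Sum>i\<in>I. f i v)"
  by (induction I rule: infinite_finite_induct) (auto intro: holo_on_const holo_on_add)

lemma poly2_holo: "poly2 f \<Longrightarrow> holo_on S f"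
proof -
  assume "poly2 f"
  then obtain N c where "\<And>z. f z = (\<Sum>a\<le>N. \<Sum>b\<le>N. c a b * z $ 1 ^ a * z $ 2 ^ b)" by (rule poly2_coeffs) (rule that)
  then have "f = (\<lambda>z. \<Sum>a\<le>(N::nat). \<Sum>b\<le>N. c a b * z $ 1 ^ a * z $ 2 ^ b)" by (simp add: fun_eq_iff)
  then show ?thesis by (auto intro!: holo_on_sum holo_intros)
qed

text \<open>On the complex line through \<open>z\<close> and \<open>z0\<close> the polynomial is an
  entire function of one variable with a nonzero value at the parameter \<open>1\<close>. By the
  identity theorem it cannot vanish on the nonempty open set of parameters that land in
  \<open>O'\<close>.\<close>

lemma poly2_nonzero_dense:
  assumes "poly2 h" "h z0 \<noteq> 0" "open O'" "z \<in> O'"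
  obtains w where "w \<in> O'" "h w \<noteq> 0"
proof -
  define l where "l t = z + t *s (z0 - z)" for t :: complex
  have vl: "vholomorphic_on l UNIV"
    unfolding vholomorphic_on_def l_def by (auto intro!: holomorphic_intros)
  have hl: "(\<lambda>t. h (l t)) holomorphic_on UNIV"
    by (rule holomorphic_on_holo_compose[OF vl open_UNIV poly2_holo[OF assms(1)]]) auto
  have op: "open (l -` O')"
    using vholomorphic_on_imp_continuous_on[OF vl] assms(3) by (auto simp: continuous_on_open_vimage)
  have "\<exists>t\<in>l -` O'. h (l t) \<noteq> 0"
  proof (rule ccontr)
    assume "\<not> ?thesis"
    then have z: "h (l t) = 0" if "t \<in> l -` O'" for t using that by blast
    have "0 \<in> l -` O'" using assms(4) by (simp add: l_def)
    then have ne: "l -` O' \<noteq> {}" by blast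
    have "h (l 1) = 0"
      by (rule analytic_continuation_open[OF op open_UNIV ne connected_UNIV subset_UNIV hl holomorphic_on_const z UNIV_I])
    with assms(2) show False by (simp add: l_def)
  qed
  then obtain t where "l t \<in> O'" "h (l t) \<noteq> 0" by auto
  then show ?thesis by (rule that)
qed

lemma regular_atI: "poly2 n \<Longrightarrow> poly2 d \<Longrightarrow> d p \<noteq> 0 \<Longrightarrow> (\<And>z. d z \<noteq> 0 \<Longrightarrow> f z = n z / d z) \<Longrightarrow> regular_at f p"
  unfolding regular_at_def by blast

lemma regular_at_poly2: "poly2 f \<Longrightarrow> regular_at f p"
  by (rule regular_atI[OF _ poly2_const[of 1]]) auto

lemma regular_at_add:
  assumes "regular_at f p" "regular_at g p"
  shows "regular_at (\<lambda>z. f z + g z) p"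
proof -
  from assms obtain n d m e where "poly2 n" "poly2 d" "d p \<noteq> 0" "\<And>z. d z \<noteq> 0 \<Longrightarrow> f z = n z / d z"
    "poly2 m" "poly2 e" "e p \<noteq> 0" "\<And>z. e z \<noteq> 0 \<Longrightarrow> g z = m z / e z" unfolding regular_at_def by metis
  then show ?thesis
    by (intro regular_atI[of "\<lambda>z. n z * e z + m z * d z" "\<lambda>z. d z * e z"])
      (auto intro!: poly2_intros simp: field_simps)
qed

lemma regular_at_mult:
  assumes "regular_at f p" "regular_at g p"
  shows "regular_at (\<lambda>z. f z * g z) p"
proof -
  from assms obtain n d m e where "poly2 n" "poly2 d" "d p \<noteq> 0" "\<And>z. d z \<noteq> 0 \<Longrightarrow> f z = n z / d z"
    "poly2 m" "poly2 e" "e p \<noteq> 0" "\<And>z. e z \<noteq> 0 \<Longrightarrow> g z = m z / e z" unfolding regular_at_def by metis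
  then show ?thesis
    by (intro regular_atI[of "\<lambda>z. n z * m z" "\<lambda>z. d z * e z"])
      (auto intro!: poly2_intros simp: field_simps)
qed

lemma regular_at_const: "regular_at (\<lambda>_. c) p"
  by (rule regular_at_poly2[OF poly2_const])

lemma regular_at_minus: "regular_at f p \<Longrightarrow> regular_at (\<lambda>z. - f z) p"
  using regular_at_mult[OF regular_at_const[of "-1"], of f] by simp

lemma regular_at_diff: "regular_at f p \<Longrightarrow> regular_at g p \<Longrightarrow> regular_at (\<lambda>z. f z - g z) p"
  using regular_at_add[of f p "\<lambda>z. - g z"] regular_at_minus[of g p] by simp

lemma regular_at_power: "regular_at f p \<Longrightarrow> regular_at (\<lambda>z. f z ^ n) p"
  by (induction n) (auto intro: regular_at_const regular_at_mult)

lemma regular_at_divide: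
  assumes "regular_at f p" "regular_at g p" "g p \<noteq> 0"
  shows "regular_at (\<lambda>z. f z / g z) p"
proof -
  from assms obtain n d m e where *: "poly2 n" "poly2 d" "d p \<noteq> 0" "\<And>z. d z \<noteq> 0 \<Longrightarrow> f z = n z / d z"
    "poly2 m" "poly2 e" "e p \<noteq> 0" "\<And>z. e z \<noteq> 0 \<Longrightarrow> g z = m z / e z" unfolding regular_at_def by metis
  then have "m p \<noteq> 0" using assms(3) by auto
  show ?thesis
  \<comment> \<open>The fraction is extended by \<open>e z\<close>, so that a nonzero denominator
    implies \<open>e z \<noteq> 0\<close>; the representation of \<open>g\<close> is known only
    there.\<close>
  proof (rule regular_atI[of "\<lambda>z. n z * e z ^ 2" "\<lambda>z. d z * m z * e z"])
    show "poly2 (\<lambda>z. n z * e z ^ 2)" "poly2 (\<lambda>z. d z * m z * e z)" by (intro poly2_intros *)+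
    show "d p * m p * e p \<noteq> 0" using * \<open>m p \<noteq> 0\<close> by simp
    fix z assume "d z * m z * e z \<noteq> 0"
    then have z: "d z \<noteq> 0" "m z \<noteq> 0" "e z \<noteq> 0" by auto
    show "f z / g z = n z * e z ^ 2 / (d z * m z * e z)"
      unfolding *(4)[OF z(1)] *(8)[OF z(3)] using z by (simp add: field_simps power2_eq_square)
  qed
qed

lemmas regular_intros = regular_at_const regular_at_poly2[OF poly2_fst] regular_at_poly2[OF poly2_snd]
  regular_at_add regular_at_mult regular_at_minus regular_at_diff regular_at_power regular_at_divide

lemma regular_at_isCont:
  assumes "regular_at f p"
  shows "isCont f p"
proof -
  from assms obtain n d where *: "poly2 n" "poly2 d" "d p \<noteq> 0" "\<And>z. d z \<noteq> 0 \<Longrightarrow> f z = n z / d z"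
    unfolding regular_at_def by metis
  have c: "continuous_on UNIV n" "continuous_on UNIV d"
    using holo_on_imp_continuous_on poly2_holo *(1,2) by blast+
  then have "isCont (\<lambda>z. n z / d z) p"
    using *(3) by (intro continuous_intros) (auto simp: continuous_on_eq_continuous_at)
  moreover have "open {z. d z \<noteq> 0}" using c by (intro open_Collect_neq continuous_intros)
  then have "\<forall>\<^sub>F z in nhds p. f z = n z / d z"
    using *(3,4) by (auto simp: eventually_nhds intro!: exI[of _ "{z. d z \<noteq> 0}"])
  ultimately show ?thesis by (simp add: isCont_cong)
qed

lemma regular_map_at_isCont:
  assumes "regular_map_at F p"
  shows "isCont F p"
  unfolding isCont_def
  by (rule vec_tendstoI) (use assms regular_at_isCont in \<open>auto simp: regular_map_at_def isCont_def\<close>)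

lemma regular_map_at_vector:
  "regular_at f p \<Longrightarrow> regular_at g p \<Longrightarrow> regular_map_at (\<lambda>z. vector [f z, g z]) p"
  by (simp add: regular_map_at_def forall_2)

lemma regular_map_at_nth: "regular_map_at F p \<Longrightarrow> regular_at (\<lambda>z. F z $ i) p"
  by (simp add: regular_map_at_def)

section \<open>The charts and their inverses\<close>

text \<open>Chart 1 solved for the original coordinates: \<open>x = 1 / x_1\<close> and
  \<open>y = x + a / x - y_1 / x^2\<close> with \<open>a = (\<alpha> - 2 s) / 2\<close>. Charts 2
  and 3 are solved in the same way.\<close>

definition ichart :: "complex \<Rightarrow> complex \<Rightarrow> nat \<Rightarrow> complex^2 \<Rightarrow> complex^2" where
  "ichart \<alpha> s j w =
     (if j = 0 then vector [w $ 1, w $ 2]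
      else if j = 1 then vector [1 / w $ 1, 1 / w $ 1 + (\<alpha> - 2 * s) / 2 * w $ 1 - w $ 2 * w $ 1 ^ 2]
      else if j = 2 then vector [1 / w $ 1, - 1 / w $ 1 - (\<alpha> + 2 * s) / 2 * w $ 1 - w $ 2 * w $ 1 ^ 2]
      else vector [- w $ 1 * w $ 2 ^ 2 - 2 * s * w $ 2, 1 / w $ 2])"

text \<open>One condition for two purposes: it describes the points \<open>(x, y)\<close> where
  chart \<open>j\<close> is regular and also the points of chart \<open>j\<close> that lie over the
  affine plane. This is possible because the coordinate concerned is merely replaced by its
  reciprocal.\<close>

definition finite_part :: "nat \<Rightarrow> complex^2 \<Rightarrow> bool" where
  "finite_part j w \<longleftrightarrow> (if j = 0 then True else if j = 1 \<or> j = 2 then w $ 1 \<noteq> 0 else w $ 2 \<noteq> 0)"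

abbreviation "J \<equiv> {0, 1, 2, 3 :: nat}"

lemma chart_simps:
  "chart \<alpha> s 0 z = vector [z $ 1, z $ 2]"
  "chart \<alpha> s (Suc 0) z = vector [1 / z $ 1, - ((z $ 2 - z $ 1) * z $ 1 - (\<alpha> - 2 * s) / 2) * z $ 1]"
  "chart \<alpha> s 2 z = vector [1 / z $ 1, - ((z $ 2 + z $ 1) * z $ 1 + (\<alpha> + 2 * s) / 2) * z $ 1]"
  "chart \<alpha> s 3 z = vector [- (z $ 1 * z $ 2 + 2 * s) * z $ 2, 1 / z $ 2]"
  by (simp_all add: chart_def Let_def)

lemma ichart_simps:
  "ichart \<alpha> s 0 w = vector [w $ 1, w $ 2]"
  "ichart \<alpha> s (Suc 0) w = vector [1 / w $ 1, 1 / w $ 1 + (\<alpha> - 2 * s) / 2 * w $ 1 - w $ 2 * w $ 1 ^ 2]"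
  "ichart \<alpha> s 2 w = vector [1 / w $ 1, - 1 / w $ 1 - (\<alpha> + 2 * s) / 2 * w $ 1 - w $ 2 * w $ 1 ^ 2]"
  "ichart \<alpha> s 3 w = vector [- w $ 1 * w $ 2 ^ 2 - 2 * s * w $ 2, 1 / w $ 2]"
  by (simp_all add: ichart_def)

lemma finite_part_simps:
  "finite_part 0 w" "finite_part (Suc 0) w \<longleftrightarrow> w $ 1 \<noteq> 0" "finite_part 2 w \<longleftrightarrow> w $ 1 \<noteq> 0" "finite_part 3 w \<longleftrightarrow> w $ 2 \<noteq> 0"
  by (simp_all add: finite_part_def)

lemma J_cases: "j \<in> J \<Longrightarrow> (j = 0 \<Longrightarrow> P) \<Longrightarrow> (j = Suc 0 \<Longrightarrow> P) \<Longrightarrow> (j = 2 \<Longrightarrow> P) \<Longrightarrow> (j = 3 \<Longrightarrow> P) \<Longrightarrow> P"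
  by auto

lemmas chart_all_simps = chart_simps ichart_simps finite_part_simps

lemma chart_ichart: "j \<in> J \<Longrightarrow> finite_part j w \<Longrightarrow> chart \<alpha> s j (ichart \<alpha> s j w) = w"
  by (erule J_cases; simp add: chart_all_simps vec2_eq_iff; simp add: field_simps power2_eq_square)

lemma ichart_chart: "j \<in> J \<Longrightarrow> finite_part j z \<Longrightarrow> ichart \<alpha> s j (chart \<alpha> s j z) = z"
  by (erule J_cases; simp add: chart_all_simps vec2_eq_iff; simp add: field_simps power2_eq_square)

lemma finite_part_chart: "j \<in> J \<Longrightarrow> finite_part j z \<Longrightarrow> finite_part j (chart \<alpha> s j z)"
  and finite_part_ichart: "j \<in> J \<Longrightarrow> finite_part j z \<Longrightarrow> finite_part j (ichart \<alpha> s j z)"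
  by (erule J_cases; simp add: chart_all_simps)+

lemma regular_chart_compose:
  "j \<in> J \<Longrightarrow> regular_map_at F p \<Longrightarrow> finite_part j (F p) \<Longrightarrow> regular_map_at (\<lambda>z. chart \<alpha> s j (F z)) p"
  by (erule J_cases; simp add: chart_all_simps;
      intro regular_map_at_vector regular_intros regular_map_at_nth; simp)

lemma regular_ichart_compose:
  "j \<in> J \<Longrightarrow> regular_map_at F p \<Longrightarrow> finite_part j (F p) \<Longrightarrow> regular_map_at (\<lambda>z. ichart \<alpha> s j (F z)) p"
  by (erule J_cases; simp add: chart_all_simps;
      intro regular_map_at_vector regular_intros regular_map_at_nth; simp)

lemma regular_map_at_id: "regular_map_at (\<lambda>z. z) p"
  unfolding regular_map_at_def forall_2 by (intro conjI regular_intros)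

text \<open>The product \<open>x y\<close> is one test polynomial for all charts, as they are
  regular outside its zeros.\<close>

lemma generically_finite:
  assumes "\<And>z. z $ 1 \<noteq> 0 \<Longrightarrow> z $ 2 \<noteq> 0 \<Longrightarrow> Q z"
  shows "generically Q"
  unfolding generically_def
proof (intro exI conjI)
  show "poly2 (\<lambda>z. z $ 1 * z $ 2)" by (intro poly2_intros)
  show "(vector [1, 1] :: complex^2) $ 1 * (vector [1, 1] :: complex^2) $ 2 \<noteq> 0" by simp
qed (use assms in auto)

lemma finite_part_generic: "z $ 1 \<noteq> 0 \<Longrightarrow> z $ 2 \<noteq> 0 \<Longrightarrow> finite_part j z"
  by (simp add: finite_part_def)

lemma birational_chart:
  assumes "j \<in> J"
  shows "birational (chart \<alpha> s j)"
  unfolding birational_def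
proof (intro conjI exI)
  have f: "finite_part j (vector [1, 1])" by (simp add: finite_part_def)
  show "regular_map_at (chart \<alpha> s j) (vector [1, 1])"
    using regular_chart_compose[OF assms regular_map_at_id f] .
  show "regular_map_at (ichart \<alpha> s j) (vector [1, 1])"
    using regular_ichart_compose[OF assms regular_map_at_id f] .
  show "generically (\<lambda>z. ichart \<alpha> s j (chart \<alpha> s j z) = z)" "generically (\<lambda>w. chart \<alpha> s j (ichart \<alpha> s j w) = w)"
    using ichart_chart[OF assms] chart_ichart[OF assms] by (auto intro!: generically_finite simp: finite_part_generic)
qed

text \<open>A rational function cannot be regular where it has a pole: the identity \<open>x * (1 / x) = 1\<close>
  extends to all points of regularity by continuity.\<close>

lemma regular_reciprocal:
  assumes "regular_at (\<lambda>z. 1 / z $ i) p" "i = 1 \<or> i = 2"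
  shows "p $ i \<noteq> 0"
proof
  assume "p $ i = 0"
  define l where "l t = p + t *s (axis i 1 :: complex^2)" for t :: complex
  have l: "(l \<longlongrightarrow> p) (at 0)"
  proof -
    have "isCont l 0"
      unfolding l_def isCont_def by (rule vec_tendstoI) (auto intro!: tendsto_eq_intros)
    then show ?thesis by (simp add: isCont_def l_def)
  qed
  from isCont_tendsto_compose[OF regular_at_isCont[OF assms(1)] l]
  have "((\<lambda>t. t * (1 / l t $ i)) \<longlongrightarrow> 0 * (1 / p $ i)) (at 0)" by (intro tendsto_mult tendsto_ident_at)
  moreover have "\<forall>\<^sub>F t in at 0. t * (1 / l t $ i) = 1"
    using \<open>p $ i = 0\<close> by (auto simp: l_def eventually_at intro!: exI[of _ 1])
  ultimately have "((\<lambda>_. 1) \<longlongrightarrow> 0 * (1 / p $ i)) (at (0::complex))"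
    by (rule Lim_transform_eventually)
  then show False by (simp add: tendsto_const_iff)
qed

text \<open>Each of charts 1 to 3 has the reciprocal of \<open>x\<close> or of \<open>y\<close> as a
  coordinate, so its regularity excludes a zero of that variable.\<close>

lemma regular_chart_finite:
  assumes "j \<in> J" "regular_map_at (chart \<alpha> s j) p"
  shows "finite_part j p"
proof -
  have r: "regular_at (\<lambda>z. chart \<alpha> s j z $ i) p" for i using assms(2) by (simp add: regular_map_at_def)
  from assms(1) show ?thesis
    by (rule J_cases) (use r[of 1] r[of 2] regular_reciprocal[of _ p] in \<open>simp_all add: chart_all_simps\<close>)
qed

text \<open>The differential at \<open>p\<close>, read off from the expansions
  \<open>y_1 = x^3 - x^2 y + a x\<close>, \<open>y_2 = - x^3 - x^2 y - b x\<close> and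
  \<open>x_3 = - x y^2 - 2 s y\<close>, where \<open>a = (\<alpha> - 2 s) / 2\<close> and
  \<open>b = (\<alpha> + 2 s) / 2\<close>.\<close>

definition dchart :: "complex \<Rightarrow> complex \<Rightarrow> nat \<Rightarrow> complex^2 \<Rightarrow> complex^2 \<Rightarrow> complex^2" where
  "dchart \<alpha> s j p u =
     (if j = 0 then vector [u $ 1, u $ 2]
      else if j = 1 then vector [- u $ 1 / p $ 1 ^ 2,
        (- 2 * p $ 1 * p $ 2 + 3 * p $ 1 ^ 2 + (\<alpha> - 2 * s) / 2) * u $ 1 - p $ 1 ^ 2 * u $ 2]
      else if j = 2 then vector [- u $ 1 / p $ 1 ^ 2,
        (- 2 * p $ 1 * p $ 2 - 3 * p $ 1 ^ 2 - (\<alpha> + 2 * s) / 2) * u $ 1 - p $ 1 ^ 2 * u $ 2]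
      else vector [(- 2 * p $ 1 * p $ 2 - 2 * s) * u $ 2 - p $ 2 ^ 2 * u $ 1, - u $ 2 / p $ 2 ^ 2])"

lemma dchart_simps:
  "dchart \<alpha> s 0 p u = vector [u $ 1, u $ 2]"
  "dchart \<alpha> s (Suc 0) p u = vector [- u $ 1 / p $ 1 ^ 2,
     (- 2 * p $ 1 * p $ 2 + 3 * p $ 1 ^ 2 + (\<alpha> - 2 * s) / 2) * u $ 1 - p $ 1 ^ 2 * u $ 2]"
  "dchart \<alpha> s 2 p u = vector [- u $ 1 / p $ 1 ^ 2,
     (- 2 * p $ 1 * p $ 2 - 3 * p $ 1 ^ 2 - (\<alpha> + 2 * s) / 2) * u $ 1 - p $ 1 ^ 2 * u $ 2]"
  "dchart \<alpha> s 3 p u = vector [(- 2 * p $ 1 * p $ 2 - 2 * s) * u $ 2 - p $ 2 ^ 2 * u $ 1, - u $ 2 / p $ 2 ^ 2]"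
  by (simp_all add: dchart_def)

lemma has_derivative_chart:
  assumes "j \<in> J" "finite_part j p"
  shows "(chart \<alpha> s j has_derivative dchart \<alpha> s j p) (at p)"
proof -
  have c: "((\<lambda>z :: complex^2. z $ i) has_derivative (\<lambda>u. u $ i)) (at p)" for i
    by (auto intro!: bounded_linear_imp_has_derivative bounded_linear_vec_nth)
  have "((\<lambda>z. chart \<alpha> s j z $ i) has_derivative (\<lambda>u. dchart \<alpha> s j p u $ i)) (at p)" for i
    using assms(1)
  proof (rule J_cases)
    assume j: "j = 0"
    show ?thesis using exhaust_2[of i] c unfolding j chart_simps dchart_simps by (elim disjE) auto
  next
    assume j: "j = Suc 0"
    then have "p $ 1 \<noteq> 0" using assms(2) by (simp add: finite_part_simps)
    then show ?thesis
      using exhaust_2[of i] unfolding j chart_simps dchart_simps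
      by (elim disjE) (auto intro!: derivative_eq_intros c simp: fun_eq_iff field_simps power2_eq_square)
  next
    assume j: "j = 2"
    then have "p $ 1 \<noteq> 0" using assms(2) by (simp add: finite_part_simps)
    then show ?thesis
      using exhaust_2[of i] unfolding j chart_simps dchart_simps
      by (elim disjE) (auto intro!: derivative_eq_intros c simp: fun_eq_iff field_simps power2_eq_square)
  next
    assume j: "j = 3"
    then have "p $ 2 \<noteq> 0" using assms(2) by (simp add: finite_part_simps)
    then show ?thesis
      using exhaust_2[of i] unfolding j chart_simps dchart_simps
      by (elim disjE) (auto intro!: derivative_eq_intros c simp: fun_eq_iff field_simps power2_eq_square)
  qed
  from has_derivative_vec[OF this] show ?thesis by simp
qed

text \<open>The differentials are triangular. Apart from the identity chart, their diagonal entries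
  are \<open>- 1 / x^2\<close> and \<open>- x^2\<close>, or \<open>- y^2\<close> and
  \<open>- 1 / y^2\<close>, so the determinant is \<open>1\<close>.\<close>

lemma symplectic_chart:
  assumes "j \<in> J"
  shows "symplectic (chart \<alpha> s j)"
  unfolding symplectic_def
proof (intro allI impI)
  fix p assume "regular_map_at (chart \<alpha> s j) p"
  with assms have f: "finite_part j p" by (rule regular_chart_finite)
  have "dchart \<alpha> s j p u $ 1 * dchart \<alpha> s j p v $ 2 - dchart \<alpha> s j p u $ 2 * dchart \<alpha> s j p v $ 1 =
      u $ 1 * v $ 2 - u $ 2 * v $ 1" for u v
    using assms by (rule J_cases) (use f in \<open>simp_all add: dchart_simps finite_part_simps field_simps\<close>)
  with has_derivative_chart[OF assms f]
  show "\<exists>L. (chart \<alpha> s j has_derivative L) (at p) \<and>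
      (\<forall>u v. L u $ 1 * L v $ 2 - L u $ 2 * L v $ 1 = u $ 1 * v $ 2 - u $ 2 * v $ 1)" by blast
qed

section \<open>The glued space\<close>

lemma vholo_ichart:
  assumes "j \<in> J"
  shows "vholo_on {w. finite_part j w} (ichart \<alpha> s j)"
  using assms
proof (rule J_cases)
  assume "j = 0"
  then show ?thesis unfolding vholo_on_def forall_2 by (auto simp: chart_all_simps intro!: holo_intros)
next
  assume "j = Suc 0"
  then show ?thesis unfolding vholo_on_def forall_2 by (auto simp: chart_all_simps intro!: holo_intros)
next
  assume "j = 2"
  then show ?thesis unfolding vholo_on_def forall_2 by (auto simp: chart_all_simps intro!: holo_intros)
next
  assume "j = 3"
  then show ?thesis unfolding vholo_on_def forall_2 by (auto simp: chart_all_simps intro!: holo_intros)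
qed

lemma vholo_chart:
  assumes "j \<in> J"
  shows "vholo_on {w. finite_part j w} (chart \<alpha> s j)"
  using assms
proof (rule J_cases)
  assume "j = 0"
  then show ?thesis unfolding vholo_on_def forall_2 by (auto simp: chart_all_simps intro!: holo_intros)
next
  assume "j = Suc 0"
  then show ?thesis unfolding vholo_on_def forall_2 by (auto simp: chart_all_simps intro!: holo_intros)
next
  assume "j = 2"
  then show ?thesis unfolding vholo_on_def forall_2 by (auto simp: chart_all_simps intro!: holo_intros)
next
  assume "j = 3"
  then show ?thesis unfolding vholo_on_def forall_2 by (auto simp: chart_all_simps intro!: holo_intros)
qed

lemma open_finite_part: "open {w. finite_part j w}"
  unfolding finite_part_def
  by (cases "j = 0"; cases "j = 1 \<or> j = 2"; simp; intro open_Collect_neq continuous_intros)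

text \<open>By continuity, points identified by a biregular map are adherent, and comparing coordinates
  shows that adherent points are the same. This computes the gluing relation, and since adherence is a
  closed relation it also gives the Hausdorff property.\<close>

definition adherent :: "complex \<Rightarrow> complex \<Rightarrow> nat \<Rightarrow> nat \<Rightarrow> complex^2 \<Rightarrow> complex^2 \<Rightarrow> bool" where
  "adherent \<alpha> s j k p q \<longleftrightarrow>
     (\<forall>e>0. \<exists>z. z $ 1 \<noteq> 0 \<and> z $ 2 \<noteq> 0 \<and> dist (chart \<alpha> s j z) p < e \<and> dist (chart \<alpha> s k z) q < e)"

text \<open>The first alternative takes care of the points that a chart adds to the affine plane;
  the second compares two points through the point \<open>(x, y)\<close> below them.\<close>

definition same_point :: "complex \<Rightarrow> complex \<Rightarrow> nat \<Rightarrow> nat \<Rightarrow> complex^2 \<Rightarrow> complex^2 \<Rightarrow> bool" where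
  "same_point \<alpha> s j k p q \<longleftrightarrow>
     j = k \<and> p = q \<or> finite_part j p \<and> finite_part k q \<and> ichart \<alpha> s j p = ichart \<alpha> s k q"

lemma adherent_sym: "adherent \<alpha> s j k p q \<Longrightarrow> adherent \<alpha> s k j q p"
  unfolding adherent_def by metis

lemma same_point_sym: "same_point \<alpha> s j k p q \<Longrightarrow> same_point \<alpha> s k j q p"
  unfolding same_point_def by metis

text \<open>A coordinate identity that holds generically on the plane passes to adherent pairs by
  continuity.\<close>

lemma adherent_limit:
  assumes "adherent \<alpha> s j k p q" "continuous_on UNIV (\<lambda>x. P (fst x) (snd x))"
    and "\<And>z. z $ 1 \<noteq> 0 \<Longrightarrow> z $ 2 \<noteq> 0 \<Longrightarrow> P (chart \<alpha> s j z) (chart \<alpha> s k z) = (0 :: complex)"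
  shows "P p q = 0"
proof (rule ccontr)
  assume "P p q \<noteq> 0"
  have "isCont (\<lambda>x. P (fst x) (snd x)) (p, q)" using assms(2) by (simp add: continuous_on_eq_continuous_at)
  then obtain d where d: "d > 0" "\<And>x. dist x (p, q) < d \<Longrightarrow> dist (P (fst x) (snd x)) (P p q) < norm (P p q)"
    unfolding continuous_at_eps_delta using \<open>P p q \<noteq> 0\<close> by (metis fst_conv snd_conv zero_less_norm_iff)
  from assms(1) d(1) obtain z where z: "z $ 1 \<noteq> 0" "z $ 2 \<noteq> 0" "dist (chart \<alpha> s j z) p < d / 2" "dist (chart \<alpha> s k z) q < d / 2"
    unfolding adherent_def by (meson half_gt_zero)
  have "dist (chart \<alpha> s j z, chart \<alpha> s k z) (p, q) \<le> dist (chart \<alpha> s j z) p + dist (chart \<alpha> s k z) q"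
    by (simp add: dist_Pair_Pair sqrt_sum_squares_le_sum)
  also have "\<dots> < d" using z by simp
  finally have "dist (P (chart \<alpha> s j z) (chart \<alpha> s k z)) (P p q) < norm (P p q)"
    using d(2)[of "(chart \<alpha> s j z, chart \<alpha> s k z)"] by simp
  with assms(3)[OF z(1,2)] show False by simp
qed

lemma adherent_coord:
  fixes f g :: "complex^2 \<Rightarrow> complex^2 \<Rightarrow> complex"
  assumes "adherent \<alpha> s j k p q" "continuous_on UNIV (\<lambda>x. f (fst x) (snd x))" "continuous_on UNIV (\<lambda>x. g (fst x) (snd x))"
    and "\<And>z. z $ 1 \<noteq> 0 \<Longrightarrow> z $ 2 \<noteq> 0 \<Longrightarrow> f (chart \<alpha> s j z) (chart \<alpha> s k z) = g (chart \<alpha> s j z) (chart \<alpha> s k z)"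
  shows "f p q = g p q"
proof -
  have "f p q - g p q = 0"
    by (rule adherent_limit[OF assms(1) continuous_on_diff[OF assms(2,3)]]) (simp add: assms(4))
  then show ?thesis by simp
qed

text \<open>For each pair of charts, two identities between the coordinates are cleared of
  denominators and passed to the limit. One of them could not hold if the coordinate to be inverted
  were zero; once this is known, the denominators are restored and the points are seen to
  coincide.\<close>

lemma adherent_imp_same_point_less:
  assumes "j \<in> J" "k \<in> J" "j < k" "adherent \<alpha> s j k p q"
  shows "same_point \<alpha> s j k p q"
proof -
  note lim = adherent_coord[OF assms(4)]
  from assms(1-3) consider "j = 0" "k = Suc 0" | "j = 0" "k = 2" | "j = 0" "k = 3" | "j = Suc 0" "k = 2"
    | "j = Suc 0" "k = 3" | "j = 2" "k = 3" by auto
  then show ?thesis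
  proof cases
    case 1
    have a: "p $ 1 * q $ 1 = 1"
      by (rule lim[of "\<lambda>p q. p $ 1 * q $ 1" "\<lambda>p q. 1"]) (auto intro!: continuous_intros simp: 1 chart_simps)
    have b: "q $ 2 = - ((p $ 2 - p $ 1) * p $ 1 - (\<alpha> - 2 * s) / 2) * p $ 1"
      by (rule lim[of "\<lambda>p q. q $ 2" "\<lambda>p q. - ((p $ 2 - p $ 1) * p $ 1 - (\<alpha> - 2 * s) / 2) * p $ 1"])
        (auto intro!: continuous_intros simp: 1 chart_simps)
    from a have nz: "p $ 1 \<noteq> 0" by auto
    then have c: "q $ 1 = 1 / p $ 1" using a by (simp add: eq_divide_eq mult.commute)
    have "finite_part k p" using nz by (simp add: 1 finite_part_simps)
    moreover have "q = chart \<alpha> s k p" unfolding vec2_eq_iff using b c by (simp add: 1 chart_simps)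
    moreover have "ichart \<alpha> s j p = p" by (simp add: 1 chart_all_simps vec2_eq_iff)
    ultimately show ?thesis using ichart_chart[OF assms(2)] finite_part_chart[OF assms(2)] 1
      by (simp add: same_point_def finite_part_simps)
  next
    case 2
    have a: "p $ 1 * q $ 1 = 1"
      by (rule lim[of "\<lambda>p q. p $ 1 * q $ 1" "\<lambda>p q. 1"]) (auto intro!: continuous_intros simp: 2 chart_simps)
    have b: "q $ 2 = - ((p $ 2 + p $ 1) * p $ 1 + (\<alpha> + 2 * s) / 2) * p $ 1"
      by (rule lim[of "\<lambda>p q. q $ 2" "\<lambda>p q. - ((p $ 2 + p $ 1) * p $ 1 + (\<alpha> + 2 * s) / 2) * p $ 1"])
        (auto intro!: continuous_intros simp: 2 chart_simps)
    from a have nz: "p $ 1 \<noteq> 0" by auto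
    then have c: "q $ 1 = 1 / p $ 1" using a by (simp add: eq_divide_eq mult.commute)
    have "finite_part k p" using nz by (simp add: 2 finite_part_simps)
    moreover have "q = chart \<alpha> s k p" unfolding vec2_eq_iff using b c by (simp add: 2 chart_simps)
    moreover have "ichart \<alpha> s j p = p" by (simp add: 2 chart_all_simps vec2_eq_iff)
    ultimately show ?thesis using ichart_chart[OF assms(2)] finite_part_chart[OF assms(2)] 2
      by (simp add: same_point_def finite_part_simps)
  next
    case 3
    have a: "p $ 2 * q $ 2 = 1"
      by (rule lim[of "\<lambda>p q. p $ 2 * q $ 2" "\<lambda>p q. 1"]) (auto intro!: continuous_intros simp: 3 chart_simps)
    have b: "q $ 1 = - (p $ 1 * p $ 2 + 2 * s) * p $ 2"
      by (rule lim[of "\<lambda>p q. q $ 1" "\<lambda>p q. - (p $ 1 * p $ 2 + 2 * s) * p $ 2"])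
        (auto intro!: continuous_intros simp: 3 chart_simps)
    from a have nz: "p $ 2 \<noteq> 0" by auto
    then have c: "q $ 2 = 1 / p $ 2" using a by (simp add: eq_divide_eq mult.commute)
    have "finite_part k p" using nz by (simp add: 3 finite_part_simps)
    moreover have "q = chart \<alpha> s k p" unfolding vec2_eq_iff using b c by (simp add: 3 chart_simps)
    moreover have "ichart \<alpha> s j p = p" by (simp add: 3 chart_all_simps vec2_eq_iff)
    ultimately show ?thesis using ichart_chart[OF assms(2)] finite_part_chart[OF assms(2)] 3
      by (simp add: same_point_def finite_part_simps)
  next
    case 4
    have a: "p $ 1 = q $ 1"
      by (rule lim[of "\<lambda>p q. p $ 1" "\<lambda>p q. q $ 1"]) (auto intro!: continuous_intros simp: 4 chart_simps)
    \<comment> \<open>The relation \<open>y_1 - y_2 = 2 x^3 + \<alpha> x\<close> multiplied by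
      \<open>x_1^3\<close>. For \<open>x_1 = 0\<close> it would read \<open>0 = 2\<close>, which
      keeps apart the points added by charts 1 and 2.\<close>
    have b: "p $ 1 ^ 3 * (p $ 2 - q $ 2) = 2 + 2 * \<alpha> / 2 * p $ 1 ^ 2"
      by (rule lim[of "\<lambda>p q. p $ 1 ^ 3 * (p $ 2 - q $ 2)" "\<lambda>p q. 2 + 2 * \<alpha> / 2 * p $ 1 ^ 2"])
        (auto intro!: continuous_intros simp: 4 chart_simps field_simps power2_eq_square power3_eq_cube)
    then have nz: "p $ 1 \<noteq> 0" by auto
    have e: "1 / p $ 1 + (\<alpha> - 2 * s) / 2 * p $ 1 - p $ 2 * p $ 1 ^ 2 = - 1 / p $ 1 - (\<alpha> + 2 * s) / 2 * p $ 1 - q $ 2 * p $ 1 ^ 2" (is "?l = ?r")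
    proof -
      have "?l - ?r = (2 + 2 * \<alpha> / 2 * p $ 1 ^ 2 - p $ 1 ^ 3 * (p $ 2 - q $ 2)) / p $ 1"
        using nz by (simp add: field_simps power2_eq_square power3_eq_cube)
      then have "?l - ?r = 0" unfolding b by (simp only: diff_self div_0)
      then show ?thesis by (simp only: right_minus_eq)
    qed
    have "ichart \<alpha> s j p = ichart \<alpha> s k q"
      unfolding 4 ichart_simps vec2_eq_iff vector_2 using e by (simp only: a simp_thms)
    then show ?thesis using a nz by (simp add: same_point_def 4 finite_part_simps)
  next
    case 5
    have a: "p $ 1 * (- q $ 1 * q $ 2 ^ 2 - 2 * s * q $ 2) = 1"
      by (rule lim[of "\<lambda>p q. p $ 1 * (- q $ 1 * q $ 2 ^ 2 - 2 * s * q $ 2)" "\<lambda>p q. 1"])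
        (auto intro!: continuous_intros simp: 5 chart_simps field_simps power2_eq_square)
    \<comment> \<open>The value \<open>1 / y_3\<close> of \<open>y\<close> is equated with the
      expression of \<open>y\<close> in chart 1 and cleared of denominators.\<close>
    have b: "q $ 2 * (1 + (\<alpha> - 2 * s) / 2 * p $ 1 ^ 2 - p $ 2 * p $ 1 ^ 3) = p $ 1"
      by (rule lim[of "\<lambda>p q. q $ 2 * (1 + (\<alpha> - 2 * s) / 2 * p $ 1 ^ 2 - p $ 2 * p $ 1 ^ 3)" "\<lambda>p q. p $ 1"])
        (auto intro!: continuous_intros simp: 5 chart_simps field_simps power2_eq_square power3_eq_cube)
    from a have nz: "p $ 1 \<noteq> 0" by auto
    with b have nz2: "q $ 2 \<noteq> 0" by auto
    have "1 / p $ 1 = - q $ 1 * q $ 2 ^ 2 - 2 * s * q $ 2" using a nz by (simp add: field_simps)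
    moreover have "1 / p $ 1 + (\<alpha> - 2 * s) / 2 * p $ 1 - p $ 2 * p $ 1 ^ 2 = 1 / q $ 2"
    proof -
      have "1 / q $ 2 = (1 + (\<alpha> - 2 * s) / 2 * p $ 1 ^ 2 - p $ 2 * p $ 1 ^ 3) / p $ 1"
        using b nz nz2 by (simp add: frac_eq_eq mult.commute)
      also have "\<dots> = 1 / p $ 1 + (\<alpha> - 2 * s) / 2 * p $ 1 - p $ 2 * p $ 1 ^ 2"
        using nz by (simp add: field_simps power2_eq_square power3_eq_cube)
      finally show ?thesis by simp
    qed
    ultimately show ?thesis using nz nz2 by (simp add: same_point_def 5 chart_all_simps)
  next
    case 6
    have a: "p $ 1 * (- q $ 1 * q $ 2 ^ 2 - 2 * s * q $ 2) = 1"
      by (rule lim[of "\<lambda>p q. p $ 1 * (- q $ 1 * q $ 2 ^ 2 - 2 * s * q $ 2)" "\<lambda>p q. 1"])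
        (auto intro!: continuous_intros simp: 6 chart_simps field_simps power2_eq_square)
    have b: "q $ 2 * (- 1 - (\<alpha> + 2 * s) / 2 * p $ 1 ^ 2 - p $ 2 * p $ 1 ^ 3) = p $ 1"
      by (rule lim[of "\<lambda>p q. q $ 2 * (- 1 - (\<alpha> + 2 * s) / 2 * p $ 1 ^ 2 - p $ 2 * p $ 1 ^ 3)" "\<lambda>p q. p $ 1"])
        (auto intro!: continuous_intros simp: 6 chart_simps field_simps power2_eq_square power3_eq_cube)
    from a have nz: "p $ 1 \<noteq> 0" by auto
    with b have nz2: "q $ 2 \<noteq> 0" by auto
    have "1 / p $ 1 = - q $ 1 * q $ 2 ^ 2 - 2 * s * q $ 2" using a nz by (simp add: field_simps)
    moreover have "- 1 / p $ 1 - (\<alpha> + 2 * s) / 2 * p $ 1 - p $ 2 * p $ 1 ^ 2 = 1 / q $ 2"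
    proof -
      have "1 / q $ 2 = (- 1 - (\<alpha> + 2 * s) / 2 * p $ 1 ^ 2 - p $ 2 * p $ 1 ^ 3) / p $ 1"
        using b nz nz2 by (simp add: frac_eq_eq mult.commute)
      also have "\<dots> = - 1 / p $ 1 - (\<alpha> + 2 * s) / 2 * p $ 1 - p $ 2 * p $ 1 ^ 2"
        using nz by (simp add: field_simps power2_eq_square power3_eq_cube)
      finally show ?thesis by simp
    qed
    ultimately show ?thesis using nz nz2 by (simp add: same_point_def 6 chart_all_simps)
  qed
qed

lemma adherent_imp_same_point:
  assumes "j \<in> J" "k \<in> J" "adherent \<alpha> s j k p q"
  shows "same_point \<alpha> s j k p q"
proof -
  consider "j < k" | "k < j" | "j = k" by linarith
  then show ?thesis
  proof cases
    case 1
    then show ?thesis by (rule adherent_imp_same_point_less[OF assms(1,2) _ assms(3)])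
  next
    case 2
    from adherent_imp_same_point_less[OF assms(2,1) this adherent_sym[OF assms(3)]] show ?thesis
      by (rule same_point_sym)
  next
    case 3
    have "p $ i = q $ i" for i
      by (rule adherent_coord[OF assms(3), of "\<lambda>p q. p $ i" "\<lambda>p q. q $ i"]) (auto intro!: continuous_intros simp: 3)
    with 3 show ?thesis by (simp add: same_point_def vec_eq_iff)
  qed
qed

text \<open>The polynomial is built from the denominators and numerators of \<open>x\<close> and
  \<open>y\<close> as functions of the coordinates of chart \<open>j\<close>.\<close>

lemma generic_ichart:
  assumes "j \<in> J"
  obtains h where "poly2 h" "\<exists>w. h w \<noteq> 0"
    "\<And>w. h w \<noteq> 0 \<Longrightarrow> finite_part j w \<and> ichart \<alpha> s j w $ 1 \<noteq> 0 \<and> ichart \<alpha> s j w $ 2 \<noteq> 0"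
  using assms
proof (rule J_cases)
  assume "j = 0"
  show ?thesis
    by (rule that[of "\<lambda>w. w $ 1 * w $ 2"])
      (auto intro!: poly2_intros exI[of _ "vector [1, 1]"] simp: \<open>j = 0\<close> chart_all_simps)
next
  assume j: "j = Suc 0"
  show ?thesis
  proof (rule that[of "\<lambda>w. w $ 1 * (1 + (\<alpha> - 2 * s) / 2 * w $ 1 ^ 2 - w $ 2 * w $ 1 ^ 3)"])
    fix w :: "complex^2" assume *: "w $ 1 * (1 + (\<alpha> - 2 * s) / 2 * w $ 1 ^ 2 - w $ 2 * w $ 1 ^ 3) \<noteq> 0"
    then have "w $ 1 \<noteq> 0" by auto
    then have "ichart \<alpha> s j w $ 2 = (1 + (\<alpha> - 2 * s) / 2 * w $ 1 ^ 2 - w $ 2 * w $ 1 ^ 3) / w $ 1"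
      by (simp add: j chart_all_simps field_simps power2_eq_square power3_eq_cube)
    with * show "finite_part j w \<and> ichart \<alpha> s j w $ 1 \<noteq> 0 \<and> ichart \<alpha> s j w $ 2 \<noteq> 0"
      by (simp add: j chart_all_simps)
  next
    \<comment> \<open>A second coordinate equal to the constant of the chart makes the quadratic and
      cubic terms cancel at first coordinate \<open>1\<close>.\<close>
    have "(1::complex) * (1 + x * 1 ^ 2 - x * 1 ^ 3) \<noteq> 0" for x by simp
    from this[of "(\<alpha> - 2 * s) / 2"]
    show "\<exists>w :: complex^2. w $ 1 * (1 + (\<alpha> - 2 * s) / 2 * w $ 1 ^ 2 - w $ 2 * w $ 1 ^ 3) \<noteq> 0"
      by (intro exI[of _ "vector [1, (\<alpha> - 2 * s) / 2]"]) (simp only: vector_2 not_False_eq_True)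
  qed (intro poly2_intros)
next
  assume j: "j = 2"
  show ?thesis
  proof (rule that[of "\<lambda>w. w $ 1 * (- 1 - (\<alpha> + 2 * s) / 2 * w $ 1 ^ 2 - w $ 2 * w $ 1 ^ 3)"])
    fix w :: "complex^2" assume *: "w $ 1 * (- 1 - (\<alpha> + 2 * s) / 2 * w $ 1 ^ 2 - w $ 2 * w $ 1 ^ 3) \<noteq> 0"
    then have "w $ 1 \<noteq> 0" by auto
    then have "ichart \<alpha> s j w $ 2 = (- 1 - (\<alpha> + 2 * s) / 2 * w $ 1 ^ 2 - w $ 2 * w $ 1 ^ 3) / w $ 1"
      by (simp add: j chart_all_simps field_simps power2_eq_square power3_eq_cube)
    with * show "finite_part j w \<and> ichart \<alpha> s j w $ 1 \<noteq> 0 \<and> ichart \<alpha> s j w $ 2 \<noteq> 0"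
      by (simp add: j chart_all_simps)
  next
    have "(1::complex) * (- 1 - x * 1 ^ 2 - (- x) * 1 ^ 3) \<noteq> 0" for x by simp
    from this[of "(\<alpha> + 2 * s) / 2"]
    show "\<exists>w :: complex^2. w $ 1 * (- 1 - (\<alpha> + 2 * s) / 2 * w $ 1 ^ 2 - w $ 2 * w $ 1 ^ 3) \<noteq> 0"
      by (intro exI[of _ "vector [1, - ((\<alpha> + 2 * s) / 2)]"]) (simp only: vector_2 not_False_eq_True)
  qed (intro poly2_intros)
next
  assume j: "j = 3"
  show ?thesis
  proof (rule that[of "\<lambda>w. w $ 2 * (w $ 1 * w $ 2 + 2 * s)"])
    fix w :: "complex^2" assume *: "w $ 2 * (w $ 1 * w $ 2 + 2 * s) \<noteq> 0"
    have "ichart \<alpha> s j w $ 1 = - (w $ 2 * (w $ 1 * w $ 2 + 2 * s))"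
      by (simp add: j chart_all_simps field_simps power2_eq_square)
    with * show "finite_part j w \<and> ichart \<alpha> s j w $ 1 \<noteq> 0 \<and> ichart \<alpha> s j w $ 2 \<noteq> 0"
      by (simp add: j chart_all_simps)
  qed (auto intro!: poly2_intros exI[of _ "vector [1 - 2 * s, 1]"])
qed

text \<open>Two approximations: a generic \<open>w\<close> near \<open>p\<close> comes from a point
  of the affine plane, and arbitrarily close to that point there is a \<open>z\<close> at which
  \<open>F\<close> really carries \<open>chart \<alpha> s j z\<close> to
  \<open>chart \<alpha> s k z\<close>. Continuity of \<open>F\<close> at \<open>p\<close> then
  brings the latter close to \<open>q\<close>.\<close>

lemma biregular_imp_adherent:
  assumes "j \<in> J" "biregular_at (chart \<alpha> s j) (chart \<alpha> s k) p q"
  shows "adherent \<alpha> s j k p q"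
  unfolding adherent_def
proof (intro allI impI)
  fix e :: real assume e: "e > 0"
  from assms(2) obtain F where F: "regular_map_at F p" "F p = q" "generically (\<lambda>z. F (chart \<alpha> s j z) = chart \<alpha> s k z)"
    unfolding biregular_at_def by blast
  from F(3) obtain h z0 where h: "poly2 h" "h z0 \<noteq> 0" "\<And>z. h z \<noteq> 0 \<Longrightarrow> F (chart \<alpha> s j z) = chart \<alpha> s k z"
    unfolding generically_def by metis
  from regular_map_at_isCont[OF F(1)] e obtain d where d: "d > 0" "\<And>w. dist w p < d \<Longrightarrow> dist (F w) q < e"
    unfolding continuous_at_eps_delta F(2)[symmetric] by metis
  define d' where "d' = min d e"
  obtain g where g: "poly2 g" "\<exists>w. g w \<noteq> 0"
    "\<And>w. g w \<noteq> 0 \<Longrightarrow> finite_part j w \<and> ichart \<alpha> s j w $ 1 \<noteq> 0 \<and> ichart \<alpha> s j w $ 2 \<noteq> 0"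
    by (rule generic_ichart[OF assms(1)]) (rule that)
  from g(2) obtain w0 where w0: "g w0 \<noteq> 0" ..
  have "p \<in> ball p d'" using d e by (simp add: d'_def)
  then obtain w where w: "w \<in> ball p d'" "g w \<noteq> 0"
    by (rule poly2_nonzero_dense[OF g(1) w0 open_ball]) (rule that)
  define O1 where "O1 = {z :: complex^2. z $ 1 \<noteq> 0} \<inter> {z. z $ 2 \<noteq> 0}"
  have O1: "open O1" unfolding O1_def by (intro open_Int open_Collect_neq continuous_intros)
  have cont: "continuous_on O1 (chart \<alpha> s j)"
    by (rule continuous_on_subset[OF vholo_on_imp_continuous_on[OF vholo_chart[OF assms(1)]]])
      (auto simp: O1_def finite_part_generic)
  define O2 where "O2 = chart \<alpha> s j -` ball p d' \<inter> O1"
  have "open O2" unfolding O2_def using continuous_on_open_vimage[OF O1] cont by blast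
  moreover have "ichart \<alpha> s j w \<in> O2"
    using g(3)[OF w(2)] w(1) chart_ichart[OF assms(1)] by (simp add: O2_def O1_def)
  ultimately obtain z where z: "z \<in> O2" "h z \<noteq> 0"
    by (rule poly2_nonzero_dense[OF h(1,2)]) (rule that)
  have "dist (chart \<alpha> s j z) p < d'" using z(1) by (simp add: O2_def dist_commute)
  then have "dist (chart \<alpha> s j z) p < e" "dist (chart \<alpha> s j z) p < d" by (auto simp: d'_def)
  with d(2) h(3)[OF z(2)] have "dist (chart \<alpha> s k z) q < e" by metis
  with z(1) \<open>dist (chart \<alpha> s j z) p < e\<close>
  show "\<exists>z. z $ 1 \<noteq> 0 \<and> z $ 2 \<noteq> 0 \<and> dist (chart \<alpha> s j z) p < e \<and> dist (chart \<alpha> s k z) q < e"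
    by (auto simp: O2_def O1_def)
qed

text \<open>For points over the affine plane the coordinate change is \<open>ichart\<close> of the
  one chart followed by the other chart.\<close>

lemma same_point_imp_biregular:
  assumes "j \<in> J" "k \<in> J" "same_point \<alpha> s j k p q"
  shows "biregular_at (chart \<alpha> s j) (chart \<alpha> s k) p q"
proof (cases "j = k \<and> p = q")
  case True
  then show ?thesis
    unfolding biregular_at_def
    by (intro exI[of _ "\<lambda>z. z"]) (auto intro!: regular_map_at_id generically_finite)
next
  case False
  with assms(3) have f: "finite_part j p" "finite_part k q" and e: "ichart \<alpha> s j p = ichart \<alpha> s k q"
    unfolding same_point_def by auto
  have ek: "finite_part k (ichart \<alpha> s j p)" unfolding e by (rule finite_part_ichart[OF assms(2) f(2)])
  have ej: "finite_part j (ichart \<alpha> s k q)" unfolding e[symmetric] by (rule finite_part_ichart[OF assms(1) f(1)])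
  show ?thesis
    unfolding biregular_at_def
  proof (intro exI conjI)
    show "regular_map_at (\<lambda>w. chart \<alpha> s k (ichart \<alpha> s j w)) p"
      by (intro regular_chart_compose[OF assms(2)] regular_ichart_compose[OF assms(1)] regular_map_at_id f ek)
    show "regular_map_at (\<lambda>w. chart \<alpha> s j (ichart \<alpha> s k w)) q"
      by (intro regular_chart_compose[OF assms(1)] regular_ichart_compose[OF assms(2)] regular_map_at_id f ej)
    show "chart \<alpha> s k (ichart \<alpha> s j p) = q" unfolding e by (rule chart_ichart[OF assms(2) f(2)])
    show "chart \<alpha> s j (ichart \<alpha> s k q) = p" unfolding e[symmetric] by (rule chart_ichart[OF assms(1) f(1)])
    show "generically (\<lambda>z. chart \<alpha> s k (ichart \<alpha> s j (chart \<alpha> s j z)) = chart \<alpha> s k z)"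
      "generically (\<lambda>z. chart \<alpha> s j (ichart \<alpha> s k (chart \<alpha> s k z)) = chart \<alpha> s j z)"
      using ichart_chart[OF assms(1)] ichart_chart[OF assms(2)]
      by (auto intro!: generically_finite simp: finite_part_generic)
  qed
qed

lemma biregular_iff_same_point:
  assumes "j \<in> J" "k \<in> J"
  shows "biregular_at (chart \<alpha> s j) (chart \<alpha> s k) p q \<longleftrightarrow> same_point \<alpha> s j k p q"
  by (rule iffI, rule adherent_imp_same_point[OF assms biregular_imp_adherent[OF assms(1)]], assumption,
      rule same_point_imp_biregular[OF assms])

abbreviation charts :: "complex \<Rightarrow> complex \<Rightarrow> nat \<Rightarrow> complex \<Rightarrow> complex^2 \<Rightarrow> complex^2" where
  "charts \<alpha> s \<equiv> (\<lambda>j t. chart \<alpha> s j)"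

lemma glue_iff: "((j, v), (k, w)) \<in> glue J (charts \<alpha> s) \<longleftrightarrow>
    j \<in> J \<and> k \<in> J \<and> v $ 3 = w $ 3 \<and> same_point \<alpha> s j k (plane_part v) (plane_part w)"
  unfolding glue_def using biregular_iff_same_point[of j k \<alpha> s "plane_part v" "plane_part w"]
  by (simp only: mem_Collect_eq case_prod_conv) metis

lemma same_point_trans:
  assumes "same_point \<alpha> s j k p q" "same_point \<alpha> s k l q r"
  shows "same_point \<alpha> s j l p r"
  using assms unfolding same_point_def by auto

lemma equiv_glue: "equiv (J \<times> UNIV) (glue J (charts \<alpha> s))"
proof (rule equivI)
  show "glue J (charts \<alpha> s) \<subseteq> (J \<times> UNIV) \<times> J \<times> UNIV"
  proof
    fix x assume x: "x \<in> glue J (charts \<alpha> s)"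
    obtain j v k w where e: "x = ((j, v), (k, w))" by (metis surj_pair)
    from x show "x \<in> (J \<times> UNIV) \<times> J \<times> UNIV" unfolding e glue_iff by blast
  qed
  show "refl_on (J \<times> UNIV) (glue J (charts \<alpha> s))"
  proof (rule refl_onI)
    fix x :: "nat \<times> (complex^3)" assume "x \<in> J \<times> UNIV"
    then obtain j v where x: "x = (j, v)" "j \<in> J" by blast
    then show "(x, x) \<in> glue J (charts \<alpha> s)" unfolding x glue_iff same_point_def by blast
  qed
  show "sym (glue J (charts \<alpha> s))"
  proof (rule symI)
    fix x y assume xy: "(x, y) \<in> glue J (charts \<alpha> s)"
    obtain j v k w where e: "x = (j, v)" "y = (k, w)" by (cases x, cases y) blast
    from xy show "(y, x) \<in> glue J (charts \<alpha> s)" unfolding e glue_iff using same_point_sym by metis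
  qed
  show "trans (glue J (charts \<alpha> s))"
  proof (rule transI)
    fix x y z assume xyz: "(x, y) \<in> glue J (charts \<alpha> s)" "(y, z) \<in> glue J (charts \<alpha> s)"
    obtain j v k w l u where e: "x = (j, v)" "y = (k, w)" "z = (l, u)" by (cases x, cases y, cases z) blast
    from xyz show "(x, z) \<in> glue J (charts \<alpha> s)" unfolding e glue_iff using same_point_trans by metis
  qed
qed

lemma glued_point_eq_iff:
  assumes "j \<in> J" "k \<in> J"
  shows "glued_point J (charts \<alpha> s) j v = glued_point J (charts \<alpha> s) k w \<longleftrightarrow>
    v $ 3 = w $ 3 \<and> same_point \<alpha> s j k (plane_part v) (plane_part w)"
proof -
  have "glued_point J (charts \<alpha> s) j v = glued_point J (charts \<alpha> s) k w \<longleftrightarrow> ((j, v), (k, w)) \<in> glue J (charts \<alpha> s)"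
    unfolding glued_point_def by (rule eq_equiv_class_iff[OF equiv_glue]) (use assms in auto)
  with assms show ?thesis unfolding glue_iff by simp
qed

lemma same_point_refl_iff: "j \<in> J \<Longrightarrow> same_point \<alpha> s j j p q \<longleftrightarrow> p = q"
  unfolding same_point_def using chart_ichart by metis

lemma join_simps [simp]: "plane_part (join z t) = z" "join z t $ 3 = t" "join (plane_part v) (v $ 3) = v"
  by (simp_all add: join_def plane_part_def vec2_eq_iff vec3_eq_iff)

lemma plane_part_nth [simp]: "plane_part v $ 1 = v $ 1" "plane_part v $ 2 = v $ 2"
  by (simp_all add: plane_part_def)

lemma vholo_plane_part: "vholo_on S plane_part"
  unfolding vholo_on_def forall_2 plane_part_nth by (auto intro: holo_intros)

lemma vholo_join: "vholo_on S f \<Longrightarrow> holo_on S g \<Longrightarrow> vholo_on S (\<lambda>v. join (f v) (g v))"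
  unfolding vholo_on_def forall_3 join_def by (simp add: vholo_on_def)

lemma vec3_plane_eq: "v = w \<longleftrightarrow> plane_part v = plane_part w \<and> v $ 3 = w $ 3"
  by (auto simp: vec3_eq_iff vec2_eq_iff)

lemma compat_glued_atlas: "compat (glued_atlas J (charts \<alpha> s))"
proof -
  have inj: "inj (glued_point J (charts \<alpha> s) j)" if j: "j \<in> J" for j
    unfolding inj_def glued_point_eq_iff[OF j j] same_point_refl_iff[OF j] vec3_plane_eq by blast
  have lift: "lift_at UNIV (glued_point J (charts \<alpha> s) k) (glued_point J (charts \<alpha> s) j) v"
    if j: "j \<in> J" and k: "k \<in> J" and vw: "glued_point J (charts \<alpha> s) j v = glued_point J (charts \<alpha> s) k w" for j k v w
  proof (cases "j = k")
    case True
    show ?thesis unfolding True by (rule lift_atI[OF open_UNIV UNIV_I vholo_on_id]) auto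
  next
    case False
    with vw have f: "finite_part j (plane_part v)" "finite_part k (plane_part w)"
      "ichart \<alpha> s j (plane_part v) = ichart \<alpha> s k (plane_part w)"
      unfolding glued_point_eq_iff[OF j k] same_point_def by auto
    define N1 where "N1 = plane_part -` {p. finite_part j p}"
    have N1: "open N1" unfolding N1_def
      by (rule open_vimage[OF open_finite_part vholo_on_imp_continuous_on[OF vholo_plane_part]])
    have h1: "vholo_on N1 (\<lambda>v. ichart \<alpha> s j (plane_part v))"
      by (rule vholo_on_compose[OF vholo_plane_part vholo_ichart[OF j]]) (auto simp: N1_def)
    define N where "N = (\<lambda>v. ichart \<alpha> s j (plane_part v)) -` {p. finite_part k p} \<inter> N1"
    have N: "open N" unfolding N_def
      using continuous_on_open_vimage[OF N1] vholo_on_imp_continuous_on[OF h1] open_finite_part by blast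
    have h2: "vholo_on N (\<lambda>v. chart \<alpha> s k (ichart \<alpha> s j (plane_part v)))"
      by (rule vholo_on_compose[OF vholo_on_subset[OF h1] vholo_chart[OF k]]) (auto simp: N_def)
    show ?thesis
    proof (rule lift_atI[OF N])
      show "v \<in> N" using f finite_part_ichart[OF k f(2)] by (simp add: N_def N1_def)
      show "vholo_on N (\<lambda>v. join (chart \<alpha> s k (ichart \<alpha> s j (plane_part v))) (v $ 3))"
        by (rule vholo_join[OF h2 holo_on_coord])
      fix x assume "x \<in> N"
      then have x: "finite_part j (plane_part x)" "finite_part k (ichart \<alpha> s j (plane_part x))" by (auto simp: N_def N1_def)
      then show "glued_point J (charts \<alpha> s) k (join (chart \<alpha> s k (ichart \<alpha> s j (plane_part x))) (x $ 3)) =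
          glued_point J (charts \<alpha> s) j x"
        unfolding glued_point_eq_iff[OF k j] same_point_def using ichart_chart[OF k x(2)] finite_part_chart[OF k x(2)] by simp
    qed simp
  qed
  show ?thesis
    unfolding compat_def
  proof (intro conjI ballI)
    fix X assume "X \<in> glued_atlas J (charts \<alpha> s)"
    then obtain j where X: "j \<in> J" "X = (UNIV, glued_point J (charts \<alpha> s) j)" unfolding glued_atlas_def by blast
    show "case X of (V, \<psi>) \<Rightarrow> open V \<and> inj_on \<psi> V" using inj[OF X(1)] X(2) by simp
    have "lift_at UNIV (glued_point J (charts \<alpha> s) k) (glued_point J (charts \<alpha> s) j) v"
      if "k \<in> J" "glued_point J (charts \<alpha> s) j v \<in> range (glued_point J (charts \<alpha> s) k)" for k v
      using that lift[OF X(1) that(1)] by blast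
    then show "case X of (V, \<psi>) \<Rightarrow> \<forall>(W, \<eta>)\<in>glued_atlas J (charts \<alpha> s). \<forall>v\<in>V. \<psi> v \<in> \<eta> ` W \<longrightarrow> lift_at W \<eta> \<psi> v"
      unfolding X(2) glued_atlas_def by auto
  qed
qed

lemma same_point_imp_adherent: "j \<in> J \<Longrightarrow> k \<in> J \<Longrightarrow> same_point \<alpha> s j k p q \<Longrightarrow> adherent \<alpha> s j k p q"
  by (rule biregular_imp_adherent[OF _ same_point_imp_biregular])

lemma complex_manifold_glued: "complex_manifold (glued_atlas J (charts \<alpha> s))"
proof (rule complex_manifoldI[OF compat_glued_atlas])
  show "second_countable (manifold_topology (glued_atlas J (charts \<alpha> s)))"
    by (rule second_countable_atlas[OF compat_glued_atlas]) (simp add: glued_atlas_def)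
  show "Hausdorff_space (manifold_topology (glued_atlas J (charts \<alpha> s)))"
  proof (rule Hausdorff_atlas[OF compat_glued_atlas])
    fix V \<psi> W \<eta> and v w :: "complex^3"
    assume "(V, \<psi>) \<in> glued_atlas J (charts \<alpha> s)" "(W, \<eta>) \<in> glued_atlas J (charts \<alpha> s)" and ne: "\<psi> v \<noteq> \<eta> w"
    then obtain j k where j: "j \<in> J" "V = UNIV" "\<psi> = glued_point J (charts \<alpha> s) j"
      and k: "k \<in> J" "W = UNIV" "\<eta> = glued_point J (charts \<alpha> s) k" unfolding glued_atlas_def by blast
    have cpp: "continuous_on UNIV (plane_part)" by (rule vholo_on_imp_continuous_on[OF vholo_plane_part])
    from ne have "v $ 3 \<noteq> w $ 3 \<or> \<not> same_point \<alpha> s j k (plane_part v) (plane_part w)"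
      unfolding j k glued_point_eq_iff[OF j(1) k(1)] by blast
    then consider "v $ 3 \<noteq> w $ 3" | "\<not> adherent \<alpha> s j k (plane_part v) (plane_part w)"
      using adherent_imp_same_point[OF j(1) k(1)] by blast
    then show "\<exists>N M. open N \<and> open M \<and> v \<in> N \<and> w \<in> M \<and> N \<subseteq> V \<and> M \<subseteq> W \<and> \<psi> ` N \<inter> \<eta> ` M = {}"
    proof cases
      case 1
      then obtain A B where AB: "open A" "open B" "v $ 3 \<in> A" "w $ 3 \<in> B" "A \<inter> B = {}" by (meson hausdorff)
      have o: "open ((\<lambda>v :: complex^3. v $ 3) -` A)" "open ((\<lambda>v :: complex^3. v $ 3) -` B)"
        by (rule open_vimage_vec_nth[OF AB(1)], rule open_vimage_vec_nth[OF AB(2)])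
      have "\<psi> ` ((\<lambda>v. v $ 3) -` A) \<inter> \<eta> ` ((\<lambda>v. v $ 3) -` B) = {}"
      proof (rule equals0I)
        fix y assume "y \<in> \<psi> ` ((\<lambda>v. v $ 3) -` A) \<inter> \<eta> ` ((\<lambda>v. v $ 3) -` B)"
        then obtain v' w' where "v' $ 3 \<in> A" "w' $ 3 \<in> B" "\<psi> v' = \<eta> w'" by auto
        with AB(5) show False unfolding j k glued_point_eq_iff[OF j(1) k(1)] by auto
      qed
      with o AB(3,4) show ?thesis unfolding j(2) k(2) by (intro exI conjI) (assumption | simp)+
    next
      case 2
      \<comment> \<open>If the balls of half this radius contained identified points, these would be
        adherent, and a generic \<open>z\<close> would come within \<open>e\<close> of both
        \<open>v\<close> and \<open>w\<close>, contrary to the choice of \<open>e\<close>.\<close>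
      then obtain e where e: "e > 0" "\<And>z. z $ 1 \<noteq> 0 \<Longrightarrow> z $ 2 \<noteq> 0 \<Longrightarrow>
          \<not> (dist (chart \<alpha> s j z) (plane_part v) < e \<and> dist (chart \<alpha> s k z) (plane_part w) < e)"
        unfolding adherent_def by blast
      let ?N = "plane_part -` ball (plane_part v) (e / 2)" and ?M = "plane_part -` ball (plane_part w) (e / 2)"
      have o: "open ?N" "open ?M" by (rule open_vimage[OF open_ball cpp])+
      have "\<psi> ` ?N \<inter> \<eta> ` ?M = {}"
      proof (rule equals0I)
        fix y assume "y \<in> \<psi> ` ?N \<inter> \<eta> ` ?M"
        then obtain v' w' where vw: "plane_part v' \<in> ball (plane_part v) (e / 2)"
          "plane_part w' \<in> ball (plane_part w) (e / 2)" "\<psi> v' = \<eta> w'" by auto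
        then have "adherent \<alpha> s j k (plane_part v') (plane_part w')"
          unfolding j k glued_point_eq_iff[OF j(1) k(1)] using same_point_imp_adherent[OF j(1) k(1)] by blast
        with e(1) obtain z where z: "z $ 1 \<noteq> 0" "z $ 2 \<noteq> 0" "dist (chart \<alpha> s j z) (plane_part v') < e / 2"
          "dist (chart \<alpha> s k z) (plane_part w') < e / 2" unfolding adherent_def by (meson half_gt_zero)
        have "dist (chart \<alpha> s j z) (plane_part v) < e" "dist (chart \<alpha> s k z) (plane_part w) < e"
          using vw(1,2) z(3,4) by (auto simp: dist_commute intro: dist_triangle_half_l)
        with e(2) z(1,2) show False by blast
      qed
      with o e(1) show ?thesis unfolding j(2) k(2) by (intro exI[of _ ?N] exI[of _ ?M]) simp
    qed
  qed
qed

section \<open>The phase space\<close>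

text \<open>The differential of the chart applied to the system, with \<open>ichart\<close>
  substituted; all denominators cancel. \<open>ab\<close> is half the product of
  \<open>(\<alpha> - 2 s) / 2\<close> and \<open>(\<alpha> + 2 s) / 2\<close>, and \<open>X\<close>
  is \<open>x\<close> in terms of chart 3.\<close>

definition chart_rhs :: "complex \<Rightarrow> complex \<Rightarrow> nat \<Rightarrow> complex^2 \<Rightarrow> complex^2" where
  "chart_rhs \<alpha> s j w =
     (let ab = (\<alpha> - 2 * s) * (\<alpha> + 2 * s) / 8; X = - w $ 1 * w $ 2 ^ 2 - 2 * s * w $ 2 in
      if j = 0 then vector [w $ 1 * w $ 2 + s, 3/2 * w $ 1 ^ 2 - 1/2 * w $ 2 ^ 2 + \<alpha> / 2]
      else if j = 1 then vector [- 1 - \<alpha> / 2 * w $ 1 ^ 2 + w $ 2 * w $ 1 ^ 3,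
        - ab + \<alpha> * w $ 1 * w $ 2 - 3/2 * w $ 2 ^ 2 * w $ 1 ^ 2]
      else if j = 2 then vector [1 + \<alpha> / 2 * w $ 1 ^ 2 + w $ 2 * w $ 1 ^ 3,
        - ab - \<alpha> * w $ 1 * w $ 2 - 3/2 * w $ 2 ^ 2 * w $ 1 ^ 2]
      else vector [(3 * X ^ 2 + \<alpha>) * (w $ 1 * w $ 2 + s), 1/2 - (3 * X ^ 2 + \<alpha>) * w $ 2 ^ 2 / 2])"

text \<open>The system is autonomous, so the coefficients can be taken constant in
  \<open>t\<close>.\<close>

lemma polynomial_rhsI:
  assumes "\<And>i. poly2 (\<lambda>w. f w $ i)"
  shows "polynomial_rhs (\<lambda>t. f)"
  unfolding polynomial_rhs_def
proof
  fix i
  obtain N c where "\<And>z. f z $ i = (\<Sum>a\<le>N. \<Sum>b\<le>N. c a b * z $ 1 ^ a * z $ 2 ^ b)"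
    by (rule poly2_coeffs[OF assms]) (rule that)
  then show "\<exists>(N::nat) (c :: nat \<Rightarrow> nat \<Rightarrow> complex \<Rightarrow> complex). (\<forall>a b. c a b holomorphic_on UNIV) \<and>
     (\<forall>(t :: complex) w. f w $ i = (\<Sum>a\<le>N. \<Sum>b\<le>N. c a b t * w $ 1 ^ a * w $ 2 ^ b))"
    by (intro exI[of _ N] exI[of _ "\<lambda>a b _. c a b"]) auto
qed

lemma poly2_divide: "poly2 f \<Longrightarrow> poly2 (\<lambda>z. f z / c)"
  using poly2_mult[OF poly2_const[of "1 / c"], of f] by simp

lemma polynomial_chart_rhs: "polynomial_rhs (\<lambda>t. chart_rhs \<alpha> s j)"
proof (rule polynomial_rhsI)
  fix i :: 2
  have "poly2 (\<lambda>w. chart_rhs \<alpha> s j w $ 1) \<and> poly2 (\<lambda>w. chart_rhs \<alpha> s j w $ 2)"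
    unfolding chart_rhs_def Let_def
    by (cases "j = 0"; cases "j = 1"; cases "j = 2"; simp only: if_True if_False vector_2 simp_thms one_neq_zero zero_neq_one;
      intro conjI poly2_intros poly2_divide)
  then show "poly2 (\<lambda>w. chart_rhs \<alpha> s j w $ i)" using exhaust_2[of i] by auto
qed

lemma dchart_system:
  assumes "j \<in> J" "finite_part j z"
  shows "dchart \<alpha> s j z (system \<alpha> s t z) = chart_rhs \<alpha> s j (chart \<alpha> s j z)"
  using assms(1)
proof (rule J_cases)
  assume j: "j = 0"
  show ?thesis by (simp add: j dchart_simps chart_simps chart_rhs_def system_def Let_def)
next
  assume j: "j = Suc 0"
  then have "z $ 1 \<noteq> 0" using assms(2) by (simp add: finite_part_simps)
  then show ?thesis
    unfolding vec2_eq_iff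
    by (simp add: j dchart_simps chart_simps chart_rhs_def system_def Let_def field_simps power2_eq_square power3_eq_cube)
next
  assume j: "j = 2"
  then have "z $ 1 \<noteq> 0" using assms(2) by (simp add: finite_part_simps)
  then show ?thesis
    unfolding vec2_eq_iff
    by (simp add: j dchart_simps chart_simps chart_rhs_def system_def Let_def field_simps power2_eq_square power3_eq_cube)
next
  assume j: "j = 3"
  then have "z $ 2 \<noteq> 0" using assms(2) by (simp add: finite_part_simps)
  then show ?thesis
    unfolding vec2_eq_iff
    by (simp add: j dchart_simps chart_simps chart_rhs_def system_def Let_def field_simps power2_eq_square power3_eq_cube)
qed

lemma rewritten_chart:
  assumes "j \<in> J"
  shows "rewritten_system (system \<alpha> s) (\<lambda>t. chart \<alpha> s j) (\<lambda>t. chart_rhs \<alpha> s j)"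
  unfolding rewritten_system_def
proof (intro allI impI)
  fix t z assume "regular_map_at (chart \<alpha> s j) z"
  with assms have f: "finite_part j z" by (rule regular_chart_finite)
  have "((\<lambda>v. plane_part v $ i) has_derivative (\<lambda>v. plane_part v $ i)) (at (join z t))" for i
    using exhaust_2[of i]
    by (elim disjE) (auto intro!: bounded_linear_imp_has_derivative bounded_linear_vec_nth)
  from has_derivative_vec[OF this] have "(plane_part has_derivative plane_part) (at (join z t))" by simp
  moreover have "(chart \<alpha> s j has_derivative dchart \<alpha> s j z) (at (plane_part (join z t)))"
    using has_derivative_chart[OF assms f] by simp
  ultimately have "((\<lambda>v. chart \<alpha> s j (plane_part v)) has_derivative (\<lambda>v. dchart \<alpha> s j z (plane_part v))) (at (join z t))"
    by (rule has_derivative_compose)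
  then show "\<exists>L. ((\<lambda>v. chart \<alpha> s j (plane_part v)) has_derivative L) (at (join z t)) \<and>
          L (join (system \<alpha> s t z) 1) = chart_rhs \<alpha> s j (chart \<alpha> s j z)"
    using dchart_system[OF assms f] by (intro exI conjI) (assumption, simp)
qed

text \<open>Finite limits of both coordinates of chart \<open>j\<close> make \<open>t0\<close> a
  removable singularity there. The extended curve is built in that chart; off \<open>t0\<close> the
  solution lies over the affine plane, so both descriptions give the same glued point.\<close>

lemma solution_extends:
  assumes j: "j \<in> J" and r0: "r0 > 0" and hol: "x holomorphic_on ball t0 r0 - {t0}" "y holomorphic_on ball t0 r0 - {t0}"
    and fin: "\<forall>\<^sub>F t in at t0. finite_part j (vector [x t, y t])"
    and lim: "((\<lambda>t. chart \<alpha> s j (vector [x t, y t]) $ 1) \<longlongrightarrow> L1) (at t0)"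
      "((\<lambda>t. chart \<alpha> s j (vector [x t, y t]) $ 2) \<longlongrightarrow> L2) (at t0)"
  shows "\<exists>r>0. \<exists>\<Gamma>. holo_curve (glued_atlas J (charts \<alpha> s)) (ball t0 r) \<Gamma> \<and>
           (\<forall>t\<in>ball t0 r - {t0}. \<Gamma> t = glued_point J (charts \<alpha> s) 0 (vector [x t, y t, t]))"
proof -
  from fin obtain r1 where r1: "r1 > 0" "\<And>t. t \<noteq> t0 \<Longrightarrow> dist t t0 < r1 \<Longrightarrow> finite_part j (vector [x t, y t])"
    unfolding eventually_at by blast
  define r where "r = min r0 r1"
  define B where "B = ball t0 r - {t0}"
  have r: "r > 0" "open B" "B \<subseteq> ball t0 r0 - {t0}" using r0 r1(1) by (auto simp: r_def B_def)
  have fB: "finite_part j (vector [x t, y t])" if "t \<in> B" for t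
    using that r1(2)[of t] by (simp add: B_def r_def dist_commute)
  have v: "vholomorphic_on (\<lambda>t. vector [x t, y t] :: complex^2) B"
    unfolding vholomorphic_on_def forall_2 using hol r(3) by (auto intro: holomorphic_on_subset)
  have "vholomorphic_on (\<lambda>t. chart \<alpha> s j (vector [x t, y t])) B"
    by (rule vholomorphic_on_holo_compose[OF v r(2) vholo_chart[OF j]]) (use fB in auto)
  then have h: "(\<lambda>t. chart \<alpha> s j (vector [x t, y t]) $ i) holomorphic_on ball t0 r - {t0}" for i
    by (simp add: vholomorphic_on_def B_def)
  define f where "f t = join (vector [if t = t0 then L1 else chart \<alpha> s j (vector [x t, y t]) $ 1,
    if t = t0 then L2 else chart \<alpha> s j (vector [x t, y t]) $ 2]) t" for t
  have vf: "vholomorphic_on f (ball t0 r)"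
    unfolding vholomorphic_on_def forall_3 f_def join_def
    using removable_singularity[OF h open_ball lim(1)] removable_singularity[OF h open_ball lim(2)] by simp
  let ?\<Gamma> = "\<lambda>t. glued_point J (charts \<alpha> s) j (f t)"
  have "holo_curve (glued_atlas J (charts \<alpha> s)) (ball t0 r) ?\<Gamma>"
  proof (rule holo_curveI[OF compat_glued_atlas open_ball])
    fix t assume t: "t \<in> ball t0 r"
    \<comment> \<open>The third coordinate is time itself, with derivative \<open>1\<close>, so the
      curve has nonzero velocity everywhere.\<close>
    have "clift_at UNIV (glued_point J (charts \<alpha> s) j) ?\<Gamma> t"
      by (rule clift_atI[OF open_ball t vf, where i = 3]) (simp_all add: f_def join_def)
    moreover have "(UNIV, glued_point J (charts \<alpha> s) j) \<in> glued_atlas J (charts \<alpha> s)"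
      using j unfolding glued_atlas_def by (rule imageI)
    ultimately show "\<exists>(V, \<psi>)\<in>glued_atlas J (charts \<alpha> s). clift_at V \<psi> ?\<Gamma> t" by blast
  qed
  moreover have "?\<Gamma> t = glued_point J (charts \<alpha> s) 0 (vector [x t, y t, t])" if "t \<in> ball t0 r - {t0}" for t
  proof -
    have fp: "finite_part j (vector [x t, y t])" using fB that by (simp add: B_def)
    have f: "f t = join (chart \<alpha> s j (vector [x t, y t])) t" using that by (simp add: f_def join_def vec3_eq_iff)
    have J0: "0 \<in> J" by simp
    have p: "plane_part (vector [x t, y t, t]) = vector [x t, y t]" by (simp add: plane_part_def)
    show ?thesis
      unfolding glued_point_eq_iff[OF j J0] f p same_point_def join_simps
      using ichart_chart[OF j fp] finite_part_chart[OF j fp]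
      by (simp add: ichart_simps finite_part_simps vec2_eq_iff)
  qed
  ultimately show ?thesis using r(1) by blast
qed

text \<open>For this function \<open>H\<close> the system is \<open>x' = H_y\<close>,
  \<open>y' = - H_x\<close>.\<close>

definition hamiltonian :: "complex \<Rightarrow> complex \<Rightarrow> complex \<Rightarrow> complex \<Rightarrow> complex" where
  "hamiltonian \<alpha> s x y = x * y ^ 2 / 2 + s * y - x ^ 3 / 2 - \<alpha> * x / 2"

lemma meromorphic_solution_extends:
  assumes "meromorphic_solution_near (system \<alpha> s) t0 x y"
  shows "\<exists>r>0. \<exists>\<Gamma>. holo_curve (glued_atlas J (charts \<alpha> s)) (ball t0 r) \<Gamma> \<and>
           (\<forall>t\<in>ball t0 r - {t0}. \<Gamma> t = glued_point J (charts \<alpha> s) 0 (vector [x t, y t, t]))"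
proof -
  from assms have mx: "x meromorphic_on {t0}" and my: "y meromorphic_on {t0}"
    and ev: "\<forall>\<^sub>F t in at t0. (x has_field_derivative x t * y t + s) (at t) \<and>
        (y has_field_derivative 3/2 * x t ^ 2 - 1/2 * y t ^ 2 + \<alpha> / 2) (at t)"
    unfolding meromorphic_solution_near_def system_def Let_def by simp_all
  from ev obtain r0 where r0: "r0 > 0" and D: "\<And>t. t \<in> ball t0 r0 - {t0} \<Longrightarrow> (x has_field_derivative x t * y t + s) (at t)"
    "\<And>t. t \<in> ball t0 r0 - {t0} \<Longrightarrow> (y has_field_derivative 3/2 * x t ^ 2 - 1/2 * y t ^ 2 + \<alpha> / 2) (at t)"
    unfolding eventually_at by (auto simp: dist_commute)
  define B where "B = ball t0 r0 - {t0}"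
  have B: "open B" "connected B"
    unfolding B_def by (auto intro!: connected_open_delete)
  have hol: "x holomorphic_on B" "y holomorphic_on B"
    unfolding holomorphic_on_open[OF B(1)] using D unfolding B_def by blast+
  have HD: "((\<lambda>t. hamiltonian \<alpha> s (x t) (y t)) has_field_derivative 0) (at t)" if "t \<in> B" for t
    unfolding hamiltonian_def
    by (rule derivative_eq_intros D[OF that[unfolded B_def]] refl | simp)+
      (simp add: field_simps power2_eq_square)
  have "continuous_on B (\<lambda>t. hamiltonian \<alpha> s (x t) (y t))"
    using HD by (meson DERIV_isCont continuous_at_imp_continuous_on)
  then obtain h where h: "\<And>t. t \<in> B \<Longrightarrow> hamiltonian \<alpha> s (x t) (y t) = h"
    by (rule DERIV_zero_connected_constant[OF B(2,1) finite.emptyI]) (use HD in auto)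
  have inB: "\<forall>\<^sub>F t in at t0. t \<in> B"
    unfolding B_def using r0 by (auto simp: eventually_at dist_commute intro!: exI[of _ r0])
  have evh: "\<forall>\<^sub>F t in at t0. hamiltonian \<alpha> s (x t) (y t) = h"
    using inB by eventually_elim (rule h)
  note ext = solution_extends[OF _ r0 hol[unfolded B_def]]
  show ?thesis
  proof (cases "is_pole x t0")
    case False
    then obtain x0 where x0: "(x \<longlongrightarrow> x0) (at t0)"
      using meromorphic_on_not_essential[OF mx] unfolding not_essential_def by blast
    show ?thesis
    proof (cases "is_pole y t0")
      case False
      then obtain y0 where y0: "(y \<longlongrightarrow> y0) (at t0)"
        using meromorphic_on_not_essential[OF my] unfolding not_essential_def by blast
      show ?thesis by (rule ext[of 0]) (use x0 y0 in \<open>simp_all add: chart_all_simps\<close>)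
    next
      case True
      then have yi: "filterlim y at_infinity (at t0)" by (simp add: is_pole_def)
      then have yn: "\<forall>\<^sub>F t in at t0. y t \<noteq> 0" by (rule filterlim_at_infinity_imp_eventually_ne)
      have l2: "((\<lambda>t. 1 / y t) \<longlongrightarrow> 0) (at t0)"
        by (rule tendsto_divide_0[OF tendsto_const yi])
      \<comment> \<open>The energy relation \<open>2 h = x y^2 + 2 s y - x^3 - \<alpha> x\<close>
        expresses the first coordinate of chart 3 as a polynomial in \<open>x\<close>, which has a
        finite limit here.\<close>
      have "((\<lambda>t. - 2 * h - x t ^ 3 - \<alpha> * x t) \<longlongrightarrow> - 2 * h - x0 ^ 3 - \<alpha> * x0) (at t0)"
        by (intro tendsto_intros x0)
      moreover have "\<forall>\<^sub>F t in at t0. - 2 * h - x t ^ 3 - \<alpha> * x t = - (x t * y t + 2 * s) * y t"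
        using evh
      proof eventually_elim
        case (elim t)
        show ?case unfolding elim[symmetric] by (simp add: hamiltonian_def field_simps power2_eq_square)
      qed
      ultimately have l1: "((\<lambda>t. - (x t * y t + 2 * s) * y t) \<longlongrightarrow> - 2 * h - x0 ^ 3 - \<alpha> * x0) (at t0)"
        by (rule Lim_transform_eventually)
      show ?thesis by (rule ext[of 3]) (use l1 l2 yn in \<open>simp_all add: chart_all_simps\<close>)
    qed
  next
    case True
    then have xi: "filterlim x at_infinity (at t0)" by (simp add: is_pole_def)
    then have xn: "\<forall>\<^sub>F t in at t0. x t \<noteq> 0" by (rule filterlim_at_infinity_imp_eventually_ne)
    define u where "u t = 1 / x t" for t
    have u: "(u \<longlongrightarrow> 0) (at t0)" unfolding u_def by (rule tendsto_divide_0[OF tendsto_const xi])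
    define q where "q t = y t / x t" for t
    have mq: "q meromorphic_on {t0}" unfolding q_def by (intro meromorphic_intros mx my)
    \<comment> \<open>The energy relation divided by \<open>x^3\<close>, in terms of
      \<open>q = y / x\<close> and \<open>u = 1 / x\<close>.\<close>
    have rel: "\<forall>\<^sub>F t in at t0. q t * (q t + 2 * s * u t ^ 2) = 1 + \<alpha> * u t ^ 2 + 2 * h * u t ^ 3"
      using evh xn
    proof eventually_elim
      case (elim t)
      have "2 * hamiltonian \<alpha> s (x t) (y t) * u t ^ 3 = q t ^ 2 + 2 * s * q t * u t ^ 2 - 1 - \<alpha> * u t ^ 2"
        using elim(2) by (simp add: hamiltonian_def q_def u_def field_simps power2_eq_square power3_eq_cube)
      with elim(1) show ?case by (simp add: algebra_simps power2_eq_square)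
    qed
    have lim1: "((\<lambda>t. 1 + \<alpha> * u t ^ 2 + 2 * h * u t ^ 3) \<longlongrightarrow> 1 + \<alpha> * 0 ^ 2 + 2 * h * 0 ^ 3) (at t0)"
      by (intro tendsto_intros u)
    have "\<not> is_pole q t0"
    proof
      assume "is_pole q t0"
      then have qi: "filterlim q at_infinity (at t0)" by (simp add: is_pole_def)
      then have qn: "\<forall>\<^sub>F t in at t0. q t \<noteq> 0" by (rule filterlim_at_infinity_imp_eventually_ne)
      \<comment> \<open>At a pole of \<open>q\<close>, dividing the relation by \<open>q\<close>
        would express \<open>q\<close> through quantities that tend to zero.\<close>
      have "((\<lambda>t. (1 + \<alpha> * u t ^ 2 + 2 * h * u t ^ 3) / q t - 2 * s * u t ^ 2) \<longlongrightarrow> 0 - 2 * s * 0 ^ 2) (at t0)"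
        by (intro tendsto_diff tendsto_divide_0[OF lim1 qi] tendsto_intros u)
      moreover have "\<forall>\<^sub>F t in at t0. (1 + \<alpha> * u t ^ 2 + 2 * h * u t ^ 3) / q t - 2 * s * u t ^ 2 = q t"
        using rel qn
      proof eventually_elim
        case (elim t)
        then show ?case unfolding elim(1)[symmetric] by simp
      qed
      ultimately have "(q \<longlongrightarrow> 0 - 2 * s * 0 ^ 2) (at t0)" by (rule Lim_transform_eventually)
      with qi show False using not_tendsto_and_filterlim_at_infinity[of "at t0" q] by simp
    qed
    then obtain q0 where q0: "(q \<longlongrightarrow> q0) (at t0)"
      using meromorphic_on_not_essential[OF mq] unfolding not_essential_def by blast
    have "((\<lambda>t. q t * (q t + 2 * s * u t ^ 2)) \<longlongrightarrow> q0 * (q0 + 2 * s * 0 ^ 2)) (at t0)"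
      by (intro tendsto_intros q0 u)
    from Lim_transform_eventually[OF this rel] lim1 have "q0 * (q0 + 2 * s * 0 ^ 2) = 1 + \<alpha> * 0 ^ 2 + 2 * h * 0 ^ 3"
      by (intro tendsto_unique[of "at t0"]) auto
    then have "q0 ^ 2 = 1" by (simp add: power2_eq_square)
    then have "q0 = 1 \<or> q0 = - 1" by (simp add: power2_eq_1_iff)
    then show ?thesis
    proof
      assume q1: "q0 = 1"
      define a where "a = (\<alpha> - 2 * s) / 2"
      define v where "v t = - ((y t - x t) * x t - a) * x t" for t
      \<comment> \<open>\<open>v\<close> is the second coordinate of chart 1, whose boundedness is
        still unknown. The limit \<open>1\<close> of \<open>q\<close> gives only this weak estimate
        of its growth.\<close>
      have v3: "((\<lambda>t. v t * u t ^ 3) \<longlongrightarrow> 0) (at t0)"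
      proof (rule Lim_transform_eventually)
        show "((\<lambda>t. 1 + a * u t ^ 2 - q t) \<longlongrightarrow> 0) (at t0)"
          using q0 u q1 by (auto intro!: tendsto_eq_intros)
        show "\<forall>\<^sub>F t in at t0. 1 + a * u t ^ 2 - q t = v t * u t ^ 3"
          using xn by eventually_elim (simp add: v_def u_def q_def field_simps power2_eq_square power3_eq_cube)
      qed
      have "((\<lambda>t. 1 + \<alpha> / 2 * u t ^ 2 - v t * u t ^ 3 / 2) \<longlongrightarrow> 1 + \<alpha> / 2 * 0 ^ 2 - 0 / 2) (at t0)"
        by (intro tendsto_add tendsto_diff tendsto_const tendsto_mult[OF tendsto_const tendsto_power[OF u]]
            tendsto_divide[OF v3 tendsto_const]) simp
      then have Dl: "((\<lambda>t. 1 + \<alpha> / 2 * u t ^ 2 - v t * u t ^ 3 / 2) \<longlongrightarrow> 1) (at t0)" by simp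
      \<comment> \<open>By the choice of \<open>a\<close> the terms with positive powers of
        \<open>x\<close> drop out of the energy relation, which becomes \<open>v (1 + \<alpha> u^2 /
        2 - v u^3 / 2) = a (\<alpha> + 2 s) u / 4 - h\<close>. It is quadratic in \<open>v\<close>,
        but the bracket tends to \<open>1\<close> by the weak estimate, so the limit of
        \<open>v\<close> can be read off.\<close>
      have "(v \<longlongrightarrow> - h) (at t0)"
      proof (rule Lim_transform_eventually)
        have "((\<lambda>t. (a * (\<alpha> + 2 * s) / 4 * u t - h) / (1 + \<alpha> / 2 * u t ^ 2 - v t * u t ^ 3 / 2)) \<longlongrightarrow>
            (a * (\<alpha> + 2 * s) / 4 * 0 - h) / 1) (at t0)"
          by (intro tendsto_divide[OF _ Dl] tendsto_intros u) simp
        then show "((\<lambda>t. (a * (\<alpha> + 2 * s) / 4 * u t - h) / (1 + \<alpha> / 2 * u t ^ 2 - v t * u t ^ 3 / 2)) \<longlongrightarrow> - h) (at t0)"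
          by simp
        have "\<forall>\<^sub>F t in at t0. 1 + \<alpha> / 2 * u t ^ 2 - v t * u t ^ 3 / 2 \<noteq> 0"
          by (rule tendsto_imp_eventually_ne[OF Dl]) simp
        then show "\<forall>\<^sub>F t in at t0. (a * (\<alpha> + 2 * s) / 4 * u t - h) / (1 + \<alpha> / 2 * u t ^ 2 - v t * u t ^ 3 / 2) = v t"
          using xn evh
        proof eventually_elim
          case (elim t)
          have "v t * (1 + \<alpha> / 2 * u t ^ 2 - v t * u t ^ 3 / 2) = a * (\<alpha> + 2 * s) / 4 * u t - hamiltonian \<alpha> s (x t) (y t)"
            using elim(2) by (simp add: hamiltonian_def v_def u_def a_def field_simps power2_eq_square power3_eq_cube)
          with elim(1,3) show ?case by (simp add: divide_eq_eq)
        qed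
      qed
      then show ?thesis
        by (intro ext[of 1]) (use u xn in \<open>simp_all add: chart_all_simps u_def[abs_def] v_def[abs_def] a_def\<close>)
    next
      assume q1: "q0 = - 1"
      define b where "b = (\<alpha> + 2 * s) / 2"
      define v where "v t = - ((y t + x t) * x t + b) * x t" for t
      have v3: "((\<lambda>t. v t * u t ^ 3) \<longlongrightarrow> 0) (at t0)"
      proof (rule Lim_transform_eventually)
        show "((\<lambda>t. - 1 - b * u t ^ 2 - q t) \<longlongrightarrow> 0) (at t0)"
          using q0 u q1 by (auto intro!: tendsto_eq_intros)
        show "\<forall>\<^sub>F t in at t0. - 1 - b * u t ^ 2 - q t = v t * u t ^ 3"
          using xn by eventually_elim (simp add: v_def u_def q_def field_simps power2_eq_square power3_eq_cube)
      qed
      have "((\<lambda>t. 1 + \<alpha> / 2 * u t ^ 2 + v t * u t ^ 3 / 2) \<longlongrightarrow> 1 + \<alpha> / 2 * 0 ^ 2 + 0 / 2) (at t0)"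
        by (intro tendsto_add tendsto_diff tendsto_const tendsto_mult[OF tendsto_const tendsto_power[OF u]]
            tendsto_divide[OF v3 tendsto_const]) simp
      then have Dl: "((\<lambda>t. 1 + \<alpha> / 2 * u t ^ 2 + v t * u t ^ 3 / 2) \<longlongrightarrow> 1) (at t0)" by simp
      \<comment> \<open>The same computation with \<open>y = - x - b u - v u^2\<close>. The cross
        term of \<open>y^2\<close> that contains \<open>v\<close> has changed sign, so the limit is
        \<open>h\<close> instead of \<open>- h\<close>.\<close>
      have "(v \<longlongrightarrow> h) (at t0)"
      proof (rule Lim_transform_eventually)
        have "((\<lambda>t. (h - b * (\<alpha> - 2 * s) / 4 * u t) / (1 + \<alpha> / 2 * u t ^ 2 + v t * u t ^ 3 / 2)) \<longlongrightarrow>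
            (h - b * (\<alpha> - 2 * s) / 4 * 0) / 1) (at t0)"
          by (intro tendsto_divide[OF _ Dl] tendsto_intros u) simp
        then show "((\<lambda>t. (h - b * (\<alpha> - 2 * s) / 4 * u t) / (1 + \<alpha> / 2 * u t ^ 2 + v t * u t ^ 3 / 2)) \<longlongrightarrow> h) (at t0)"
          by simp
        have "\<forall>\<^sub>F t in at t0. 1 + \<alpha> / 2 * u t ^ 2 + v t * u t ^ 3 / 2 \<noteq> 0"
          by (rule tendsto_imp_eventually_ne[OF Dl]) simp
        then show "\<forall>\<^sub>F t in at t0. (h - b * (\<alpha> - 2 * s) / 4 * u t) / (1 + \<alpha> / 2 * u t ^ 2 + v t * u t ^ 3 / 2) = v t"
          using xn evh
        proof eventually_elim
          case (elim t)
          have "v t * (1 + \<alpha> / 2 * u t ^ 2 + v t * u t ^ 3 / 2) = hamiltonian \<alpha> s (x t) (y t) - b * (\<alpha> - 2 * s) / 4 * u t"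
            using elim(2) by (simp add: hamiltonian_def v_def u_def b_def field_simps power2_eq_square power3_eq_cube)
          with elim(1,3) show ?case by (simp add: divide_eq_eq)
        qed
      qed
      then show ?thesis
        by (intro ext[of 2]) (use u xn in \<open>simp_all add: chart_all_simps u_def[abs_def] v_def[abs_def] b_def\<close>)
    qed
  qed
qed

lemma phase_space_charts: "phase_space (system \<alpha> s) J (charts \<alpha> s)"
  unfolding phase_space_def
proof (intro conjI ballI allI impI)
  show "0 \<in> J" by simp
  show "chart \<alpha> s 0 z = z" for z by (simp add: chart_simps vec2_eq_iff)
  show "equiv (J \<times> UNIV) (glue J (charts \<alpha> s))" by (rule equiv_glue)
  show "complex_manifold (glued_atlas J (charts \<alpha> s))" by (rule complex_manifold_glued)
  show "\<exists>g. polynomial_rhs g \<and> rewritten_system (system \<alpha> s) (\<lambda>t. chart \<alpha> s j) g" if "j \<in> J" for j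
    using polynomial_chart_rhs rewritten_chart[OF that] by blast
  show "\<exists>r>0. \<exists>\<Gamma>. holo_curve (glued_atlas J (charts \<alpha> s)) (ball t0 r) \<Gamma> \<and>
           (\<forall>t\<in>ball t0 r - {t0}. \<Gamma> t = glued_point J (charts \<alpha> s) 0 (vector [x t, y t, t]))"
    if "meromorphic_solution_near (system \<alpha> s) t0 x y" for t0 x y
    by (rule meromorphic_solution_extends[OF that])
qed

section \<open>The fibres as open subsets of the surface\<close>

definition fibre_point :: "complex \<Rightarrow> complex \<Rightarrow> complex \<Rightarrow> nat \<Rightarrow> complex^2 \<Rightarrow> (nat \<times> (complex^3)) set" where
  "fibre_point \<alpha> s t j z = glued_point J (charts \<alpha> s) j (join z t)"

lemma fibre_point_eq_iff:
  "j \<in> J \<Longrightarrow> k \<in> J \<Longrightarrow> fibre_point \<alpha> s t j p = fibre_point \<alpha> s t k q \<longleftrightarrow> same_point \<alpha> s j k p q"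
  unfolding fibre_point_def by (simp only: glued_point_eq_iff join_simps simp_thms)

lemma fibre_atlas_iff: "(V, \<psi>) \<in> fibre_atlas J (charts \<alpha> s) t \<longleftrightarrow> (\<exists>j\<in>J. V = UNIV \<and> \<psi> = fibre_point \<alpha> s t j)"
  unfolding fibre_atlas_def fibre_point_def[abs_def] by blast

text \<open>With \<open>m = y / x\<close> and \<open>n = 1 / x\<close>, charts 1 and 2 read
  \<open>m = 1 + a n^2 - y_1 n^3\<close> and \<open>m = - 1 - b n^2 - y_2 n^3\<close>, where
  \<open>a = (\<alpha> - 2 s) / 2\<close> and \<open>b = (\<alpha> + 2 s) / 2\<close>; chart 3 reads
  \<open>x / y = - 2 s y_3^2 - x_3 y_3^3\<close>. Comparison with \<open>arm_map_eq\<close> gives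
  the base point and the constant of each arm.\<close>

definition surface_chart :: "complex \<Rightarrow> complex \<Rightarrow> nat \<Rightarrow> complex^2 \<Rightarrow> ipoint" where
  "surface_chart \<alpha> s j =
     (if j = 0 then chartZ
      else if j = 1 then arm_map chartX (vector [1, 0]) ((\<alpha> - 2 * s) / 2)
      else if j = 2 then arm_map chartX (vector [- 1, 0]) (- (\<alpha> + 2 * s) / 2)
      else arm_map chartY 0 (- 2 * s))"

text \<open>In the comparison with \<open>arm_map_eq\<close> the coordinate \<open>w $ 1\<close> is
  \<open>- y_1\<close>, \<open>- y_2\<close> or \<open>- x_3\<close>, and \<open>w $ 2\<close> is
  \<open>x_1\<close>, \<open>x_2\<close> or \<open>y_3\<close>.\<close>

definition coord_change :: "nat \<Rightarrow> complex^2 \<Rightarrow> complex^2" where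
  "coord_change j z =
     (if j = 0 then z else if j = 3 then vector [- z $ 1, z $ 2] else vector [- z $ 2, z $ 1])"

definition coord_change_inv :: "nat \<Rightarrow> complex^2 \<Rightarrow> complex^2" where
  "coord_change_inv j z =
     (if j = 0 then z else if j = 3 then vector [- z $ 1, z $ 2] else vector [z $ 2, - z $ 1])"

lemma coord_change_inverse [simp]:
  "coord_change j (coord_change_inv j z) = z" "coord_change_inv j (coord_change j z) = z"
  by (simp_all add: coord_change_def coord_change_inv_def vec2_eq_iff)

lemma vholo_coord_change: "vholo_on S (coord_change j)" "vholo_on S (coord_change_inv j)"
proof -
  have n: "vholo_on S (\<lambda>z. z)" "vholo_on S (\<lambda>z :: complex^2. vector [- z $ 1, z $ 2] :: complex^2)"
    "vholo_on S (\<lambda>z :: complex^2. vector [- z $ 2, z $ 1] :: complex^2)"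
    "vholo_on S (\<lambda>z :: complex^2. vector [z $ 2, - z $ 1] :: complex^2)"
    by (intro vholo_on_id vholo_on_vector2 holo_intros)+
  show "vholo_on S (coord_change j)"
    unfolding coord_change_def[abs_def] using n by (cases "j = 0"; cases "j = 3") simp_all
  show "vholo_on S (coord_change_inv j)"
    unfolding coord_change_inv_def[abs_def] using n by (cases "j = 0"; cases "j = 3") simp_all
qed

definition surface_point :: "complex \<Rightarrow> complex \<Rightarrow> nat \<Rightarrow> complex^2 \<Rightarrow> ipoint" where
  "surface_point \<alpha> s j z = surface_chart \<alpha> s j (coord_change j z)"

definition surface_end :: "complex \<Rightarrow> complex \<Rightarrow> nat \<Rightarrow> ipoint" where
  "surface_end \<alpha> s j =
     (if j = 1 then arm_point (chartX (vector [1, 0])) ((\<alpha> - 2 * s) / 2)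
      else if j = 2 then arm_point (chartX (vector [- 1, 0])) (- (\<alpha> + 2 * s) / 2)
      else arm_point (chartY 0) (- 2 * s))"

lemma surface_point_finite:
  assumes "j \<in> J" "finite_part j z"
  shows "surface_point \<alpha> s j z = chartZ (ichart \<alpha> s j z)"
  using assms(1)
proof (rule J_cases)
  assume j: "j = 0"
  have "ichart \<alpha> s 0 z = z" by (simp add: ichart_simps vec2_eq_iff)
  then show ?thesis by (simp add: j surface_point_def surface_chart_def coord_change_def)
next
  assume j: "j = Suc 0"
  then have "z $ 1 \<noteq> 0" using assms(2) by (simp add: finite_part_simps)
  then show ?thesis
    by (simp add: j surface_point_def surface_chart_def coord_change_def arm_map_eq chartX_def chartZ_def
        ichart_simps proj_point_eq_iff vec3_eq_iff)
      (simp add: field_simps power2_eq_square)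
next
  assume j: "j = 2"
  then have "z $ 1 \<noteq> 0" using assms(2) by (simp add: finite_part_simps)
  then show ?thesis
    by (simp add: j surface_point_def surface_chart_def coord_change_def arm_map_eq chartX_def chartZ_def
        ichart_simps proj_point_eq_iff vec3_eq_iff)
      (simp add: field_simps power2_eq_square)
next
  assume j: "j = 3"
  then have "z $ 2 \<noteq> 0" using assms(2) by (simp add: finite_part_simps)
  then show ?thesis
    by (simp add: j surface_point_def surface_chart_def coord_change_def arm_map_eq chartY_def chartZ_def
        ichart_simps proj_point_eq_iff vec3_eq_iff)
      (simp add: algebra_simps power2_eq_square)
qed

lemma surface_point_infinite:
  assumes "j \<in> J" "\<not> finite_part j z"
  shows "surface_point \<alpha> s j z = Near (surface_end \<alpha> s j) (P1_inf (coord_change j z $ 1))" "coord_change j z $ 2 = 0" "j \<noteq> 0"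
proof -
  show "j \<noteq> 0" using assms(2) by (intro notI) (simp add: finite_part_simps)
  show "coord_change j z $ 2 = 0"
    using assms(1) by (rule J_cases) (use assms(2) in \<open>simp_all add: finite_part_simps coord_change_def\<close>)
  with \<open>j \<noteq> 0\<close> have "coord_change j z $ 2 = 0 \<and> j \<noteq> 0" by blast
  with assms(1) show "surface_point \<alpha> s j z = Near (surface_end \<alpha> s j) (P1_inf (coord_change j z $ 1))"
    by (elim J_cases) (simp_all add: surface_point_def surface_chart_def surface_end_def arm_map_eq)
qed

lemma P1_inf_eq_iff: "P1_inf x = P1_inf y \<longleftrightarrow> x = y"
  by (simp add: P1_inf_def)

text \<open>The arms start at three different points of the line at infinity, and an end determines
  its base point.\<close>

lemma surface_end_inj:
  assumes "j \<in> J" "k \<in> J" "j \<noteq> 0" "k \<noteq> 0" "surface_end \<alpha> s j = surface_end \<alpha> s k"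
  shows "j = k"
proof -
  have ne: "chartX (vector [1, 0]) \<noteq> chartX (vector [- 1, 0])" "chartX (vector [1, 0]) \<noteq> chartY 0"
    "chartX (vector [- 1, 0]) \<noteq> chartY 0"
    by (auto simp: chartX_def chartY_def proj_point_eq_iff vec3_eq_iff)
  from assms(1-4) have "j = 1 \<or> j = 2 \<or> j = 3" "k = 1 \<or> k = 2 \<or> k = 3" by auto
  then show ?thesis
    using assms(5) ne ne[THEN not_sym] by (elim disjE) (simp_all add: surface_end_def arm_point_def)
qed

text \<open>Points over the affine plane are compared in the plane; added points are infinitely near
  points, whose arm and direction determine the chart and the coordinates. The surface therefore
  makes exactly the identifications of the gluing, so \<open>fibre_map\<close> is well defined and
  injective.\<close>

lemma surface_point_eq_iff:
  assumes "j \<in> J" "k \<in> J"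
  shows "surface_point \<alpha> s j p = surface_point \<alpha> s k q \<longleftrightarrow> same_point \<alpha> s j k p q"
proof
  assume "same_point \<alpha> s j k p q"
  then show "surface_point \<alpha> s j p = surface_point \<alpha> s k q"
    unfolding same_point_def using surface_point_finite assms by auto
next
  assume e: "surface_point \<alpha> s j p = surface_point \<alpha> s k q"
  have nz: "chartZ v \<noteq> Near r l" for v r l
    using line_Plane(2)[of v] by auto
  show "same_point \<alpha> s j k p q"
  proof (cases "finite_part j p")
    case True
    then have "finite_part k q"
      using e surface_point_finite[OF assms(1) True] surface_point_infinite(1)[OF assms(2)] nz by metis
    then show ?thesis
      using e True surface_point_finite[OF assms(1)] surface_point_finite[OF assms(2)] inj_plane_charts(1)
      unfolding same_point_def inj_def by metis
  next
    case False
    then have k: "\<not> finite_part k q"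
      using e surface_point_finite[OF assms(2)] surface_point_infinite(1)[OF assms(1) False] nz by metis
    note a = surface_point_infinite[OF assms(1) False] and b = surface_point_infinite[OF assms(2) k]
    from e have "surface_end \<alpha> s j = surface_end \<alpha> s k" and c: "coord_change j p $ 1 = coord_change k q $ 1"
      unfolding a(1) b(1) by (simp_all add: P1_inf_eq_iff)
    with surface_end_inj[OF assms a(3) b(3)] have jk: "j = k" by blast
    have "coord_change j p = coord_change j q" using a(2) b(2) c by (simp add: vec2_eq_iff jk)
    then have "p = q" by (metis coord_change_inverse(2))
    with jk show ?thesis by (simp add: same_point_def)
  qed
qed

text \<open>A value is chosen among the representatives of a class; by
  \<open>surface_point_eq_iff\<close> they all give the same one.\<close>

definition fibre_map :: "complex \<Rightarrow> complex \<Rightarrow> complex \<Rightarrow> (nat \<times> (complex^3)) set \<Rightarrow> ipoint" where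
  "fibre_map \<alpha> s t P = (SOME x. \<exists>j\<in>J. \<exists>z. P = fibre_point \<alpha> s t j z \<and> x = surface_point \<alpha> s j z)"

lemma fibre_map_point:
  assumes "j \<in> J"
  shows "fibre_map \<alpha> s t (fibre_point \<alpha> s t j z) = surface_point \<alpha> s j z"
proof -
  have "\<exists>x. \<exists>k\<in>J. \<exists>w. fibre_point \<alpha> s t j z = fibre_point \<alpha> s t k w \<and> x = surface_point \<alpha> s k w"
    using assms by blast
  from someI_ex[OF this] obtain k w where "k \<in> J" "fibre_point \<alpha> s t j z = fibre_point \<alpha> s t k w"
    "fibre_map \<alpha> s t (fibre_point \<alpha> s t j z) = surface_point \<alpha> s k w" unfolding fibre_map_def by blast
  then show ?thesis using fibre_point_eq_iff[OF assms] surface_point_eq_iff[OF assms] by metis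
qed

lemma points_fibre: "P \<in> points (fibre_atlas J (charts \<alpha> s) t) \<longleftrightarrow> (\<exists>j\<in>J. \<exists>z. P = fibre_point \<alpha> s t j z)"
  unfolding points_iff fibre_atlas_iff by blast

lemma inj_on_fibre_map: "inj_on (fibre_map \<alpha> s t) (points (fibre_atlas J (charts \<alpha> s) t))"
proof (rule inj_onI)
  fix P Q assume "P \<in> points (fibre_atlas J (charts \<alpha> s) t)" "Q \<in> points (fibre_atlas J (charts \<alpha> s) t)"
    and e: "fibre_map \<alpha> s t P = fibre_map \<alpha> s t Q"
  then obtain j z k w where P: "j \<in> J" "P = fibre_point \<alpha> s t j z" "k \<in> J" "Q = fibre_point \<alpha> s t k w"
    unfolding points_fibre by blast
  with e show "P = Q" using fibre_map_point fibre_point_eq_iff[OF P(1,3)] surface_point_eq_iff[OF P(1,3)] by metis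
qed

lemma image_fibre_map:
  "fibre_map \<alpha> s t ` points (fibre_atlas J (charts \<alpha> s) t) = (\<Union>j\<in>J. range (surface_point \<alpha> s j))"
proof (intro equalityI subsetI)
  fix x assume "x \<in> fibre_map \<alpha> s t ` points (fibre_atlas J (charts \<alpha> s) t)"
  then obtain j z where "j \<in> J" "x = fibre_map \<alpha> s t (fibre_point \<alpha> s t j z)"
    unfolding image_iff Bex_def points_fibre by blast
  then show "x \<in> (\<Union>j\<in>J. range (surface_point \<alpha> s j))" using fibre_map_point by (metis UN_iff rangeI)
next
  fix x assume "x \<in> (\<Union>j\<in>J. range (surface_point \<alpha> s j))"
  then obtain j z where jz: "j \<in> J" "x = surface_point \<alpha> s j z" by (elim UN_E rangeE)
  then have "x = fibre_map \<alpha> s t (fibre_point \<alpha> s t j z)" using fibre_map_point by simp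
  moreover have "fibre_point \<alpha> s t j z \<in> points (fibre_atlas J (charts \<alpha> s) t)" using jz(1) points_fibre by blast
  ultimately show "x \<in> fibre_map \<alpha> s t ` points (fibre_atlas J (charts \<alpha> s) t)" by (rule image_eqI)
qed

lemma range_surface_point: "range (surface_point \<alpha> s j) = range (surface_chart \<alpha> s j)"
proof (intro equalityI subsetI)
  fix x assume "x \<in> range (surface_point \<alpha> s j)"
  then show "x \<in> range (surface_chart \<alpha> s j)" by (auto simp: surface_point_def)
next
  fix x assume "x \<in> range (surface_chart \<alpha> s j)"
  then obtain w where "x = surface_chart \<alpha> s j w" by blast
  then have "x = surface_point \<alpha> s j (coord_change_inv j w)" by (simp add: surface_point_def)
  then show "x \<in> range (surface_point \<alpha> s j)" by (rule range_eqI)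
qed

text \<open>The image is brought into the form in which \<open>E6_surface\<close> describes the
  complement of the seven curves.\<close>

lemma image_fibre_map_explicit:
  "fibre_map \<alpha> s t ` points (fibre_atlas J (charts \<alpha> s) t) = range chartZ \<union>
     (\<Union>q\<in>end_points ((\<alpha> - 2 * s) / 2) (- (\<alpha> + 2 * s) / 2) (- 2 * s). range (\<lambda>w. Near q (P1_inf w)))"
  (is "_ = _ \<union> ?E")
  unfolding image_fibre_map
proof (intro equalityI subsetI)
  have ends: "q \<in> end_points ((\<alpha> - 2 * s) / 2) (- (\<alpha> + 2 * s) / 2) (- 2 * s) \<longleftrightarrow> (\<exists>j\<in>J. j \<noteq> 0 \<and> q = surface_end \<alpha> s j)" for q
    unfolding end_points_def surface_end_def by auto
  {
    fix x assume "x \<in> (\<Union>j\<in>J. range (surface_point \<alpha> s j))"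
    then obtain j z where jz: "j \<in> J" "x = surface_point \<alpha> s j z" by (elim UN_E rangeE)
    show "x \<in> range chartZ \<union> ?E"
    proof (cases "finite_part j z")
      case True
      then show ?thesis using surface_point_finite[OF jz(1)] jz(2) by simp
    next
      case False
      from surface_point_infinite[OF jz(1) False] jz ends[of "surface_end \<alpha> s j"] show ?thesis by blast
    qed
  next
    fix x assume "x \<in> range chartZ \<union> ?E"
    then show "x \<in> (\<Union>j\<in>J. range (surface_point \<alpha> s j))"
    proof
      assume "x \<in> range chartZ"
      then have "x \<in> range (surface_point \<alpha> s 0)" unfolding range_surface_point by (simp add: surface_chart_def)
      then show ?thesis by blast
    next
      assume "x \<in> ?E"
      then obtain q w where "q \<in> end_points ((\<alpha> - 2 * s) / 2) (- (\<alpha> + 2 * s) / 2) (- 2 * s)" and x: "x = Near q (P1_inf w)" by blast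
      with ends obtain j where j: "j \<in> J" "j \<noteq> 0" "q = surface_end \<alpha> s j" by blast
      have "x = surface_chart \<alpha> s j (vector [w, 0])"
        using j(2) unfolding x j(3) by (simp add: surface_chart_def surface_end_def arm_map_eq)
      then have "x \<in> range (surface_point \<alpha> s j)" unfolding range_surface_point by (rule range_eqI)
      with j(1) show ?thesis by blast
    qed
  }
qed

text \<open>Between corresponding charts of the fibre and the surface, the map and its inverse are
  \<open>coord_change\<close> and \<open>coord_change_inv\<close>. The rest, including the
  compatibility of the fibre charts with each other, is inherited from \<open>S\<close>.\<close>

lemma fibre_open_embedding:
  assumes cS: "compat S" and ch: "\<And>j. j \<in> J \<Longrightarrow> (UNIV, surface_chart \<alpha> s j) \<in> S"
  shows "open_embedding (fibre_atlas J (charts \<alpha> s) t) S (fibre_map \<alpha> s t)"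
proof -
  let ?X = "fibre_atlas J (charts \<alpha> s) t" and ?\<iota> = "fibre_map \<alpha> s t"
  have up: "lift_at UNIV (surface_chart \<alpha> s j) (surface_point \<alpha> s j) v" for j v
    by (rule lift_atI[OF open_UNIV UNIV_I vholo_coord_change(1)[of _ j]]) (simp_all add: surface_point_def)
  have down: "lift_at UNIV (fibre_point \<alpha> s t k) h' v"
    if k: "k \<in> J" and l: "lift_at UNIV (surface_chart \<alpha> s k) h v"
      and hh: "\<And>x z. h x = surface_point \<alpha> s k z \<Longrightarrow> h' x = fibre_point \<alpha> s t k z" for k h h' and v :: "complex^2"
  proof -
    from l obtain N f where N: "open N" "v \<in> N" "vholo_on N f" "\<And>x. x \<in> N \<Longrightarrow> surface_chart \<alpha> s k (f x) = h x"
      by (auto simp: lift_at_def)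
    show ?thesis
    proof (rule lift_atI[OF N(1,2)])
      show "vholo_on N (\<lambda>x. coord_change_inv k (f x))"
        by (rule vholo_on_compose[OF N(3) vholo_coord_change(2)]) (rule subset_UNIV)
      fix x assume "x \<in> N"
      then have "h x = surface_point \<alpha> s k (coord_change_inv k (f x))" using N(4) by (simp add: surface_point_def)
      then show "fibre_point \<alpha> s t k (coord_change_inv k (f x)) = h' x" using hh by simp
    qed simp
  qed
  have cX: "compat ?X"
  proof -
    have inj: "inj (fibre_point \<alpha> s t j)" if "j \<in> J" for j
      unfolding inj_def fibre_point_eq_iff[OF that that] same_point_refl_iff[OF that] by blast
    have "lift_at UNIV (fibre_point \<alpha> s t k) (fibre_point \<alpha> s t j) v"
      if jk: "j \<in> J" "k \<in> J" and r: "fibre_point \<alpha> s t j v \<in> range (fibre_point \<alpha> s t k)" for j k v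
    proof (rule down[OF jk(2)])
      from r obtain w where "fibre_point \<alpha> s t j v = fibre_point \<alpha> s t k w" by blast
      then have "surface_point \<alpha> s j v = surface_point \<alpha> s k w"
        unfolding fibre_point_eq_iff[OF jk] surface_point_eq_iff[OF jk] .
      then have "surface_point \<alpha> s j v \<in> range (surface_chart \<alpha> s k)" by (simp add: surface_point_def)
      then show "lift_at UNIV (surface_chart \<alpha> s k) (surface_point \<alpha> s j) v"
        by (rule lift_change[OF cS ch[OF jk(1)] ch[OF jk(2)] up])
      show "fibre_point \<alpha> s t j x = fibre_point \<alpha> s t k z" if "surface_point \<alpha> s j x = surface_point \<alpha> s k z" for x z
        using that unfolding fibre_point_eq_iff[OF jk] surface_point_eq_iff[OF jk] .
    qed
    with inj show ?thesis unfolding compat_def Ball_def split_paired_All prod.case fibre_atlas_iff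
      by (metis open_UNIV)
  qed
  have op: "openin (manifold_topology S) (?\<iota> ` points ?X)"
  proof -
    have "openin (manifold_topology S) (\<Union>j\<in>J. range (surface_chart \<alpha> s j))"
    proof (rule openin_Union, elim imageE)
      fix U j assume "U = range (surface_chart \<alpha> s j)" "j \<in> J"
      then show "openin (manifold_topology S) U" using openin_chart[OF cS ch open_UNIV subset_UNIV] by simp
    qed
    then show ?thesis unfolding image_fibre_map range_surface_point .
  qed
  have inv: "inv_into (points ?X) ?\<iota> (surface_point \<alpha> s k z) = fibre_point \<alpha> s t k z" if k: "k \<in> J" for k z
  proof -
    have "fibre_point \<alpha> s t k z \<in> points ?X" using k points_fibre by blast
    from inv_into_f_f[OF inj_on_fibre_map this] show ?thesis by (simp only: fibre_map_point[OF k])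
  qed
  show ?thesis
    unfolding open_embedding_def
  proof (intro conjI)
    show "inj_on ?\<iota> (points ?X)" by (rule inj_on_fibre_map)
    show "openin (manifold_topology S) (?\<iota> ` points ?X)" by (rule op)
    show "holo_map ?X S ?\<iota>"
    proof (rule holo_mapI[OF cS compat_open[OF cX]])
      fix V \<psi> v assume "(V, \<psi>) \<in> ?X"
      then obtain j where j: "j \<in> J" "\<psi> = fibre_point \<alpha> s t j" unfolding fibre_atlas_iff by blast
      have "lift_at UNIV (surface_chart \<alpha> s j) (\<lambda>v. ?\<iota> (\<psi> v)) v"
        using up[of j v] unfolding j(2) fibre_map_point[OF j(1)] .
      then show "\<exists>(W, \<eta>)\<in>S. lift_at W \<eta> (\<lambda>v. ?\<iota> (\<psi> v)) v" using ch[OF j(1)] by blast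
    qed
    show "holo_map (restrict_atlas S (?\<iota> ` points ?X)) ?X (inv_into (points ?X) ?\<iota>)"
    proof (rule holo_mapI[OF cX])
      fix V \<psi> assume "(V, \<psi>) \<in> restrict_atlas S (?\<iota> ` points ?X)"
      then obtain W where W: "(W, \<psi>) \<in> S" "V = {v \<in> W. \<psi> v \<in> ?\<iota> ` points ?X}" unfolding restrict_atlas_iff by blast
      show "open V" using op W unfolding openin_compat[OF cS] by auto
      fix v assume "v \<in> V"
      then have v: "v \<in> W" "\<psi> v \<in> (\<Union>j\<in>J. range (surface_chart \<alpha> s j))"
        using W(2) unfolding image_fibre_map range_surface_point by blast+
      then obtain k where k: "k \<in> J" "\<psi> v \<in> range (surface_chart \<alpha> s k)" by blast
      have "lift_at UNIV (fibre_point \<alpha> s t k) (\<lambda>v. inv_into (points ?X) ?\<iota> (\<psi> v)) v"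
      proof (rule down[OF k(1)])
        show "lift_at UNIV (surface_chart \<alpha> s k) \<psi> v" by (rule lift_at_chart[OF cS W(1) ch[OF k(1)] v(1) k(2)])
        show "inv_into (points ?X) ?\<iota> (\<psi> x) = fibre_point \<alpha> s t k z" if "\<psi> x = surface_point \<alpha> s k z" for x z
          unfolding that by (rule inv[OF k(1)])
      qed
      moreover have "(UNIV, fibre_point \<alpha> s t k) \<in> ?X" using k(1) unfolding fibre_atlas_iff by blast
      ultimately show "\<exists>(W, \<eta>)\<in>?X. lift_at W \<eta> (\<lambda>v. inv_into (points ?X) ?\<iota> (\<psi> v)) v" by blast
    qed
  qed
qed

theorem theorem22p2:
  fixes \<alpha> \<beta> s :: complex
  assumes "s ^ 2 = - \<beta>"
  shows
    "(\<forall>j\<in>{0,1,2,3}. birational (chart \<alpha> s j) \<and> symplectic (chart \<alpha> s j)) \<and>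
     phase_space (system \<alpha> s) {0,1,2,3} (\<lambda>j t. chart \<alpha> s j) \<and>
     (\<forall>t. \<exists>S \<iota>.
        surface_of_type E6_nodes E6_edges S (fibre_atlas {0,1,2,3} (\<lambda>j t. chart \<alpha> s j) t) \<iota> \<and>
        (\<forall>z. blow_down (\<iota> (glued_point {0,1,2,3} (\<lambda>j t. chart \<alpha> s j) 0 (join z t))) =
               proj_point (vector [z $ 1, z $ 2, 1])))"
proof (intro conjI ballI allI)
  show "birational (chart \<alpha> s j)" "symplectic (chart \<alpha> s j)" if "j \<in> {0,1,2,3}" for j
    using birational_chart[OF that] symplectic_chart[OF that] .
  show "phase_space (system \<alpha> s) {0,1,2,3} (\<lambda>j t. chart \<alpha> s j)" by (rule phase_space_charts)
  fix t
  \<comment> \<open>The constants are those of \<open>surface_chart\<close>. They do not involve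
    \<open>t\<close>, so the same surface serves for every fibre.\<close>
  obtain S \<gamma> where S: "blown_up_plane S" "compat S" "(UNIV, chartZ) \<in> S"
    "(UNIV, arm_map chartX (vector [1, 0]) ((\<alpha> - 2 * s) / 2)) \<in> S"
    "(UNIV, arm_map chartX (vector [- 1, 0]) (- (\<alpha> + 2 * s) / 2)) \<in> S"
    "(UNIV, arm_map chartY 0 (- 2 * s)) \<in> S"
    and E6: "\<forall>i\<in>E6_nodes. P1_embedding S (\<gamma> i)" "inj_on (\<lambda>i. range (\<gamma> i)) E6_nodes"
    "points S - (range chartZ \<union> (\<Union>q\<in>end_points ((\<alpha> - 2 * s) / 2) (- (\<alpha> + 2 * s) / 2) (- 2 * s).
       range (\<lambda>w. Near q (P1_inf w)))) = (\<Union>i\<in>E6_nodes. range (\<gamma> i))"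
    "\<forall>i\<in>E6_nodes. has_intersection_number S (\<gamma> i) (range (\<gamma> i)) (- 2)"
    "\<forall>i\<in>E6_nodes. \<forall>j\<in>E6_nodes. i \<noteq> j \<longrightarrow>
       has_intersection_number S (\<gamma> i) (range (\<gamma> j)) (if {i, j} \<in> E6_edges then 1 else 0)"
    by (rule E6_surface) (rule that)
  have ch: "(UNIV, surface_chart \<alpha> s j) \<in> S" if "j \<in> J" for j
    using that S(3-6) unfolding surface_chart_def by auto
  have "surface_of_type E6_nodes E6_edges S (fibre_atlas J (charts \<alpha> s) t) (fibre_map \<alpha> s t)"
    unfolding surface_of_type_def image_fibre_map_explicit
    using S(1) fibre_open_embedding[OF S(2) ch] E6 by (intro conjI exI[of _ \<gamma>]) (assumption | simp)+
  moreover have "blow_down (fibre_map \<alpha> s t (glued_point J (charts \<alpha> s) 0 (join z t))) =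
      proj_point (vector [z $ 1, z $ 2, 1])" for z
  proof -
    have J0: "0 \<in> J" by simp
    have "fibre_map \<alpha> s t (glued_point J (charts \<alpha> s) 0 (join z t)) = chartZ z"
      using fibre_map_point[OF J0, of \<alpha> s t z]
      by (simp add: fibre_point_def surface_point_def surface_chart_def coord_change_def)
    then show ?thesis by (simp add: chartZ_def proj_point_def)
  qed
  ultimately show "\<exists>S \<iota>. surface_of_type E6_nodes E6_edges S (fibre_atlas {0,1,2,3} (\<lambda>j t. chart \<alpha> s j) t) \<iota> \<and>
        (\<forall>z. blow_down (\<iota> (glued_point {0,1,2,3} (\<lambda>j t. chart \<alpha> s j) 0 (join z t))) =
               proj_point (vector [z $ 1, z $ 2, 1]))" by blast
qed

end
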